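(* Let $\chi\in\widehat{\mathcal O_{\mathbb E}^\times}$ and $\eta\in\widehat{\mathcal O_{\mathbb F}^\times}$. The family of distributions $K_{s,t}^{\chi,\eta}\in\mathcal D'(\mathbb E)$, which for $\operatorname{Re}(2s\pm t+\frac12)>0$ is given by the locally integrable function $$K_{s,t}^{\chi,\eta}(x)=\chi_{s-\frac12}(x^2)\cdot(\chi_{s-\frac12}\eta_{t+\frac12})\Big(\frac{x_2}{x_1^2-x_2^2\alpha^2}\Big)\qquad(x=x_1+x_2\alpha\in\mathbb E\setminus\mathbb F),$$ has a meromorphic extension to $(s,t)\in\mathbb C^2$, with simple poles at $(\chi,s,\eta,t)\in\mathcal S_+\cup\mathcal S_-$. For $(\chi,s,\eta,t)\notin\mathcal S_+\cup\mathcal S_-$ we have $K_{s,t}^{\chi,\eta}\in\mathcal D'(\mathbb E)_{s,t}^{\chi,\eta}$.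
   Context: Fields. $\mathbb E/\mathbb F$ is a quadratic extension of non-archimedean local fields, $\mathbb E=\mathbb F(\alpha)$ with $\alpha\in\mathbb E\setminus\mathbb F$, $\alpha^2\in\mathbb F^\times\setminus\mathbb F^{\times2}$. For $k\in\{\mathbb E,\mathbb F\}$: $\mathcal O_k$ is the ring of integers, $\mathcal O_k^\times$ its units, $\varpi_k$ a chosen uniformizer, $q_k$ the residue cardinality, $\nu_k$ the valuation, $|\cdot|_k$ the absolute value with $d(ax)=|a|_k\,dx$ for Haar measure $dx$ on $k$ (so $|\varpi_k|_k=q_k^{-1}$). After possibly multiplying $\alpha$ by a power of $\varpi_{\mathbb F}$, either $\alpha^2\in\mathcal O_{\mathbb F}^\times$ (the case where $\mathbb E/\mathbb F$ is unramified, $q_{\mathbb E}=q_{\mathbb F}^2$) or $\alpha^2\in\varpi_{\mathbb F}\mathcal O_{\mathbb F}^\times$ (the case where $\mathbb E/\mathbb F$ is ramified, $q_{\mathbb E}=q_{\mathbb F}$). Elements of $\mathbb E$ are written $x=x_1+x_2\alpha$ with $x_1,x_2\in\mathbb F$. Haar measures are normalized so that $\mathcal O_k$ has measure $1$, and $dx=dx_1\,dx_2$. Characters. $\widehat{\mathcal O_k^\times}$ is the set of (continuous) characters of $\mathcal O_k^\times$. For $\chi\in\widehat{\mathcal O_k^\times}$, $s\in\mathbb C$, $\chi_s$ is the character of $k^\times$ given by $\chi_s(x)=\chi(\varpi_k^{-\nu_k(x)}x)|x|_k^s$. Distributions. $C_c^\infty$ denotes locally constant compactly supported functions; $\mathcal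 D'(\mathbb E)$ is the space of all linear functionals on $C_c^\infty(\mathbb E)$; locally integrable functions are viewed as distributions via integration against $dx$. A family of distributions is meromorphic/holomorphic if its pairing with every test function is. Symmetry breaking kernels. $\mathcal D'(\mathbb E)_{s,t}^{\chi,\eta}$ is the space of $u\in\mathcal D'(\mathbb E)$ such that, in the sense of distributions, (a) for all $a\in\mathbb F^\times$: $u(ax)=\chi_{s-\frac12}(a)\eta_{t+\frac12}(a)^{-1}u(x)$ on $\mathbb E$; (b) for all $b\in\mathbb F^\times$: $u(\frac{x}{1-bx})=\chi_{s-\frac12}((1-bx)^2)^{-1}u(x)$ on $\mathbb E\setminus\{b^{-1}\}$. (Here $\langle u(a\cdot),\varphi\rangle=|a|_{\mathbb E}^{-1}\langle u,\varphi(a^{-1}\cdot)\rangle$, and $\langle u(\frac{\cdot}{1-b\cdot}),\varphi\rangle=\langle u,|1+b\cdot|_{\mathbb E}^{-2}\varphi(\frac{\cdot}{1+b\cdot})\rangle$ for $\varphi\in C_c^\infty(\mathbb E\setminus\{b^{-1}\})$.) Parameter sets. $\mathcal S_\pm$ is the set of $(\chi,s,\eta,t)\in\widehat{\mathcal O_{\mathbb E}^\times}\times\mathbb C\times\widehat{\mathcal O_{\mathbb F}^\times}\times\mathbb C$ with $\chi|_{\mathcal O_{\mathbb F}^\times}\cdot\eta^{\pm1}=1$ and $2s\pm t+\frac12\in\frac{2\pi i}{\ln q_{\mathbb F}}\mathbb Z$.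
   Formalization: The uniformizers are assumed compatible (ϖ_F = ϖ_E if E/F is unramified, ϖ_F = ϖ_E² if ramified); for arbitrary choices with χ(ϖ_E^{-e}ϖ_F) ≠ 1, where e is the ramification index, the poles are shifted off S_+ ∪ S_- and the claim fails. *)

theory Defs
  imports "HOL-Analysis.Analysis"
begin

section \<open>Non-archimedean local fields\<close>

text \<open>
  The valuation is normalized (its value group is all of the integers) and integer-valued;
  its value at 0, mathematically infinite, is left unspecified, so every use at a possibly
  vanishing argument is guarded.
\<close>

definition integers :: "('k::field \<Rightarrow> int) \<Rightarrow> 'k set" where
  "integers v = {x. x = 0 \<or> 0 \<le> v x}"

definition int_units :: "('k::field \<Rightarrow> int) \<Rightarrow> 'k set" where
  "int_units v = {x. x \<noteq> 0 \<and> v x = 0}"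

definition residue_card :: "('k::field \<Rightarrow> int) \<Rightarrow> nat" where
  "residue_card v =
     card (integers v // {(x, y) \<in> integers v \<times> integers v. x = y \<or> 1 \<le> v (x - y)})"

text \<open>
  The topology of the type is the valuation topology; compactness of the ring of integers is
  equivalent to completeness together with finiteness of the residue field.
\<close>

locale local_field =
  fixes v :: "'k::{field, topological_space} \<Rightarrow> int"
  assumes val_mult: "\<And>x y. x \<noteq> 0 \<Longrightarrow> y \<noteq> 0 \<Longrightarrow> v (x * y) = v x + v y"
    and val_add: "\<And>x y. x \<noteq> 0 \<Longrightarrow> y \<noteq> 0 \<Longrightarrow> x + y \<noteq> 0 \<Longrightarrow> min (v x) (v y) \<le> v (x + y)"
    and val_normalized: "\<exists>x. x \<noteq> 0 \<and> v x = 1"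
    and open_val: "\<And>S. open S \<longleftrightarrow> (\<forall>x\<in>S. \<exists>n. \<forall>y. y \<noteq> x \<and> n \<le> v (y - x) \<longrightarrow> y \<in> S)"
    and compact_integers: "compact (integers v)"

definition uniformizer :: "('k::field \<Rightarrow> int) \<Rightarrow> 'k \<Rightarrow> bool" where
  "uniformizer v p \<longleftrightarrow> p \<noteq> 0 \<and> v p = 1"

definition normalized_haar ::
    "('k::{field, topological_space} \<Rightarrow> int) \<Rightarrow> 'k measure \<Rightarrow> bool" where
  "normalized_haar v \<mu> \<longleftrightarrow>
     sets \<mu> = sets borel \<and>
     (\<forall>a. \<forall>A\<in>sets borel. emeasure \<mu> ((+) a ` A) = emeasure \<mu> A) \<and>
     emeasure \<mu> (integers v) = 1"

text \<open>The module of the field: multiplication by \<open>a\<close> scales Haar measure by this factor.\<close>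

definition mod_abs :: "('k::field \<Rightarrow> int) \<Rightarrow> 'k \<Rightarrow> real" where
  "mod_abs v x = (if x = 0 then 0 else real (residue_card v) powi (- v x))"


section \<open>Characters\<close>

text \<open>
  A character of the unit group is a function on the whole field of which only the values on
  the units matter.
\<close>

definition unit_char :: "('k::{field, topological_space} \<Rightarrow> int) \<Rightarrow> ('k \<Rightarrow> complex) \<Rightarrow> bool" where
  "unit_char v chi \<longleftrightarrow>
     continuous_on (int_units v) chi \<and> chi 1 = 1 \<and>
     (\<forall>x\<in>int_units v. \<forall>y\<in>int_units v. chi (x * y) = chi x * chi y)"

definition char_ext ::
    "('k::field \<Rightarrow> int) \<Rightarrow> 'k \<Rightarrow> ('k \<Rightarrow> complex) \<Rightarrow> complex \<Rightarrow> 'k \<Rightarrow> complex" where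
  "char_ext v p chi s x = chi (p powi (- v x) * x) * of_real (mod_abs v x) powr s"


section \<open>The quadratic extension\<close>

text \<open>
  The ground field is embedded by \<open>\<iota>\<close>, and \<open>d\<close> is the square of \<open>\<alpha>\<close> viewed in the ground
  field. In \<open>alpha_normalized\<close> the first case is the unramified one, the second the ramified
  one. The uniformizers are chosen compatibly: \<open>pF\<close> is \<open>pE\<close> in the unramified case and its
  square in the ramified case. For incompatible uniformizers the extended character of the
  big field takes at \<open>\<iota> pF\<close> the extra factor \<open>chi (pE powi - vE (\<iota> pF) * \<iota> pF)\<close>, which
  translates the pole loci of the kernel.
\<close>

locale quadratic_extension = F: local_field vF + E: local_field vE
  for vF :: "'f::{field, topological_space} \<Rightarrow> int"
    and vE :: "'e::{field, topological_space} \<Rightarrow> int" +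
  fixes pF :: 'f and pE :: 'e and \<iota> :: "'f \<Rightarrow> 'e" and \<alpha> :: 'e and d :: 'f
  assumes uniformizer_F: "uniformizer vF pF"
    and uniformizer_E: "uniformizer vE pE"
    and emb_one: "\<iota> 1 = 1"
    and emb_add: "\<And>x y. \<iota> (x + y) = \<iota> x + \<iota> y"
    and emb_mult: "\<And>x y. \<iota> (x * y) = \<iota> x * \<iota> y"
    and emb_continuous: "continuous_on UNIV \<iota>"
    and alpha_notin: "\<alpha> \<notin> range \<iota>"
    and alpha_square: "\<alpha>\<^sup>2 = \<iota> d"
    and d_nonzero: "d \<noteq> 0"
    and d_nonsquare: "\<And>y. d \<noteq> y\<^sup>2"
    and generated: "\<And>x. \<exists>x1 x2. x = \<iota> x1 + \<iota> x2 * \<alpha>"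
    and alpha_normalized:
      "(vF d = 0 \<and> residue_card vE = (residue_card vF)\<^sup>2) \<or>
       (vF d = 1 \<and> residue_card vE = residue_card vF)"
    and uniformizers_compatible: "\<iota> pF = pE powi vE (\<iota> pF)"

definition coords :: "('f::field \<Rightarrow> 'e::field) \<Rightarrow> 'e \<Rightarrow> 'e \<Rightarrow> 'f \<times> 'f" where
  "coords \<iota> \<alpha> x = (THE p. x = \<iota> (fst p) + \<iota> (snd p) * \<alpha>)"


section \<open>Test functions and distributions\<close>

definition test_fun :: "'a::topological_space set \<Rightarrow> ('a \<Rightarrow> complex) set" where
  "test_fun \<Omega> =
     {\<phi>. (\<forall>x. \<exists>U. open U \<and> x \<in> U \<and> (\<forall>y\<in>U. \<phi> y = \<phi> x)) \<and>
          compact (closure {x. \<phi> x \<noteq> 0}) \<and> closure {x. \<phi> x \<noteq> 0} \<subseteq> \<Omega>}"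

text \<open>
  Only the values of a functional on test functions matter.
\<close>

definition distribution :: "(('a::topological_space \<Rightarrow> complex) \<Rightarrow> complex) \<Rightarrow> bool" where
  "distribution u \<longleftrightarrow>
     (\<forall>\<phi>\<in>test_fun UNIV. \<forall>\<psi>\<in>test_fun UNIV. u (\<lambda>x. \<phi> x + \<psi> x) = u \<phi> + u \<psi>) \<and>
     (\<forall>c. \<forall>\<phi>\<in>test_fun UNIV. u (\<lambda>x. c * \<phi> x) = c * u \<phi>)"

definition locally_integrable ::
    "'a::topological_space measure \<Rightarrow> ('a \<Rightarrow> complex) \<Rightarrow> bool" where
  "locally_integrable \<mu> f \<longleftrightarrow> (\<forall>C. compact C \<longrightarrow> set_integrable \<mu> C f)"

definition fun_distribution ::
    "'a::topological_space measure \<Rightarrow> ('a \<Rightarrow> complex) \<Rightarrow> ('a \<Rightarrow> complex) \<Rightarrow> complex" where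
  "fun_distribution \<mu> f \<phi> = (\<integral>x. f x * \<phi> x \<partial>\<mu>)"

text \<open>
  The two conditions are the equivariance under dilations and under the maps
  \<open>x \<mapsto> x / (1 - b x)\<close>, paired with a test function. In the second one the function
  \<open>|1 + b x|\<^sup>-\<^sup>2 \<phi> (x / (1 + b x))\<close> has to be extended by 0 to \<open>x = - 1 / b\<close>; this is
  what \<open>mod_abs v 0 = 0\<close> and \<open>0 powi - 2 = 0\<close> give.
\<close>

definition sb_kernels ::
    "('f::{field, topological_space} \<Rightarrow> int) \<Rightarrow> ('e::{field, topological_space} \<Rightarrow> int) \<Rightarrow>
     'f \<Rightarrow> 'e \<Rightarrow> ('f \<Rightarrow> 'e) \<Rightarrow> ('e \<Rightarrow> complex) \<Rightarrow> ('f \<Rightarrow> complex) \<Rightarrow>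
     complex \<Rightarrow> complex \<Rightarrow> (('e \<Rightarrow> complex) \<Rightarrow> complex) set" where
  "sb_kernels vF vE pF pE \<iota> chi eta s t =
     {u. distribution u \<and>
        (\<forall>a. a \<noteq> 0 \<longrightarrow> (\<forall>\<phi>\<in>test_fun UNIV.
           of_real (inverse (mod_abs vE (\<iota> a))) * u (\<lambda>x. \<phi> (inverse (\<iota> a) * x)) =
           char_ext vE pE chi (s - 1/2) (\<iota> a) * inverse (char_ext vF pF eta (t + 1/2) a) * u \<phi>)) \<and>
        (\<forall>b. b \<noteq> 0 \<longrightarrow> (\<forall>\<phi>\<in>test_fun (- {inverse (\<iota> b)}).
           u (\<lambda>x. of_real (mod_abs vE (1 + \<iota> b * x) powi (- 2)) * \<phi> (x / (1 + \<iota> b * x))) =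
           u (\<lambda>x. inverse (char_ext vE pE chi (s - 1/2) ((1 - \<iota> b * x)\<^sup>2)) * \<phi> x)))}"

definition sb_kernel_fun ::
    "('f::{field, topological_space} \<Rightarrow> int) \<Rightarrow> ('e::{field, topological_space} \<Rightarrow> int) \<Rightarrow>
     'f \<Rightarrow> 'e \<Rightarrow> ('f \<Rightarrow> 'e) \<Rightarrow> 'e \<Rightarrow> 'f \<Rightarrow> ('e \<Rightarrow> complex) \<Rightarrow> ('f \<Rightarrow> complex) \<Rightarrow>
     complex \<Rightarrow> complex \<Rightarrow> 'e \<Rightarrow> complex" where
  "sb_kernel_fun vF vE pF pE \<iota> \<alpha> d chi eta s t x =
     (if x \<in> range \<iota> then 0
      else let (x1, x2) = coords \<iota> \<alpha> x; y = x2 / (x1\<^sup>2 - x2\<^sup>2 * d)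
           in char_ext vE pE chi (s - 1/2) (x\<^sup>2) *
              (char_ext vE pE chi (s - 1/2) (\<iota> y) * char_ext vF pF eta (t + 1/2) y))"

text \<open>The sets \<open>\<S>\<^sub>+\<close> and \<open>\<S>\<^sub>-\<close> are \<open>pole_params\<close> for the sign \<open>1\<close> and \<open>- 1\<close>.\<close>

definition pole_params ::
    "('f::{field, topological_space} \<Rightarrow> int) \<Rightarrow> ('e::{field, topological_space} \<Rightarrow> int) \<Rightarrow>
     ('f \<Rightarrow> 'e) \<Rightarrow> int \<Rightarrow> (('e \<Rightarrow> complex) \<times> complex \<times> ('f \<Rightarrow> complex) \<times> complex) set" where
  "pole_params vF vE \<iota> \<epsilon> =
     {(chi, s, eta, t). unit_char vE chi \<and> unit_char vF eta \<and>
        (\<forall>u\<in>int_units vF. chi (\<iota> u) * eta u powi \<epsilon> = 1) \<and>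
        (\<exists>k::int. 2 * s + of_int \<epsilon> * t + 1/2 =
           2 * of_real pi * \<i> / of_real (ln (real (residue_card vF))) * of_int k)}"


section \<open>Meromorphic families in two complex variables\<close>

definition holomorphic2_on :: "(complex \<times> complex \<Rightarrow> complex) \<Rightarrow> (complex \<times> complex) set \<Rightarrow> bool"
  where "holomorphic2_on f U \<longleftrightarrow>
     (\<forall>z\<in>U. \<exists>A B. (f has_derivative (\<lambda>(h, k). A * h + B * k)) (at z))"

text \<open>
  A reduced local equation of a hypersurface \<open>S\<close>: the differential of \<open>g\<close> is nonzero at a
  dense set of points of \<open>S\<close>, so that \<open>g\<close> vanishes to first order along every branch of \<open>S\<close>.
\<close>

definition reduced_equation ::
    "(complex \<times> complex) set \<Rightarrow> (complex \<times> complex) set \<Rightarrow> (complex \<times> complex \<Rightarrow> complex) \<Rightarrow> bool"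
  where "reduced_equation S U g \<longleftrightarrow>
     open U \<and> holomorphic2_on g U \<and> S \<inter> U = {z\<in>U. g z = 0} \<and>
     S \<inter> U \<subseteq> closure {z \<in> S \<inter> U. \<not> (g has_derivative (\<lambda>_. 0)) (at z)}"

text \<open>
  At a crossing of several branches of \<open>S\<close> this allows a pole of order one along each branch.
\<close>

definition at_most_simple_pole ::
    "(complex \<times> complex) set \<Rightarrow> (complex \<times> complex \<Rightarrow> complex) \<Rightarrow> complex \<times> complex \<Rightarrow> bool"
  where "at_most_simple_pole S f p \<longleftrightarrow>
     (\<exists>U g h. p \<in> U \<and> reduced_equation S U g \<and> holomorphic2_on h U \<and>
        (\<forall>z\<in>U - S. f z = h z / g z))"

definition removable ::
    "(complex \<times> complex) set \<Rightarrow> (complex \<times> complex \<Rightarrow> complex) \<Rightarrow> complex \<times> complex \<Rightarrow> bool"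
  where "removable S f p \<longleftrightarrow>
     (\<exists>U h. open U \<and> p \<in> U \<and> holomorphic2_on h U \<and> (\<forall>z\<in>U - S. f z = h z))"

text \<open>
  A family \<open>T\<close> of distributions is meromorphic on the whole parameter plane with polar set
  exactly \<open>S\<close> and all poles simple. Every point of \<open>S\<close> is a pole of the family, that is, of
  its pairing with some test function; the values of \<open>T\<close> on \<open>S\<close> itself are irrelevant.
\<close>

definition meromorphic_family_simple_poles ::
    "(complex \<times> complex \<Rightarrow> ('a::topological_space \<Rightarrow> complex) \<Rightarrow> complex) \<Rightarrow>
     (complex \<times> complex) set \<Rightarrow> bool" where
  "meromorphic_family_simple_poles T S \<longleftrightarrow>
     (\<forall>z. z \<notin> S \<longrightarrow> distribution (T z)) \<and>
     (\<forall>\<phi>\<in>test_fun UNIV. holomorphic2_on (\<lambda>z. T z \<phi>) (- S) \<and>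
        (\<forall>p\<in>S. at_most_simple_pole S (\<lambda>z. T z \<phi>) p)) \<and>
     (\<forall>p\<in>S. \<exists>\<phi>\<in>test_fun UNIV. \<not> removable S (\<lambda>z. T z \<phi>) p)"

end

theory Submission
  imports Defs "HOL-Complex_Analysis.Complex_Analysis"
begin

text \<open>
  Off the ground field the kernel is a locally constant function of absolute value
  \<open>|x\<^sub>2|\<^bsup>2s + t - 1/2\<^esup> |x|\<^bsup>- t - 1/2\<^esup>\<close>; it is homogeneous under dilations by the ground field and, near a
  nonzero point of the ground field, under stretching of the coordinate \<open>x\<^sub>2\<close> alone. So its integral over a
  small box around such a point, respectively over the ring of integers, is a geometric series with ratio
  \<open>q\<^bsup>- (2s + t + 1/2)\<^esup>\<close>, respectively \<open>q\<^bsup>- (2s - t + 1/2)\<^esup>\<close>, or it vanishes because a character is nontrivial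
  on the units. Together with the functions supported off the ground field the indicators of these sets span
  all test functions, which gives the continuation. The equivariance properties are changes of variables in
  the domain of convergence and persist by the identity theorem on complex lines.

  The residue along one family of poles is computed on a box around 1. Along the other family it is a multiple
  of the evaluation at 0, and the multiple is the integral of a character of the big field over the projective
  line. If it vanished identically, a character of the big field would have integral 0 over every strip in
  every sphere, and a Radon transform argument excludes this.
\<close>

section \<open>Local fields\<close>

text \<open>Only the Haar measure of the big field is given. Volumes of coordinate boxes are
  therefore found by counting cosets, and the scaling factor of a linear map comes from uniqueness
  of translation invariant measures. Contracting the second coordinate by \<open>pF\<close> costs a
  volume factor 1/q, dilating both costs 1/q^2; combined with the homogeneity of the kernel these
  are the shifts by 1/2 in the polar loci. Compatible uniformizers make the angular characters equal
  to 1 at \<open>pF\<close>, so the ratios carry no further constant.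

  Two-variable function theory is kept to a minimum: every pairing, multiplied by one explicit
  product \<open>pole_factor\<close>, is entire. Uniqueness then needs only complex lines,
  simplicity of the poles is read off from a single global equation, and removability of a pole
  forces the numerator to vanish on nearby poles.

  The hard point is that the residue at 0 does not vanish identically on any open piece of its line.
  Instead of an evaluation depending on conductor and ramification, vanishing is assumed: comparing
  coefficients along the line separates the level sets of the valuations, and the remaining
  statement concerns one unitary character.\<close>

definition fideal :: "('k::field \<Rightarrow> int) \<Rightarrow> int \<Rightarrow> 'k set" where
  "fideal v n = {x. x = 0 \<or> n \<le> v x}"

text \<open>A finite subfamily of an increasing chain is dominated by its largest member.
  Boundedness and closedness of compact sets and the uniform level of a test function are all read
  off from such chains.\<close>

lemma compact_increasing_cover:
  fixes U :: "nat \<Rightarrow> 'a::topological_space set"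
  assumes "compact S" "\<And>n. open (U n)" "\<And>m n. m \<le> n \<Longrightarrow> U m \<subseteq> U n" "S \<subseteq> (\<Union>n. U n)"
  obtains n where "S \<subseteq> U n"
proof -
  obtain C where C: "finite C" "S \<subseteq> (\<Union>n\<in>C. U n)"
    using compactE_image[OF assms(1), of UNIV U] assms by metis
  have "U n \<subseteq> U (Max (insert 0 C))" if "n \<in> C" for n
    using C(1) that by (intro assms(3) Max_ge) auto
  then have "S \<subseteq> U (Max (insert 0 C))" using C(2) by blast
  then show ?thesis using that by blast
qed

context local_field
begin

lemma zero_in_fideal [simp]: "0 \<in> fideal v n"
  by (simp add: fideal_def)

lemma fideal_0: "fideal v 0 = integers v"
  by (auto simp: fideal_def integers_def)

lemma fideal_mono: "m \<le> n \<Longrightarrow> fideal v n \<subseteq> fideal v m"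
  by (auto simp: fideal_def)

lemma fideal_monoD: "x \<in> fideal v n \<Longrightarrow> m \<le> n \<Longrightarrow> x \<in> fideal v m"
  by (auto simp: fideal_def)

lemma fideal_iff: "x \<noteq> 0 \<Longrightarrow> x \<in> fideal v n \<longleftrightarrow> n \<le> v x"
  by (auto simp: fideal_def)

lemma val_1 [simp]: "v 1 = 0"
  using val_mult[of 1 1] by simp

lemma val_minus [simp]: "v (- x) = v x"
proof (cases "x = 0")
  case False
  have "v (- 1) = 0" using val_mult[of "- 1" "- 1"] by simp
  then show ?thesis using val_mult[of "- 1" x] False by simp
qed simp

lemma val_inverse: "x \<noteq> 0 \<Longrightarrow> v (inverse x) = - v x"
  using val_mult[of x "inverse x"] by simp

lemma val_divide: "x \<noteq> 0 \<Longrightarrow> y \<noteq> 0 \<Longrightarrow> v (x / y) = v x - v y"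
  by (simp add: divide_inverse val_mult val_inverse)

lemma val_power: "x \<noteq> 0 \<Longrightarrow> v (x ^ n) = int n * v x"
  by (induction n) (auto simp: val_mult algebra_simps)

lemma val_power_int: "x \<noteq> 0 \<Longrightarrow> v (x powi n) = n * v x"
  by (auto simp: power_int_def val_power val_inverse)

lemma fideal_add: "x \<in> fideal v n \<Longrightarrow> y \<in> fideal v n \<Longrightarrow> x + y \<in> fideal v n"
  using val_add[of x y] by (fastforce simp: fideal_def)

lemma fideal_uminus: "- x \<in> fideal v n \<longleftrightarrow> x \<in> fideal v n"
  by (auto simp: fideal_def)

lemma fideal_diff: "x \<in> fideal v n \<Longrightarrow> y \<in> fideal v n \<Longrightarrow> x - y \<in> fideal v n"
  using fideal_add[of x n "- y"] by (simp add: fideal_uminus)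

lemma fideal_diff_commute: "x - y \<in> fideal v n \<longleftrightarrow> y - x \<in> fideal v n"
  using fideal_uminus[of "x - y" n] by simp

lemma fideal_diff_trans: "x - y \<in> fideal v n \<Longrightarrow> y - z \<in> fideal v n \<Longrightarrow> x - z \<in> fideal v n"
  using fideal_add[of "x - y" n "y - z"] by simp

lemma fideal_mult: "x \<in> fideal v m \<Longrightarrow> y \<in> fideal v n \<Longrightarrow> x * y \<in> fideal v (m + n)"
  by (cases "x = 0 \<or> y = 0") (auto simp: fideal_def val_mult)

lemma fideal_scale: "a \<noteq> 0 \<Longrightarrow> a * x \<in> fideal v n \<longleftrightarrow> x \<in> fideal v (n - v a)"
  by (cases "x = 0") (auto simp: fideal_def val_mult)

text \<open>The dominant term decides an ultrametric sum: a perturbation of strictly larger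
  valuation changes neither nonvanishing nor the valuation. Local constancy of absolute values and
  characters rests on this.\<close>

lemma val_stable:
  assumes "x \<noteq> 0" "y - x \<in> fideal v (v x + 1)"
  shows "y \<noteq> 0" "v y = v x"
proof -
  show y: "y \<noteq> 0" using assms fideal_uminus[of "y - x"] fideal_iff[of x "v x + 1"] by auto
  show "v y = v x"
  proof (rule ccontr)
    assume ne: "v y \<noteq> v x"
    have d: "y - x \<noteq> 0" "v (y - x) \<ge> v x + 1" using ne assms(2) by (auto simp: fideal_def)
    have 1: "min (v x) (v (y - x)) \<le> v y"
      using val_add[of x "y - x"] assms(1) d y by simp
    have 2: "min (v y) (v (x - y)) \<le> v x"
      using val_add[of y "x - y"] assms(1) d y by simp
    have "v (x - y) = v (y - x)" using val_minus[of "x - y"] by simp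
    with 1 2 d ne show False by linarith
  qed
qed

lemma ex_val: "\<exists>x. x \<noteq> 0 \<and> v x = n"
proof -
  obtain p where "p \<noteq> 0" "v p = 1" using val_normalized by auto
  then show ?thesis by (intro exI[of _ "p powi n"]) (simp add: val_power_int)
qed

lemma open_iff: "open S \<longleftrightarrow> (\<forall>x\<in>S. \<exists>n. \<forall>y. y - x \<in> fideal v n \<longrightarrow> y \<in> S)"
proof -
  have "(y \<noteq> x \<and> n \<le> v (y - x) \<longrightarrow> y \<in> S) \<longleftrightarrow> (y - x \<in> fideal v n \<longrightarrow> y \<in> S)" if "x \<in> S" for x y n
    using that by (auto simp: fideal_def)
  then have "(\<forall>x\<in>S. \<exists>n. \<forall>y. y \<noteq> x \<and> n \<le> v (y - x) \<longrightarrow> y \<in> S) \<longleftrightarrow>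
      (\<forall>x\<in>S. \<exists>n. \<forall>y. y - x \<in> fideal v n \<longrightarrow> y \<in> S)" by simp
  then show ?thesis unfolding open_val .
qed

lemma open_coset [simp]: "open {y. y - x \<in> fideal v n}"
  unfolding open_iff by (auto intro: fideal_diff_trans)

lemma closed_coset [simp]: "closed {y. y - x \<in> fideal v n}"
  unfolding closed_def open_iff
proof (intro ballI exI allI impI)
  fix z y assume "z \<in> - {y. y - x \<in> fideal v n}" "y - z \<in> fideal v n"
  then show "y \<in> - {y. y - x \<in> fideal v n}"
    using fideal_diff_trans[of z y n x] fideal_diff_commute[of y z n] by auto
qed

lemma open_fideal [simp]: "open (fideal v n)"
  using open_coset[of 0 n] by simp

lemma closed_fideal [simp]: "closed (fideal v n)"
  using closed_coset[of 0 n] by simp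

text \<open>The type class provides a field and a topology without any relation between them, so
  continuity of field operations has to come from \<open>open_iff\<close>.\<close>

lemma continuous_affine: "continuous_on UNIV (\<lambda>x::'k. a * x + b)"
proof (cases "a = 0")
  case False
  have "open ((\<lambda>x. a * x + b) -` S)" if S: "open S" for S
    unfolding open_iff
  proof
    fix x assume "x \<in> (\<lambda>x. a * x + b) -` S"
    then obtain n where n: "\<And>y. y - (a * x + b) \<in> fideal v n \<Longrightarrow> y \<in> S"
      using S unfolding open_iff by auto
    have "a * y + b \<in> S" if "y - x \<in> fideal v (n - v a)" for y
      using n[of "a * y + b"] that fideal_scale[OF False, of "y - x" n] by (simp add: algebra_simps)
    then show "\<exists>n. \<forall>y. y - x \<in> fideal v n \<longrightarrow> y \<in> (\<lambda>x. a * x + b) -` S" by auto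
  qed
  then show ?thesis by (simp add: continuous_on_open_vimage)
qed simp

lemma compact_fideal: "compact (fideal v n)"
proof -
  obtain a where a: "a \<noteq> 0" "v a = n" using ex_val by blast
  have "fideal v n = (\<lambda>x. a * x + 0) ` integers v"
  proof (intro set_eqI iffI)
    fix x assume "x \<in> fideal v n"
    then have "x / a \<in> integers v" using fideal_scale[of a "x / a" n] a by (simp add: fideal_0)
    then show "x \<in> (\<lambda>x. a * x + 0) ` integers v" using a by (force intro: image_eqI[of _ _ "x / a"])
  qed (use a in \<open>auto simp: fideal_scale simp flip: fideal_0\<close>)
  then show ?thesis
    using compact_continuous_image[OF continuous_on_subset[OF continuous_affine[of a 0]] compact_integers]
    by auto
qed

lemma bounded_ex: "\<exists>k::nat. x \<in> fideal v (- int k)"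
  by (rule exI[of _ "nat (- v x)"]) (auto simp: fideal_def)

lemma compact_bounded:
  fixes C :: "'k set"
  assumes "compact C" obtains k :: nat where "C \<subseteq> fideal v (- int k)"
proof -
  have "C \<subseteq> (\<Union>k. fideal v (- int k))" using bounded_ex by blast
  then show ?thesis
    using compact_increasing_cover[OF assms, of "\<lambda>k. fideal v (- int k)"] fideal_mono that by force
qed

lemma separated: "x \<noteq> y \<Longrightarrow> \<exists>k::nat. y - x \<notin> fideal v (int k)"
  by (rule exI[of _ "nat (v (y - x) + 1)"]) (auto simp: fideal_def)

text \<open>The Hausdorff property is not part of the type class. It comes from
  \<open>separated\<close>: the complements of shrinking cosets of \<open>x\<close> form an
  increasing open cover of any set avoiding \<open>x\<close>.\<close>

lemma compact_closed:
  fixes C :: "'k set"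
  assumes "compact C" shows "closed C"
  unfolding closed_def open_iff
proof
  fix x assume x: "x \<in> - C"
  have "open {y. y - x \<notin> fideal v n}" for n
    using closed_coset[of x n] by (simp add: closed_def Collect_neg_eq)
  moreover have "C \<subseteq> (\<Union>k. {y. y - x \<notin> fideal v (int k)})"
  proof
    fix y assume "y \<in> C"
    then show "y \<in> (\<Union>k. {y. y - x \<notin> fideal v (int k)})" using separated[of x y] x by auto
  qed
  moreover have "{y. y - x \<notin> fideal v (int i)} \<subseteq> {y. y - x \<notin> fideal v (int j)}" if "i \<le> j" for i j
    using that fideal_mono[of "int i" "int j"] by auto
  ultimately obtain k :: nat where "C \<subseteq> {y. y - x \<notin> fideal v (int k)}"
    using compact_increasing_cover[OF assms, of "\<lambda>k. {y. y - x \<notin> fideal v (int k)}"] by metis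
  then show "\<exists>n. \<forall>y. y - x \<in> fideal v n \<longrightarrow> y \<in> - C" by blast
qed

text \<open>Finite index of one ideal in another, by compactness. The level \<open>max m n\<close>
  keeps the second ideal inside the first when \<open>n < m\<close>.\<close>

lemma finite_reps:
  obtains R where "finite R" "R \<subseteq> fideal v m" "\<And>x. x \<in> fideal v m \<Longrightarrow> \<exists>!r. r \<in> R \<and> x - r \<in> fideal v (max m n)"
proof -
  let ?n = "max m n"
  have "fideal v m \<subseteq> (\<Union>x\<in>fideal v m. {y. y - x \<in> fideal v ?n})" by auto
  then obtain C where C: "C \<subseteq> fideal v m" "finite C" "fideal v m \<subseteq> (\<Union>x\<in>C. {y. y - x \<in> fideal v ?n})"
    using compactE_image[OF compact_fideal[of m], of "fideal v m" "\<lambda>x. {y. y - x \<in> fideal v ?n}"]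
    by (metis open_coset)
  define f where "f x = (SOME r. r \<in> C \<and> x - r \<in> fideal v ?n)" for x
  have f: "f x \<in> C \<and> x - f x \<in> fideal v ?n" if "x \<in> fideal v m" for x
    unfolding f_def by (rule someI_ex) (use that C in auto)
  \<comment> \<open>The predicate to choose from depends only on the coset, so the same element is
    picked throughout a coset; this makes the image of \<open>f\<close> a transversal.\<close>
  have eq: "f x = f y" if "x - y \<in> fideal v ?n" for x y
  proof -
    have "(x - r \<in> fideal v ?n) = (y - r \<in> fideal v ?n)" for r
      using that fideal_diff_trans[of x y ?n r] fideal_diff_trans[of y x ?n r] fideal_diff_commute[of x y] by auto
    then show ?thesis by (simp add: f_def)
  qed
  show ?thesis
  proof
    show "finite (f ` fideal v m)" using f C(2) by (meson finite_subset image_subsetI)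
    show "f ` fideal v m \<subseteq> fideal v m" using f C(1) by blast
    fix x assume x: "x \<in> fideal v m"
    show "\<exists>!r. r \<in> f ` fideal v m \<and> x - r \<in> fideal v ?n"
    proof (rule ex1I[of _ "f x"])
      fix r assume r: "r \<in> f ` fideal v m \<and> x - r \<in> fideal v ?n"
      then obtain y where y: "y \<in> fideal v m" "r = f y" by auto
      have "x - y \<in> fideal v ?n"
        using r y f[OF y(1)] fideal_diff_trans[of x "f y" ?n y] fideal_diff_commute[of y "f y"] by auto
      then show "r = f x" using y eq by simp
    qed (use f x in auto)
  qed
qed

text \<open>Trades the quotient set in \<open>residue_card\<close> for a transversal, on which
  cosets can be counted. There are at least two classes because 0 and 1 are incongruent.\<close>

lemma residue_reps:
  obtains R where "finite R" "card R = residue_card v" "R \<subseteq> fideal v 0"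
    "\<And>x. x \<in> fideal v 0 \<Longrightarrow> \<exists>!r. r \<in> R \<and> x - r \<in> fideal v 1" "residue_card v \<ge> 2"
proof -
  obtain R where R: "finite R" "R \<subseteq> fideal v 0" "\<And>x. x \<in> fideal v 0 \<Longrightarrow> \<exists>!r. r \<in> R \<and> x - r \<in> fideal v 1"
    using finite_reps[of 0 1] by auto
  define E where "E = {(x, y) \<in> integers v \<times> integers v. x = y \<or> 1 \<le> v (x - y)}"
  have E: "(x, y) \<in> E \<longleftrightarrow> x \<in> fideal v 0 \<and> y \<in> fideal v 0 \<and> x - y \<in> fideal v 1" for x y
    unfolding E_def fideal_0[symmetric] by (auto simp: fideal_def)
  have eqv: "equiv (fideal v 0) E"
    by (rule equivI) (auto simp: refl_on_def sym_def trans_def E intro: fideal_diff_trans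
      dest: fideal_diff_commute[THEN iffD1])
  have "bij_betw (\<lambda>r. E `` {r}) R (fideal v 0 // E)"
  proof (rule bij_betwI')
    fix x y assume "x \<in> R" "y \<in> R"
    then show "(E `` {x} = E `` {y}) = (x = y)"
      using eq_equiv_class_iff[OF eqv, of x y] R(2,3) E
      by (metis R(2,3) cancel_comm_monoid_add_class.diff_cancel subsetD zero_in_fideal)
  next
    fix X assume "X \<in> fideal v 0 // E"
    then obtain x where x: "x \<in> fideal v 0" "X = E `` {x}" by (auto simp: quotient_def)
    then obtain r where "r \<in> R" "x - r \<in> fideal v 1" using R(3) by blast
    then show "\<exists>r\<in>R. X = E `` {r}"
      using eq_equiv_class_iff[OF eqv, of x r] x R(2) E by blast
  qed (use R(2) in \<open>auto intro: quotientI\<close>)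
  then have card: "card R = residue_card v"
    unfolding residue_card_def E_def fideal_0 by (rule bij_betw_same_card)
  obtain r0 where r0: "r0 \<in> R" "0 - r0 \<in> fideal v 1" using R(3)[of 0] by auto
  obtain r1 where r1: "r1 \<in> R" "1 - r1 \<in> fideal v 1" using R(3)[of 1] by (auto simp: fideal_def)
  have "r0 \<noteq> r1"
  proof
    assume "r0 = r1"
    then have "1 - 0 \<in> fideal v 1"
      using r0 r1 fideal_diff_trans[of 1 r1 1 0] fideal_diff_commute[of 0 r0] by auto
    then show False by (simp add: fideal_def)
  qed
  then have "card {r0, r1} \<le> card R" using r0 r1 R(1) by (intro card_mono) auto
  then have "residue_card v \<ge> 2" using card \<open>r0 \<noteq> r1\<close> by simp
  with R card show ?thesis using that by blast
qed

lemma residue_card_ge_2: "residue_card v \<ge> 2"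
  using residue_reps by blast


section \<open>Test functions\<close>

lemma support_clopen:
  assumes "\<forall>x. \<exists>U. open U \<and> x \<in> U \<and> (\<forall>y\<in>U. \<phi> y = \<phi> x)"
  shows "closure {x. \<phi> x \<noteq> (0::complex)} = {x. \<phi> x \<noteq> 0}"
proof -
  have "open (- {x. \<phi> x \<noteq> 0})"
  proof (subst open_subopen, intro ballI)
    fix x assume "x \<in> - {x. \<phi> x \<noteq> 0}"
    moreover obtain U where "open U" "x \<in> U" "\<forall>y\<in>U. \<phi> y = \<phi> x" using assms by blast
    ultimately show "\<exists>T. open T \<and> x \<in> T \<and> T \<subseteq> - {x. \<phi> x \<noteq> 0}"
      by (metis (mono_tags, lifting) ComplD ComplI mem_Collect_eq subsetI)
  qed
  then show ?thesis by (simp add: closed_def closure_closed)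
qed

lemma test_fun_iff: "\<phi> \<in> test_fun \<Omega> \<longleftrightarrow> \<phi> \<in> test_fun UNIV \<and> (\<forall>x. \<phi> x \<noteq> 0 \<longrightarrow> x \<in> \<Omega>)"
  unfolding test_fun_def using support_clopen[of \<phi>] by auto

lemma test_fun_compact_support: "\<phi> \<in> test_fun UNIV \<Longrightarrow> compact {x. \<phi> x \<noteq> 0}"
  unfolding test_fun_def using support_clopen[of \<phi>] by auto

lemma test_funI_local:
  fixes f :: "'k \<Rightarrow> complex"
  assumes loc: "\<And>x. \<exists>n. \<forall>y. y - x \<in> fideal v n \<longrightarrow> f y = f x" and supp: "\<And>x. f x \<noteq> 0 \<Longrightarrow> x \<in> fideal v l"
  shows "f \<in> test_fun UNIV"
proof -
  have lc: "\<forall>x. \<exists>U. open U \<and> x \<in> U \<and> (\<forall>y\<in>U. f y = f x)"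
  proof
    fix x
    obtain n where "\<forall>y. y - x \<in> fideal v n \<longrightarrow> f y = f x" using loc by blast
    then have "\<forall>y\<in>{y. y - x \<in> fideal v n}. f y = f x" by blast
    then show "\<exists>U. open U \<and> x \<in> U \<and> (\<forall>y\<in>U. f y = f x)"
      using open_coset[of x n] by (metis (mono_tags, lifting) cancel_comm_monoid_add_class.diff_cancel mem_Collect_eq zero_in_fideal)
  qed
  have "closed {x. f x \<noteq> 0}" using support_clopen[OF lc] closed_closure by metis
  then have "compact (fideal v l \<inter> {x. f x \<noteq> 0})"
    by (intro compact_Int_closed compact_fideal)
  moreover have "fideal v l \<inter> {x. f x \<noteq> 0} = {x. f x \<noteq> 0}" using supp by auto
  ultimately show ?thesis using lc support_clopen[OF lc] by (simp add: test_fun_def)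
qed

lemma test_funI:
  fixes \<phi> :: "'k \<Rightarrow> complex"
  assumes "\<And>x y. y - x \<in> fideal v k \<Longrightarrow> \<phi> y = \<phi> x" and "\<And>x. \<phi> x \<noteq> 0 \<Longrightarrow> x \<in> fideal v l"
  shows "\<phi> \<in> test_fun UNIV"
proof (rule test_funI_local)
  show "\<exists>n. \<forall>y. y - x \<in> fideal v n \<longrightarrow> \<phi> y = \<phi> x" for x using assms(1) by blast
qed (rule assms(2))

text \<open>Local constancy becomes uniform: the sets \<open>U k\<close> of points where level
  \<open>k\<close> suffices increase and cover a compact ideal containing the support, so one
  \<open>k\<close> serves everywhere.\<close>

lemma test_funE:
  fixes \<phi> :: "'k \<Rightarrow> complex"
  assumes "\<phi> \<in> test_fun UNIV"
  obtains k :: nat where "\<And>x y. y - x \<in> fideal v (int k) \<Longrightarrow> \<phi> y = \<phi> x"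
    "\<And>x. \<phi> x \<noteq> 0 \<Longrightarrow> x \<in> fideal v (- int k)"
proof -
  have lc: "\<exists>U. open U \<and> x \<in> U \<and> (\<forall>y\<in>U. \<phi> y = \<phi> x)" for x
    using assms by (auto simp: test_fun_def)
  obtain l :: nat where l: "{x. \<phi> x \<noteq> 0} \<subseteq> fideal v (- int l)"
    using compact_bounded[OF test_fun_compact_support[OF assms]] by blast
  define U where "U k = {x. \<forall>y. y - x \<in> fideal v (int k) \<longrightarrow> \<phi> y = \<phi> x}" for k :: nat
  have "open (U k)" for k unfolding open_iff
  proof
    fix x assume x: "x \<in> U k"
    have "z \<in> U k" if z: "z - x \<in> fideal v (int k)" for z
    proof -
      have x: "\<phi> y = \<phi> x" if "y - x \<in> fideal v (int k)" for y
        using x that unfolding U_def by blast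
      have "\<phi> y = \<phi> z" if "y - z \<in> fideal v (int k)" for y
        using x[OF z] x[OF fideal_diff_trans[OF that z]] by (rule trans[OF _ sym, rotated])
      then show ?thesis unfolding U_def by blast
    qed
    then show "\<exists>n. \<forall>y. y - x \<in> fideal v n \<longrightarrow> y \<in> U k" by blast
  qed
  moreover have "U m \<subseteq> U n" if "m \<le> n" for m n
    using that fideal_mono[of "int m" "int n"] by (auto simp: U_def)
  moreover have "fideal v (- int l) \<subseteq> (\<Union>k. U k)"
  proof
    fix x
    obtain V where "open V" "x \<in> V" "\<forall>y\<in>V. \<phi> y = \<phi> x" using lc by blast
    then obtain n where n: "\<And>y. y - x \<in> fideal v n \<Longrightarrow> \<phi> y = \<phi> x" unfolding open_iff by blast
    have "\<phi> y = \<phi> x" if "y - x \<in> fideal v (int (nat n))" for y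
      by (rule n) (use that fideal_monoD[of "y - x" "int (nat n)" n] in auto)
    then have "x \<in> U (nat n)" unfolding U_def by blast
    then show "x \<in> (\<Union>k. U k)" by blast
  qed
  ultimately obtain k where k: "fideal v (- int l) \<subseteq> U k"
    using compact_increasing_cover[OF compact_fideal[of "- int l"], of U] by metis
  show ?thesis
  proof (rule that[of "max k l"])
    fix x show "\<phi> x \<noteq> 0 \<Longrightarrow> x \<in> fideal v (- int (max k l))"
      using l fideal_mono[of "- int (max k l)" "- int l"] by auto
  next
    fix x y assume xy: "y - x \<in> fideal v (int (max k l))"
    then have xy': "y - x \<in> fideal v (int k)" "y - x \<in> fideal v (- int l)"
      using fideal_monoD[of _ "int (max k l)"] by auto
    show "\<phi> y = \<phi> x"
    proof (cases "x \<in> fideal v (- int l)")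
      case True then show ?thesis using k xy' by (auto simp: U_def)
    next
      case False
      \<comment> \<open>Outside the ideal the ultrametric inequality keeps the whole coset outside,
        so both values vanish.\<close>
      then have "y \<notin> fideal v (- int l)" using xy'(2) fideal_diff[of y _ "y - x"] by auto
      then have "\<phi> x = 0" "\<phi> y = 0" using False l by blast+
      then show ?thesis by simp
    qed
  qed
qed

lemma test_fun_add:
  fixes \<phi> \<psi> :: "'k \<Rightarrow> complex"
  assumes "\<phi> \<in> test_fun UNIV" "\<psi> \<in> test_fun UNIV"
  shows "(\<lambda>x. \<phi> x + \<psi> x) \<in> test_fun UNIV"
proof -
  from assms obtain k l where k: "\<And>x y. y - x \<in> fideal v (int k) \<Longrightarrow> \<phi> y = \<phi> x" "\<And>x. \<phi> x \<noteq> 0 \<Longrightarrow> x \<in> fideal v (- int k)"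
    and l: "\<And>x y. y - x \<in> fideal v (int l) \<Longrightarrow> \<psi> y = \<psi> x" "\<And>x. \<psi> x \<noteq> 0 \<Longrightarrow> x \<in> fideal v (- int l)"
    by (metis test_funE)
  show ?thesis
  proof (rule test_funI[of "max (int k) (int l)" _ "min (- int k) (- int l)"])
    fix x y assume "y - x \<in> fideal v (max (int k) (int l))"
    then show "\<phi> y + \<psi> y = \<phi> x + \<psi> x" using k(1)[of y x] l(1)[of y x] fideal_monoD[of "y - x"] by auto
  next
    fix x assume "\<phi> x + \<psi> x \<noteq> 0"
    then have "\<phi> x \<noteq> 0 \<or> \<psi> x \<noteq> 0" by auto
    then show "x \<in> fideal v (min (- int k) (- int l))" using k(2)[of x] l(2)[of x] fideal_monoD[of x] by auto
  qed
qed

lemma test_fun_scale: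
  fixes \<phi> :: "'k \<Rightarrow> complex"
  assumes "\<phi> \<in> test_fun UNIV"
  shows "(\<lambda>x. c * \<phi> x) \<in> test_fun UNIV"
proof -
  obtain k where k: "\<And>x y. y - x \<in> fideal v (int k) \<Longrightarrow> \<phi> y = \<phi> x" "\<And>x. \<phi> x \<noteq> 0 \<Longrightarrow> x \<in> fideal v (- int k)"
    using test_funE[OF assms] by metis
  show ?thesis
    by (rule test_funI[of "int k" _ "- int k"]) (use k in \<open>fastforce+\<close>)
qed

text \<open>The multiplier has to be locally constant only where \<open>\<phi>\<close> is nonzero:
  the automorphy factors to be inserted are singular at a point outside the support.\<close>

lemma test_fun_mult:
  fixes \<phi> :: "'k \<Rightarrow> complex"
  assumes \<phi>: "\<phi> \<in> test_fun UNIV"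
    and f: "\<And>x. \<phi> x \<noteq> 0 \<Longrightarrow> \<exists>n. \<forall>y. y - x \<in> fideal v n \<longrightarrow> f y = f x"
  shows "(\<lambda>x. f x * \<phi> x) \<in> test_fun UNIV"
proof -
  obtain k where k: "\<And>x y. y - x \<in> fideal v (int k) \<Longrightarrow> \<phi> y = \<phi> x" "\<And>x. \<phi> x \<noteq> 0 \<Longrightarrow> x \<in> fideal v (- int k)"
    using test_funE[OF \<phi>] by metis
  show ?thesis
  proof (rule test_funI_local)
    fix x show "\<exists>n. \<forall>y. y - x \<in> fideal v n \<longrightarrow> f y * \<phi> y = f x * \<phi> x"
    proof (cases "\<phi> x = 0")
      case True
      have "f y * \<phi> y = f x * \<phi> x" if "y - x \<in> fideal v (int k)" for y
        using k(1)[OF that] True by simp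
      then show ?thesis by blast
    next
      case False
      then obtain n where n: "\<And>y. y - x \<in> fideal v n \<Longrightarrow> f y = f x" using f by blast
      have "f y * \<phi> y = f x * \<phi> x" if "y - x \<in> fideal v (max n (int k))" for y
      proof -
        have "y - x \<in> fideal v n" "y - x \<in> fideal v (int k)" using fideal_monoD[OF that] by simp_all
        then have "f y = f x" "\<phi> y = \<phi> x" using n k(1) by blast+
        then show ?thesis by metis
      qed
      then show ?thesis by blast
    qed
  qed (use k(2) in auto)
qed

end

section \<open>Haar measure\<close>

definition disc :: "('k::field \<Rightarrow> int) \<Rightarrow> 'k \<Rightarrow> int \<Rightarrow> 'k set" where
  "disc v x n = {y. y - x \<in> fideal v n}"

text \<open>Invariance without normalization, so that push-forwards of Haar measure qualify before
  their scaling constant is known.\<close>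

definition transl_inv :: "'k::{field, topological_space} measure \<Rightarrow> bool" where
  "transl_inv M \<longleftrightarrow> sets M = sets borel \<and>
     (\<forall>a. \<forall>A\<in>sets borel. emeasure M ((+) a ` A) = emeasure M A)"

lemma finite_disjoint_translates:
  fixes M :: "'k::{field, topological_space} measure"
  assumes "transl_inv M" "finite R" "H \<in> sets borel" "\<And>a. (+) a ` H \<in> sets borel"
    and "\<And>r s. r \<in> R \<Longrightarrow> s \<in> R \<Longrightarrow> r \<noteq> s \<Longrightarrow> (+) (g r) ` H \<inter> (+) (g s) ` H = {}"
  shows "emeasure M (\<Union>r\<in>R. (+) (g r) ` H) = of_nat (card R) * emeasure M H"
proof -
  have "emeasure M (\<Union>r\<in>R. (+) (g r) ` H) = (\<Sum>r\<in>R. emeasure M ((+) (g r) ` H))"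
    using assms by (intro sum_emeasure[symmetric]) (auto simp: transl_inv_def disjoint_family_on_def)
  also have "\<dots> = of_nat (card R) * emeasure M H"
    using assms(1,3) by (simp add: transl_inv_def)
  finally show ?thesis .
qed

context local_field
begin

abbreviation "q \<equiv> residue_card v"

lemma q_gt_0: "real q > 0" and q_gt_1: "real q > 1"
  using residue_card_ge_2 by simp_all

lemma disc_translate: "disc v x n = (+) x ` fideal v n"
  by (auto simp: disc_def intro!: image_eqI[of _ _ "_ - x"])

lemma disc_0: "disc v 0 n = fideal v n"
  by (simp add: disc_def)

lemma disc_borel [simp]: "disc v x n \<in> sets borel"
  by (simp add: disc_def)

lemma fideal_borel [simp]: "fideal v n \<in> sets borel"
  by simp

lemma center_in_disc [simp]: "x \<in> disc v x n"
  by (simp add: disc_def)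

lemma disc_eq: "y \<in> disc v x n \<Longrightarrow> disc v y n = disc v x n"
  unfolding disc_def using fideal_diff_trans[of _ y n x] fideal_diff_trans[of _ x n y] fideal_diff_commute[of y x] by blast

lemma disc_mono: "m \<le> n \<Longrightarrow> disc v x n \<subseteq> disc v x m"
  unfolding disc_def using fideal_mono[of m n] by blast

text \<open>Every point of an ultrametric disc is a centre, so discs that meet are nested. This
  makes the discs an intersection-stable generator.\<close>

lemma disc_Int: "disc v x m \<inter> disc v y n = {} \<or> disc v x m \<inter> disc v y n = disc v x m
    \<or> disc v x m \<inter> disc v y n = disc v y n"
proof (cases "disc v x m \<inter> disc v y n = {}")
  case False
  then obtain z where "z \<in> disc v x m" "z \<in> disc v y n" by blast
  then have "disc v x m = disc v z m" "disc v y n = disc v z n" using disc_eq by auto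
  then show ?thesis using disc_mono[of m n z] disc_mono[of n m z] by (cases "m \<le> n") auto
qed simp

text \<open>For a fixed radius only finitely many discs have their centre in a given ideal, since
  ideals are compact.\<close>

lemma countable_discs: "countable {D :: 'k set. \<exists>x n. D = disc v x n}"
proof -
  have fin: "finite {D. \<exists>x\<in>fideal v (- int k). D = disc v x n}" for k n
  proof -
    obtain R where R: "finite R" "\<And>x. x \<in> fideal v (min n (- int k)) \<Longrightarrow> \<exists>!r. r \<in> R \<and> x - r \<in> fideal v (max (min n (- int k)) n)"
      using finite_reps[of "min n (- int k)" n] by metis
    have "{D. \<exists>x\<in>fideal v (- int k). D = disc v x n} \<subseteq> (\<lambda>r. disc v r n) ` R"
    proof clarify
      fix x assume "x \<in> fideal v (- int k)"
      then obtain r where "r \<in> R" "x - r \<in> fideal v n"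
        using R(2)[of x] fideal_monoD[of x "- int k" "min n (- int k)"] by auto
      then show "disc v x n \<in> (\<lambda>r. disc v r n) ` R"
        using disc_eq[of x r n] by (auto simp: disc_def)
    qed
    then show ?thesis using R(1) finite_surj by blast
  qed
  have "{D. \<exists>x n. D = disc v x n} \<subseteq> (\<Union>k::nat. \<Union>n. {D. \<exists>x\<in>fideal v (- int k). D = disc v x n})"
  proof clarify
    fix x n
    obtain k :: nat where "x \<in> fideal v (- int k)" using bounded_ex by blast
    then show "disc v x n \<in> (\<Union>k::nat. \<Union>n. {D. \<exists>x\<in>fideal v (- int k). D = disc v x n})" by blast
  qed
  moreover have "countable (\<Union>k::nat. \<Union>n. {D. \<exists>x\<in>fideal v (- int k). D = disc v x n})"
    by (intro countable_UN countable_finite fin countableI_type)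
  ultimately show ?thesis by (rule countable_subset)
qed

text \<open>A uniqueness theorem with one exceptional point \<open>c\<close>. For a Moebius map
  \<open>c\<close> is the image of infinity: discs around it have unbounded preimages, whereas discs
  avoiding it pull back to discs, and \<open>{c}\<close> is tested separately.\<close>

lemma measure_eqI_discs:
  fixes M N :: "'k measure"
  assumes M: "sets M = sets borel" and N: "sets N = sets borel"
    and sing: "emeasure M {c} = emeasure N {c}" "emeasure M {c} \<noteq> \<infinity>"
    and eq: "\<And>x n. c \<notin> disc v x n \<Longrightarrow> emeasure M (disc v x n) = emeasure N (disc v x n)"
    and fin: "\<And>x n. c \<notin> disc v x n \<Longrightarrow> emeasure M (disc v x n) \<noteq> \<infinity>"
  shows "M = N"
proof -
  define D where "D = {D. \<exists>x n. D = disc v x n \<and> c \<notin> disc v x n}"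
  have cD: "countable D"
    by (rule countable_subset[OF _ countable_discs]) (auto simp: D_def)
  let ?E = "{{}, {c}} \<union> D"
  have ex: "\<exists>X\<in>D. x \<in> X \<and> X \<subseteq> S" if S: "open S" "x \<in> S" and xc: "x \<noteq> c" for x S
  proof -
    obtain n where n: "\<And>y. y - x \<in> fideal v n \<Longrightarrow> y \<in> S" using S unfolding open_iff by blast
    obtain k :: nat where "c - x \<notin> fideal v (int k)" using separated[OF xc] by blast
    then have "c \<notin> disc v x (max n (int k))"
      using fideal_monoD[of "c - x" "max n (int k)" "int k"] by (auto simp: disc_def)
    moreover have "disc v x (max n (int k)) \<subseteq> S"
      using n fideal_monoD[of _ "max n (int k)" n] by (auto simp: disc_def)
    ultimately show ?thesis unfolding D_def by (intro bexI[of _ "disc v x (max n (int k))"]) auto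
  qed
  have sing_borel: "{c} \<in> sets borel"
  proof -
    have "open (- {c})" unfolding open_iff
    proof
      fix x assume "x \<in> - {c}"
      then obtain k :: nat where "c - x \<notin> fideal v (int k)" using separated[of x c] by auto
      then show "\<exists>n. \<forall>y. y - x \<in> fideal v n \<longrightarrow> y \<in> - {c}" by blast
    qed
    then show ?thesis by (metis borel_closed closed_def)
  qed
  have gen: "sets borel = sigma_sets UNIV ?E"
  proof (rule antisym)
    \<comment> \<open>An open set is a countable union of discs avoiding \<open>c\<close>, together
      with \<open>{c}\<close> if it contains \<open>c\<close>.\<close>
    have "S \<in> sigma_sets UNIV ?E" if S: "open S" for S
    proof -
      define B where "B = {X\<in>D. X \<subseteq> S} \<union> (if c \<in> S then {{c}} else {})"
      have "\<Union>B \<in> sigma_sets UNIV ?E"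
      proof (rule sigma_sets_UNION)
        show "countable B" using cD by (auto simp: B_def)
        show "X \<in> sigma_sets UNIV ?E" if "X \<in> B" for X
          using that by (intro sigma_sets.Basic) (auto simp: B_def split: if_splits)
      qed
      moreover have "S = \<Union>B"
        using ex[OF S] by (auto simp: B_def)
      ultimately show ?thesis by metis
    qed
    then show "sets borel \<subseteq> sigma_sets UNIV ?E"
      unfolding borel_def by (auto simp: intro!: sigma_sets_mono)
    show "sigma_sets UNIV ?E \<subseteq> sets (borel::'k measure)"
    proof -
      have "?E \<subseteq> sets (borel::'k measure)" using sing_borel by (auto simp: D_def)
      from sets.sigma_sets_subset[OF this] show ?thesis by simp
    qed
  qed
  show ?thesis
  proof (rule measure_eqI_generator_eq_countable[of ?E UNIV M N "insert {c} D"])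
    show "Int_stable ?E"
    proof (rule Int_stableI)
      fix a b assume "a \<in> ?E" "b \<in> ?E"
      then consider "a = {} \<or> b = {} \<or> (a = {c} \<and> b = {c})" | "a = {c}" "b \<in> D" | "a \<in> D" "b = {c}"
        | "a \<in> D" "b \<in> D" by blast
      then show "a \<inter> b \<in> ?E"
      proof cases
        case 4
        then have "a \<inter> b = {} \<or> a \<inter> b = a \<or> a \<inter> b = b"
          unfolding D_def using disc_Int by fast
        with 4 show ?thesis by (elim disjE) simp_all
      next
        case 1 then show ?thesis by auto
      next
        case 2
        then have "a \<inter> b = {}" unfolding D_def by blast
        then show ?thesis by simp
      next
        case 3
        then have "a \<inter> b = {}" unfolding D_def by blast
        then show ?thesis by simp
      qed
    qed
    show "\<Union> (insert {c} D) = UNIV"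
    proof (intro set_eqI iffI UNIV_I)
      fix x show "x \<in> \<Union> (insert {c} D)" using ex[of UNIV x] by (cases "x = c") auto
    qed
    show "emeasure M X = emeasure N X" if "X \<in> ?E" for X
    proof -
      from that consider "X = {}" | "X = {c}" | x n where "X = disc v x n" "c \<notin> disc v x n"
        unfolding D_def by blast
      then show ?thesis by cases (simp_all add: sing eq)
    qed
    show "emeasure M X \<noteq> \<infinity>" if "X \<in> insert {c} D" for X
    proof -
      from that consider "X = {c}" | x n where "X = disc v x n" "c \<notin> disc v x n"
        unfolding D_def by blast
      then show ?thesis by cases (use sing(2) fin in simp_all)
    qed
    show "sets M = sigma_sets UNIV ?E" "sets N = sigma_sets UNIV ?E" using M N gen by simp_all
  qed (use cD in auto)
qed

text \<open>A residue transversal, scaled by an element of valuation \<open>n\<close>, splits the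
  ideal into \<open>q\<close> translates of the next one.\<close>

lemma transl_inv_fideal_Suc:
  assumes "transl_inv M"
  shows "emeasure M (fideal v n) = of_nat q * emeasure M (fideal v (n + 1))"
proof -
  obtain R where R: "finite R" "card R = q" "R \<subseteq> fideal v 0"
    "\<And>x. x \<in> fideal v 0 \<Longrightarrow> \<exists>!r. r \<in> R \<and> x - r \<in> fideal v 1" "q \<ge> 2"
    by (rule residue_reps) blast
  obtain a where a: "a \<noteq> 0" "v a = n" using ex_val by blast
  have *: "a * x - a * r \<in> fideal v (n + 1) \<longleftrightarrow> x - r \<in> fideal v 1" for x r
    using fideal_scale[OF a(1), of "x - r" "n + 1"] a by (simp add: algebra_simps)
  have "fideal v n = (\<Union>r\<in>R. (+) (a * r) ` fideal v (n + 1))"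
  proof (intro set_eqI iffI)
    fix y assume y: "y \<in> fideal v n"
    then have "y / a \<in> fideal v 0" using fideal_scale[OF a(1), of "y / a" n] a by simp
    then obtain r where "r \<in> R" "y / a - r \<in> fideal v 1" using R(4) by blast
    then have "y - a * r \<in> fideal v (n + 1)" using *[of "y / a" r] a by simp
    then show "y \<in> (\<Union>r\<in>R. (+) (a * r) ` fideal v (n + 1))"
      using \<open>r \<in> R\<close> disc_translate[of "a * r" "n + 1"] unfolding disc_def by blast
  next
    fix y assume "y \<in> (\<Union>r\<in>R. (+) (a * r) ` fideal v (n + 1))"
    then obtain r h where rh: "r \<in> R" "h \<in> fideal v (n + 1)" "y = a * r + h" by auto
    have "a * r \<in> fideal v n" using fideal_scale[OF a(1), of r n] a R(3) rh(1) by auto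
    then show "y \<in> fideal v n" using fideal_add[of "a * r" n h] fideal_monoD[OF rh(2), of n] rh(3) by simp
  qed
  also have "emeasure M \<dots> = of_nat (card R) * emeasure M (fideal v (n + 1))"
  proof (rule finite_disjoint_translates[OF assms R(1)])
    show "(+) b ` fideal v (n + 1) \<in> sets borel" for b
      using disc_borel[of b "n + 1"] by (simp add: disc_translate)
    fix r s assume rs: "r \<in> R" "s \<in> R" "r \<noteq> s"
    show "(+) (a * r) ` fideal v (n + 1) \<inter> (+) (a * s) ` fideal v (n + 1) = {}"
    proof (rule ccontr)
      assume "(+) (a * r) ` fideal v (n + 1) \<inter> (+) (a * s) ` fideal v (n + 1) \<noteq> {}"
      then obtain y where "y - a * r \<in> fideal v (n + 1)" "y - a * s \<in> fideal v (n + 1)"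
        unfolding disc_translate[symmetric] disc_def by blast
      then have "a * r - a * s \<in> fideal v (n + 1)"
        using fideal_diff_trans[of "a * r" y] fideal_diff_commute[of y "a * r"] by simp
      then have "r - s \<in> fideal v 1" using * by simp
      moreover have "r \<in> fideal v 0" "r - r \<in> fideal v 1" using rs R(3) by auto
      ultimately show False using R(4)[of r] rs by blast
    qed
  qed simp
  finally show ?thesis using R(2) by simp
qed

lemma transl_inv_fideal:
  assumes "transl_inv M"
  shows "emeasure M (fideal v n) = ennreal (real q powi (- n)) * emeasure M (fideal v 0)"
proof -
  have q: "of_nat q = ennreal (real q)" by (simp add: ennreal_of_nat_eq_real_of_nat)
  show ?thesis
  proof (induction n rule: int_induct[of _ 0])
    case (step1 i)
    have "ennreal (1 / real q) * emeasure M (fideal v i) = emeasure M (fideal v (i + 1))"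
      unfolding transl_inv_fideal_Suc[OF assms, of i] q mult.assoc[symmetric]
      using q_gt_0 by (simp add: ennreal_mult'[symmetric])
    moreover have "real q powi (- (i + 1)) = (1 / real q) * real q powi (- i)"
      using q_gt_0 by (simp add: power_int_diff power_int_minus divide_simps)
    ultimately show ?case using step1 q_gt_0
      by (simp add: ennreal_mult'[symmetric] mult.assoc[symmetric])
  next
    case (step2 i)
    have "real q powi (- (i - 1)) = real q * real q powi (- i)"
      using q_gt_0 by (simp add: power_int_diff power_int_minus divide_simps)
    then show ?case using step2 transl_inv_fideal_Suc[OF assms, of "i - 1"] q_gt_0
      by (simp add: ennreal_mult' mult.assoc q)
  qed simp
qed

end

locale haar_field = local_field v for v :: "'k::{field, topological_space} \<Rightarrow> int" +
  fixes \<mu> :: "'k measure"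
  assumes haar: "normalized_haar v \<mu>"
begin

lemma sets_haar [simp, measurable_cong]: "sets \<mu> = sets borel"
  using haar by (simp add: normalized_haar_def)

lemma space_haar [simp]: "space \<mu> = UNIV"
  using sets_eq_imp_space_eq[OF sets_haar] by simp

lemma transl_inv_haar: "transl_inv \<mu>"
  using haar by (simp add: normalized_haar_def transl_inv_def)

lemma emeasure_fideal: "emeasure \<mu> (fideal v n) = ennreal (real q powi (- n))"
  using transl_inv_fideal[OF transl_inv_haar, of n] haar by (simp add: normalized_haar_def fideal_0)

lemma emeasure_disc: "emeasure \<mu> (disc v x n) = ennreal (real q powi (- n))"
  using transl_inv_haar emeasure_fideal by (simp add: disc_translate transl_inv_def)

lemma measure_disc: "measure \<mu> (disc v x n) = real q powi (- n)"
  using emeasure_disc[of x n] by (simp add: measure_def)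

lemma finite_emeasure_bounded:
  assumes "A \<subseteq> fideal v k" shows "emeasure \<mu> A < \<infinity>"
  using emeasure_mono[OF assms, of \<mu>] emeasure_fideal[of k] by (auto simp: top.not_eq_extremum less_top
    intro: le_less_trans)

lemma emeasure_singleton: "emeasure \<mu> {x} = 0"
proof -
  have le: "emeasure \<mu> {x} \<le> ennreal (inverse (real q) ^ n)" for n
    using emeasure_mono[of "{x}" "disc v x (int n)" \<mu>] emeasure_disc[of x "int n"]
    by (simp add: power_int_minus power_inverse)
  have "(\<lambda>n. inverse (real q) ^ n) \<longlonglongrightarrow> 0"
    using q_gt_1 by (intro LIMSEQ_power_zero) (simp add: field_simps)
  then have "(\<lambda>n. ennreal (inverse (real q) ^ n)) \<longlonglongrightarrow> ennreal 0"
    by (rule tendsto_ennrealI)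
  then show ?thesis using le LIMSEQ_le_const[of _ 0 "emeasure \<mu> {x}"] by (metis ennreal_0 le_zero_eq)
qed

text \<open>Uniqueness of Haar measure by counting: invariance and indices fix the measure of every
  disc as a multiple of that of the integers, and 0 is a null point as it lies in arbitrarily small
  discs.\<close>

lemma transl_inv_unique:
  assumes "transl_inv M" "emeasure M (fideal v 0) \<noteq> \<infinity>"
  shows "M = density \<mu> (\<lambda>_. emeasure M (fideal v 0))"
proof (rule measure_eqI_discs[of _ _ 0])
  let ?N = "density \<mu> (\<lambda>_. emeasure M (fideal v 0))"
  have N: "emeasure ?N A = emeasure M (fideal v 0) * emeasure \<mu> A" if "A \<in> sets borel" for A
    using that by (simp add: emeasure_density_const)
  have M: "emeasure M (disc v x n) = ennreal (real q powi (- n)) * emeasure M (fideal v 0)" for x n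
    using assms(1) transl_inv_fideal[OF assms(1), of n] by (simp add: disc_translate transl_inv_def)
  have sing: "{0} \<in> sets (borel::'k measure)"
  proof -
    have "{0} = (\<Inter>n::nat. fideal v (int n))"
      using separated[of 0] by auto
    then show ?thesis by (metis borel_closed closed_INT closed_fideal)
  qed
  have le: "emeasure M {0} \<le> ennreal (inverse (real q) ^ n) * emeasure M (fideal v 0)" for n
    using emeasure_mono[of "{0}" "fideal v (int n)" M] assms(1) M[of 0 "int n"]
    by (simp add: transl_inv_def disc_0 power_int_minus power_inverse)
  have "(\<lambda>n. inverse (real q) ^ n) \<longlonglongrightarrow> 0"
    using q_gt_1 by (intro LIMSEQ_power_zero) (simp add: field_simps)
  then have "(\<lambda>n. ennreal (inverse (real q) ^ n)) \<longlonglongrightarrow> ennreal 0"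
    by (rule tendsto_ennrealI)
  then have "(\<lambda>n. ennreal (inverse (real q) ^ n) * emeasure M (fideal v 0)) \<longlonglongrightarrow> ennreal 0 * emeasure M (fideal v 0)"
    using assms(2) by (intro tendsto_mult_ennreal tendsto_const) auto
  then have M0: "emeasure M {0} = 0" using le LIMSEQ_le_const[of _ 0 "emeasure M {0}"] by force
  then show "emeasure M {0} = emeasure ?N {0}" "emeasure M {0} \<noteq> \<infinity>"
    using N[OF sing] emeasure_singleton[of 0] by auto
  show "emeasure M (disc v x n) = emeasure ?N (disc v x n)" for x n
    using N[of "disc v x n"] M[of x n] emeasure_disc[of x n] by (simp add: mult.commute)
  show "emeasure M (disc v x n) \<noteq> \<infinity>" for x n
    using M[of x n] assms(2) by (simp add: ennreal_mult_eq_top_iff)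
qed (use assms in \<open>simp_all add: transl_inv_def\<close>)

end

context local_field
begin

lemma singleton_closed [simp]: "closed {c::'k}"
  using compact_closed[of "{c}"] by simp

text \<open>Covers functions that are continuous off a closed set and have a default value on it,
  such as the kernel on the ground field or a Moebius map at its pole.\<close>

lemma measurable_off_closed:
  fixes f :: "'k \<Rightarrow> 'b::topological_space"
  assumes Z: "closed Z" "\<And>x. x \<in> Z \<Longrightarrow> f x = c"
    and f: "\<And>x S. x \<notin> Z \<Longrightarrow> open S \<Longrightarrow> f x \<in> S \<Longrightarrow> \<exists>n. \<forall>y. y - x \<in> fideal v n \<longrightarrow> f y \<in> S"
  shows "f \<in> borel_measurable borel"
proof (rule borel_measurableI)
  fix S :: "'b set" assume S: "open S"
  have "open (f -` S \<inter> - Z)" unfolding open_iff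
  proof
    fix x assume x: "x \<in> f -` S \<inter> - Z"
    then obtain n where n: "\<And>y. y - x \<in> fideal v n \<Longrightarrow> f y \<in> S" using f[of x S] S by auto
    obtain m where m: "\<And>y. y - x \<in> fideal v m \<Longrightarrow> y \<in> - Z"
      using x Z(1) unfolding closed_def open_iff by blast
    have "y \<in> f -` S \<inter> - Z" if "y - x \<in> fideal v (max m n)" for y
      using n[of y] m[of y] fideal_monoD[OF that, of n] fideal_monoD[OF that, of m] by simp
    then show "\<exists>n. \<forall>y. y - x \<in> fideal v n \<longrightarrow> y \<in> f -` S \<inter> - Z" by blast
  qed
  moreover have "f -` S = (f -` S \<inter> - Z) \<union> (if c \<in> S then Z else {})"
    using Z(2) by auto
  moreover have "(if c \<in> S then Z else {}) \<in> sets borel" using Z(1) by auto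
  ultimately have "f -` S \<in> sets borel"
    using sets.Un[OF borel_open[of "f -` S \<inter> - Z"], of "if c \<in> S then Z else {}"] by (metis (no_types))
  then show "f -` S \<inter> space borel \<in> sets borel" by simp
qed

lemma affine_measurable: "(\<lambda>x::'k. a * x + b) \<in> borel_measurable borel"
  by (rule borel_measurable_continuous_onI[OF continuous_affine])

end

section \<open>Changes of variables for Haar measure: linear maps and Moebius maps\<close>

context local_field
begin

lemma moebius_continuous:
  assumes b: "b \<noteq> 0" and x: "1 + b * x \<noteq> 0"
  shows "\<exists>m. \<forall>y. y - x \<in> fideal v m \<longrightarrow> 1 + b * y \<noteq> 0 \<and> v (1 + b * y) = v (1 + b * x) \<and>
    y / (1 + b * y) - x / (1 + b * x) \<in> fideal v n"
proof (intro exI allI impI)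
  let ?k = "v (1 + b * x)"
  \<comment> \<open>The first bound keeps the valuation of \<open>1 + b * y\<close> constant; the
    second comes from the difference of the quotients,
    \<open>(y - x) / ((1 + b * y) * (1 + b * x))\<close>.\<close>
  fix y assume y: "y - x \<in> fideal v (max (?k + 1 - v b) (n + 2 * ?k))"
  have "(1 + b * y) - (1 + b * x) \<in> fideal v (?k + 1)"
    using fideal_scale[OF b, of "y - x" "?k + 1"] fideal_monoD[OF y, of "?k + 1 - v b"]
    by (simp add: algebra_simps)
  then have n0: "1 + b * y \<noteq> 0" "v (1 + b * y) = ?k" using val_stable[OF x, of "1 + b * y"] by auto
  have eq: "y / (1 + b * y) - x / (1 + b * x) = inverse ((1 + b * y) * (1 + b * x)) * (y - x)"
    using n0 x by (simp add: field_simps)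
  have "v (inverse ((1 + b * y) * (1 + b * x))) = - 2 * ?k"
    using n0 x by (simp add: val_inverse val_mult)
  then have "y / (1 + b * y) - x / (1 + b * x) \<in> fideal v n" unfolding eq
    using fideal_scale[of "inverse ((1 + b * y) * (1 + b * x))" "y - x" n] n0 x fideal_monoD[OF y, of "n + 2 * ?k"] by simp
  with n0 show "1 + b * y \<noteq> 0 \<and> v (1 + b * y) = v (1 + b * x) \<and>
    y / (1 + b * y) - x / (1 + b * x) \<in> fideal v n" by blast
qed

end

context haar_field
begin

lemma measurable_haar [simp]: "measurable \<mu> N = measurable borel N"
  by (rule measurable_cong_sets) simp_all

text \<open>The constant is the reciprocal of the module: a push-forward measures preimages, so
  multiplication by \<open>a\<close> has \<open>c = q powi v a\<close>.\<close>

definition scales :: "('k \<Rightarrow> 'k) \<Rightarrow> real \<Rightarrow> bool" where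
  "scales L c \<longleftrightarrow> L \<in> borel_measurable borel \<and> c > 0 \<and> distr \<mu> borel L = density \<mu> (\<lambda>_. ennreal c)"

lemma scales_integrable:
  fixes f :: "'k \<Rightarrow> complex"
  assumes "scales L c" "integrable \<mu> f"
  shows "integrable \<mu> (\<lambda>x. f (L x))" "(\<integral>x. f (L x) \<partial>\<mu>) = c * (\<integral>x. f x \<partial>\<mu>)"
proof -
  have L: "L \<in> measurable \<mu> borel" "c \<ge> 0" and d: "distr \<mu> borel L = density \<mu> (\<lambda>_. ennreal c)"
    using assms(1) by (simp_all add: scales_def)
  have f: "f \<in> borel_measurable borel" "f \<in> borel_measurable \<mu>"
    using borel_measurable_integrable[OF assms(2)] by simp_all
  have "integrable (distr \<mu> borel L) f"
    unfolding d using f(2) L(2) assms(2) by (subst integrable_density) auto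
  then show "integrable \<mu> (\<lambda>x. f (L x))" using integrable_distr[OF L(1)] by blast
  have "(\<integral>x. f (L x) \<partial>\<mu>) = integral\<^sup>L (distr \<mu> borel L) f"
    by (rule integral_distr[OF L(1) f(1), symmetric])
  also have "\<dots> = c * (\<integral>x. f x \<partial>\<mu>)"
    unfolding d using f(2) L(2) by (subst integral_density) (auto simp: scaleR_conv_of_real)
  finally show "(\<integral>x. f (L x) \<partial>\<mu>) = c * (\<integral>x. f x \<partial>\<mu>)" .
qed

text \<open>Surjectivity lifts translations, so the push-forward is again translation invariant and
  hence a multiple of Haar measure; the multiple is read off from a single set \<open>A\<close> of
  known measure.\<close>

lemma scales_linear:
  assumes L: "L \<in> borel_measurable borel" "\<And>x y. L (x + y) = L x + L y" "surj L"
    and A: "A \<in> sets borel" "emeasure \<mu> A \<noteq> 0" "emeasure \<mu> A \<noteq> \<infinity>"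
      "emeasure \<mu> (L -` A) = ennreal c * emeasure \<mu> A" "c > 0"
    and fin: "emeasure \<mu> (L -` fideal v 0) \<noteq> \<infinity>"
  shows "scales L c"
proof -
  let ?M = "distr \<mu> borel L"
  have Lm: "L \<in> measurable \<mu> borel" using L(1) by simp
  have M: "emeasure ?M B = emeasure \<mu> (L -` B)" if "B \<in> sets borel" for B
    using that by (subst emeasure_distr[OF Lm]) auto
  have tb: "(+) a ` B \<in> sets borel" if B: "B \<in> sets borel" for a and B :: "'k set"
  proof -
    have "(+) a ` B = (\<lambda>x. 1 * x + (- a)) -` B" by (force intro!: image_eqI[of _ _ "_ - a"])
    then show ?thesis using measurable_sets[OF affine_measurable[of 1 "- a"] B] by simp
  qed
  have inv: "transl_inv ?M" unfolding transl_inv_def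
  proof (intro conjI allI ballI)
    fix a B assume B: "B \<in> sets (borel::'k measure)"
    obtain a' where a': "a = L a'" using L(3) by blast
    have Lm': "L (x - a') = L x - L a'" for x using L(2)[of "x - a'" a'] by simp
    have "L -` ((+) a ` B) = (+) a' ` (L -` B)"
    proof (intro set_eqI iffI)
      fix x assume "x \<in> L -` ((+) a ` B)"
      then obtain b where "b \<in> B" "L x = L a' + b" using a' by auto
      then have "L (x - a') \<in> B" using Lm'[of x] by simp
      then show "x \<in> (+) a' ` (L -` B)" by (intro image_eqI[of _ _ "x - a'"]) auto
    qed (use a' L(2) in auto)
    moreover have "L -` B \<in> sets borel" using measurable_sets[OF L(1) B] by simp
    ultimately show "emeasure ?M ((+) a ` B) = emeasure ?M B"
      using M[OF B] M[OF tb[OF B]] transl_inv_haar by (simp add: transl_inv_def)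
  qed simp
  have M0: "emeasure ?M (fideal v 0) \<noteq> \<infinity>" using M[of "fideal v 0"] fin by simp
  have eq: "?M = density \<mu> (\<lambda>_. emeasure ?M (fideal v 0))"
    by (rule transl_inv_unique[OF inv M0])
  have "emeasure ?M A = emeasure ?M (fideal v 0) * emeasure \<mu> A"
    by (subst eq) (use A(1) in \<open>simp add: emeasure_density_const\<close>)
  then have "emeasure ?M (fideal v 0) * emeasure \<mu> A = ennreal c * emeasure \<mu> A"
    using M[OF A(1)] A(4) by simp
  then have "emeasure ?M (fideal v 0) = ennreal c"
    using A(2,3) by (simp add: ennreal_mult_cancel_left mult.commute[of _ "emeasure \<mu> A"])
  then show ?thesis unfolding scales_def using L(1) A(5) eq by simp
qed

lemma scales_mult:
  assumes "a \<noteq> 0" shows "scales (\<lambda>x. a * x) (real q powi v a)"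
proof (rule scales_linear[of _ "fideal v 0"])
  show "(\<lambda>x. a * x) \<in> borel_measurable borel" using affine_measurable[of a 0] by simp
  show "surj (\<lambda>x. a * x)" by (rule surjI[of _ "\<lambda>x. x / a"]) (use assms in simp)
  have *: "(\<lambda>x. a * x) -` fideal v 0 = fideal v (- v a)" using fideal_scale[OF assms, of _ 0] by auto
  show "emeasure \<mu> ((\<lambda>x. a * x) -` fideal v 0) = ennreal (real q powi v a) * emeasure \<mu> (fideal v 0)"
    unfolding * by (simp add: emeasure_fideal)
  show "emeasure \<mu> ((\<lambda>x. a * x) -` fideal v 0) \<noteq> \<infinity>" unfolding * by (simp add: emeasure_fideal)
  show "0 < real q powi v a" using q_gt_0 by (rule zero_less_power_int)
qed (simp_all add: emeasure_fideal algebra_simps)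

text \<open>The integral of \<open>F\<close> is the geometric series with ratio \<open>l c\<close> obtained by summing \<open>f\<close> over the
  orbits of \<open>L\<close>.\<close>

lemma integrable_self_similar:
  fixes f F :: "'k \<Rightarrow> complex"
  assumes L: "scales L c" and f: "integrable \<mu> f"
    and F: "\<And>x. F x = f x + l * F (L x)"
    and ev: "\<And>x. \<exists>k. \<forall>i\<ge>k. F ((L ^^ i) x) = 0"
    and lc: "norm (l * of_real c) < 1"
  shows "integrable \<mu> F" "(1 - l * of_real c) * (\<integral>x. F x \<partial>\<mu>) = (\<integral>x. f x \<partial>\<mu>)"
proof -
  have c: "c > 0" using L by (simp add: scales_def)
  have Lf: "integrable \<mu> (\<lambda>x. f ((L ^^ i) x)) \<and> (\<integral>x. norm (f ((L ^^ i) x)) \<partial>\<mu>) = c ^ i * (\<integral>x. norm (f x) \<partial>\<mu>)" for i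
  proof (induction i)
    case (Suc i)
    then have i: "integrable \<mu> (\<lambda>x. f ((L ^^ i) x))" by simp
    have i': "integrable \<mu> (\<lambda>x. complex_of_real (norm (f ((L ^^ i) x))))"
      using i by (intro integrable_of_real integrable_norm)
    have "complex_of_real (\<integral>x. norm (f ((L ^^ i) (L x))) \<partial>\<mu>) = c * complex_of_real (\<integral>x. norm (f ((L ^^ i) x)) \<partial>\<mu>)"
      using scales_integrable(2)[OF L i'] by simp
    then have "(\<integral>x. norm (f ((L ^^ i) (L x))) \<partial>\<mu>) = c * (\<integral>x. norm (f ((L ^^ i) x)) \<partial>\<mu>)"
      by (metis of_real_eq_iff of_real_mult)
    then show ?case
      using Suc scales_integrable(1)[OF L i] by (simp add: funpow_swap1)
  qed (simp add: f)
  define g where "g i x = l ^ i * f ((L ^^ i) x)" for i x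
  have F_sum: "F x = (\<Sum>j<i. g j x) + l ^ i * F ((L ^^ i) x)" for i x
  proof (induction i)
    case (Suc i)
    show ?case
      unfolding Suc by (subst F[of "(L ^^ i) x"]) (simp add: g_def algebra_simps)
  qed simp
  \<comment> \<open>Pointwise the series is finite, because the orbit eventually leaves the support
    of \<open>F\<close>; convergence is an issue only for the integrals.\<close>
  have fin: "\<exists>k. (\<forall>i\<ge>k. g i x = 0) \<and> F x = (\<Sum>j<k. g j x)" for x
  proof -
    obtain k where k: "\<And>i. i \<ge> k \<Longrightarrow> F ((L ^^ i) x) = 0" using ev by blast
    have "g i x = 0" if "i \<ge> k" for i
      using F[of "(L ^^ i) x"] k[of i] k[of "Suc i"] that by (simp add: g_def)
    moreover have "F x = (\<Sum>j<k. g j x)" using F_sum[of x k] k[of k] by simp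
    ultimately show ?thesis by blast
  qed
  have sums: "(\<lambda>i. g i x) sums F x" for x
  proof -
    obtain k where "\<forall>i\<ge>k. g i x = 0" "F x = (\<Sum>j<k. g j x)" using fin by blast
    then show ?thesis using sums_finite[of "{..<k}" "\<lambda>i. g i x"] by auto
  qed
  have norms: "summable (\<lambda>i. norm (g i x))" for x
  proof -
    obtain k where "\<forall>i\<ge>k. g i x = 0" using fin by blast
    then show ?thesis by (intro summable_finite[of "{..<k}"]) auto
  qed
  \<comment> \<open>The integral of the norm is multiplied by \<open>norm l * c\<close> in each
    step, so these integrals form a convergent geometric series and termwise integration is
    allowed.\<close>
  have "(\<integral>x. norm (g i x) \<partial>\<mu>) = norm (l * of_real c) ^ i * (\<integral>x. norm (f x) \<partial>\<mu>)" for i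
    using Lf[of i] c by (simp add: g_def norm_mult norm_power power_mult_distrib)
  then have "summable (\<lambda>i. \<integral>x. norm (g i x) \<partial>\<mu>)"
    using lc by (simp add: summable_mult2 summable_geometric)
  then have "integrable \<mu> (\<lambda>x. \<Sum>i. g i x)"
    using Lf norms by (intro integrable_suminf) (auto simp: g_def)
  moreover have "(\<lambda>x. \<Sum>i. g i x) = F" by (intro ext sums_unique[OF sums, symmetric])
  ultimately show FI: "integrable \<mu> F" by simp
  have "(\<integral>x. F x \<partial>\<mu>) = (\<integral>x. f x + l * F (L x) \<partial>\<mu>)"
    by (rule Bochner_Integration.integral_cong[OF refl F])
  also have "\<dots> = (\<integral>x. f x \<partial>\<mu>) + l * (c * (\<integral>x. F x \<partial>\<mu>))"
    using f scales_integrable[OF L FI] by simp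
  finally show "(1 - l * of_real c) * (\<integral>x. F x \<partial>\<mu>) = (\<integral>x. f x \<partial>\<mu>)"
    by (simp add: algebra_simps)
qed

text \<open>The Jacobian is verified on discs avoiding \<open>1 / b\<close>. Such a disc of centre
  \<open>x\<close> pulls back to a disc about \<open>x / (1 - b * x)\<close>, with radius divided by
  the squared absolute value of \<open>1 - b * x\<close>, and on it the weight is constant and
  compensates this factor.\<close>

lemma moebius_distr:
  assumes b: "b \<noteq> 0"
  shows "distr (density \<mu> (\<lambda>y. ennreal (mod_abs v (1 + b * y) powi (- 2)))) borel (\<lambda>y. y / (1 + b * y)) = \<mu>"
    and "(\<lambda>y. y / (1 + b * y)) \<in> borel_measurable borel"
    and "(\<lambda>y. mod_abs v (1 + b * y) powi (- 2)) \<in> borel_measurable borel"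
proof -
  define y0 where "y0 = - (1 / b)"
  have y0: "1 + b * y = 0 \<longleftrightarrow> y = y0" for y
    unfolding y0_def using b by (auto simp: field_simps add_eq_0_iff)
  define g where "g y = y / (1 + b * y)" for y
  define w where "w y = mod_abs v (1 + b * y) powi (- 2)" for y
  show gm: "(\<lambda>y. y / (1 + b * y)) \<in> borel_measurable borel"
  proof (rule measurable_off_closed[of "{y0}"])
    fix x S assume x: "x \<notin> {y0}" and S: "open S" "x / (1 + b * x) \<in> S"
    obtain n where n: "\<And>z. z - x / (1 + b * x) \<in> fideal v n \<Longrightarrow> z \<in> S" using S unfolding open_iff by blast
    have "1 + b * x \<noteq> 0" using x y0 by blast
    from moebius_continuous[OF b this, of n] n
    show "\<exists>n. \<forall>y. y - x \<in> fideal v n \<longrightarrow> y / (1 + b * y) \<in> S" by blast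
  qed (use y0 in auto)
  show wm: "(\<lambda>y. mod_abs v (1 + b * y) powi (- 2)) \<in> borel_measurable borel"
  proof (rule measurable_off_closed[of "{y0}"])
    fix x S assume x: "x \<notin> {y0}" and S: "open S" "mod_abs v (1 + b * x) powi (- 2) \<in> S"
    have "1 + b * x \<noteq> 0" using x y0 by blast
    then obtain m where m: "\<And>y. y - x \<in> fideal v m \<Longrightarrow> 1 + b * y \<noteq> 0 \<and> v (1 + b * y) = v (1 + b * x)"
      using moebius_continuous[OF b] by blast
    have "mod_abs v (1 + b * y) powi (- 2) \<in> S" if "y - x \<in> fideal v m" for y
      using m[OF that] S(2) \<open>1 + b * x \<noteq> 0\<close> by (simp add: mod_abs_def)
    then show "\<exists>n. \<forall>y. y - x \<in> fideal v n \<longrightarrow> mod_abs v (1 + b * y) powi (- 2) \<in> S" by blast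
  qed (use y0 in auto)
  have g_m: "g \<in> measurable (density \<mu> (\<lambda>y. ennreal (w y))) borel"
    using gm by (simp add: g_def[abs_def])
  let ?M = "distr (density \<mu> (\<lambda>y. ennreal (w y))) borel g"
  have M: "emeasure ?M A = (\<integral>\<^sup>+ y. ennreal (w y) * indicator (g -` A) y \<partial>\<mu>)" if A: "A \<in> sets borel" for A
  proof -
    have "g -` A \<in> sets borel" using measurable_sets[OF gm A] by (simp add: g_def[abs_def])
    then show ?thesis using A g_m wm by (simp add: emeasure_distr emeasure_density w_def[abs_def])
  qed
  have "?M = \<mu>"
  proof (rule measure_eqI_discs[of _ _ "1 / b"])
    \<comment> \<open>\<open>1 / b\<close> is the image of infinity and is never attained; at the
      pole itself division by zero gives the value 0.\<close>
    have "g y \<noteq> 1 / b" for y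
    proof (cases "1 + b * y = 0")
      case False
      then show ?thesis using b by (simp add: g_def divide_eq_eq eq_divide_eq mult.commute)
    qed (use b in \<open>simp add: g_def\<close>)
    then have "g -` {1 / b} = {}" by blast
    then show "emeasure ?M {1 / b} = emeasure \<mu> {1 / b}" "emeasure ?M {1 / b} \<noteq> \<infinity>"
      using M[of "{1 / b}"] emeasure_singleton by simp_all
    fix x n assume nd: "1 / b \<notin> disc v x n"
    define u where "u = 1 - b * x"
    have u0: "u \<noteq> 0"
    proof
      assume "u = 0"
      then have "1 / b = x" using b by (simp add: u_def field_simps)
      then show False using nd by simp
    qed
    \<comment> \<open>Because the disc avoids \<open>1 / b\<close>, the value \<open>u\<close> at
      its centre dominates the variation of \<open>1 - b * z\<close> over the disc, so this
      expression has constant valuation there.\<close>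
    have vu: "v u < n + v b"
    proof -
      have "1 / b - x = inverse b * u" using b by (simp add: u_def field_simps)
      then have "inverse b * u \<notin> fideal v n" using nd by (simp add: disc_def)
      then show ?thesis using fideal_scale[of "inverse b" u n] b u0 by (simp add: val_inverse fideal_iff)
    qed
    let ?x = "x / u" and ?n = "n - 2 * v u"
    have 1: "y \<noteq> y0 \<and> v (1 + b * y) = - v u \<and> g y \<in> disc v x n" if "y \<in> disc v ?x ?n" for y
    proof -
      define h where "h = y - ?x"
      have h: "h \<in> fideal v ?n" using that by (simp add: disc_def h_def)
      have eq: "1 + b * y = (1 + u * b * h) * inverse u"
      proof -
        have "1 + b * y = (u + b * x) / u + b * h"
          using u0 by (simp add: h_def add_divide_distrib algebra_simps)
        also have "u + b * x = 1" by (simp add: u_def)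
        finally show ?thesis using u0 by (simp add: field_simps)
      qed
      have "(1 + u * b * h) - 1 \<in> fideal v 1"
        using fideal_scale[of "u * b" h 1] u0 b fideal_monoD[OF h, of "1 - (v u + v b)"] vu
        by (simp add: val_mult mult.assoc)
      then have s: "1 + u * b * h \<noteq> 0" "v (1 + u * b * h) = 0"
        using val_stable[of 1 "1 + u * b * h"] by auto
      then have y: "1 + b * y \<noteq> 0" "v (1 + b * y) = - v u"
        using eq u0 by (simp_all add: val_mult val_inverse)
      have "g y - x = (y - x * (1 + b * y)) / (1 + b * y)"
        using y(1) by (simp add: g_def diff_divide_distrib)
      also have "y - x * (1 + b * y) = u * y - x"
        by (simp add: u_def algebra_simps)
      also have "\<dots> = u * h"
        using u0 by (simp add: h_def algebra_simps)
      finally have gx: "g y - x = (u / (1 + b * y)) * h" by simp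
      have "g y - x \<in> fideal v n"
        unfolding gx using fideal_scale[of "u / (1 + b * y)" h n] u0 y h by (simp add: val_divide)
      then show ?thesis using y y0 by (auto simp: disc_def)
    qed
    have 2: "y \<in> disc v ?x ?n" if "y \<noteq> y0" "g y \<in> disc v x n" for y
    proof -
      define k where "k = g y - x"
      have k: "k \<in> fideal v n" using that by (simp add: disc_def k_def)
      have y: "1 + b * y \<noteq> 0" using that y0 by blast
      have i: "1 - b * g y = inverse (1 + b * y)" using y by (simp add: g_def field_simps)
      have "(1 - b * g y) - u = b * (- k)" by (simp add: k_def u_def algebra_simps)
      then have "(1 - b * g y) - u \<in> fideal v (v u + 1)"
        using fideal_scale[OF b, of "- k" "v u + 1"] fideal_uminus[of k] fideal_monoD[OF k, of "v u + 1 - v b"] vu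
        by simp
      then have v1: "1 - b * g y \<noteq> 0" "v (1 - b * g y) = v u"
        using val_stable[OF u0] by blast+
      have "y = g y / (1 - b * g y)" using i y by (simp add: g_def)
      then have "y - ?x = g y / (1 - b * g y) - ?x" by simp
      also have "\<dots> = inverse ((1 - b * g y) * u) * k"
        using v1 u0 by (simp add: k_def field_simps) (simp add: u_def algebra_simps)
      finally have eq: "y - ?x = inverse ((1 - b * g y) * u) * k" .
      show ?thesis unfolding disc_def mem_Collect_eq eq
        using fideal_scale[of "inverse ((1 - b * g y) * u)" k ?n] v1 u0 k
        by (simp add: val_inverse val_mult)
    qed
    have "ennreal (w y) * indicator (g -` disc v x n) y =
        ennreal (real q powi (- 2 * v u)) * indicator (disc v ?x ?n) y" for y
    proof (cases "y \<in> disc v ?x ?n")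
      case True
      then have "w y = real q powi (- 2 * v u)"
        using 1[of y] y0[of y] q_gt_0 by (simp add: w_def mod_abs_def power_int_mult[symmetric] mult.commute)
      then show ?thesis using True 1[of y] by simp
    next
      case False
      show ?thesis
      proof (cases "y = y0")
        \<comment> \<open>At the pole the weight is \<open>0 powi - 2 = 0\<close>, so the default
          value of \<open>g\<close> there contributes nothing.\<close>
        case True then show ?thesis using False y0[of y0] by (simp add: w_def mod_abs_def)
      next
        case ne: False
        then have "y \<notin> g -` disc v x n" using 2[of y] False by auto
        then show ?thesis using False by simp
      qed
    qed
    then have "emeasure ?M (disc v x n) = ennreal (real q powi (- 2 * v u)) * emeasure \<mu> (disc v ?x ?n)"
      using M[OF disc_borel, of x n] by (simp add: nn_integral_cmult_indicator)
    also have "\<dots> = ennreal (real q powi (- 2 * v u) * real q powi (- ?n))"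
      by (simp add: emeasure_disc ennreal_mult)
    also have "real q powi (- 2 * v u) * real q powi (- ?n) = real q powi (- n)"
      using q_gt_0 by (subst power_int_add[symmetric]) auto
    finally have e: "emeasure ?M (disc v x n) = ennreal (real q powi (- n))" .
    then show "emeasure ?M (disc v x n) = emeasure \<mu> (disc v x n)"
      by (simp add: emeasure_disc)
    show "emeasure ?M (disc v x n) \<noteq> \<infinity>" using e by simp
  qed simp_all
  then show "distr (density \<mu> (\<lambda>y. ennreal (mod_abs v (1 + b * y) powi (- 2)))) borel (\<lambda>y. y / (1 + b * y)) = \<mu>"
    by (simp add: w_def[abs_def] g_def[abs_def])
qed

lemma moebius_integral:
  fixes F :: "'k \<Rightarrow> complex"
  assumes b: "b \<noteq> 0" and F: "F \<in> borel_measurable borel"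
  shows "(\<integral>x. F x \<partial>\<mu>) = (\<integral>y. of_real (mod_abs v (1 + b * y) powi (- 2)) * F (y / (1 + b * y)) \<partial>\<mu>)"
proof -
  note m = moebius_distr[OF b]
  have F': "F \<in> borel_measurable \<mu>" "(\<lambda>y. F (y / (1 + b * y))) \<in> borel_measurable \<mu>"
    using F measurable_compose[OF m(2) F] by simp_all
  have "(\<integral>x. F x \<partial>\<mu>) = (\<integral>y. F (y / (1 + b * y)) \<partial>(density \<mu> (\<lambda>y. ennreal (mod_abs v (1 + b * y) powi (- 2)))))"
    by (subst m(1)[symmetric], rule integral_distr) (use m(2) F in simp_all)
  also have "\<dots> = (\<integral>y. (mod_abs v (1 + b * y) powi (- 2)) *\<^sub>R F (y / (1 + b * y)) \<partial>\<mu>)"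
    by (rule integral_density) (use m(3) F' in \<open>auto simp: mod_abs_def\<close>)
  finally show ?thesis by (simp add: scaleR_conv_of_real)
qed

end

section \<open>Coordinates on the quadratic extension\<close>

context quadratic_extension
begin

lemma iota_0 [simp]: "\<iota> 0 = 0"
  using emb_add[of 0 0] by (metis add.right_neutral add_left_cancel)

lemma iota_minus: "\<iota> (- x) = - \<iota> x"
  using emb_add[of x "- x"] by (simp add: eq_neg_iff_add_eq_0 add.commute)

lemma iota_diff: "\<iota> (x - y) = \<iota> x - \<iota> y"
  using emb_add[of x "- y"] by (simp add: iota_minus)

lemma iota_eq_0 [simp]: "\<iota> x = 0 \<longleftrightarrow> x = 0"
proof
  assume "\<iota> x = 0"
  then have "x \<noteq> 0 \<Longrightarrow> \<iota> 1 = 0" using emb_mult[of x "inverse x"] by simp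
  then show "x = 0" using emb_one by auto
qed simp

lemma iota_inject [simp]: "\<iota> x = \<iota> y \<longleftrightarrow> x = y"
  using iota_eq_0[of "x - y"] by (simp add: iota_diff)

lemma iota_inverse: "\<iota> (inverse x) = inverse (\<iota> x)"
  using emb_mult[of x "inverse x"] emb_one
  by (cases "x = 0") (auto simp: inverse_unique)

lemma iota_divide: "\<iota> (x / y) = \<iota> x / \<iota> y"
  by (simp add: divide_inverse emb_mult iota_inverse)

lemma iota_power: "\<iota> (x ^ n) = \<iota> x ^ n"
  by (induction n) (simp_all add: emb_one emb_mult)

lemma iota_power_int: "\<iota> (x powi n) = \<iota> x powi n"
  by (simp add: power_int_def iota_power iota_inverse)

lemma alpha_nonzero [simp]: "\<alpha> \<noteq> 0"
  using alpha_notin iota_0 by (metis rangeI)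

definition c1 :: "'e \<Rightarrow> 'f" where "c1 x = fst (coords \<iota> \<alpha> x)"
definition c2 :: "'e \<Rightarrow> 'f" where "c2 x = snd (coords \<iota> \<alpha> x)"

lemma rep_unique:
  assumes "\<iota> a + \<iota> b * \<alpha> = \<iota> a' + \<iota> b' * \<alpha>" shows "a = a' \<and> b = b'"
proof (cases "b = b'")
  case False
  then have "\<alpha> = \<iota> ((a' - a) / (b - b'))"
    using assms by (simp add: iota_divide iota_diff field_simps)
  then show ?thesis using alpha_notin by blast
qed (use assms in simp)

lemma coords_eq: "coords \<iota> \<alpha> (\<iota> a + \<iota> b * \<alpha>) = (a, b)"
  unfolding coords_def by (rule the_equality) (auto dest: rep_unique)

lemma c1_rep [simp]: "c1 (\<iota> a + \<iota> b * \<alpha>) = a" and c2_rep [simp]: "c2 (\<iota> a + \<iota> b * \<alpha>) = b"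
  by (simp_all add: c1_def c2_def coords_eq)

lemma rep: "x = \<iota> (c1 x) + \<iota> (c2 x) * \<alpha>"
  using generated[of x] c1_rep c2_rep by metis

lemma coords_c: "coords \<iota> \<alpha> x = (c1 x, c2 x)"
  by (simp add: c1_def c2_def)

lemma c_eqI: "c1 x = c1 y \<Longrightarrow> c2 x = c2 y \<Longrightarrow> x = y"
  by (metis rep)

lemma c_unique: "x = \<iota> a + \<iota> b * \<alpha> \<Longrightarrow> c1 x = a \<and> c2 x = b"
  by simp

lemma c_iota [simp]: "c1 (\<iota> a) = a" "c2 (\<iota> a) = 0"
  using c_unique[of "\<iota> a" a 0] by simp_all

lemma c_0 [simp]: "c1 0 = 0" "c2 0 = 0"
  using c_iota[of 0] by simp_all

lemma c_1 [simp]: "c1 1 = 1" "c2 1 = 0"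
  using c_iota[of 1] by (simp_all add: emb_one)

lemma c_add: "c1 (x + y) = c1 x + c1 y" "c2 (x + y) = c2 x + c2 y"
proof -
  have "x + y = (\<iota> (c1 x) + \<iota> (c2 x) * \<alpha>) + (\<iota> (c1 y) + \<iota> (c2 y) * \<alpha>)"
    using rep[of x] rep[of y] by metis
  also have "\<dots> = \<iota> (c1 x + c1 y) + \<iota> (c2 x + c2 y) * \<alpha>"
    by (simp add: emb_add algebra_simps)
  finally have "x + y = \<iota> (c1 x + c1 y) + \<iota> (c2 x + c2 y) * \<alpha>" .
  from c_unique[OF this] show "c1 (x + y) = c1 x + c1 y" "c2 (x + y) = c2 x + c2 y" by simp_all
qed

lemma c_mult: "c1 (x * y) = c1 x * c1 y + c2 x * c2 y * d" "c2 (x * y) = c1 x * c2 y + c2 x * c1 y"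
proof -
  have "x * y = (\<iota> (c1 x) + \<iota> (c2 x) * \<alpha>) * (\<iota> (c1 y) + \<iota> (c2 y) * \<alpha>)"
    using rep[of x] rep[of y] by metis
  also have "\<dots> = \<iota> (c1 x) * \<iota> (c1 y) + \<iota> (c2 x) * \<iota> (c2 y) * \<alpha>\<^sup>2
      + (\<iota> (c1 x) * \<iota> (c2 y) + \<iota> (c2 x) * \<iota> (c1 y)) * \<alpha>"
    by (simp add: algebra_simps power2_eq_square)
  also have "\<dots> = \<iota> (c1 x * c1 y + c2 x * c2 y * d) + \<iota> (c1 x * c2 y + c2 x * c1 y) * \<alpha>"
    by (simp add: emb_add emb_mult alpha_square algebra_simps)
  finally show "c1 (x * y) = c1 x * c1 y + c2 x * c2 y * d" "c2 (x * y) = c1 x * c2 y + c2 x * c1 y"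
    using c_unique by blast+
qed

lemma c_scale: "c1 (\<iota> a * x) = a * c1 x" "c2 (\<iota> a * x) = a * c2 x"
  by (simp_all add: c_mult)

lemma c_minus: "c1 (- x) = - c1 x" "c2 (- x) = - c2 x"
  using c_add[of x "- x"] by (simp_all add: eq_neg_iff_add_eq_0 add.commute)

lemma c_diff: "c1 (x - y) = c1 x - c1 y" "c2 (x - y) = c2 x - c2 y"
  using c_add[of x "- y"] by (simp_all add: c_minus)

lemma c2_eq_0: "c2 x = 0 \<longleftrightarrow> x \<in> range \<iota>"
proof
  assume "c2 x = 0"
  then have "x = \<iota> (c1 x)" using rep[of x] by simp
  then show "x \<in> range \<iota>" by blast
qed auto

text \<open>Galois conjugation of the quadratic extension; \<open>nrm\<close> is the norm to the
  ground field.\<close>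

definition cj :: "'e \<Rightarrow> 'e" where "cj x = \<iota> (c1 x) + \<iota> (- c2 x) * \<alpha>"
definition nrm :: "'e \<Rightarrow> 'f" where "nrm x = (c1 x)\<^sup>2 - (c2 x)\<^sup>2 * d"

lemma c_cj [simp]: "c1 (cj x) = c1 x" "c2 (cj x) = - c2 x"
  unfolding cj_def by simp_all

lemma cj_mult: "cj (x * y) = cj x * cj y"
  by (rule c_eqI) (simp_all add: c_mult)

lemma cj_iota [simp]: "cj (\<iota> a) = \<iota> a"
  by (rule c_eqI) simp_all

lemma cj_1 [simp]: "cj 1 = 1"
  using cj_iota[of 1] by (simp add: emb_one)

lemma cj_power: "cj (x ^ n) = cj x ^ n"
  by (induction n) (simp_all add: cj_mult)

lemma cj_diff: "cj (x - y) = cj x - cj y"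
  by (rule c_eqI) (simp_all add: c_diff)

lemma iota_nrm: "\<iota> (nrm x) = x * cj x"
  by (rule c_eqI) (simp_all add: c_mult nrm_def power2_eq_square algebra_simps)

lemma nrm_mult: "nrm (x * y) = nrm x * nrm y"
proof -
  have "\<iota> (nrm (x * y)) = \<iota> (nrm x * nrm y)"
    unfolding emb_mult iota_nrm cj_mult by (simp only: ac_simps)
  then show ?thesis by simp
qed

lemma nrm_iota: "nrm (\<iota> a) = a\<^sup>2"
  by (simp add: nrm_def)

lemma cj_eq_0 [simp]: "cj x = 0 \<longleftrightarrow> x = 0"
  by (metis c_0 c_cj c_eqI neg_equal_0_iff_equal)

lemma nrm_eq_0 [simp]: "nrm x = 0 \<longleftrightarrow> x = 0"
  using iota_nrm[of x] by (metis cj_eq_0 iota_eq_0 mult_eq_0_iff)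

lemma cj_inverse: "cj (inverse x) = inverse (cj x)"
proof (cases "x = 0")
  case True
  then show ?thesis by (metis cj_eq_0 inverse_zero)
next
  case False
  then show ?thesis using cj_mult[of x "inverse x"] by (simp add: inverse_unique)
qed

section \<open>Valuations and topologies of the two fields compared\<close>

definition ram :: int where "ram = vE (\<iota> pF)"

lemma pF: "pF \<noteq> 0" "vF pF = 1" and pE: "pE \<noteq> 0" "vE pE = 1"
  using uniformizer_F uniformizer_E by (auto simp: uniformizer_def)

text \<open>Continuity of \<iota> links the two valuations. High powers of \<open>pF\<close> must
  become small, so \<open>ram\<close>, the ramification index, is positive. A unit \<open>u\<close>
  cannot get negative valuation, for \<open>pF powi n * u ^ k\<close> stays in one ideal of the
  small field while its image would leave every ideal.\<close>

lemma ram_pos: "ram \<ge> 1"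
  and val_iota: "a \<noteq> 0 \<Longrightarrow> vE (\<iota> a) = ram * vF a"
proof -
  have "open (\<iota> -` fideal vE 1)"
    using emb_continuous by (simp add: continuous_on_open_vimage)
  then obtain n where n: "\<And>a. a \<in> fideal vF n \<Longrightarrow> \<iota> a \<in> fideal vE 1"
    unfolding F.open_iff using E.zero_in_fideal iota_0 by (metis diff_zero vimage_eq)
  have pos: "k * ram \<ge> 1" if "k \<ge> n" for k
    using n[of "pF powi k"] that pF unfolding ram_def
    by (simp add: iota_power_int fideal_def F.val_power_int E.val_power_int)
  show ram: "ram \<ge> 1"
    using pos[of "max n 1"] by (metis int_one_le_iff_zero_less max.cobounded1 max.cobounded2 zero_less_mult_pos
        less_le_trans zero_less_one)
  have nonneg: "vE (\<iota> u) \<ge> 0" if u: "u \<noteq> 0" "vF u = 0" for u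
  proof (rule ccontr)
    assume neg: "\<not> vE (\<iota> u) \<ge> 0"
    \<comment> \<open>So large that \<open>n * ram - k\<close> is not positive, against the lower
      bound 1 for the valuation of the image.\<close>
    define k where "k = nat (max 0 (n * ram))"
    have "pF powi n * u ^ k \<in> fideal vF n"
      using u pF by (simp add: fideal_def F.val_mult F.val_power F.val_power_int)
    then have "vE (\<iota> (pF powi n * u ^ k)) \<ge> 1" using n u pF by (fastforce simp: fideal_def)
    then have "n * ram + int k * vE (\<iota> u) \<ge> 1"
      using u pF by (simp add: emb_mult iota_power iota_power_int E.val_mult E.val_power E.val_power_int ram_def)
    moreover have "int k * vE (\<iota> u) \<le> int k * (- 1)"
      using neg by (intro mult_left_mono) auto
    moreover have "int k \<ge> n * ram" by (simp add: k_def)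
    ultimately show False by linarith
  qed
  have unit: "vE (\<iota> u) = 0" if u: "u \<noteq> 0" "vF u = 0" for u
    using nonneg[OF u] nonneg[of "inverse u"] u by (simp add: F.val_inverse iota_inverse E.val_inverse)
  assume a: "a \<noteq> 0"
  have "vE (\<iota> (a * pF powi (- vF a))) = 0"
    by (rule unit) (use a pF in \<open>simp_all add: F.val_mult F.val_power_int\<close>)
  then show "vE (\<iota> a) = ram * vF a"
    using a pF by (simp add: emb_mult iota_power_int E.val_mult E.val_power_int ram_def[symmetric])
qed

lemma iota_fideal: "\<iota> a \<in> fideal vE (ram * k) \<longleftrightarrow> a \<in> fideal vF k"
  using ram_pos by (cases "a = 0") (auto simp: fideal_def val_iota)

definition Box :: "int \<Rightarrow> int \<Rightarrow> 'e set" where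
  "Box m n = {x. c1 x \<in> fideal vF m \<and> c2 x \<in> fideal vF n}"

text \<open>The image of a compact ideal is closed and misses \<alpha>, so \<alpha> has positive
  distance from it; elements of the ground field outside that ideal are too large to come near
  \<alpha>.\<close>

lemma alpha_far_from_base:
  obtains M where "\<And>y. \<iota> y + \<alpha> \<notin> fideal vE M"
proof -
  \<comment> \<open>If \<open>\<iota> y + \<alpha>\<close> is at most as large as \<alpha>, so is
    \<open>\<iota> y\<close>; this level of ideal contains all such \<open>y\<close>.\<close>
  define k where "k = min 0 (vE \<alpha>)"
  have "compact ((\<lambda>y. - 1 * y + 0) ` \<iota> ` fideal vF k)"
    using emb_continuous E.continuous_affine F.compact_fideal
    by (blast intro: compact_continuous_image continuous_on_subset)
  then have "closed ((\<lambda>y. - 1 * y + 0) ` \<iota> ` fideal vF k)" by (rule E.compact_closed)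
  moreover have "\<alpha> \<notin> (\<lambda>y. - 1 * y + 0) ` \<iota> ` fideal vF k"
    using alpha_notin by (auto simp: iota_minus[symmetric])
  ultimately obtain n where n: "\<And>y. y - \<alpha> \<in> fideal vE n \<Longrightarrow> y \<notin> (\<lambda>y. - 1 * y + 0) ` \<iota> ` fideal vF k"
    unfolding closed_def E.open_iff by blast
  have "\<iota> y + \<alpha> \<notin> fideal vE (max n (vE \<alpha>))" for y
  proof
    assume y: "\<iota> y + \<alpha> \<in> fideal vE (max n (vE \<alpha>))"
    have "\<iota> y + \<alpha> - \<alpha> \<in> fideal vE (vE \<alpha>)"
      using E.fideal_monoD[OF y] by (intro E.fideal_diff) (auto simp: fideal_def)
    then have "y = 0 \<or> vE \<alpha> \<le> ram * vF y"
      by (cases "y = 0") (simp_all add: fideal_def val_iota)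
    then have "y \<in> fideal vF k"
    proof (cases "vF y \<ge> 0")
      case False
      then have "ram * vF y \<le> 1 * vF y" using ram_pos by (intro mult_right_mono_neg) auto
      then show ?thesis using \<open>y = 0 \<or> vE \<alpha> \<le> ram * vF y\<close> by (auto simp: fideal_def k_def)
    qed (auto simp: fideal_def k_def)
    moreover have "- \<iota> y - \<alpha> \<in> fideal vE n"
      using E.fideal_monoD[OF y, of n] E.fideal_uminus[of "\<iota> y + \<alpha>" n] by simp
    ultimately show False using n[of "- \<iota> y"] by auto
  qed
  then show ?thesis using that by blast
qed

text \<open>The coordinate topology is the valuation topology, with a loss \<open>C\<close>
  independent of the scale because both sides are homogeneous under powers of \<open>pF\<close>. At
  scale 0 the coordinate \<open>c2 x\<close> is bounded by writing \<open>x\<close> as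
  \<open>\<iota> (c2 x)\<close> times some \<open>\<iota> y + \<alpha>\<close>, which is never
  small.\<close>

lemma commensurable:
  obtains C where "C \<ge> 0" "\<And>k. fideal vE (ram * k) \<subseteq> Box (k - C) (k - C)" "\<And>k. Box (k + C) (k + C) \<subseteq> fideal vE (ram * k)"
proof -
  obtain M where M: "\<And>y. \<iota> y + \<alpha> \<notin> fideal vE M" using alpha_far_from_base by blast
  define C where "C = ram * \<bar>M\<bar> + \<bar>vE \<alpha>\<bar>"
  have MC: "\<bar>M\<bar> \<le> C" "\<bar>vE \<alpha>\<bar> \<le> C" "C \<ge> 0"
    using mult_right_mono[OF ram_pos, of "\<bar>M\<bar>"] ram_pos unfolding C_def by auto
  have rc: "t \<le> ram * t" if "t \<ge> 0" for t using mult_right_mono[OF ram_pos that] by simp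
  have rc': "ram * t \<le> t" if "t \<le> 0" for t using mult_right_mono_neg[OF ram_pos that] by simp
  have 1: "x \<in> Box (- C) (- C)" if x: "x \<in> fideal vE 0" for x
  proof -
    have c2: "c2 x = 0 \<or> vF (c2 x) \<ge> - \<bar>M\<bar>"
    proof (rule ccontr)
      assume neg: "\<not> ?thesis"
      have nz: "\<iota> (c1 x / c2 x) + \<alpha> \<noteq> 0" using M E.zero_in_fideal by metis
      have "x = \<iota> (c2 x) * (\<iota> (c1 x / c2 x) + \<alpha>)"
        using neg by (subst rep[of x]) (simp add: iota_divide field_simps)
      then have "vE x = ram * vF (c2 x) + vE (\<iota> (c1 x / c2 x) + \<alpha>)" "x \<noteq> 0"
        using neg nz by (metis E.val_mult iota_eq_0 val_iota, metis iota_eq_0 mult_eq_0_iff)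
      moreover have "vE (\<iota> (c1 x / c2 x) + \<alpha>) < M" using M[of "c1 x / c2 x"] by (auto simp: fideal_def)
      moreover have "ram * vF (c2 x) \<le> vF (c2 x)" using neg by (intro rc') auto
      ultimately show False using x neg by (auto simp: fideal_def)
    qed
    have "\<iota> (c2 x) * \<alpha> \<in> fideal vE (- C)"
    proof (cases "c2 x = 0")
      case False
      then have "ram * vF (c2 x) \<ge> ram * (- \<bar>M\<bar>)" using c2 ram_pos by (intro mult_left_mono) auto
      then show ?thesis using False by (simp add: fideal_def E.val_mult val_iota C_def)
    qed simp
    moreover have "x \<in> fideal vE (- C)" using E.fideal_monoD[OF x] MC by simp
    ultimately have "x - \<iota> (c2 x) * \<alpha> \<in> fideal vE (- C)" by (rule E.fideal_diff[rotated])
    then have "\<iota> (c1 x) \<in> fideal vE (- C)" using rep[of x] by (metis add_diff_cancel_right')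
    moreover have "ram * (- C) \<le> - C" using MC by (intro rc') simp
    ultimately have "c1 x \<in> fideal vF (- C)" using iota_fideal[of "c1 x" "- C"] E.fideal_monoD by blast
    moreover have "c2 x \<in> fideal vF (- C)" using c2 MC by (auto simp: fideal_def)
    ultimately show ?thesis by (simp add: Box_def)
  qed
  have 2: "x \<in> fideal vE 0" if "x \<in> Box C C" for x
  proof -
    have x: "\<iota> (c1 x) \<in> fideal vE (ram * C)" "\<iota> (c2 x) \<in> fideal vE (ram * C)"
      using that by (auto simp: Box_def iota_fideal)
    then have "\<iota> (c2 x) * \<alpha> \<in> fideal vE (ram * C + vE \<alpha>)" by (intro E.fideal_mult) (auto simp: fideal_def)
    then have "\<iota> (c1 x) \<in> fideal vE 0" "\<iota> (c2 x) * \<alpha> \<in> fideal vE 0"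
      using E.fideal_monoD[OF x(1), of 0] E.fideal_monoD[of _ "ram * C + vE \<alpha>" 0] rc[of C] MC by auto
    then show ?thesis using E.fideal_add rep[of x] by metis
  qed
  have scale: "\<exists>x'. x = \<iota> (pF powi k) * x'" for x k
    using pF by (intro exI[of _ "x / \<iota> (pF powi k)"]) simp
  have pk: "vE (\<iota> (pF powi k)) = ram * k" "vF (pF powi k) = k" "pF powi k \<noteq> 0" "\<iota> (pF powi k) \<noteq> 0" for k
    using pF by (simp_all add: val_iota F.val_power_int)
  show ?thesis
  proof (rule that[of C])
    show "fideal vE (ram * k) \<subseteq> Box (k - C) (k - C)" for k
    proof
      fix x assume x: "x \<in> fideal vE (ram * k)"
      obtain x' where x': "x = \<iota> (pF powi k) * x'" using scale by blast
      then have "x' \<in> fideal vE 0" using x E.fideal_scale[OF pk(4), of k x' "ram * k"] pk(1) by simp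
      then show "x \<in> Box (k - C) (k - C)"
        using 1[of x'] x' F.fideal_scale[OF pk(3), of k _ "k - C"] pk(2) by (simp add: Box_def c_scale)
    qed
    show "Box (k + C) (k + C) \<subseteq> fideal vE (ram * k)" for k
    proof
      fix x assume x: "x \<in> Box (k + C) (k + C)"
      obtain x' where x': "x = \<iota> (pF powi k) * x'" using scale by blast
      then have "x' \<in> Box C C" using x F.fideal_scale[OF pk(3), of k _ "k + C"] pk(2) by (simp add: Box_def c_scale)
      then show "x \<in> fideal vE (ram * k)"
        using 2[of x'] x' E.fideal_scale[OF pk(4), of k x' "ram * k"] pk(1) by simp
    qed
  qed (use MC in simp)
qed

text \<open>Conjugation preserves boxes and so is bounded up to a constant; if it enlarged a unit,
  it would enlarge the powers of that unit without bound. A general element is reduced to a unit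
  through its \<open>ram\<close>-th power.\<close>

lemma val_cj: "x \<noteq> 0 \<Longrightarrow> vE (cj x) = vE x"
proof -
  obtain C where C: "C \<ge> 0" "\<And>k. fideal vE (ram * k) \<subseteq> Box (k - C) (k - C)" "\<And>k. Box (k + C) (k + C) \<subseteq> fideal vE (ram * k)"
    using commensurable by blast
  have nonneg: "vE (cj x) \<ge> 0" if x: "x \<noteq> 0" "vE x = 0" for x
  proof (rule ccontr)
    assume neg: "\<not> vE (cj x) \<ge> 0"
    define n where "n = nat (ram * (2 * C) + 1)"
    have "x ^ n \<in> fideal vE (ram * 0)" using x by (simp add: fideal_def E.val_power)
    then have "cj (x ^ n) \<in> Box (- C) (- C)"
      using C(2)[of 0] by (auto simp: Box_def F.fideal_uminus)
    then have "cj (x ^ n) \<in> fideal vE (ram * (- (2 * C)))" using C(3)[of "- 2 * C"] by auto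
    then have "int n * vE (cj x) \<ge> - (ram * (2 * C))" using x by (simp add: fideal_def cj_power E.val_power)
    moreover have "int n * vE (cj x) \<le> int n * (- 1)" using neg by (intro mult_left_mono) auto
    moreover have "ram * (2 * C) \<ge> 0" using ram_pos C(1) by simp
    ultimately show False by (simp add: n_def)
  qed
  have unit: "vE (cj x) = 0" if x: "x \<noteq> 0" "vE x = 0" for x
    using nonneg[OF x] nonneg[of "inverse x"] x by (simp add: E.val_inverse cj_inverse)
  assume x: "x \<noteq> 0"
  have r: "int (nat ram) = ram" using ram_pos by simp
  have "vE (cj (x ^ nat ram * \<iota> (pF powi (- vE x)))) = 0"
    by (rule unit) (use x pF r in \<open>simp_all add: E.val_mult E.val_power val_iota F.val_power_int\<close>)
  then have "ram * vE (cj x) = ram * vE x"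
    using x pF r by (simp add: cj_mult cj_power E.val_mult E.val_power val_iota F.val_power_int)
  then show ?thesis using ram_pos by simp
qed

lemma val_nrm: "x \<noteq> 0 \<Longrightarrow> ram * vF (nrm x) = 2 * vE x"
  using val_iota[of "nrm x"] by (simp add: iota_nrm E.val_mult val_cj)

lemma range_iota_closed: "closed (range \<iota>)"
  unfolding closed_def E.open_iff
proof
  obtain C where C: "C \<ge> 0" "\<And>k. fideal vE (ram * k) \<subseteq> Box (k - C) (k - C)" "\<And>k. Box (k + C) (k + C) \<subseteq> fideal vE (ram * k)"
    using commensurable by blast
  fix x assume "x \<in> - range \<iota>"
  then have x: "c2 x \<noteq> 0" by (simp add: c2_eq_0)
  have "y \<in> - range \<iota>" if "y - x \<in> fideal vE (ram * (vF (c2 x) + 1 + C))" for y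
  proof -
    have "c2 y - c2 x \<in> fideal vF (vF (c2 x) + 1)"
      using C(2)[of "vF (c2 x) + 1 + C"] that by (auto simp: Box_def c_diff)
    then have "c2 y \<noteq> 0" using F.val_stable[OF x] by blast
    then show ?thesis by (simp add: c2_eq_0)
  qed
  then show "\<exists>n. \<forall>y. y - x \<in> fideal vE n \<longrightarrow> y \<in> - range \<iota>" by blast
qed

lemma Box_nbhd: "\<exists>k. fideal vE k \<subseteq> Box m n" "\<exists>k. Box k k \<subseteq> fideal vE n"
proof -
  obtain C where C: "C \<ge> 0" "\<And>k. fideal vE (ram * k) \<subseteq> Box (k - C) (k - C)" "\<And>k. Box (k + C) (k + C) \<subseteq> fideal vE (ram * k)"
    using commensurable by blast
  have "fideal vE (ram * (max m n + C)) \<subseteq> Box m n"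
    using C(2)[of "max m n + C"] F.fideal_mono[of m "max m n"] F.fideal_mono[of n "max m n"] by (auto simp: Box_def)
  then show "\<exists>k. fideal vE k \<subseteq> Box m n" by blast
  have "n \<le> ram * max 0 n" using mult_right_mono[OF ram_pos, of "max 0 n"] by simp
  then have "Box (max 0 n + C) (max 0 n + C) \<subseteq> fideal vE n" using C(3)[of "max 0 n"] E.fideal_mono by blast
  then show "\<exists>k. Box k k \<subseteq> fideal vE n" by blast
qed

lemma Box_bounded: "\<exists>k. Box m n \<subseteq> fideal vE k" "\<exists>k. fideal vE n \<subseteq> Box k k"
proof -
  obtain C where C: "C \<ge> 0" "\<And>k. fideal vE (ram * k) \<subseteq> Box (k - C) (k - C)" "\<And>k. Box (k + C) (k + C) \<subseteq> fideal vE (ram * k)"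
    using commensurable by blast
  have "Box m n \<subseteq> fideal vE (ram * (min m n - C))"
    using C(3)[of "min m n - C"] F.fideal_mono[of "min m n" m] F.fideal_mono[of "min m n" n] by (auto simp: Box_def)
  then show "\<exists>k. Box m n \<subseteq> fideal vE k" by blast
  have "ram * min 0 n \<le> n" using mult_right_mono_neg[OF ram_pos, of "min 0 n"] by simp
  then have "fideal vE n \<subseteq> Box (min 0 n - C) (min 0 n - C)" using C(2)[of "min 0 n"] E.fideal_mono by blast
  then show "\<exists>k. fideal vE n \<subseteq> Box k k" by blast
qed

lemma Box_add: "x \<in> Box m n \<Longrightarrow> y \<in> Box m n \<Longrightarrow> x + y \<in> Box m n"
  and Box_diff: "x \<in> Box m n \<Longrightarrow> y \<in> Box m n \<Longrightarrow> x - y \<in> Box m n"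
  and Box_mono: "x \<in> Box m n \<Longrightarrow> m' \<le> m \<Longrightarrow> n' \<le> n \<Longrightarrow> x \<in> Box m' n'"
  by (auto simp: Box_def c_add c_diff F.fideal_add F.fideal_diff intro: F.fideal_monoD)

lemma open_Box: "open ((\<lambda>y. y - x) -` Box m n)"
  unfolding E.open_iff
proof
  obtain k where k: "fideal vE k \<subseteq> Box m n" using Box_nbhd by blast
  fix y assume "y \<in> (\<lambda>y. y - x) -` Box m n"
  then have "z \<in> (\<lambda>y. y - x) -` Box m n" if "z - y \<in> fideal vE k" for z
    using Box_add[of "z - y" m n "y - x"] that k by auto
  then show "\<exists>k. \<forall>z. z - y \<in> fideal vE k \<longrightarrow> z \<in> (\<lambda>y. y - x) -` Box m n" by blast
qed

lemma Box_borel [simp]: "Box m n \<in> sets borel"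
  using open_Box[of 0 m n] by simp

end

section \<open>Haar measure in coordinates\<close>

locale quadratic_haar = quadratic_extension vF vE pF pE \<iota> \<alpha> d + H: haar_field vE \<mu>
  for vF :: "'f::{field, topological_space} \<Rightarrow> int"
    and vE :: "'e::{field, topological_space} \<Rightarrow> int"
    and pF pE \<iota> \<alpha> d and \<mu> :: "'e measure"
begin

abbreviation "qF \<equiv> real (residue_card vF)"

text \<open>Counts cosets in one coordinate, selected by the flag \<open>b\<close>
  (\<open>True\<close> for \<open>c1\<close>), so that box volumes come from the measure on the big
  field alone.\<close>

lemma Box_translates:
  assumes g: "\<And>r. g r = (if b then \<iota> r else \<iota> r * \<alpha>)"
  shows "emeasure \<mu> (Box (if b then m else m') (if b then n' else n))
    = of_nat (residue_card vF) * emeasure \<mu> (Box (if b then m + 1 else m') (if b then n' else n + 1))"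
proof -
  let ?k = "if b then m else n"
  let ?B = "Box (if b then m + 1 else m') (if b then n' else n + 1)"
  obtain R where R: "finite R" "card R = residue_card vF" "R \<subseteq> fideal vF 0"
    "\<And>x. x \<in> fideal vF 0 \<Longrightarrow> \<exists>!r. r \<in> R \<and> x - r \<in> fideal vF 1" "residue_card vF \<ge> 2"
    by (rule F.residue_reps) blast
  obtain a where a: "a \<noteq> 0" "vF a = ?k" using F.ex_val by blast
  have *: "a * x - a * r \<in> fideal vF (?k + 1) \<longleftrightarrow> x - r \<in> fideal vF 1" for x r
    using F.fideal_scale[OF a(1), of "x - r" "?k + 1"] a(2) by (simp only: right_diff_distrib) simp
  have ar: "a * r \<in> fideal vF ?k" if "r \<in> R" for r
    using F.fideal_scale[OF a(1), of r ?k] a(2) R(3) that by auto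
  have mem: "y \<in> (+) (g (a * r)) ` ?B \<longleftrightarrow>
      (if b then c1 y - a * r \<in> fideal vF (m + 1) \<and> c2 y \<in> fideal vF n'
       else c1 y \<in> fideal vF m' \<and> c2 y - a * r \<in> fideal vF (n + 1))" for y r
  proof -
    have "y \<in> (+) (g (a * r)) ` ?B \<longleftrightarrow> y - g (a * r) \<in> ?B"
      by (auto intro!: image_eqI[of _ _ "y - g (a * r)"])
    then show ?thesis using c_unique[of "\<iota> (a * r) * \<alpha>" 0 "a * r"] by (simp add: Box_def c_diff g)
  qed
  have surj: "\<exists>r\<in>R. x - a * r \<in> fideal vF (?k + 1)" if "x \<in> fideal vF ?k" for x
  proof -
    have "x / a \<in> fideal vF 0" using F.fideal_scale[OF a(1), of "x / a" ?k] a that by simp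
    then obtain r where "r \<in> R" "x / a - r \<in> fideal vF 1" using R(4) by blast
    then show ?thesis using *[of "x / a" r] a(1) by (intro bexI[of _ r]) auto
  qed
  have down: "x \<in> fideal vF ?k" if "x - a * r \<in> fideal vF (?k + 1)" "r \<in> R" for x r
    using F.fideal_add[OF F.fideal_monoD[OF that(1), of ?k] ar[OF that(2)]] by simp
  have "Box (if b then m else m') (if b then n' else n) = (\<Union>r\<in>R. (+) (g (a * r)) ` ?B)"
  proof (rule set_eqI)
    fix y
    show "y \<in> Box (if b then m else m') (if b then n' else n) \<longleftrightarrow> y \<in> (\<Union>r\<in>R. (+) (g (a * r)) ` ?B)"
      unfolding UN_iff mem using surj down by (cases b) (auto simp: Box_def)
  qed
  also have "emeasure \<mu> \<dots> = of_nat (card R) * emeasure \<mu> ?B"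
  proof (rule finite_disjoint_translates[OF H.transl_inv_haar R(1)])
    show "(+) y ` ?B \<in> sets borel" for y
    proof -
      have "(+) y ` ?B = (\<lambda>z. z - y) -` ?B" by (force intro!: image_eqI[of _ _ "_ - y"])
      then show ?thesis using open_Box by (metis borel_open)
    qed
    fix r s assume rs: "r \<in> R" "s \<in> R" "r \<noteq> s"
    show "(+) (g (a * r)) ` ?B \<inter> (+) (g (a * s)) ` ?B = {}"
    proof (rule ccontr)
      assume "(+) (g (a * r)) ` ?B \<inter> (+) (g (a * s)) ` ?B \<noteq> {}"
      then obtain y where "y \<in> (+) (g (a * r)) ` ?B" "y \<in> (+) (g (a * s)) ` ?B" by blast
      then obtain z where z: "z - a * r \<in> fideal vF (?k + 1)" "z - a * s \<in> fideal vF (?k + 1)"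
        unfolding mem by (cases b) auto
      then have "a * r - a * s \<in> fideal vF (?k + 1)"
        using F.fideal_diff_trans[of "a * r" z] F.fideal_diff_commute[of z "a * r"] by simp
      then have "r - s \<in> fideal vF 1" using * by simp
      moreover have "r \<in> fideal vF 0" "r - r \<in> fideal vF 1" using rs R(3) by auto
      ultimately show False using R(4)[of r] rs by blast
    qed
  qed simp
  finally show ?thesis using R(2) by simp
qed

lemma emeasure_Box_Suc:
  "emeasure \<mu> (Box m n) = ennreal qF * emeasure \<mu> (Box (m + 1) n)"
  "emeasure \<mu> (Box m n) = ennreal qF * emeasure \<mu> (Box m (n + 1))"
  using Box_translates[of "\<lambda>r. \<iota> r" True m _ n] Box_translates[of "\<lambda>r. \<iota> r * \<alpha>" False _ m _ n]
  by (simp_all add: ennreal_of_nat_eq_real_of_nat)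

lemma emeasure_geometric:
  fixes f :: "int \<Rightarrow> ennreal"
  assumes "\<And>n. f n = ennreal qF * f (n + 1)"
  shows "f n = ennreal (qF powi (- n)) * f 0"
proof (induction n rule: int_induct[of _ 0])
  case (step1 i)
  have "ennreal (1 / qF) * f i = f (i + 1)"
    unfolding assms[of i] mult.assoc[symmetric]
    using F.q_gt_0 by (simp add: ennreal_mult'[symmetric])
  moreover have "qF powi (- (i + 1)) = (1 / qF) * qF powi (- i)"
    using F.q_gt_0 by (simp add: power_int_diff power_int_minus divide_simps)
  ultimately show ?case using step1 F.q_gt_0
    by (simp add: ennreal_mult'[symmetric] mult.assoc[symmetric])
next
  case (step2 i)
  have "qF powi (- (i - 1)) = qF * qF powi (- i)"
    using F.q_gt_0 by (simp add: power_int_diff power_int_minus divide_simps)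
  then show ?case using step2 assms[of "i - 1"] F.q_gt_0
    by (simp add: ennreal_mult' mult.assoc)
qed simp

text \<open>Kept as a parameter: the lattice spanned by 1 and \<alpha> over the small ring of
  integers need not be the whole ring of integers, which has volume 1.\<close>

definition box_vol :: real where "box_vol = measure \<mu> (Box 0 0)"

lemma box_vol_pos: "box_vol > 0"
  and emeasure_Box: "emeasure \<mu> (Box m n) = ennreal (qF powi (- m - n) * box_vol)"
proof -
  obtain k l where kl: "Box 0 0 \<subseteq> fideal vE k" "fideal vE l \<subseteq> Box 0 0" using Box_nbhd Box_bounded by meson
  have fin: "emeasure \<mu> (Box 0 0) \<noteq> \<infinity>" using H.finite_emeasure_bounded[OF kl(1)] by simp
  have eq: "emeasure \<mu> (Box 0 0) = ennreal box_vol"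
    using fin by (simp add: box_vol_def emeasure_eq_ennreal_measure)
  have "0 < emeasure \<mu> (fideal vE l)" using E.q_gt_0 by (simp add: H.emeasure_fideal)
  also have "\<dots> \<le> emeasure \<mu> (Box 0 0)" by (rule emeasure_mono[OF kl(2)]) simp
  finally show "box_vol > 0" using eq by simp
  have "emeasure \<mu> (Box m n) = ennreal (qF powi (- m)) * emeasure \<mu> (Box 0 n)"
    by (rule emeasure_geometric) (rule emeasure_Box_Suc(1))
  also have "emeasure \<mu> (Box 0 n) = ennreal (qF powi (- n)) * emeasure \<mu> (Box 0 0)"
    by (rule emeasure_geometric) (rule emeasure_Box_Suc(2))
  finally show "emeasure \<mu> (Box m n) = ennreal (qF powi (- m - n) * box_vol)"
    using F.q_gt_0 eq \<open>box_vol > 0\<close>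
    by (simp add: ennreal_mult'[symmetric] mult.assoc[symmetric] power_int_diff power_int_minus field_simps)
qed

lemma scales_emeasure:
  assumes "H.scales L c" "A \<in> sets borel"
  shows "emeasure \<mu> (L -` A) = ennreal c * emeasure \<mu> A"
proof -
  have "emeasure (distr \<mu> borel L) A = emeasure \<mu> (L -` A)"
    using assms by (subst emeasure_distr) (auto simp: H.scales_def)
  then show ?thesis using assms by (simp add: H.scales_def emeasure_density_const)
qed

text \<open>Multiplication by \<open>\<iota> pF\<close> scales boxes by one factor \<open>qF\<close>
  for each coordinate; comparing with its scaling of Haar measure gives the identity e f =
  2.\<close>

lemma residue_card_relation: "real (residue_card vE) powi ram = qF ^ 2"
proof -
  have "(\<lambda>x. \<iota> pF * x) -` Box 0 0 = Box (- 1) (- 1)"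
    using F.fideal_scale[OF pF(1), of _ 0] pF(2) by (auto simp: Box_def c_scale)
  then have "ennreal (qF ^ 2 * box_vol) = ennreal (real (residue_card vE) powi ram) * ennreal box_vol"
    using scales_emeasure[OF H.scales_mult[of "\<iota> pF"], of "Box 0 0"] pF by (simp add: emeasure_Box ram_def)
  then have "qF ^ 2 * box_vol = real (residue_card vE) powi ram * box_vol"
    using box_vol_pos E.q_gt_0 by (simp add: ennreal_mult'[symmetric])
  then show ?thesis using box_vol_pos by simp
qed

text \<open>The absolute value of the big field is that of the norm in the small one, which lets
  every weight be expressed through \<open>vF\<close>. Squares are compared because
  \<open>ram * vF (nrm x)\<close> is twice \<open>vE x\<close>.\<close>

lemma card_powi_val: "x \<noteq> 0 \<Longrightarrow> real (residue_card vE) powi (vE x) = qF powi (vF (nrm x))"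
proof -
  assume x: "x \<noteq> 0"
  have "(real (residue_card vE) powi vE x) ^ 2 = real (residue_card vE) powi (ram * vF (nrm x))"
    unfolding val_nrm[OF x] by (simp add: power_int_mult mult.commute)
  also have "\<dots> = (qF powi vF (nrm x)) ^ 2"
    unfolding power_int_mult residue_card_relation by (metis power_int_mult power_int_of_nat mult.commute)
  finally show ?thesis using E.q_gt_0 F.q_gt_0 by (simp add: power2_eq_iff_nonneg)
qed

lemma mod_abs_E: "x \<noteq> 0 \<Longrightarrow> mod_abs vE x = qF powi (- vF (nrm x))"
  using card_powi_val[of x] by (simp add: mod_abs_def power_int_minus)

text \<open>Linear over the small field only: it fixes the ground field pointwise and acts
  transversally to it. This is the symmetry behind the first family of poles.\<close>

definition stretch :: "'f \<Rightarrow> 'e \<Rightarrow> 'e" where "stretch a x = \<iota> (c1 x) + \<iota> (a * c2 x) * \<alpha>"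

lemma c_stretch [simp]: "c1 (stretch a x) = c1 x" "c2 (stretch a x) = a * c2 x"
  by (simp_all add: stretch_def)

lemma scales_stretch:
  assumes a: "a \<noteq> 0" shows "H.scales (stretch a) (qF powi vF a)"
proof -
  have pre: "stretch a -` Box m n = Box m (n - vF a)" for m n
    using F.fideal_scale[OF a] by (auto simp: Box_def)
  show ?thesis
  proof (rule H.scales_linear[of _ "Box 0 0"])
    show "stretch a \<in> borel_measurable borel"
    proof (rule E.measurable_off_closed[of "{}"])
      fix x S assume S: "open S" "stretch a x \<in> S"
      then obtain n where n: "\<And>y. y - stretch a x \<in> fideal vE n \<Longrightarrow> y \<in> S" unfolding E.open_iff by blast
      obtain k where k: "Box k k \<subseteq> fideal vE n" using Box_nbhd by blast
      obtain l where l: "fideal vE l \<subseteq> Box k (k - vF a)" using Box_nbhd by blast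
      have "stretch a y \<in> S" if "y - x \<in> fideal vE l" for y
      proof (rule n)
        have "stretch a (y - x) \<in> Box k k" using that l pre by blast
        moreover have "stretch a (y - x) = stretch a y - stretch a x"
          by (rule c_eqI) (simp_all add: c_diff algebra_simps)
        ultimately show "stretch a y - stretch a x \<in> fideal vE n" using k by auto
      qed
      then show "\<exists>n. \<forall>y. y - x \<in> fideal vE n \<longrightarrow> stretch a y \<in> S" by blast
    qed auto
    show "stretch a (x + y) = stretch a x + stretch a y" for x y
      by (rule c_eqI) (simp_all add: c_add algebra_simps)
    show "surj (stretch a)"
      by (rule surjI[of _ "stretch (inverse a)"]) (rule c_eqI, use a in simp_all)
    show "emeasure \<mu> (stretch a -` Box 0 0) = ennreal (qF powi vF a) * emeasure \<mu> (Box 0 0)"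
      unfolding pre emeasure_Box using F.q_gt_0 by (simp add: ennreal_mult')
    show "emeasure \<mu> (Box 0 0) \<noteq> 0" "emeasure \<mu> (Box 0 0) \<noteq> \<infinity>"
      using box_vol_pos by (simp_all add: emeasure_Box)
    show "0 < qF powi vF a" using F.q_gt_0 by (rule zero_less_power_int)
    obtain k where k: "fideal vE 0 \<subseteq> Box k k" using Box_bounded by blast
    have "emeasure \<mu> (stretch a -` fideal vE 0) \<le> emeasure \<mu> (stretch a -` Box k k)"
      by (rule emeasure_mono) (use k in blast, simp add: pre)
    then show "emeasure \<mu> (stretch a -` fideal vE 0) \<noteq> \<infinity>" unfolding pre emeasure_Box
      by (metis ennreal_less_top infinity_ennreal_def leD)
  qed simp
qed

end

section \<open>Characters and the kernel\<close>

text \<open>The part of the extended character that does not depend on \<open>s\<close>: a character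
  of the full multiplicative group with value 1 at the chosen uniformizer.\<close>

definition ang_char :: "('k::field \<Rightarrow> int) \<Rightarrow> 'k \<Rightarrow> ('k \<Rightarrow> complex) \<Rightarrow> 'k \<Rightarrow> complex" where
  "ang_char v p chi x = chi (p powi (- v x) * x)"

lemma char_ext_ang_char: "char_ext v p chi s x = ang_char v p chi x * of_real (mod_abs v x) powr s"
  by (simp add: char_ext_def ang_char_def)

text \<open>The unit circle has no small subgroups; hence characters of the units are locally constant.\<close>

lemma powers_near_1:
  fixes w :: complex
  assumes "\<And>k::nat. norm (w ^ k - 1) \<le> 1 / 2" shows "w = 1"
proof (rule ccontr)
  assume "w \<noteq> 1"
  \<comment> \<open>Squaring multiplies the distance from 1 by \<open>norm (u + 1)\<close>, which is
    at least 3/2 as long as \<open>u\<close> is within 1/2 of 1.\<close>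
  have "(3 / 2) ^ k * norm (w - 1) \<le> norm (w ^ (2 ^ k) - 1)" for k :: nat
  proof (induction k)
    case (Suc k)
    let ?u = "w ^ (2 ^ k)"
    have "2 = norm ((?u + 1) - (?u - 1))" by simp
    also have "\<dots> \<le> norm (?u + 1) + norm (?u - 1)" by (rule norm_triangle_ineq4)
    finally have "norm (?u + 1) \<ge> 3 / 2" using assms[of "2 ^ k"] by simp
    have "(3 / 2) ^ Suc k * norm (w - 1) \<le> 3 / 2 * norm (?u - 1)"
      using mult_left_mono[OF Suc, of "3 / 2"] by (simp add: mult.assoc)
    also have "\<dots> \<le> norm (?u + 1) * norm (?u - 1)"
      using \<open>norm (?u + 1) \<ge> 3 / 2\<close> by (intro mult_right_mono) auto
    also have "\<dots> = norm (w ^ (2 ^ Suc k) - 1)"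
    proof -
      have "w ^ (2 ^ Suc k) = ?u * ?u" by (simp add: power_add[symmetric] mult_2)
      then have "w ^ (2 ^ Suc k) - 1 = (?u + 1) * (?u - 1)" by (simp add: algebra_simps)
      then show ?thesis by (simp only: norm_mult)
    qed
    finally show ?case .
  qed simp
  then have "(3 / 2) ^ k * norm (w - 1) \<le> 1 / 2" for k :: nat using assms[of "2 ^ k"] by (rule order_trans)
  moreover obtain k where "(1 / 2) / norm (w - 1) < (3 / 2 :: real) ^ k"
    using real_arch_pow[of "3 / 2 :: real"] by auto
  moreover from this have "1 / 2 < (3 / 2) ^ k * norm (w - 1)" using \<open>w \<noteq> 1\<close> by (simp add: pos_divide_less_eq)
  ultimately show False by (meson not_le)
qed

context local_field
begin

lemma int_units_iff: "x \<in> int_units v \<longleftrightarrow> x \<noteq> 0 \<and> v x = 0"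
  by (simp add: int_units_def)

lemma near_1_unit: "x - 1 \<in> fideal v n \<Longrightarrow> n \<ge> 1 \<Longrightarrow> x \<in> int_units v"
  using val_stable[of 1 x] fideal_monoD[of "x - 1" n 1] by (simp add: int_units_iff)

lemma near_1_mult: "x - 1 \<in> fideal v n \<Longrightarrow> y - 1 \<in> fideal v n \<Longrightarrow> n \<ge> 1 \<Longrightarrow> x * y - 1 \<in> fideal v n"
proof -
  assume xy: "x - 1 \<in> fideal v n" "y - 1 \<in> fideal v n" "n \<ge> 1"
  have "x \<in> fideal v 0" using near_1_unit[OF xy(1,3)] by (simp add: int_units_iff fideal_def)
  then have "x * (y - 1) \<in> fideal v n" using fideal_mult[of x 0 "y - 1" n] xy by simp
  then have "x * (y - 1) + (x - 1) \<in> fideal v n" using fideal_add xy(1) by blast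
  then show ?thesis by (simp add: algebra_simps)
qed

lemma near_1_power: "x - 1 \<in> fideal v n \<Longrightarrow> n \<ge> 1 \<Longrightarrow> x ^ k - 1 \<in> fideal v n"
  by (induction k) (auto intro: near_1_mult)

lemma unit_char_power:
  assumes "unit_char v chi" "x \<in> int_units v" shows "chi (x ^ k) = chi x ^ k"
proof (induction k)
  case (Suc k)
  have "x ^ k \<in> int_units v" using assms(2) by (simp add: int_units_iff val_power)
  then show ?case using assms Suc by (simp add: unit_char_def)
qed (use assms in \<open>simp add: unit_char_def\<close>)

text \<open>The elements congruent to 1 modulo a deep ideal are closed under powers, and continuity
  sends them into a small ball around 1; so \<open>powers_near_1\<close> applies to each
  value.\<close>

lemma unit_char_locally_trivial:
  assumes chi: "unit_char v chi"
  obtains n where "n \<ge> 1" "\<And>x. x - 1 \<in> fideal v n \<Longrightarrow> chi x = 1"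
proof -
  have "continuous_on (int_units v) chi" using chi by (simp add: unit_char_def)
  then obtain A where A: "open A" "A \<inter> int_units v = chi -` ball 1 (1 / 2) \<inter> int_units v"
    unfolding continuous_on_open_invariant using open_ball by meson
  have "1 \<in> A" using A(2) chi by (auto simp: unit_char_def int_units_iff)
  then obtain n where n: "\<And>y. y - 1 \<in> fideal v n \<Longrightarrow> y \<in> A" using A(1) unfolding open_iff by blast
  have "chi x = 1" if x: "x - 1 \<in> fideal v (max n 1)" for x
  proof (rule powers_near_1)
    fix k
    have "x ^ k - 1 \<in> fideal v (max n 1)" using near_1_power[OF x] by simp
    then have "x ^ k \<in> A \<inter> int_units v"
      using n near_1_unit fideal_monoD[of "x ^ k - 1" "max n 1" n] by simp
    then have "chi (x ^ k) \<in> ball 1 (1 / 2)" using A(2) by blast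
    then show "norm (chi x ^ k - 1) \<le> 1 / 2"
      using unit_char_power[OF chi near_1_unit[OF x]] by (simp add: dist_norm norm_minus_commute)
  qed
  then show ?thesis using that[of "max n 1"] by simp
qed

text \<open>The unit group is compact, so the powers of a value stay bounded; applied to an element
  and its inverse this forces modulus 1.\<close>

lemma unit_char_norm:
  assumes chi: "unit_char v chi" and x: "x \<in> int_units v"
  shows "norm (chi x) = 1"
proof -
  have eq: "int_units v = fideal v 0 \<inter> - fideal v 1" by (auto simp: int_units_iff fideal_def)
  have "compact (int_units v)"
    unfolding eq by (intro compact_Int_closed compact_fideal closed_Compl open_fideal)
  then have "bounded (chi ` int_units v)"
    using chi by (auto simp: unit_char_def intro!: compact_imp_bounded compact_continuous_image)
  then obtain M where M: "\<And>y. y \<in> int_units v \<Longrightarrow> norm (chi y) \<le> M" by (auto simp: bounded_iff)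
  have le: "norm (chi y) \<le> 1" if y: "y \<in> int_units v" for y
  proof (rule ccontr)
    assume "\<not> norm (chi y) \<le> 1"
    then obtain k where "M < norm (chi y) ^ k" using real_arch_pow[of "norm (chi y)" M] by auto
    moreover have "y ^ k \<in> int_units v" using y by (simp add: int_units_iff val_power)
    ultimately show False using M[of "y ^ k"] unit_char_power[OF chi y] by (simp add: norm_power)
  qed
  have i: "inverse x \<in> int_units v" using x by (simp add: int_units_iff val_inverse)
  have "chi (x * inverse x) = chi x * chi (inverse x)" using chi x i by (simp add: unit_char_def)
  then have "norm (chi x) * norm (chi (inverse x)) = 1"
    using chi x by (simp add: norm_mult[symmetric] unit_char_def int_units_iff)
  moreover have "norm (chi x) * norm (chi (inverse x)) \<le> norm (chi x) * 1"
    using le[OF i] by (intro mult_left_mono) auto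
  ultimately show ?thesis using le[OF x] by simp
qed

context
  fixes p chi assumes p: "uniformizer v p" and chi: "unit_char v chi"
begin

lemma unif: "p \<noteq> 0" "v p = 1"
  using p by (auto simp: uniformizer_def)

lemma unit_part: "x \<noteq> 0 \<Longrightarrow> p powi (- v x) * x \<in> int_units v"
  using unif by (simp add: int_units_iff val_mult val_power_int)

lemma ang_char_unit: "x \<in> int_units v \<Longrightarrow> ang_char v p chi x = chi x"
  by (simp add: ang_char_def int_units_iff)

lemma ang_char_mult: "x \<noteq> 0 \<Longrightarrow> y \<noteq> 0 \<Longrightarrow> ang_char v p chi (x * y) = ang_char v p chi x * ang_char v p chi y"
proof -
  assume xy: "x \<noteq> 0" "y \<noteq> 0"
  have "p powi (- v (x * y)) = p powi (- v x) * p powi (- v y)"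
    using xy unif by (simp add: val_mult power_int_add[symmetric])
  then have "p powi (- v (x * y)) * (x * y) = (p powi (- v x) * x) * (p powi (- v y) * y)"
    by (simp only: ac_simps)
  moreover have "chi ((p powi (- v x) * x) * (p powi (- v y) * y)) = chi (p powi (- v x) * x) * chi (p powi (- v y) * y)"
    using chi unit_part[OF xy(1)] unit_part[OF xy(2)] unfolding unit_char_def by blast
  ultimately show ?thesis by (simp only: ang_char_def)
qed

lemma ang_char_1: "ang_char v p chi 1 = 1"
  using chi by (simp add: ang_char_def unit_char_def)

lemma ang_char_norm: "x \<noteq> 0 \<Longrightarrow> norm (ang_char v p chi x) = 1"
  unfolding ang_char_def using unit_char_norm[OF chi unit_part] .

lemma ang_char_nonzero: "x \<noteq> 0 \<Longrightarrow> ang_char v p chi x \<noteq> 0"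
  using ang_char_norm[of x] by auto

lemma ang_char_inverse: "x \<noteq> 0 \<Longrightarrow> ang_char v p chi (inverse x) = inverse (ang_char v p chi x)"
  using ang_char_mult[of x "inverse x"] ang_char_1 by (simp add: inverse_unique)

lemma ang_char_divide: "x \<noteq> 0 \<Longrightarrow> y \<noteq> 0 \<Longrightarrow> ang_char v p chi (x / y) = ang_char v p chi x / ang_char v p chi y"
  by (simp add: divide_inverse ang_char_mult ang_char_inverse)

lemma ang_char_locally_constant:
  obtains n where "n \<ge> 1" "\<And>x y. x \<noteq> 0 \<Longrightarrow> y - x \<in> fideal v (v x + n) \<Longrightarrow> y \<noteq> 0 \<and> v y = v x \<and> ang_char v p chi y = ang_char v p chi x"
proof -
  obtain n where n: "n \<ge> 1" "\<And>x. x - 1 \<in> fideal v n \<Longrightarrow> chi x = 1"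
    using unit_char_locally_trivial[OF chi] by blast
  show ?thesis
  proof (rule that[OF n(1)])
    fix x y assume x: "x \<noteq> 0" and yx: "y - x \<in> fideal v (v x + n)"
    have y: "y \<noteq> 0" "v y = v x"
      using val_stable[OF x, of y] fideal_monoD[OF yx, of "v x + 1"] n(1) by simp_all
    have "y / x - 1 = inverse x * (y - x)" using x by (simp add: field_simps)
    then have 1: "y / x - 1 \<in> fideal v n"
      using fideal_scale[of "inverse x" "y - x" n] x yx by (simp add: val_inverse add.commute)
    have "ang_char v p chi (y / x) = 1"
      using n(2)[OF 1] ang_char_unit[OF near_1_unit[OF 1 n(1)]] by simp
    then show "y \<noteq> 0 \<and> v y = v x \<and> ang_char v p chi y = ang_char v p chi x"
      using ang_char_divide[OF y(1) x] ang_char_nonzero[OF x] y by (simp add: divide_eq_1_iff)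
  qed
qed

end

end

section \<open>The kernel, its homogeneity and its local constancy\<close>

locale kernel_params = quadratic_haar vF vE pF pE \<iota> \<alpha> d \<mu>
  for vF :: "'f::{field, topological_space} \<Rightarrow> int"
    and vE :: "'e::{field, topological_space} \<Rightarrow> int"
    and pF pE \<iota> \<alpha> d and \<mu> :: "'e measure" +
  fixes chi :: "'e \<Rightarrow> complex" and eta :: "'f \<Rightarrow> complex"
  assumes chi: "unit_char vE chi" and eta: "unit_char vF eta"
begin

definition "chiE = ang_char vE pE chi"
definition "etaF = ang_char vF pF eta"

lemmas chiE_mult = E.ang_char_mult[OF uniformizer_E chi, folded chiE_def]
lemmas chiE_divide = E.ang_char_divide[OF uniformizer_E chi, folded chiE_def]
lemmas chiE_norm = E.ang_char_norm[OF uniformizer_E chi, folded chiE_def]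
lemmas chiE_nonzero = E.ang_char_nonzero[OF uniformizer_E chi, folded chiE_def]
lemmas chiE_local = E.ang_char_locally_constant[OF uniformizer_E chi, folded chiE_def]
lemmas chiE_unit = E.ang_char_unit[OF uniformizer_E chi, folded chiE_def]
lemmas chiE_1 = E.ang_char_1[OF uniformizer_E chi, folded chiE_def]
lemmas etaF_mult = F.ang_char_mult[OF uniformizer_F eta, folded etaF_def]
lemmas etaF_divide = F.ang_char_divide[OF uniformizer_F eta, folded etaF_def]
lemmas etaF_norm = F.ang_char_norm[OF uniformizer_F eta, folded etaF_def]
lemmas etaF_nonzero = F.ang_char_nonzero[OF uniformizer_F eta, folded etaF_def]
lemmas etaF_local = F.ang_char_locally_constant[OF uniformizer_F eta, folded etaF_def]
lemmas etaF_unit = F.ang_char_unit[OF uniformizer_F eta, folded etaF_def]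
lemmas etaF_1 = F.ang_char_1[OF uniformizer_F eta, folded etaF_def]

text \<open>Here the compatibility of the uniformizers enters: this value would otherwise appear as
  a constant in the ratios of the geometric series.\<close>

lemma chiE_pF: "chiE (\<iota> pF) = 1"
proof -
  have "pE powi (- vE (\<iota> pF)) * \<iota> pF = 1"
    using uniformizers_compatible pE(1) pF(1) by (simp add: power_int_minus field_simps)
  then show ?thesis using chi by (simp add: chiE_def ang_char_def unit_char_def)
qed

lemma etaF_pF: "etaF pF = 1"
  using eta pF by (simp add: etaF_def ang_char_def unit_char_def power_int_minus)

text \<open>Chi times eta, respectively chi over eta, on the multiplicative group of the small
  field; whether they are trivial decides which family of poles exists.\<close>

definition omega_plus :: "'f \<Rightarrow> complex" where "omega_plus a = chiE (\<iota> a) * etaF a"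
definition omega_minus :: "'f \<Rightarrow> complex" where "omega_minus a = chiE (\<iota> a) / etaF a"

lemma omega_plus_mult: "a \<noteq> 0 \<Longrightarrow> b \<noteq> 0 \<Longrightarrow> omega_plus (a * b) = omega_plus a * omega_plus b"
  and omega_minus_mult: "a \<noteq> 0 \<Longrightarrow> b \<noteq> 0 \<Longrightarrow> omega_minus (a * b) = omega_minus a * omega_minus b"
  and omega_plus_divide: "a \<noteq> 0 \<Longrightarrow> b \<noteq> 0 \<Longrightarrow> omega_plus (a / b) = omega_plus a / omega_plus b"
  by (simp_all add: omega_plus_def omega_minus_def emb_mult iota_divide chiE_mult etaF_mult chiE_divide etaF_divide)

lemma omega_plus_norm: "a \<noteq> 0 \<Longrightarrow> norm (omega_plus a) = 1" and omega_minus_norm: "a \<noteq> 0 \<Longrightarrow> norm (omega_minus a) = 1"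
  by (simp_all add: omega_plus_def omega_minus_def norm_mult norm_divide chiE_norm etaF_norm)

lemma omega_plus_pF: "omega_plus pF = 1" and omega_minus_pF: "omega_minus pF = 1" and omega_plus_1: "omega_plus 1 = 1" and omega_minus_1: "omega_minus 1 = 1"
  by (simp_all add: omega_plus_def omega_minus_def chiE_pF etaF_pF emb_one chiE_1 etaF_1)

lemma chiE_local_ex:
  assumes "x \<noteq> 0" shows "\<exists>n. \<forall>y. y - x \<in> fideal vE n \<longrightarrow> y \<noteq> 0 \<and> vE y = vE x \<and> chiE y = chiE x"
proof -
  obtain n where "n \<ge> 1" "\<And>x y. x \<noteq> 0 \<Longrightarrow> y - x \<in> fideal vE (vE x + n) \<Longrightarrow> y \<noteq> 0 \<and> vE y = vE x \<and> chiE y = chiE x"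
    using chiE_local by blast
  then show ?thesis using assms by blast
qed

lemma omega_plus_locally_constant:
  obtains n where "n \<ge> 1" "\<And>a b. a \<noteq> 0 \<Longrightarrow> b - a \<in> fideal vF (vF a + n) \<Longrightarrow> b \<noteq> 0 \<and> vF b = vF a
    \<and> omega_plus b = omega_plus a \<and> omega_minus b = omega_minus a \<and> chiE (\<iota> b) = chiE (\<iota> a)"
proof -
  obtain n1 where n1: "n1 \<ge> 1" "\<And>x y. x \<noteq> 0 \<Longrightarrow> y - x \<in> fideal vE (vE x + n1) \<Longrightarrow> y \<noteq> 0 \<and> vE y = vE x \<and> chiE y = chiE x"
    using chiE_local by blast
  obtain n2 where n2: "n2 \<ge> 1" "\<And>x y. x \<noteq> 0 \<Longrightarrow> y - x \<in> fideal vF (vF x + n2) \<Longrightarrow> y \<noteq> 0 \<and> vF y = vF x \<and> etaF y = etaF x"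
    using etaF_local by blast
  show ?thesis
  proof (rule that[of "max n1 n2"])
    fix a b assume a: "a \<noteq> 0" and ba: "b - a \<in> fideal vF (vF a + max n1 n2)"
    have 2: "b \<noteq> 0 \<and> vF b = vF a \<and> etaF b = etaF a"
      by (rule n2(2)[OF a]) (use F.fideal_monoD[OF ba] in auto)
    have "\<iota> b - \<iota> a \<in> fideal vE (ram * (vF a + max n1 n2))"
      using ba by (simp add: iota_diff[symmetric] iota_fideal)
    moreover have "vE (\<iota> a) + n1 \<le> ram * (vF a + max n1 n2)"
    proof -
      have "n1 \<le> max n1 n2" "0 \<le> max n1 n2" using n1 by auto
      then have "1 * n1 \<le> ram * max n1 n2" using ram_pos n1 by (intro mult_mono) auto
      then show ?thesis using a by (simp add: val_iota algebra_simps)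
    qed
    ultimately have "chiE (\<iota> b) = chiE (\<iota> a)" using n1(2)[of "\<iota> a" "\<iota> b"] a E.fideal_monoD by simp
    with 2 show "b \<noteq> 0 \<and> vF b = vF a \<and> omega_plus b = omega_plus a \<and> omega_minus b = omega_minus a \<and> chiE (\<iota> b) = chiE (\<iota> a)"
      by (simp add: omega_plus_def omega_minus_def)
  qed (use n1 in simp)
qed

definition lnq :: real where "lnq = ln qF"

lemma lnq_pos: "lnq > 0"
  using F.q_gt_1 by (simp add: lnq_def)

lemma qF_powi_powr: "complex_of_real (qF powi k) powr z = exp (of_real lnq * (of_int k * z))"
proof -
  have "ln (qF powi k) = of_int k * lnq"
    using F.q_gt_0 by (metis ln_powr lnq_def powr_real_of_int' less_eq_real_def neq_iff)
  moreover have "qF powi k > 0" using F.q_gt_0 by (rule zero_less_power_int)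
  moreover have "of_real r powr z = exp (z * of_real (ln r))" if "r > 0" for r
    using that by (simp add: powr_def Ln_of_real)
  ultimately have "complex_of_real (qF powi k) powr z = exp (z * of_real (of_int k * lnq))" by metis
  then show ?thesis by (simp only: of_real_mult of_real_of_int_eq ac_simps)
qed

definition Kz :: "complex \<times> complex \<Rightarrow> 'e \<Rightarrow> complex" where
  "Kz z = sb_kernel_fun vF vE pF pE \<iota> \<alpha> d chi eta (fst z) (snd z)"

definition kappa :: "'e \<Rightarrow> complex" where "kappa x = chiE (x\<^sup>2) * omega_plus (c2 x / nrm x)"

text \<open>The absolute value part of the kernel: |x2| to the power 2s + t - 1/2 times |N x| to the
  power - t - 1/2, for valuations \<open>n\<close> of the second coordinate and \<open>m\<close> of
  the norm. The unitary part \<open>kappa\<close> does not depend on the parameters.\<close>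

definition wt :: "complex \<times> complex \<Rightarrow> int \<Rightarrow> int \<Rightarrow> complex" where
  "wt z n m = exp (- of_real lnq * (of_int n * (2 * fst z + snd z - 1/2) - of_int m * (snd z + 1/2)))"

lemma Kz_base: "c2 x = 0 \<Longrightarrow> Kz z x = 0"
  by (simp add: Kz_def sb_kernel_fun_def c2_eq_0)

lemma Kz_eq: "c2 x \<noteq> 0 \<Longrightarrow> Kz z x = kappa x * wt z (vF (c2 x)) (vF (nrm x))"
proof -
  assume x: "c2 x \<noteq> 0"
  then have x0: "x \<noteq> 0" "nrm x \<noteq> 0" using c_0 by auto
  define y where "y = c2 x / nrm x"
  have y: "y \<noteq> 0" "vF y = vF (c2 x) - vF (nrm x)" using x x0 by (simp_all add: y_def F.val_divide)
  have m1: "mod_abs vE (x\<^sup>2) = qF powi (- 2 * vF (nrm x))"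
    using x0 by (simp add: mod_abs_E power2_eq_square nrm_mult F.val_mult)
  have m2: "mod_abs vE (\<iota> y) = qF powi (- 2 * vF y)"
    using y by (simp add: mod_abs_E nrm_iota F.val_power)
  have m3: "mod_abs vF y = qF powi (- vF y)" using y by (simp add: mod_abs_def)
  \<comment> \<open>The absolute value of \<open>\<iota> y\<close> is the square of that of
    \<open>y\<close>, so the powers of the norm with exponent involving \<open>s\<close> coming from
    x^2 and from \<open>y\<close> cancel.\<close>
  have "Kz z x = char_ext vE pE chi (fst z - 1/2) (x\<^sup>2) *
      (char_ext vE pE chi (fst z - 1/2) (\<iota> y) * char_ext vF pF eta (snd z + 1/2) y)"
    using x by (simp add: Kz_def sb_kernel_fun_def c2_eq_0[symmetric] coords_c y_def nrm_def Let_def)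
  also have "\<dots> = kappa x * (exp (of_real lnq * (of_int (- 2 * vF (nrm x)) * (fst z - 1/2))) *
      exp (of_real lnq * (of_int (- 2 * vF y) * (fst z - 1/2))) *
      exp (of_real lnq * (of_int (- vF y) * (snd z + 1/2))))"
    unfolding char_ext_ang_char m1 m2 m3 qF_powi_powr
    by (simp add: kappa_def omega_plus_def chiE_def etaF_def y_def)
  also have "\<dots> = kappa x * wt z (vF (c2 x)) (vF (nrm x))"
    unfolding wt_def exp_add[symmetric] y(2) by (simp add: algebra_simps)
  finally show ?thesis .
qed

text \<open>The square contributes chi of \<open>a\<close> twice while \<open>c2 x / nrm x\<close>
  is divided by \<open>a\<close>; what remains is chi over eta.\<close>

lemma kappa_scale: "a \<noteq> 0 \<Longrightarrow> c2 x \<noteq> 0 \<Longrightarrow> kappa (\<iota> a * x) = omega_minus a * kappa x"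
proof -
  assume a: "a \<noteq> 0" and x: "c2 x \<noteq> 0"
  then have x0: "x \<noteq> 0" "nrm x \<noteq> 0" using c_0 by auto
  have "a * c2 x / (a\<^sup>2 * nrm x) = (c2 x / nrm x) / a" using a by (simp add: power2_eq_square)
  then have eq: "omega_plus (a * c2 x / (a\<^sup>2 * nrm x)) = omega_plus (c2 x / nrm x) / omega_plus a"
    using a x x0 omega_plus_divide[of "c2 x / nrm x" a] by simp
  moreover have "a * c2 x / (a\<^sup>2 * nrm x) = c2 x / (a * nrm x)" using a by (simp add: power2_eq_square)
  ultimately have eq: "omega_plus (c2 x / (a * nrm x)) = omega_plus (c2 x / nrm x) / omega_plus a" by simp
  have "kappa (\<iota> a * x) = chiE (\<iota> a) * chiE (\<iota> a) / omega_plus a * kappa x"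
    using a x0 by (simp add: kappa_def c_scale nrm_mult nrm_iota eq power_mult_distrib chiE_mult power2_eq_square)
  also have "chiE (\<iota> a) * chiE (\<iota> a) / omega_plus a = omega_minus a"
    using chiE_nonzero[of "\<iota> a"] a by (simp add: omega_plus_def omega_minus_def)
  finally show ?thesis .
qed

lemma Kz_scale:
  assumes a: "a \<noteq> 0"
  shows "Kz z (\<iota> a * x) = omega_minus a * exp (- of_real lnq * (of_int (vF a) * (2 * fst z - snd z - 3/2))) * Kz z x"
proof (cases "c2 x = 0")
  case False
  then have x0: "nrm x \<noteq> 0" using c_0 by auto
  have "wt z (vF (a * c2 x)) (vF (a\<^sup>2 * nrm x)) =
      exp (- of_real lnq * (of_int (vF a) * (2 * fst z - snd z - 3/2))) * wt z (vF (c2 x)) (vF (nrm x))"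
    unfolding wt_def exp_add[symmetric] using a x0 False
    by (simp add: F.val_mult F.val_power algebra_simps)
  then show ?thesis
    using False a by (simp add: Kz_eq c_scale nrm_mult nrm_iota kappa_scale)
qed (simp add: Kz_base c_scale)

text \<open>Splits the kernel into \<open>Gz\<close>, locally constant at every nonzero point, and
  \<open>Hz\<close>, a character of the second coordinate; near nonzero points of the ground field
  only \<open>Hz\<close> is singular.\<close>

definition Gz :: "complex \<times> complex \<Rightarrow> 'e \<Rightarrow> complex" where
  "Gz z x = chiE (x\<^sup>2) / omega_plus (nrm x) * exp (of_real lnq * (of_int (vF (nrm x)) * (snd z + 1/2)))"
definition Hz :: "complex \<times> complex \<Rightarrow> 'f \<Rightarrow> complex" where
  "Hz z a = omega_plus a * exp (- of_real lnq * (of_int (vF a) * (2 * fst z + snd z - 1/2)))"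

lemma Kz_factor: "c2 x \<noteq> 0 \<Longrightarrow> Kz z x = Gz z x * Hz z (c2 x)"
proof -
  assume x: "c2 x \<noteq> 0"
  then have x0: "nrm x \<noteq> 0" using c_0 by auto
  show ?thesis
  proof -
    have "wt z (vF (c2 x)) (vF (nrm x)) = exp (of_real lnq * (of_int (vF (nrm x)) * (snd z + 1/2))) *
        exp (- of_real lnq * (of_int (vF (c2 x)) * (2 * fst z + snd z - 1/2)))"
      unfolding wt_def exp_add[symmetric] by (simp add: algebra_simps)
    then show ?thesis
      unfolding Kz_eq[OF x] kappa_def Gz_def Hz_def omega_plus_divide[OF x x0] by simp
  qed
qed

lemma Hz_mult: "a \<noteq> 0 \<Longrightarrow> b \<noteq> 0 \<Longrightarrow> Hz z (a * b) = Hz z a * Hz z b"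
  by (simp add: Hz_def omega_plus_mult F.val_mult algebra_simps exp_add exp_diff)

lemma nrm_near_1:
  obtains k where "\<And>h. h \<in> fideal vE k \<Longrightarrow> nrm (1 + h) - 1 \<in> fideal vF n"
proof -
  define N where "N = max n 0 + \<bar>vF d\<bar>"
  obtain k where k: "fideal vE k \<subseteq> Box N N" using Box_nbhd by blast
  have "nrm (1 + h) - 1 \<in> fideal vF n" if "h \<in> fideal vE k" for h
  proof -
    have h: "c1 h \<in> fideal vF N" "c2 h \<in> fideal vF N" using that k by (auto simp: Box_def)
    have e: "nrm (1 + h) - 1 = (c1 h + c1 h) + (c1 h * c1 h - d * (c2 h * c2 h))"
      by (simp add: nrm_def c_add power2_eq_square algebra_simps)
    have "c1 h * c1 h \<in> fideal vF (N + N)" "c2 h * c2 h \<in> fideal vF (N + N)"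
      using F.fideal_mult[OF h(1) h(1)] F.fideal_mult[OF h(2) h(2)] by simp_all
    moreover then have "d * (c2 h * c2 h) \<in> fideal vF (vF d + (N + N))"
      using F.fideal_mult[of d "vF d" "c2 h * c2 h" "N + N"] by (simp add: fideal_def[of vF "vF d"])
    ultimately have "c1 h * c1 h \<in> fideal vF n" "d * (c2 h * c2 h) \<in> fideal vF n" "c1 h \<in> fideal vF n"
      using h(1) by (auto elim!: F.fideal_monoD simp: N_def)
    then show ?thesis unfolding e by (intro F.fideal_add F.fideal_diff)
  qed
  then show ?thesis using that by blast
qed

text \<open>For \<open>y = x * (1 + h)\<close> with small \<open>h\<close> the norm of
  \<open>1 + h\<close> is close to 1. One radius works for all parameters \<open>z\<close>, so
  integrals over small boxes stay explicit functions of \<open>z\<close>.\<close>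

lemma Gz_locally_constant:
  assumes x: "x \<noteq> 0"
  shows "\<exists>n. \<forall>y. y - x \<in> fideal vE n \<longrightarrow> y \<noteq> 0 \<and> chiE y = chiE x \<and> vF (nrm y) = vF (nrm x) \<and>
    omega_plus (nrm y) = omega_plus (nrm x) \<and> (\<forall>z. Gz z y = Gz z x)"
proof -
  obtain m where m: "m \<ge> 1" "\<And>a b. a \<noteq> 0 \<Longrightarrow> b - a \<in> fideal vF (vF a + m) \<Longrightarrow> b \<noteq> 0 \<and> vF b = vF a
    \<and> omega_plus b = omega_plus a \<and> omega_minus b = omega_minus a \<and> chiE (\<iota> b) = chiE (\<iota> a)"
    using omega_plus_locally_constant by blast
  obtain k where k: "\<And>h. h \<in> fideal vE k \<Longrightarrow> nrm (1 + h) - 1 \<in> fideal vF m" using nrm_near_1 by blast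
  obtain n where n: "\<And>y. y - x \<in> fideal vE n \<Longrightarrow> y \<noteq> 0 \<and> vE y = vE x \<and> chiE y = chiE x"
    using chiE_local_ex[OF x] by blast
  have "y \<noteq> 0 \<and> chiE y = chiE x \<and> vF (nrm y) = vF (nrm x) \<and>
    omega_plus (nrm y) = omega_plus (nrm x) \<and> (\<forall>z. Gz z y = Gz z x)" if y: "y - x \<in> fideal vE (max n (k + vE x))" for y
  proof -
    have 1: "y \<noteq> 0" "chiE y = chiE x" using n[of y] E.fideal_monoD[OF y, of n] by auto
    define h where "h = (y - x) / x"
    have "x * h = y - x" using x by (simp add: h_def)
    then have "h \<in> fideal vE k"
      using E.fideal_scale[OF x, of h "k + vE x"] E.fideal_monoD[OF y, of "k + vE x"] by simp
    have yx: "y = x * (1 + h)" using x by (simp add: h_def field_simps)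
    have "nrm (1 + h) - 1 \<in> fideal vF (vF 1 + m)" using k[OF \<open>h \<in> fideal vE k\<close>] by simp
    then have "nrm (1 + h) \<noteq> 0 \<and> vF (nrm (1 + h)) = vF 1 \<and> omega_plus (nrm (1 + h)) = omega_plus 1"
      using m(2)[of 1 "nrm (1 + h)"] by auto
    then have "vF (nrm y) = vF (nrm x)" "omega_plus (nrm y) = omega_plus (nrm x)"
      using x by (auto simp: yx nrm_mult F.val_mult omega_plus_mult omega_plus_1)
    with 1 x show ?thesis by (simp add: Gz_def chiE_mult power2_eq_square)
  qed
  then show ?thesis by blast
qed

lemma c2_locally_constant:
  assumes x: "c2 x \<noteq> 0"
  shows "\<exists>n. \<forall>y. y - x \<in> fideal vE n \<longrightarrow> c2 y \<noteq> 0 \<and> vF (c2 y) = vF (c2 x) \<and> omega_plus (c2 y) = omega_plus (c2 x)"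
proof -
  obtain m where m: "m \<ge> 1" "\<And>a b. a \<noteq> 0 \<Longrightarrow> b - a \<in> fideal vF (vF a + m) \<Longrightarrow> b \<noteq> 0 \<and> vF b = vF a
    \<and> omega_plus b = omega_plus a \<and> omega_minus b = omega_minus a \<and> chiE (\<iota> b) = chiE (\<iota> a)"
    using omega_plus_locally_constant by blast
  obtain n where n: "fideal vE n \<subseteq> Box (vF (c2 x) + m) (vF (c2 x) + m)" using Box_nbhd by blast
  have "c2 y \<noteq> 0 \<and> vF (c2 y) = vF (c2 x) \<and> omega_plus (c2 y) = omega_plus (c2 x)" if "y - x \<in> fideal vE n" for y
    using m(2)[OF x, of "c2 y"] n that by (auto simp: Box_def c_diff)
  then show ?thesis by blast
qed

lemma Kz_locally_constant:
  assumes x: "c2 x \<noteq> 0"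
  shows "\<exists>n. \<forall>y. y - x \<in> fideal vE n \<longrightarrow> (\<forall>z. Kz z y = Kz z x)"
proof -
  have x0: "x \<noteq> 0" using x c_0 by auto
  obtain n where n: "\<And>y. y - x \<in> fideal vE n \<Longrightarrow> y \<noteq> 0 \<and> chiE y = chiE x \<and> vF (nrm y) = vF (nrm x) \<and>
    omega_plus (nrm y) = omega_plus (nrm x) \<and> (\<forall>z. Gz z y = Gz z x)"
    using Gz_locally_constant[OF x0] by blast
  obtain k where k: "\<And>y. y - x \<in> fideal vE k \<Longrightarrow> c2 y \<noteq> 0 \<and> vF (c2 y) = vF (c2 x) \<and> omega_plus (c2 y) = omega_plus (c2 x)"
    using c2_locally_constant[OF x] by blast
  have "Kz z y = Kz z x" if "y - x \<in> fideal vE (max n k)" for y z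
  proof -
    have "y - x \<in> fideal vE n" "y - x \<in> fideal vE k" using E.fideal_monoD[OF that] by auto
    then have g: "Gz z y = Gz z x" and c: "c2 y \<noteq> 0" "vF (c2 y) = vF (c2 x)" "omega_plus (c2 y) = omega_plus (c2 x)"
      using n k by blast+
    have "Hz z (c2 y) = Hz z (c2 x)" by (simp only: Hz_def c)
    with g c show ?thesis using x by (simp add: Kz_factor)
  qed
  then show ?thesis by blast
qed

lemma Kz_measurable: "Kz z \<in> borel_measurable borel"
proof (rule E.measurable_off_closed[of "range \<iota>"])
  show "closed (range \<iota>)" by (rule range_iota_closed)
  show "Kz z x = 0" if "x \<in> range \<iota>" for x using that c2_eq_0 Kz_base by blast
  fix x S assume x: "x \<notin> range \<iota>" and S: "Kz z x \<in> S"
  obtain n where "\<And>y. y - x \<in> fideal vE n \<Longrightarrow> Kz z y = Kz z x"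
    using Kz_locally_constant[of x] x c2_eq_0 by blast
  then have "\<And>y. y - x \<in> fideal vE n \<Longrightarrow> Kz z y \<in> S" using S by metis
  then show "\<exists>n. \<forall>y. y - x \<in> fideal vE n \<longrightarrow> Kz z y \<in> S" by blast
qed

lemma Kz_stretch:
  assumes "a \<noteq> 0" "Gz z (stretch a x) = Gz z x"
  shows "Kz z (stretch a x) = Hz z a * Kz z x"
  using assms by (cases "c2 x = 0") (simp_all add: Kz_base Kz_factor Hz_mult)

end

section \<open>Meromorphic continuation\<close>

definition entire2 :: "(complex \<times> complex \<Rightarrow> complex) \<Rightarrow> bool" where
  "entire2 h \<longleftrightarrow> holomorphic2_on h UNIV"

lemma holomorphic2_on_iff:
  "holomorphic2_on f U \<longleftrightarrow> (\<forall>z\<in>U. \<exists>A B. (f has_derivative (\<lambda>h. A * fst h + B * snd h)) (at z))"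
  by (simp add: holomorphic2_on_def case_prod_beta')

lemma holomorphic2_onI:
  assumes "\<And>z. z \<in> U \<Longrightarrow> (f has_derivative (\<lambda>h. A z * fst h + B z * snd h)) (at z)"
  shows "holomorphic2_on f U"
  unfolding holomorphic2_on_iff using assms by blast

lemma holomorphic2_on_subset: "holomorphic2_on f U \<Longrightarrow> V \<subseteq> U \<Longrightarrow> holomorphic2_on f V"
  unfolding holomorphic2_on_def by blast

lemma holomorphic2_const [simp]: "holomorphic2_on (\<lambda>_. c) U"
  by (rule holomorphic2_onI[of _ _ "\<lambda>_. 0" "\<lambda>_. 0"]) (auto intro!: derivative_eq_intros)

lemma holomorphic2_linear: "holomorphic2_on (\<lambda>z. a * fst z + b * snd z + c) U"
  by (rule holomorphic2_onI[of _ _ "\<lambda>_. a" "\<lambda>_. b"]) (auto intro!: derivative_eq_intros)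

lemma holomorphic2_add: "holomorphic2_on f U \<Longrightarrow> holomorphic2_on g U \<Longrightarrow> holomorphic2_on (\<lambda>z. f z + g z) U"
proof -
  assume f: "holomorphic2_on f U" and g: "holomorphic2_on g U"
  show ?thesis unfolding holomorphic2_on_iff
  proof
    fix z assume "z \<in> U"
    then obtain A B where f': "(f has_derivative (\<lambda>h. A * fst h + B * snd h)) (at z)"
      using f unfolding holomorphic2_on_iff by blast
    obtain A' B' where g': "(g has_derivative (\<lambda>h. A' * fst h + B' * snd h)) (at z)"
      using g \<open>z \<in> U\<close> unfolding holomorphic2_on_iff by blast
    from f' g' have "((\<lambda>z. f z + g z) has_derivative (\<lambda>h. (A + A') * fst h + (B + B') * snd h)) (at z)"
      by (auto intro!: derivative_eq_intros simp: algebra_simps)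
    then show "\<exists>A B. ((\<lambda>z. f z + g z) has_derivative (\<lambda>h. A * fst h + B * snd h)) (at z)" by blast
  qed
qed

lemma holomorphic2_mult: "holomorphic2_on f U \<Longrightarrow> holomorphic2_on g U \<Longrightarrow> holomorphic2_on (\<lambda>z. f z * g z) U"
proof -
  assume f: "holomorphic2_on f U" and g: "holomorphic2_on g U"
  show ?thesis unfolding holomorphic2_on_iff
  proof
    fix z assume "z \<in> U"
    then obtain A B where f': "(f has_derivative (\<lambda>h. A * fst h + B * snd h)) (at z)"
      using f unfolding holomorphic2_on_iff by blast
    obtain A' B' where g': "(g has_derivative (\<lambda>h. A' * fst h + B' * snd h)) (at z)"
      using g \<open>z \<in> U\<close> unfolding holomorphic2_on_iff by blast
    from f' g' have "((\<lambda>z. f z * g z) has_derivative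
        (\<lambda>h. (A * g z + f z * A') * fst h + (B * g z + f z * B') * snd h)) (at z)"
      by (auto intro!: derivative_eq_intros simp: algebra_simps)
    then show "\<exists>A B. ((\<lambda>z. f z * g z) has_derivative (\<lambda>h. A * fst h + B * snd h)) (at z)" by blast
  qed
qed

lemma holomorphic2_compose:
  assumes f: "holomorphic2_on f U" and g: "\<And>w. w \<in> f ` U \<Longrightarrow> g field_differentiable (at w)"
  shows "holomorphic2_on (\<lambda>z. g (f z)) U"
  unfolding holomorphic2_on_iff
proof
  fix z assume z: "z \<in> U"
  then obtain A B where f': "(f has_derivative (\<lambda>h. A * fst h + B * snd h)) (at z)"
    using f unfolding holomorphic2_on_iff by blast
  obtain D where "(g has_field_derivative D) (at (f z))" using g z by (auto simp: field_differentiable_def)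
  then have "(g has_derivative (*) D) (at (f z))" by (simp add: has_field_derivative_def)
  from has_derivative_compose[OF f' this]
  have "((\<lambda>z. g (f z)) has_derivative (\<lambda>h. D * A * fst h + D * B * snd h)) (at z)"
    by (simp add: algebra_simps)
  then show "\<exists>A B. ((\<lambda>z. g (f z)) has_derivative (\<lambda>h. A * fst h + B * snd h)) (at z)" by blast
qed

lemma holomorphic2_exp: "holomorphic2_on f U \<Longrightarrow> holomorphic2_on (\<lambda>z. exp (f z)) U"
  by (rule holomorphic2_compose[of f U exp]) (auto simp: field_differentiable_within_exp)

lemma holomorphic2_divide:
  assumes "holomorphic2_on f U" "holomorphic2_on g U" "\<And>z. z \<in> U \<Longrightarrow> g z \<noteq> 0"
  shows "holomorphic2_on (\<lambda>z. f z / g z) U"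
proof -
  have "holomorphic2_on (\<lambda>z. inverse (g z)) U"
    by (rule holomorphic2_compose[OF assms(2)])
      (use assms(3) in \<open>auto simp: field_differentiable_def intro!: exI DERIV_inverse\<close>)
  from holomorphic2_mult[OF assms(1) this] show ?thesis by (simp add: divide_inverse)
qed

lemma holomorphic2_exp_linear: "holomorphic2_on (\<lambda>z. exp (a * fst z + b * snd z + c)) U"
  by (intro holomorphic2_exp holomorphic2_linear)

lemma holomorphic2_line:
  assumes "holomorphic2_on f UNIV" shows "(\<lambda>s. f (s, a * s + b)) holomorphic_on U"
  unfolding holomorphic_on_def
proof
  fix s
  obtain A B where f: "(f has_derivative (\<lambda>h. A * fst h + B * snd h)) (at (s, a * s + b))"
    using assms unfolding holomorphic2_on_iff by (meson UNIV_I)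
  have g: "((\<lambda>s. (s, a * s + b)) has_derivative (\<lambda>h. (h, a * h))) (at s)"
    by (auto intro!: derivative_eq_intros)
  have "((\<lambda>s. f (s, a * s + b)) has_derivative (\<lambda>h. (A + B * a) * h)) (at s)"
    using has_derivative_compose[OF g f] by (simp add: algebra_simps)
  then show "(\<lambda>s. f (s, a * s + b)) field_differentiable at s within U"
    unfolding field_differentiable_def has_field_derivative_def
    by (meson has_derivative_at_withinI)
qed

text \<open>The one-variable identity theorem on a complex line. Slope 0 serves for uniqueness of
  continuations, slope 2 for the second family of poles.\<close>

lemma entire2_eq_on_line:
  assumes f: "entire2 f" and g: "entire2 g" and S: "open S" "S \<noteq> {}"
    and eq: "\<And>s. s \<in> S \<Longrightarrow> f (s, a * s + b) = g (s, a * s + b)"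
  shows "f (s, a * s + b) = g (s, a * s + b)"
proof (rule analytic_continuation_open[of S UNIV "\<lambda>s. f (s, a * s + b)" "\<lambda>s. g (s, a * s + b)" s])
  show "(\<lambda>s. f (s, a * s + b)) holomorphic_on UNIV" "(\<lambda>s. g (s, a * s + b)) holomorphic_on UNIV"
    using f g holomorphic2_line by (auto simp: entire2_def)
qed (use S eq in auto)

section \<open>Decomposition of test functions into boxes\<close>

context quadratic_extension
begin

text \<open>Boxes rather than discs, because \<open>stretch\<close> acts on them
  coordinatewise.\<close>

definition boxat :: "'e \<Rightarrow> int \<Rightarrow> 'e set" where "boxat x n = {y. y - x \<in> Box n n}"

lemma boxat_borel [simp]: "boxat x n \<in> sets borel"
proof -
  have "boxat x n = (\<lambda>y. y - x) -` Box n n" by (auto simp: boxat_def)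
  then show ?thesis using open_Box by simp
qed

lemma boxat_open: "open (boxat x n)"
  using open_Box[of x n n] by (simp add: boxat_def vimage_def)

lemma center_in_boxat [simp]: "x \<in> boxat x n"
  by (simp add: boxat_def Box_def)

lemma boxat_eq: "y \<in> boxat x n \<Longrightarrow> boxat y n = boxat x n"
proof -
  assume y: "y \<in> boxat x n"
  have "z - y \<in> Box n n \<longleftrightarrow> z - x \<in> Box n n" for z
    using Box_add[of "z - y" n n "y - x"] Box_diff[of "z - x" n n "y - x"] y by (auto simp: boxat_def)
  then show ?thesis by (simp add: boxat_def)
qed

lemma boxat_mono: "y \<in> boxat x N \<Longrightarrow> N \<le> n \<Longrightarrow> boxat y n \<subseteq> boxat x N"
proof
  fix z assume "y \<in> boxat x N" "N \<le> n" "z \<in> boxat y n"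
  then show "z \<in> boxat x N"
    using Box_add[of "z - y" N N "y - x"] Box_mono[of "z - y" n n N N] by (auto simp: boxat_def)
qed

text \<open>An induction principle: a linear property of test functions can be checked on indicators
  of small boxes. The hypothesis speaks of all finer boxes near a point because the common level
  \<open>n\<close> is fixed only after a finite subcover; boxes of that level then partition the
  support.\<close>

lemma test_fun_decompose:
  assumes zero: "P (\<lambda>_. 0)" and add: "\<And>f g. P f \<Longrightarrow> P g \<Longrightarrow> P (\<lambda>x. f x + g x)"
    and scale: "\<And>c f. P f \<Longrightarrow> P (\<lambda>x. c * f x)"
    and \<phi>: "\<phi> \<in> test_fun UNIV"
    and loc: "\<And>x. \<phi> x \<noteq> 0 \<Longrightarrow> \<exists>N. \<forall>y\<in>boxat x N. \<forall>n\<ge>N. P (indicator (boxat y n) :: 'e \<Rightarrow> complex)"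
  shows "P \<phi>"
proof -
  define S where "S = {x. \<phi> x \<noteq> 0}"
  have cS: "compact S" unfolding S_def by (rule E.test_fun_compact_support[OF \<phi>])
  obtain k where k: "\<And>x y. y - x \<in> fideal vE (int k) \<Longrightarrow> \<phi> y = \<phi> x"
    using E.test_funE[OF \<phi>] by metis
  obtain k' where k': "Box k' k' \<subseteq> fideal vE (int k)" using Box_nbhd by blast
  obtain N where N: "\<And>x y n. x \<in> S \<Longrightarrow> y \<in> boxat x (N x) \<Longrightarrow> n \<ge> N x \<Longrightarrow> P (indicator (boxat y n) :: 'e \<Rightarrow> complex)"
    using loc unfolding S_def mem_Collect_eq by metis
  have "S \<subseteq> (\<Union>x\<in>S. boxat x (N x))" using center_in_boxat by blast
  then obtain X where X: "X \<subseteq> S" "finite X" "S \<subseteq> (\<Union>x\<in>X. boxat x (N x))"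
    using compactE_image[OF cS, of S "\<lambda>x. boxat x (N x)"] boxat_open by metis
  define n where "n = Max (insert k' (N ` X))"
  have n: "n \<ge> k'" "\<And>x. x \<in> X \<Longrightarrow> n \<ge> N x" unfolding n_def using X(2) by auto
  have Pn: "P (indicator (boxat y n) :: 'e \<Rightarrow> complex)" if "y \<in> S" for y
  proof -
    obtain x where "x \<in> X" "y \<in> boxat x (N x)" using X(3) \<open>y \<in> S\<close> by blast
    then show ?thesis using N n(2) X(1) by blast
  qed
  have const: "\<phi> y = \<phi> x" if "y \<in> boxat x n" for x y
  proof (rule k)
    have "y - x \<in> Box k' k'" using that Box_mono[of "y - x" n n k' k'] n(1) by (simp add: boxat_def)
    then show "y - x \<in> fideal vE (int k)" using k' by blast
  qed
  have "S \<subseteq> (\<Union>x\<in>S. boxat x n)" using center_in_boxat by blast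
  then obtain Y where Y: "Y \<subseteq> S" "finite Y" "S \<subseteq> (\<Union>x\<in>Y. boxat x n)"
    using compactE_image[OF cS, of S "\<lambda>x. boxat x n"] boxat_open by metis
  define BB where "BB = (\<lambda>y. boxat y n) ` Y"
  have fin: "finite BB" using Y(2) by (simp add: BB_def)
  \<comment> \<open>The sum is indexed by boxes, since different centres in \<open>Y\<close> may
    give the same box.\<close>
  define pick where "pick b = (SOME y. y \<in> Y \<and> b = boxat y n)" for b
  have pick: "pick b \<in> Y \<and> b = boxat (pick b) n" if "b \<in> BB" for b
    unfolding pick_def by (rule someI_ex) (use that in \<open>auto simp: BB_def\<close>)
  have sumP: "P (\<lambda>x. \<Sum>b\<in>B. \<phi> (pick b) * indicator b x)" if "finite B" "B \<subseteq> BB" for B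
    using that
  proof (induction B rule: finite_induct)
    case (insert b B)
    have "P (indicator b :: 'e \<Rightarrow> complex)" using Pn pick[of b] insert Y(1) by (metis insert_subset subsetD)
    then have "P (\<lambda>x. \<phi> (pick b) * indicator b x)" by (rule scale)
    then have "P (\<lambda>x. \<phi> (pick b) * indicator b x + (\<Sum>b\<in>B. \<phi> (pick b) * indicator b x))"
      using insert by (intro add) auto
    then show ?case by (simp only: sum.insert[OF insert(1,2)])
  qed (simp add: zero)
  have "\<phi> x = (\<Sum>b\<in>BB. \<phi> (pick b) * indicator b x)" for x
  proof (cases "x \<in> S")
    case True
    then obtain y where y: "y \<in> Y" "x \<in> boxat y n" using Y(3) by blast
    then have b: "boxat x n \<in> BB" using boxat_eq[OF y(2)] by (simp add: BB_def)
    have iff: "x \<in> b \<longleftrightarrow> b = boxat x n" if "b \<in> BB" for b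
      using pick[OF that] boxat_eq[of x "pick b" n] center_in_boxat by metis
    have "(\<Sum>b\<in>BB. \<phi> (pick b) * indicator b x) = (\<Sum>b\<in>BB. if b = boxat x n then \<phi> (pick b) else 0)"
      by (intro sum.cong refl) (simp add: indicator_def iff)
    also have "\<dots> = \<phi> (pick (boxat x n))" using fin b by simp
    also have "\<dots> = \<phi> x" using pick[OF b] const center_in_boxat by metis
    finally show ?thesis ..
  next
    case False
    have "x \<notin> b" if "b \<in> BB" for b
    proof
      assume "x \<in> b"
      then have "\<phi> x = \<phi> (pick b)" using pick[OF that] const by metis
      then show False using False pick[OF that] Y(1) by (auto simp: S_def)
    qed
    then have "(\<Sum>b\<in>BB. \<phi> (pick b) * indicator b x) = 0" by (intro sum.neutral) auto
    then show ?thesis using False by (simp add: S_def)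
  qed
  then have "\<phi> = (\<lambda>x. \<Sum>b\<in>BB. \<phi> (pick b) * indicator b x)" by (rule ext)
  then show ?thesis using sumP[OF fin order_refl] by metis
qed

lemma indicator_test_fun:
  assumes "\<And>x y. x \<in> S \<Longrightarrow> y - x \<in> Box k k \<Longrightarrow> y \<in> S" and "S \<subseteq> Box l l"
  shows "(indicator S :: 'e \<Rightarrow> complex) \<in> test_fun UNIV"
proof -
  obtain n where n: "fideal vE n \<subseteq> Box k k" using Box_nbhd by blast
  obtain m where m: "Box l l \<subseteq> fideal vE m" using Box_bounded by blast
  show ?thesis
  proof (rule E.test_funI[of n _ m])
    fix x y assume "y - x \<in> fideal vE n"
    then have "y - x \<in> Box k k" "x - y \<in> Box k k" using n E.fideal_diff_commute[of y x] by auto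
    then have "x \<in> S \<longleftrightarrow> y \<in> S" using assms(1) by blast
    then show "indicator S y = (indicator S x :: complex)" by (simp add: indicator_def)
  next
    fix x assume "indicator S x \<noteq> (0::complex)"
    then show "x \<in> fideal vE m" using assms(2) m by (auto simp: indicator_def split: if_splits)
  qed
qed

lemma boxat_test_fun: "(indicator (boxat x n) :: 'e \<Rightarrow> complex) \<in> test_fun UNIV"
proof -
  obtain k where k: "x \<in> fideal vE (- int k)" using E.bounded_ex by blast
  obtain l where l: "fideal vE (- int k) \<subseteq> Box l l" using Box_bounded by blast
  show ?thesis
  proof (rule indicator_test_fun[of _ n])
    show "boxat x n \<subseteq> Box (min l n) (min l n)"
    proof
      fix y assume "y \<in> boxat x n"
      then have "y - x \<in> Box (min l n) (min l n)" "x \<in> Box (min l n) (min l n)"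
        using Box_mono[of "y - x" n n] Box_mono[of x l l] k l by (auto simp: boxat_def)
      then show "y \<in> Box (min l n) (min l n)" using Box_add[of "y - x" _ _ x] by fastforce
    qed
    show "z \<in> boxat x n" if "y \<in> boxat x n" "z - y \<in> Box n n" for y z
      using that Box_add[of "z - y" n n "y - x"] by (simp add: boxat_def)
  qed
qed

lemma fideal_test_fun: "(indicator (fideal vE n) :: 'e \<Rightarrow> complex) \<in> test_fun UNIV"
proof -
  obtain k where k: "Box k k \<subseteq> fideal vE n" using Box_nbhd by blast
  obtain l where l: "fideal vE n \<subseteq> Box l l" using Box_bounded by blast
  show ?thesis
  proof (rule indicator_test_fun[OF _ l])
    fix x y assume "x \<in> fideal vE n" "y - x \<in> Box k k"
    then show "y \<in> fideal vE n" using E.fideal_add[of "y - x" n x] k by auto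
  qed
qed

end

section \<open>The two geometric series\<close>

context kernel_params
begin

lemma emeasure_boxat: "emeasure \<mu> (boxat x n) = ennreal (qF powi (- 2 * n) * box_vol)"
proof -
  have "boxat x n = (+) x ` Box n n" by (force simp: boxat_def intro!: image_eqI[of _ _ "_ - x"])
  moreover have "emeasure \<mu> ((+) x ` Box n n) = emeasure \<mu> (Box n n)"
    using H.transl_inv_haar by (simp add: transl_inv_def)
  ultimately show ?thesis by (simp add: emeasure_Box)
qed

lemma measure_boxat: "measure \<mu> (boxat x n) = qF powi (- 2 * n) * box_vol"
  using emeasure_boxat[of x n] box_vol_pos F.q_gt_0 by (simp add: measure_def)

lemma integrable_const_boxat:
  fixes f :: "'e \<Rightarrow> complex"
  assumes "\<And>y. y \<in> boxat x n \<Longrightarrow> f y = c"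
  shows "integrable \<mu> (\<lambda>y. f y * indicator (boxat x n) y)"
    "(\<integral>y. f y * indicator (boxat x n) y \<partial>\<mu>) = c * of_real (measure \<mu> (boxat x n))"
proof -
  have eq: "(\<lambda>y. f y * indicator (boxat x n) y) = (\<lambda>y. c * indicator (boxat x n) y)"
    using assms by (auto simp: indicator_def)
  have i: "integrable \<mu> (indicator (boxat x n) :: 'e \<Rightarrow> complex)"
  proof -
    have "integrable \<mu> (\<lambda>y. complex_of_real (indicator (boxat x n) y))"
      using emeasure_boxat[of x n] by (intro integrable_of_real integrable_real_indicator) auto
    then show ?thesis by (simp add: of_real_indicator)
  qed
  show "integrable \<mu> (\<lambda>y. f y * indicator (boxat x n) y)" unfolding eq using i by simp
  have "(\<integral>y. indicator (boxat x n) y \<partial>\<mu>) = complex_of_real (measure \<mu> (boxat x n))"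
  proof -
    have "(\<integral>y. complex_of_real (indicator (boxat x n) y) \<partial>\<mu>) = complex_of_real (measure \<mu> (boxat x n))"
      by (subst integral_complex_of_real) simp
    then show ?thesis by (simp add: of_real_indicator)
  qed
  then show "(\<integral>y. f y * indicator (boxat x n) y \<partial>\<mu>) = c * of_real (measure \<mu> (boxat x n))"
    unfolding eq by simp
qed

text \<open>The two families of poles are \<open>A_plus z = 1\<close> and \<open>A_minus z = 1\<close>; they are present only if the
  character \<open>\<chi>\<eta>\<close>, respectively \<open>\<chi>\<eta>\<^sup>-\<^sup>1\<close>, is trivial on the units of the ground field.\<close>

definition A_plus :: "complex \<times> complex \<Rightarrow> complex" where
  "A_plus z = exp (- of_real lnq * (2 * fst z + snd z + 1/2))"
definition A_minus :: "complex \<times> complex \<Rightarrow> complex" where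
  "A_minus z = exp (- of_real lnq * (2 * fst z - snd z + 1/2))"
definition Half_plus :: "(complex \<times> complex) set" where "Half_plus = {z. Re (2 * fst z + snd z + 1/2) > 0}"
definition Half_minus :: "(complex \<times> complex) set" where "Half_minus = {z. Re (2 * fst z - snd z + 1/2) > 0}"
definition triv_plus :: bool where "triv_plus \<longleftrightarrow> (\<forall>u\<in>int_units vF. omega_plus u = 1)"
definition triv_minus :: bool where "triv_minus \<longleftrightarrow> (\<forall>u\<in>int_units vF. omega_minus u = 1)"
definition factor_plus :: "complex \<times> complex \<Rightarrow> complex" where "factor_plus z = (if triv_plus then 1 - A_plus z else 1)"
definition factor_minus :: "complex \<times> complex \<Rightarrow> complex" where "factor_minus z = (if triv_minus then 1 - A_minus z else 1)"

lemma entire_A_plus: "entire2 A_plus" and entire_A_minus: "entire2 A_minus"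
proof -
  have 1: "A_plus = (\<lambda>z. exp ((- 2 * of_real lnq) * fst z + (- of_real lnq) * snd z + (- of_real lnq / 2)))"
    "A_minus = (\<lambda>z. exp ((- 2 * of_real lnq) * fst z + of_real lnq * snd z + (- of_real lnq / 2)))"
    by (auto simp: A_plus_def A_minus_def algebra_simps)
  show "entire2 A_plus" "entire2 A_minus" unfolding entire2_def 1 by (rule holomorphic2_exp_linear)+
qed

lemma entire_factor_plus: "entire2 factor_plus" and entire_factor_minus: "entire2 factor_minus"
proof -
  have "holomorphic2_on (\<lambda>z. 1 + (- 1) * A_plus z) UNIV" "holomorphic2_on (\<lambda>z. 1 + (- 1) * A_minus z) UNIV"
    using entire_A_plus entire_A_minus unfolding entire2_def by (intro holomorphic2_add holomorphic2_mult holomorphic2_const; simp)+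
  then show "entire2 factor_plus" "entire2 factor_minus"
    unfolding entire2_def factor_plus_def[abs_def] factor_minus_def[abs_def] by (cases triv_plus; cases triv_minus; simp)+
qed

lemma entire_wt: "entire2 (\<lambda>z. wt z n m)"
proof -
  have "(\<lambda>z. wt z n m) = (\<lambda>z. exp ((- 2 * of_real lnq * of_int n) * fst z +
      (- of_real lnq * of_int n + of_real lnq * of_int m) * snd z + (of_real lnq * (of_int n + of_int m) / 2)))"
    unfolding wt_def by (intro ext arg_cong[of _ _ exp]) (simp add: algebra_simps add_divide_distrib diff_divide_distrib)
  then show ?thesis unfolding entire2_def by (simp only: holomorphic2_exp_linear)
qed

lemma entire_Kz: "entire2 (\<lambda>z. Kz z x)"
proof (cases "c2 x = 0")
  case False
  have "holomorphic2_on (\<lambda>z. kappa x * wt z (vF (c2 x)) (vF (nrm x))) UNIV"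
    by (intro holomorphic2_mult) (use entire_wt in \<open>simp_all add: entire2_def\<close>)
  then show ?thesis by (simp add: entire2_def Kz_eq[OF False])
qed (simp add: Kz_base entire2_def)

lemma norm_A_plus: "z \<in> Half_plus \<Longrightarrow> norm (A_plus z) < 1" and norm_A_minus: "z \<in> Half_minus \<Longrightarrow> norm (A_minus z) < 1"
  using lnq_pos by (simp_all add: A_plus_def A_minus_def Half_plus_def Half_minus_def mult_pos_neg del: Re_divide_numeral)

text \<open>\<open>G\<close> clears the denominators. The property is linear in
  \<open>\<phi>\<close>, so that \<open>test_fun_decompose\<close> applies to it.\<close>

definition good :: "(complex \<times> complex) set \<Rightarrow> (complex \<times> complex \<Rightarrow> complex) \<Rightarrow> ('e \<Rightarrow> complex) \<Rightarrow> bool" where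
  "good \<Omega> G \<phi> \<longleftrightarrow> (\<forall>z\<in>\<Omega>. integrable \<mu> (\<lambda>x. Kz z x * \<phi> x)) \<and>
     (\<exists>h. entire2 h \<and> (\<forall>z\<in>\<Omega>. h z = G z * (\<integral>x. Kz z x * \<phi> x \<partial>\<mu>)))"

lemma good_zero: "good \<Omega> G (\<lambda>_. 0)"
  unfolding good_def by (auto intro!: exI[of _ "\<lambda>_. 0"] simp: entire2_def)

lemma good_add: "good \<Omega> G f \<Longrightarrow> good \<Omega> G g \<Longrightarrow> good \<Omega> G (\<lambda>x. f x + g x)"
proof -
  assume fg: "good \<Omega> G f" "good \<Omega> G g"
  then obtain h k where h: "entire2 h" "\<And>z. z \<in> \<Omega> \<Longrightarrow> h z = G z * (\<integral>x. Kz z x * f x \<partial>\<mu>)"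
    and k: "entire2 k" "\<And>z. z \<in> \<Omega> \<Longrightarrow> k z = G z * (\<integral>x. Kz z x * g x \<partial>\<mu>)"
    unfolding good_def by blast
  have "entire2 (\<lambda>z. h z + k z)" using h k holomorphic2_add by (simp add: entire2_def)
  then show ?thesis using fg h(2) k(2) unfolding good_def
    by (intro conjI exI[of _ "\<lambda>z. h z + k z"]) (auto simp: distrib_left)
qed

lemma good_scale: "good \<Omega> G f \<Longrightarrow> good \<Omega> G (\<lambda>x. c * f x)"
proof -
  assume f: "good \<Omega> G f"
  then obtain h where h: "entire2 h" "\<And>z. z \<in> \<Omega> \<Longrightarrow> h z = G z * (\<integral>x. Kz z x * f x \<partial>\<mu>)"
    unfolding good_def by blast
  have 1: "entire2 (\<lambda>z. c * h z)" using h holomorphic2_mult[of "\<lambda>_. c" UNIV h] by (simp add: entire2_def)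
  have "(\<lambda>x. Kz z x * (c * f x)) = (\<lambda>x. c * (Kz z x * f x))" for z by (auto simp: mult_ac)
  then show ?thesis using f h(2) 1 unfolding good_def
    by (intro conjI exI[of _ "\<lambda>z. c * h z"]) (auto simp: mult.left_commute)
qed

lemma good_mult_factor: "good \<Omega> G f \<Longrightarrow> entire2 G' \<Longrightarrow> \<Omega>' \<subseteq> \<Omega> \<Longrightarrow> good \<Omega>' (\<lambda>z. G' z * G z) f"
proof -
  assume f: "good \<Omega> G f" and G': "entire2 G'" and sub: "\<Omega>' \<subseteq> \<Omega>"
  then obtain h where h: "entire2 h" "\<And>z. z \<in> \<Omega> \<Longrightarrow> h z = G z * (\<integral>x. Kz z x * f x \<partial>\<mu>)"
    unfolding good_def by blast
  have "entire2 (\<lambda>z. G' z * h z)" using h G' holomorphic2_mult[of G' UNIV h] by (simp add: entire2_def)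
  then show ?thesis using f h(2) sub unfolding good_def
    by (intro conjI exI[of _ "\<lambda>z. G' z * h z"]) (auto simp: mult.assoc)
qed

text \<open>Away from the ground field the kernel is constant on boxes whose size does not depend on
  \<open>z\<close>, so the pairing is a finite sum of functions entire in \<open>z\<close>.\<close>

lemma good_off_base:
  assumes \<phi>: "\<phi> \<in> test_fun UNIV" and off: "\<And>x. \<phi> x \<noteq> 0 \<Longrightarrow> c2 x \<noteq> 0"
  shows "good UNIV (\<lambda>_. 1) \<phi>"
proof (rule test_fun_decompose[OF good_zero good_add good_scale \<phi>])
  fix x assume "\<phi> x \<noteq> 0"
  then have "c2 x \<noteq> 0" using off by blast
  then obtain n where n: "\<And>y z. y - x \<in> fideal vE n \<Longrightarrow> Kz z y = Kz z x" using Kz_locally_constant by blast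
  obtain N where N: "Box N N \<subseteq> fideal vE n" using Box_nbhd by blast
  have "good UNIV (\<lambda>_. 1) (indicator (boxat y k))" if y: "y \<in> boxat x N" "k \<ge> N" for y k
  proof -
    have c: "Kz z u = Kz z x" if "u \<in> boxat y k" for u z
    proof (rule n)
      have "u \<in> boxat x N" using boxat_mono[OF y] that by blast
      then show "u - x \<in> fideal vE n" using N unfolding boxat_def by blast
    qed
    have "entire2 (\<lambda>z. Kz z x * of_real (measure \<mu> (boxat y k)))"
      using entire_Kz[of x] holomorphic2_mult[of "\<lambda>z. Kz z x" UNIV "\<lambda>_. of_real (measure \<mu> (boxat y k))"]
      by (simp add: entire2_def)
    then show ?thesis
      unfolding good_def using integrable_const_boxat[of y k "Kz _", OF c] by (auto intro!: exI)
  qed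
  then show "\<exists>N. \<forall>y\<in>boxat x N. \<forall>n\<ge>N. good UNIV (\<lambda>_. 1) (indicator (boxat y n))" by blast
qed

text \<open>Contracting the second coordinate by \<open>pF\<close> reproduces the kernel on the box
  up to \<open>Hz z pF\<close>, and volumes contribute \<open>1 / qF\<close>; together this is the
  ratio \<open>A_plus z\<close>. The series starts from the outer layer \<open>b'\<close>, which
  stays off the ground field. If chi times eta is nontrivial on the units, stretching by a suitable
  unit shows that the integral vanishes.\<close>

lemma good_boxat_base:
  assumes inv: "\<And>u a z. u \<in> boxat (\<iota> x1) n \<Longrightarrow> a \<in> fideal vF 0 \<Longrightarrow> Gz z (stretch a u) = Gz z u"
  shows "good Half_plus factor_plus (indicator (boxat (\<iota> x1) n))"
    and "z \<in> Half_plus \<Longrightarrow> triv_plus \<Longrightarrow> (1 - A_plus z) * (\<integral>x. Kz z x * indicator (boxat (\<iota> x1) n) x \<partial>\<mu>) =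
      (\<integral>x. Kz z x * indicator (boxat (\<iota> x1) n - {x. c2 x \<in> fideal vF (n + 1)}) x \<partial>\<mu>)"
proof -
  let ?b = "boxat (\<iota> x1) n"
  define b' where "b' = ?b - {x. c2 x \<in> fideal vF (n + 1)}"
  have b: "u \<in> ?b \<longleftrightarrow> c1 u - x1 \<in> fideal vF n \<and> c2 u \<in> fideal vF n" for u
    by (simp add: boxat_def Box_def c_diff)
  have b'_test: "(indicator b' :: 'e \<Rightarrow> complex) \<in> test_fun UNIV"
  proof -
    have "indicator b' = (\<lambda>x. indicator ?b x + (- 1) * indicator (?b \<inter> {x. c2 x \<in> fideal vF (n + 1)}) x :: complex)"
      by (auto simp: b'_def indicator_def)
    moreover have "(indicator (?b \<inter> {x. c2 x \<in> fideal vF (n + 1)}) :: 'e \<Rightarrow> complex) \<in> test_fun UNIV"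
    proof -
      obtain k where k: "\<iota> x1 \<in> fideal vE (- int k)" using E.bounded_ex by blast
      obtain l where l: "fideal vE (- int k) \<subseteq> Box l l" using Box_bounded by blast
      have x1: "x1 \<in> fideal vF l" using k l by (auto simp: Box_def)
      show ?thesis
      proof (rule indicator_test_fun[of _ "n + 1"])
        show "?b \<inter> {x. c2 x \<in> fideal vF (n + 1)} \<subseteq> Box (min l n) (min l n)"
        proof
          fix x assume "x \<in> ?b \<inter> {x. c2 x \<in> fideal vF (n + 1)}"
          then have "c1 x - x1 \<in> fideal vF (min l n)" "c2 x \<in> fideal vF (min l n)" "x1 \<in> fideal vF (min l n)"
            using x1 by (auto simp: b elim!: F.fideal_monoD)
          then show "x \<in> Box (min l n) (min l n)" using F.fideal_add[of "c1 x - x1" _ x1] by (auto simp: Box_def)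
        qed
        fix x y assume "x \<in> ?b \<inter> {x. c2 x \<in> fideal vF (n + 1)}" "y - x \<in> Box (n + 1) (n + 1)"
        then have "c1 x - x1 \<in> fideal vF n" "c2 x \<in> fideal vF (n + 1)" "c1 y - c1 x \<in> fideal vF n" "c2 y - c2 x \<in> fideal vF (n + 1)"
          by (auto simp: b Box_def c_diff elim!: F.fideal_monoD)
        then have "c1 y - x1 \<in> fideal vF n" "c2 y \<in> fideal vF (n + 1)"
          using F.fideal_add[of "c1 y - c1 x" n "c1 x - x1"] F.fideal_add[of "c2 y - c2 x" "n + 1" "c2 x"] by auto
        then show "y \<in> ?b \<inter> {x. c2 x \<in> fideal vF (n + 1)}" using F.fideal_monoD[of "c2 y" "n + 1" n] by (simp add: b)
      qed
    qed
    ultimately show ?thesis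
      using E.test_fun_add[OF boxat_test_fun E.test_fun_scale[of _ "- 1"]] by simp
  qed
  have "good UNIV (\<lambda>_. 1) (indicator b')"
    by (rule good_off_base[OF b'_test]) (auto simp: b'_def indicator_def split: if_splits)
  then obtain h where h: "entire2 h" "\<And>z. h z = (\<integral>x. Kz z x * indicator b' x \<partial>\<mu>)"
    and f_int: "\<And>z. integrable \<mu> (\<lambda>x. Kz z x * indicator b' x)"
    unfolding good_def by auto
  have geo: "integrable \<mu> (\<lambda>x. Kz z x * indicator ?b x) \<and>
    (1 - A_plus z) * (\<integral>x. Kz z x * indicator ?b x \<partial>\<mu>) = (\<integral>x. Kz z x * indicator b' x \<partial>\<mu>)" if z: "z \<in> Half_plus" for z
  proof -
    let ?L = "stretch (inverse pF)"
    have sc: "H.scales ?L (qF powi (- 1))"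
      using scales_stretch[of "inverse pF"] pF by (simp add: F.val_inverse)
    have lc: "Hz z pF * of_real (qF powi (- 1)) = A_plus z"
    proof -
      have "complex_of_real (qF powi (- 1)) = exp (of_real (- lnq))"
        using F.q_gt_0 unfolding exp_of_real lnq_def by (simp add: exp_minus power_int_minus)
      then show ?thesis
      proof -
        have "- of_real lnq * (of_int 1 * (2 * fst z + snd z - 1/2)) + of_real (- lnq) =
            - of_real lnq * (2 * fst z + snd z + 1/2)"
          by (simp add: field_simps)
        then have "exp (- of_real lnq * (of_int 1 * (2 * fst z + snd z - 1/2))) * exp (of_real (- lnq)) = A_plus z"
          unfolding A_plus_def exp_add[symmetric] by simp
        then show ?thesis
          unfolding Hz_def omega_plus_pF pF(2) \<open>complex_of_real (qF powi (- 1)) = exp (of_real (- lnq))\<close> by simp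
      qed
    qed
    have F_eq: "Kz z x * indicator ?b x = Kz z x * indicator b' x + Hz z pF * (Kz z (?L x) * indicator ?b (?L x))" for x
    proof -
      \<comment> \<open>\<open>?L\<close> expands the second coordinate, so within the box the
        points whose image stays there are exactly those outside the layer
        \<open>b'\<close>.\<close>
      have L: "?L x \<in> ?b \<longleftrightarrow> x \<in> ?b \<and> c2 x \<in> fideal vF (n + 1)"
        using F.fideal_scale[of "inverse pF" "c2 x" n] pF F.fideal_monoD[of "c2 x" "n + 1" n] by (auto simp: b F.val_inverse)
      show ?thesis
      proof (cases "?L x \<in> ?b")
        case True
        have xe: "x = stretch pF (?L x)" by (rule c_eqI) (use pF in simp_all)
        have "Gz z (stretch pF (?L x)) = Gz z (?L x)"
          by (rule inv[OF True]) (use pF in \<open>simp add: fideal_def\<close>)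
        then have "Kz z x = Hz z pF * Kz z (?L x)" using Kz_stretch[of pF z "?L x"] pF xe by simp
        then show ?thesis using True L by (simp add: b'_def)
      next
        case False
        then have "x \<in> ?b \<longleftrightarrow> x \<in> b'" using L by (auto simp: b'_def)
        then show ?thesis using False by (simp add: indicator_def)
      qed
    qed
    have iter: "c2 ((?L ^^ i) x) = inverse pF ^ i * c2 x" for i x
      by (induction i) (simp_all add: mult.assoc)
    have ev: "\<exists>k. \<forall>i\<ge>k. Kz z ((?L ^^ i) x) * indicator ?b ((?L ^^ i) x) = 0" for x
    proof (cases "c2 x = 0")
      case True
      then show ?thesis using iter by (auto simp: Kz_base)
    next
      case False
      have "(?L ^^ i) x \<notin> ?b" if "i \<ge> nat (vF (c2 x) - n + 1)" for i
      proof -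
        have "vF (c2 x) - int i < n" using that by linarith
        then show ?thesis using False pF by (simp add: b iter fideal_def F.val_mult F.val_power F.val_inverse)
      qed
      then show ?thesis by (intro exI[of _ "nat (vF (c2 x) - n + 1)"]) auto
    qed
    show ?thesis
      using H.integrable_self_similar[OF sc f_int F_eq ev] norm_A_plus[OF z] unfolding lc by blast
  qed
  show "(1 - A_plus z) * (\<integral>x. Kz z x * indicator ?b x \<partial>\<mu>) =
      (\<integral>x. Kz z x * indicator (?b - {x. c2 x \<in> fideal vF (n + 1)}) x \<partial>\<mu>)" if "z \<in> Half_plus" "triv_plus"
    using geo[OF that(1)] by (simp add: b'_def)
  show "good Half_plus factor_plus (indicator ?b)"
  proof (cases triv_plus)
    case True
    then show ?thesis unfolding good_def using geo h by (auto simp: factor_plus_def intro!: exI[of _ h])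
  next
    case False
    then obtain u where u: "u \<in> int_units vF" "omega_plus u \<noteq> 1" by (auto simp: triv_plus_def)
    then have u': "u \<noteq> 0" "vF u = 0" by (auto simp: F.int_units_iff)
    have "(\<integral>x. Kz z x * indicator ?b x \<partial>\<mu>) = 0" if z: "z \<in> Half_plus" for z
    proof -
      let ?F = "\<lambda>x. Kz z x * indicator ?b x"
      have "?F (stretch u x) = omega_plus u * ?F x" for x
      proof -
        have "stretch u x \<in> ?b \<longleftrightarrow> x \<in> ?b" using u' F.fideal_scale[of u "c2 x" n] by (simp add: b)
        moreover have "Kz z (stretch u x) = omega_plus u * Kz z x" if "x \<in> ?b"
          using Kz_stretch[OF u'(1) inv[OF that, of u z]] u' by (simp add: fideal_def Hz_def)
        ultimately show ?thesis by (simp add: indicator_def)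
      qed
      then have "(\<integral>x. omega_plus u * ?F x \<partial>\<mu>) = (\<integral>x. ?F x \<partial>\<mu>)"
        using H.scales_integrable(2)[OF scales_stretch[OF u'(1)], of ?F] geo[OF z] u' by simp
      then have "omega_plus u * (\<integral>x. ?F x \<partial>\<mu>) = (\<integral>x. ?F x \<partial>\<mu>)"
        by (simp only: integral_mult_right_zero)
      then have "(omega_plus u - 1) * (\<integral>x. ?F x \<partial>\<mu>) = 0" by (simp add: left_diff_distrib)
      then show ?thesis using u(2) by simp
    qed
    then show ?thesis
      unfolding good_def using geo False by (auto simp: entire2_def intro!: exI[of _ "\<lambda>_. 0"])
  qed
qed

text \<open>Prepares \<open>good_boxat_base\<close>: a small box that meets the ground field can be
  recentred there, and \<open>Gz\<close> is constant on it, hence invariant under stretching by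
  integers.\<close>

lemma Gz_stretch_inv:
  assumes x: "x \<noteq> 0"
  shows "\<exists>N. \<forall>y\<in>boxat x N. \<forall>n\<ge>N. c2 y \<in> fideal vF n \<longrightarrow> boxat y n = boxat (\<iota> (c1 y)) n \<and>
    (\<forall>u\<in>boxat (\<iota> (c1 y)) n. \<forall>a\<in>fideal vF 0. \<forall>z. Gz z (stretch a u) = Gz z u \<and> Gz z u = Gz z x)"
proof -
  obtain k where k: "\<And>y z. y - x \<in> fideal vE k \<Longrightarrow> Gz z y = Gz z x" using Gz_locally_constant[OF x] by blast
  obtain N where N: "Box N N \<subseteq> fideal vE k" using Box_nbhd by blast
  have G: "Gz z u = Gz z x" if "u \<in> boxat x N" for u z
    by (rule k) (use that N in \<open>auto simp: boxat_def\<close>)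
  show ?thesis
  proof (intro exI[of _ N] ballI allI impI conjI)
    fix y n assume y: "y \<in> boxat x N" "N \<le> n" "c2 y \<in> fideal vF n"
    have "\<iota> (c1 y) \<in> boxat y n" using y(3) by (simp add: boxat_def Box_def c_diff F.fideal_uminus)
    then show e: "boxat y n = boxat (\<iota> (c1 y)) n" using boxat_eq by simp
    fix u a z assume u: "u \<in> boxat (\<iota> (c1 y)) n" and a: "a \<in> fideal vF 0"
    have "a * c2 u \<in> fideal vF n" using F.fideal_mult[OF a, of "c2 u" n] u by (simp add: boxat_def Box_def c_diff)
    then have "stretch a u \<in> boxat (\<iota> (c1 y)) n" using u by (simp add: boxat_def Box_def c_diff)
    then have su: "stretch a u \<in> boxat x N" "u \<in> boxat x N" using u e boxat_mono[OF y(1,2)] by auto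
    show "Gz z (stretch a u) = Gz z u" using G[OF su(1)] G[OF su(2)] by simp
    show "Gz z u = Gz z x" using G[OF su(2)] .
  qed
qed

text \<open>Small boxes away from 0 either meet the ground field, where the first series applies, or
  miss it; so the second factor does not occur before 0 enters the support.\<close>

lemma good_vanish_0:
  assumes \<phi>: "\<phi> \<in> test_fun UNIV" "\<phi> 0 = 0"
  shows "good Half_plus factor_plus \<phi>"
proof (rule test_fun_decompose[OF good_zero good_add good_scale \<phi>(1)])
  fix x assume "\<phi> x \<noteq> 0"
  then have x: "x \<noteq> 0" using \<phi>(2) by auto
  from Gz_stretch_inv[OF this] obtain N where N: "\<And>y n. y \<in> boxat x N \<Longrightarrow> n \<ge> N \<Longrightarrow> c2 y \<in> fideal vF n \<Longrightarrow>
     boxat y n = boxat (\<iota> (c1 y)) n \<and>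
    (\<forall>u\<in>boxat (\<iota> (c1 y)) n. \<forall>a\<in>fideal vF 0. \<forall>z. Gz z (stretch a u) = Gz z u \<and> Gz z u = Gz z x)" by blast
  have "good Half_plus factor_plus (indicator (boxat y n))" if y: "y \<in> boxat x N" "n \<ge> N" for y n
  proof (cases "c2 y \<in> fideal vF n")
    case True
    have e: "boxat y n = boxat (\<iota> (c1 y)) n"
      and g: "\<forall>u\<in>boxat (\<iota> (c1 y)) n. \<forall>a\<in>fideal vF 0. \<forall>z. Gz z (stretch a u) = Gz z u \<and> Gz z u = Gz z x"
      using N[OF y True] by blast+
    show ?thesis unfolding e by (rule good_boxat_base(1)) (use g in blast)
  next
    case False
    have "good UNIV (\<lambda>_. 1) (indicator (boxat y n))"
    proof (rule good_off_base[OF boxat_test_fun])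
      fix u assume "indicator (boxat y n) u \<noteq> (0::complex)"
      then have "c2 u - c2 y \<in> fideal vF n" by (auto simp: indicator_def boxat_def Box_def c_diff split: if_splits)
      then show "c2 u \<noteq> 0" using False F.fideal_uminus by auto
    qed
    from good_mult_factor[OF this entire_factor_plus, of Half_plus] show ?thesis by simp
  qed
  then show "\<exists>N. \<forall>y\<in>boxat x N. \<forall>n\<ge>N. good Half_plus factor_plus (indicator (boxat y n))" by blast
qed

text \<open>Indicator of a fundamental domain for dilation by \<open>pF\<close> on the nonzero
  elements.\<close>

definition shell0 :: "'e \<Rightarrow> complex" where
  "shell0 x = indicator (fideal vE 0) x - indicator (fideal vE ram) x"

lemma shell0_test: "shell0 \<in> test_fun UNIV" and shell0_0: "shell0 0 = 0"
  using E.test_fun_add[OF fideal_test_fun[of 0] E.test_fun_scale[OF fideal_test_fun[of ram], of "- 1"]]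
  by (simp_all add: shell0_def[abs_def])

text \<open>The second series: under dilation by \<open>pF\<close> the kernel contributes the
  exponent 2s - t - 3/2 and the volume adds 2, which gives \<open>A_minus z\<close>. The initial
  term lives on \<open>shell0\<close>, which vanishes at 0 and is thus already continued.\<close>

lemma fideal0_integral:
  assumes z: "z \<in> Half_plus \<inter> Half_minus"
  shows "integrable \<mu> (\<lambda>x. Kz z x * indicator (fideal vE 0) x)"
    and "(1 - A_minus z) * (\<integral>x. Kz z x * indicator (fideal vE 0) x \<partial>\<mu>) = (\<integral>x. Kz z x * shell0 x \<partial>\<mu>)"
    and "\<not> triv_minus \<Longrightarrow> (\<integral>x. Kz z x * indicator (fideal vE 0) x \<partial>\<mu>) = 0"
proof -
  let ?F = "\<lambda>x. Kz z x * indicator (fideal vE 0) x"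
  let ?p = "inverse (\<iota> pF)"
  let ?L = "\<lambda>x. ?p * x"
  have p: "?p \<noteq> 0" "vE ?p = - ram" using pF by (simp_all add: E.val_inverse val_iota)
  have sc: "H.scales ?L (real (residue_card vE) powi (- ram))" using H.scales_mult[OF p(1)] p(2) by simp
  have cc: "real (residue_card vE) powi (- ram) = exp (- (2 * lnq))"
    using residue_card_relation F.q_gt_0
    by (simp add: power_int_minus exp_minus lnq_def exp_double)
  let ?l = "exp (- of_real lnq * (2 * fst z - snd z - 3/2))"
  have lc: "?l * of_real (real (residue_card vE) powi (- ram)) = A_minus z"
    unfolding cc exp_of_real[symmetric] A_minus_def by (simp add: exp_add[symmetric] algebra_simps)
  have good0: "good Half_plus factor_plus shell0" by (rule good_vanish_0[OF shell0_test shell0_0])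
  then have f_int: "integrable \<mu> (\<lambda>x. Kz z x * shell0 x)" using z by (simp add: good_def)
  have mem: "?L x \<in> fideal vE 0 \<longleftrightarrow> x \<in> fideal vE ram" for x using E.fideal_scale[OF p(1), of x 0] p(2) by simp
  have F_eq: "?F x = Kz z x * shell0 x + ?l * ?F (?L x)" for x
  proof -
    have "\<iota> pF * ?L x = x" using pF by simp
    then have "Kz z x = ?l * Kz z (?L x)"
      using Kz_scale[OF pF(1), of z "?L x"] pF(2) by (simp only: omega_minus_pF) simp
    moreover have "fideal vE ram \<subseteq> fideal vE 0" using ram_pos by (intro E.fideal_mono) simp
    ultimately show ?thesis using mem[of x] by (auto simp: shell0_def indicator_def)
  qed
  have iter: "(?L ^^ i) x = ?p ^ i * x" for i x
    by (induction i) (simp_all add: mult.assoc)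
  have ev: "\<exists>k. \<forall>i\<ge>k. ?F ((?L ^^ i) x) = 0" for x
  proof (cases "x = 0")
    case True then show ?thesis by (simp add: iter Kz_base)
  next
    case False
    have "(?L ^^ i) x \<notin> fideal vE 0" if "i \<ge> nat (vE x + 1)" for i
    proof -
      have "int i * ram \<ge> int i * 1" using ram_pos by (intro mult_left_mono) auto
      then show ?thesis using that False p by (simp add: iter fideal_def E.val_mult E.val_power del: power_inverse)
    qed
    then show ?thesis by (intro exI[of _ "nat (vE x + 1)"]) auto
  qed
  have nA: "norm (?l * of_real (real (residue_card vE) powi (- ram))) < 1" using norm_A_minus z unfolding lc by simp
  show int: "integrable \<mu> ?F" by (rule H.integrable_self_similar(1)[OF sc f_int F_eq ev nA])
  show "(1 - A_minus z) * (\<integral>x. ?F x \<partial>\<mu>) = (\<integral>x. Kz z x * shell0 x \<partial>\<mu>)"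
    using H.integrable_self_similar(2)[OF sc f_int F_eq ev nA] unfolding lc .
  assume "\<not> triv_minus"
  then obtain u where u: "u \<in> int_units vF" "omega_minus u \<noteq> 1" by (auto simp: triv_minus_def)
  then have u': "u \<noteq> 0" "vF u = 0" by (auto simp: F.int_units_iff)
  have u'': "\<iota> u \<noteq> 0" "vE (\<iota> u) = 0" using u' by (simp_all add: val_iota)
  have "?F (\<iota> u * x) = omega_minus u * ?F x" for x
    using Kz_scale[OF u'(1), of z x] u' u'' E.fideal_scale[OF u''(1), of x 0] by (simp add: indicator_def)
  then have "(\<integral>x. omega_minus u * ?F x \<partial>\<mu>) = (\<integral>x. ?F x \<partial>\<mu>)"
    using H.scales_integrable(2)[OF H.scales_mult[OF u''(1)] int] u'' by simp
  then have "omega_minus u * (\<integral>x. ?F x \<partial>\<mu>) = (\<integral>x. ?F x \<partial>\<mu>)"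
    by (simp only: integral_mult_right_zero)
  then have "(omega_minus u - 1) * (\<integral>x. ?F x \<partial>\<mu>) = 0" by (simp add: left_diff_distrib)
  then show "(\<integral>x. ?F x \<partial>\<mu>) = 0" using u(2) by simp
qed

definition pole_factor :: "complex \<times> complex \<Rightarrow> complex" where "pole_factor z = factor_minus z * factor_plus z"

lemma entire_pole_factor: "entire2 pole_factor"
  using entire_factor_plus entire_factor_minus unfolding entire2_def pole_factor_def[abs_def] by (intro holomorphic2_mult)

lemma good_fideal0: "good (Half_plus \<inter> Half_minus) pole_factor (indicator (fideal vE 0))"
proof -
  have "good Half_plus factor_plus shell0" by (rule good_vanish_0[OF shell0_test shell0_0])
  then obtain h where h: "entire2 h" "\<And>z. z \<in> Half_plus \<Longrightarrow> h z = factor_plus z * (\<integral>x. Kz z x * shell0 x \<partial>\<mu>)"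
    unfolding good_def by blast
  show ?thesis
  proof (cases triv_minus)
    case True
    then show ?thesis unfolding good_def using fideal0_integral(1,2) h
      by (intro conjI exI[of _ h]) (auto simp: pole_factor_def factor_minus_def fideal0_integral(2)[symmetric])
  next
    case False
    then show ?thesis unfolding good_def using fideal0_integral(1,3)
      by (intro conjI exI[of _ "\<lambda>_. 0"]) (auto simp: entire2_def)
  qed
qed

text \<open>Subtracting \<open>\<phi> 0\<close> times the indicator of the integers leaves a test
  function vanishing at 0.\<close>

lemma good_all:
  assumes \<phi>: "\<phi> \<in> test_fun UNIV"
  shows "good (Half_plus \<inter> Half_minus) pole_factor \<phi>"
proof -
  define \<psi> where "\<psi> x = \<phi> x + (- \<phi> 0) * indicator (fideal vE 0) x" for x
  have "\<psi> \<in> test_fun UNIV" unfolding \<psi>_def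
    by (intro E.test_fun_add E.test_fun_scale fideal_test_fun \<phi>)
  then have "good Half_plus factor_plus \<psi>" by (rule good_vanish_0) (simp add: \<psi>_def)
  from good_mult_factor[OF this entire_factor_minus, of "Half_plus \<inter> Half_minus"]
  have "good (Half_plus \<inter> Half_minus) pole_factor \<psi>" by (simp add: pole_factor_def[abs_def])
  from good_add[OF this good_scale[OF good_fideal0, of "\<phi> 0"]]
  show ?thesis by (simp add: \<psi>_def)
qed

text \<open>The line of constant \<open>t\<close> through any point enters the convergence region
  where Re s > |Re t|, and agreement there spreads along the whole line.\<close>

lemma entire2_unique:
  assumes "entire2 f" "entire2 g" "\<And>z. z \<in> Half_plus \<inter> Half_minus \<Longrightarrow> f z = g z"
  shows "f = g"
proof
  fix z :: "complex \<times> complex"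
  obtain s t where z: "z = (s, t)" by fastforce
  define S where "S = {s. Re s > \<bar>Re t\<bar>}"
  have "f (s, 0 * s + t) = g (s, 0 * s + t)"
  proof (rule entire2_eq_on_line[OF assms(1,2), of S])
    show "open S" unfolding S_def by (simp add: open_halfspace_Re_gt)
    have "of_real (\<bar>Re t\<bar> + 1) \<in> S" by (simp add: S_def)
    then show "S \<noteq> {}" by blast
    fix s assume "s \<in> S"
    then show "f (s, 0 * s + t) = g (s, 0 * s + t)"
      by (intro assms(3)) (auto simp: S_def Half_plus_def Half_minus_def)
  qed
  then show "f z = g z" by (simp add: z)
qed

end

section \<open>Equivariance\<close>

context haar_field
begin

lemma test_fun_measurable:
  fixes f :: "'k \<Rightarrow> complex"
  assumes "f \<in> test_fun UNIV" shows "f \<in> borel_measurable borel"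
proof (rule measurable_off_closed[of "{}"])
  obtain k where k: "\<And>x y. y - x \<in> fideal v (int k) \<Longrightarrow> f y = f x" using test_funE[OF assms] by metis
  fix x S assume "f x \<in> S"
  then have "f y \<in> S" if "y - x \<in> fideal v (int k)" for y using k[OF that] by metis
  then show "\<exists>n. \<forall>y. y - x \<in> fideal v n \<longrightarrow> f y \<in> S" by blast
qed auto

text \<open>Near the pole \<open>- inverse b\<close> the argument \<open>x / (1 + b * x)\<close>
  leaves the support of \<open>f\<close>, and for large \<open>x\<close> it approaches
  \<open>inverse b\<close>, near which \<open>f\<close> vanishes. The first gives local constancy at
  the pole, the second bounded support.\<close>

lemma moebius_test_fun:
  fixes f :: "'k \<Rightarrow> complex"
  assumes b: "b \<noteq> 0" and f: "f \<in> test_fun UNIV" "f (inverse b) = 0"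
  shows "(\<lambda>x. of_real (mod_abs v (1 + b * x) powi (- 2)) * f (x / (1 + b * x))) \<in> test_fun UNIV"
proof -
  obtain k where k: "\<And>x y. y - x \<in> fideal v (int k) \<Longrightarrow> f y = f x" "\<And>x. f x \<noteq> 0 \<Longrightarrow> x \<in> fideal v (- int k)"
    using test_funE[OF f(1)] by metis
  define y0 where "y0 = - inverse b"
  have y0: "1 + b * x = 0 \<longleftrightarrow> x = y0" for x
    unfolding y0_def using b by (auto simp: field_simps add_eq_0_iff)
  \<comment> \<open>This displacement formula turns both limits into statements about the valuation
    of \<open>x - y0\<close>.\<close>
  have g: "x / (1 + b * x) - inverse b = - (inverse (b * b * (x - y0)))" if "x \<noteq> y0" for x
  proof -
    define h where "h = x - y0"
    have h0: "h \<noteq> 0" using that by (simp add: h_def)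
    have e: "1 + b * x = b * h" using b by (simp add: h_def y0_def algebra_simps)
    have "x / (b * h) = (h - inverse b) / (b * h)" by (simp add: h_def y0_def)
    then show ?thesis unfolding e h_def[symmetric] using b h0
      by (simp add: diff_divide_distrib) (simp add: divide_inverse mult.assoc[symmetric])
  qed
  have v1: "v (inverse (b * b * (x - y0))) = - (2 * v b) - v (x - y0)" if "x \<noteq> y0" for x
    using b that by (simp add: val_inverse val_mult)
  let ?F = "\<lambda>x. of_real (mod_abs v (1 + b * x) powi (- 2)) * f (x / (1 + b * x))"
  show ?thesis
  proof (rule test_funI_local)
    fix x show "\<exists>n. \<forall>y. y - x \<in> fideal v n \<longrightarrow> ?F y = ?F x"
    proof (cases "x = y0")
      case False
      then have "1 + b * x \<noteq> 0" using y0 by blast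
      then obtain m where m: "\<And>y. y - x \<in> fideal v m \<Longrightarrow> 1 + b * y \<noteq> 0 \<and> v (1 + b * y) = v (1 + b * x) \<and>
          y / (1 + b * y) - x / (1 + b * x) \<in> fideal v (int k)"
        using moebius_continuous[OF b] by blast
      have "?F y = ?F x" if "y - x \<in> fideal v m" for y
      proof -
        have "f (y / (1 + b * y)) = f (x / (1 + b * x))" using m[OF that] k(1) by blast
        moreover have "mod_abs v (1 + b * y) = mod_abs v (1 + b * x)"
          using m[OF that] \<open>1 + b * x \<noteq> 0\<close> by (simp add: mod_abs_def)
        ultimately show ?thesis by simp
      qed
      then show ?thesis by blast
    next
      case True
      then have x0: "?F x = 0" using y0[of x] by (simp add: mod_abs_def)
      \<comment> \<open>Chosen so that the displacement from \<open>inverse b\<close> has valuation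
        below both \<open>- int k\<close> and \<open>- v b\<close>, which forces the argument out of
        the support of \<open>f\<close>.\<close>
      define M where "M = max (int k - 2 * v b + 1) (v b - 2 * v b + 1)"
      have "?F y = 0" if y: "y - x \<in> fideal v M" for y
      proof (cases "y = y0")
        case True then show ?thesis using y0[of y] by (simp add: mod_abs_def)
      next
        case False
        then have vy: "v (y - y0) \<ge> M" using y \<open>x = y0\<close> by (simp add: fideal_iff)
        have "f (y / (1 + b * y)) = 0"
        proof (rule ccontr)
          assume "f (y / (1 + b * y)) \<noteq> 0"
          then have "y / (1 + b * y) \<in> fideal v (min (- int k) (- v b))" using k(2) fideal_monoD by fastforce
          moreover have "inverse b \<in> fideal v (min (- int k) (- v b))" using b by (simp add: fideal_iff val_inverse)
          ultimately have "inverse (b * b * (y - y0)) \<in> fideal v (min (- int k) (- v b))"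
            using fideal_diff g[OF False] by (metis fideal_uminus)
          then show False using v1[OF False] vy False b by (auto simp: fideal_def M_def)
        qed
        then show ?thesis by simp
      qed
      then show ?thesis using x0 by metis
    qed
  next
    fix x assume nz: "?F x \<noteq> 0"
    then have x: "x \<noteq> y0" using y0[of x] by (auto simp: mod_abs_def)
    have "x / (1 + b * x) - inverse b \<notin> fideal v (int k)"
      using k(1)[of "x / (1 + b * x)" "inverse b"] f(2) nz by auto
    then have "\<not> int k \<le> - (2 * v b) - v (x - y0)"
      using v1[OF x] g[OF x] x b by (simp add: fideal_uminus fideal_iff)
    then have "x - y0 \<in> fideal v (min (- int k - 2 * v b) (v y0))" by (simp add: fideal_def min_le_iff_disj)
    moreover have "y0 \<in> fideal v (min (- int k - 2 * v b) (v y0))" by (simp add: fideal_def)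
    ultimately show "x \<in> fideal v (min (- int k - 2 * v b) (v y0))" using fideal_add by fastforce
  qed
qed

end

section \<open>Equivariance of the continued family\<close>

context kernel_params
begin

lemma char_ext_E:
  "x \<noteq> 0 \<Longrightarrow> char_ext vE pE chi s x = chiE x * exp (of_real lnq * (of_int (- vF (nrm x)) * s))"
  by (simp only: char_ext_ang_char mod_abs_E qF_powi_powr chiE_def simp_thms)

lemma char_ext_F:
  "a \<noteq> 0 \<Longrightarrow> char_ext vF pF eta s a = etaF a * exp (of_real lnq * (of_int (- vF a) * s))"
  using qF_powi_powr[of "- vF a" s] by (simp add: char_ext_ang_char mod_abs_def etaF_def)

text \<open>By \<open>entire2_unique\<close> there is only one such function for a test function
  \<open>\<phi>\<close>, so linear and equivariance identities valid in the convergence region pass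
  to it.\<close>

definition entire_ext :: "('e \<Rightarrow> complex) \<Rightarrow> complex \<times> complex \<Rightarrow> complex" where
  "entire_ext \<phi> = (SOME h. entire2 h \<and> (\<forall>z\<in>Half_plus \<inter> Half_minus. h z = pole_factor z * (\<integral>x. Kz z x * \<phi> x \<partial>\<mu>)))"

text \<open>On the pole set division by zero makes this the zero functional, for which linearity and
  equivariance are trivial.\<close>

definition K_ext :: "complex \<times> complex \<Rightarrow> ('e \<Rightarrow> complex) \<Rightarrow> complex" where
  "K_ext z \<phi> = entire_ext \<phi> z / pole_factor z"

definition pole_set :: "(complex \<times> complex) set" where "pole_set = {z. pole_factor z = 0}"

lemma entire_ext:
  assumes "\<phi> \<in> test_fun UNIV"
  shows entire_entire_ext: "entire2 (entire_ext \<phi>)"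
    and entire_ext_integral: "z \<in> Half_plus \<inter> Half_minus \<Longrightarrow> entire_ext \<phi> z = pole_factor z * (\<integral>x. Kz z x * \<phi> x \<partial>\<mu>)"
proof -
  have "\<exists>h. entire2 h \<and> (\<forall>z\<in>Half_plus \<inter> Half_minus. h z = pole_factor z * (\<integral>x. Kz z x * \<phi> x \<partial>\<mu>))"
    using good_all[OF assms] by (simp add: good_def)
  from someI_ex[OF this]
  show "entire2 (entire_ext \<phi>)" "z \<in> Half_plus \<inter> Half_minus \<Longrightarrow> entire_ext \<phi> z = pole_factor z * (\<integral>x. Kz z x * \<phi> x \<partial>\<mu>)"
    unfolding entire_ext_def by blast+
qed

lemma Kz_test_integrable: "\<phi> \<in> test_fun UNIV \<Longrightarrow> z \<in> Half_plus \<inter> Half_minus \<Longrightarrow> integrable \<mu> (\<lambda>x. Kz z x * \<phi> x)"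
  using good_all by (simp add: good_def)

lemma entire_ext_unique:
  assumes "\<phi> \<in> test_fun UNIV" "entire2 h" "\<And>z. z \<in> Half_plus \<inter> Half_minus \<Longrightarrow> h z = pole_factor z * (\<integral>x. Kz z x * \<phi> x \<partial>\<mu>)"
  shows "entire_ext \<phi> = h"
  by (rule entire2_unique[OF entire_entire_ext[OF assms(1)] assms(2)]) (simp add: entire_ext_integral[OF assms(1)] assms(3))

lemma entire2_times: "entire2 f \<Longrightarrow> entire2 g \<Longrightarrow> entire2 (\<lambda>z. f z * g z)"
  and entire2_plus: "entire2 f \<Longrightarrow> entire2 g \<Longrightarrow> entire2 (\<lambda>z. f z + g z)"
  and entire2_const: "entire2 (\<lambda>_. c)"
  by (simp_all add: entire2_def holomorphic2_mult holomorphic2_add)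

lemma entire_ext_add:
  assumes "\<phi> \<in> test_fun UNIV" "\<psi> \<in> test_fun UNIV"
  shows "entire_ext (\<lambda>x. \<phi> x + \<psi> x) = (\<lambda>z. entire_ext \<phi> z + entire_ext \<psi> z)"
proof (rule entire_ext_unique[OF E.test_fun_add[OF assms]])
  show "entire2 (\<lambda>z. entire_ext \<phi> z + entire_ext \<psi> z)" using assms entire_entire_ext by (intro entire2_plus)
  show "entire_ext \<phi> z + entire_ext \<psi> z = pole_factor z * (\<integral>x. Kz z x * (\<phi> x + \<psi> x) \<partial>\<mu>)" if "z \<in> Half_plus \<inter> Half_minus" for z
    using Kz_test_integrable[OF assms(1) that] Kz_test_integrable[OF assms(2) that]
    by (simp add: entire_ext_integral[OF assms(1) that] entire_ext_integral[OF assms(2) that] distrib_left)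
qed

lemma entire_ext_scale:
  assumes "\<phi> \<in> test_fun UNIV"
  shows "entire_ext (\<lambda>x. c * \<phi> x) = (\<lambda>z. c * entire_ext \<phi> z)"
proof (rule entire_ext_unique[OF E.test_fun_scale[OF assms]])
  show "entire2 (\<lambda>z. c * entire_ext \<phi> z)" by (intro entire2_times entire2_const entire_entire_ext assms)
  show "c * entire_ext \<phi> z = pole_factor z * (\<integral>x. Kz z x * (c * \<phi> x) \<partial>\<mu>)" if "z \<in> Half_plus \<inter> Half_minus" for z
    by (simp add: entire_ext_integral[OF assms that] mult.left_commute[of _ c])
qed

lemma distribution_K_ext: "distribution (K_ext z)"
  unfolding distribution_def K_ext_def by (simp add: entire_ext_add entire_ext_scale add_divide_distrib)

lemma pole_factor_nonzero_region: "z \<in> Half_plus \<inter> Half_minus \<Longrightarrow> pole_factor z \<noteq> 0"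
  using norm_A_plus[of z] norm_A_minus[of z] by (auto simp: pole_factor_def factor_plus_def factor_minus_def)

lemma K_ext_region: "\<phi> \<in> test_fun UNIV \<Longrightarrow> z \<in> Half_plus \<inter> Half_minus \<Longrightarrow> K_ext z \<phi> = (\<integral>x. Kz z x * \<phi> x \<partial>\<mu>)"
  using pole_factor_nonzero_region by (simp add: K_ext_def entire_ext_integral)

lemma Kz_locally_integrable:
  assumes z: "z \<in> Half_plus \<inter> Half_minus" shows "locally_integrable \<mu> (Kz z)"
  unfolding locally_integrable_def
proof (intro allI impI)
  fix C :: "'e set" assume C: "compact C"
  obtain k :: nat where k: "C \<subseteq> fideal vE (- int k)" using E.compact_bounded[OF C] by blast
  have "C \<in> sets \<mu>" using E.compact_closed[OF C] by simp
  from integrable_mult_indicator[OF this Kz_test_integrable[OF fideal_test_fun z]]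
  have "integrable \<mu> (\<lambda>x. indicator C x *\<^sub>R (Kz z x * indicator (fideal vE (- int k)) x))" .
  moreover have "(\<lambda>x. indicator C x *\<^sub>R (Kz z x * indicator (fideal vE (- int k)) x)) = (\<lambda>x. indicator C x *\<^sub>R Kz z x)"
    by (intro HOL.ext) (use k in \<open>auto simp: indicator_def\<close>)
  ultimately show "set_integrable \<mu> C (Kz z)" by (simp add: set_integrable_def)
qed

text \<open>The two character factors combine into one function \<open>c\<close>, entire in the
  parameters. A change of variables gives the identity in the convergence region, uniqueness extends
  it, and division by \<open>pole_factor\<close> finishes.\<close>

lemma K_ext_dilation:
  assumes a: "a \<noteq> 0" and \<phi>: "\<phi> \<in> test_fun UNIV"
  shows "of_real (inverse (mod_abs vE (\<iota> a))) * K_ext z (\<lambda>x. \<phi> (inverse (\<iota> a) * x)) =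
    char_ext vE pE chi (fst z - 1/2) (\<iota> a) * inverse (char_ext vF pF eta (snd z + 1/2) a) * K_ext z \<phi>"
proof -
  define c where "c z = omega_minus a * exp (- of_real lnq * (of_int (vF a) * (2 * fst z - snd z - 3/2)))" for z :: "complex \<times> complex"
  have c_eq: "char_ext vE pE chi (fst z - 1/2) (\<iota> a) * inverse (char_ext vF pF eta (snd z + 1/2) a) = c z" for z
  proof -
    have "- of_real lnq * (of_int (vF a) * (2 * fst z - snd z - 3/2)) =
        of_real lnq * (of_int (- vF (a\<^sup>2)) * (fst z - 1/2)) + - (of_real lnq * (of_int (- vF a) * (snd z + 1/2)))"
      using a by (simp add: F.val_power) (simp add: algebra_simps)
    then have "c z = omega_minus a * (exp (of_real lnq * (of_int (- vF (a\<^sup>2)) * (fst z - 1/2))) *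
        inverse (exp (of_real lnq * (of_int (- vF a) * (snd z + 1/2)))))"
      by (simp only: c_def exp_add exp_minus)
    moreover have "char_ext vE pE chi (fst z - 1/2) (\<iota> a) =
        chiE (\<iota> a) * exp (of_real lnq * (of_int (- vF (a\<^sup>2)) * (fst z - 1/2)))"
      using char_ext_E[of "\<iota> a" "fst z - 1/2", unfolded nrm_iota] a by simp
    ultimately show ?thesis
      using char_ext_F[OF a, of "snd z + 1/2"]
      by (simp only: omega_minus_def divide_inverse inverse_mult_distrib ac_simps)
  qed
  have c_ent: "entire2 c"
  proof -
    have "c = (\<lambda>z. omega_minus a * exp ((- 2 * of_real lnq * of_int (vF a)) * fst z + (of_real lnq * of_int (vF a)) * snd z
        + (3/2 * of_real lnq * of_int (vF a))))"
      by (intro ext) (simp add: c_def algebra_simps)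
    then show ?thesis unfolding entire2_def
      by (simp only: holomorphic2_mult holomorphic2_const holomorphic2_exp_linear)
  qed
  let ?\<phi> = "\<lambda>x. \<phi> (inverse (\<iota> a) * x)"
  obtain k where k: "\<And>x y. y - x \<in> fideal vE (int k) \<Longrightarrow> \<phi> y = \<phi> x" "\<And>x. \<phi> x \<noteq> 0 \<Longrightarrow> x \<in> fideal vE (- int k)"
    using E.test_funE[OF \<phi>] by metis
  have ia: "inverse (\<iota> a) \<noteq> 0" "vE (inverse (\<iota> a)) = - vE (\<iota> a)" using a by (simp_all add: E.val_inverse)
  have t: "?\<phi> \<in> test_fun UNIV"
  proof (rule E.test_funI)
    show "?\<phi> y = ?\<phi> x" if "y - x \<in> fideal vE (int k + vE (\<iota> a))" for x y
      using that E.fideal_scale[OF ia(1), of "y - x" "int k"] ia(2)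
      by (intro k(1)) (simp add: right_diff_distrib)
    show "x \<in> fideal vE (- int k + vE (\<iota> a))" if "?\<phi> x \<noteq> 0" for x
      using k(2)[OF that] E.fideal_scale[OF ia(1), of x "- int k"] ia(2) by simp
  qed
  let ?m = "complex_of_real (mod_abs vE (\<iota> a))"
  have m: "mod_abs vE (\<iota> a) \<noteq> 0" using a E.q_gt_0 by (simp add: mod_abs_def)
  have "entire_ext ?\<phi> = (\<lambda>z. ?m * c z * entire_ext \<phi> z)"
  proof (rule entire_ext_unique[OF t])
    show "entire2 (\<lambda>z. ?m * c z * entire_ext \<phi> z)" by (intro entire2_times entire2_const c_ent entire_entire_ext \<phi>)
    fix z assume z: "z \<in> Half_plus \<inter> Half_minus"
    let ?f = "\<lambda>y. c z * (Kz z y * \<phi> y)"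
    have "(\<integral>x. ?f (inverse (\<iota> a) * x) \<partial>\<mu>) = real (residue_card vE) powi (vE (inverse (\<iota> a))) * (\<integral>y. ?f y \<partial>\<mu>)"
      by (rule H.scales_integrable(2)[OF H.scales_mult[OF ia(1)]])
        (intro integrable_mult_right Kz_test_integrable \<phi> z)
    moreover have "?f (inverse (\<iota> a) * x) = Kz z x * ?\<phi> x" for x
    proof -
      have "\<iota> a * (inverse (\<iota> a) * x) = x" using a by simp
      then have "Kz z x = c z * Kz z (inverse (\<iota> a) * x)"
        using Kz_scale[OF a, of z "inverse (\<iota> a) * x"] by (simp only: c_def)
      then show ?thesis by simp
    qed
    moreover have "real (residue_card vE) powi (vE (inverse (\<iota> a))) = mod_abs vE (\<iota> a)"
      using a ia by (simp add: mod_abs_def)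
    ultimately have "(\<integral>x. Kz z x * ?\<phi> x \<partial>\<mu>) = ?m * (c z * (\<integral>y. Kz z y * \<phi> y \<partial>\<mu>))" by simp
    then show "?m * c z * entire_ext \<phi> z = pole_factor z * (\<integral>x. Kz z x * ?\<phi> x \<partial>\<mu>)"
      by (simp add: entire_ext_integral[OF \<phi> z] mult_ac)
  qed
  then show ?thesis unfolding c_eq using m by (simp add: K_ext_def field_simps)
qed

text \<open>For \<open>u = 1 - \<iota> b * y\<close> and \<open>w = y / u\<close>, the product of
  \<open>w\<close> with the norm of \<open>u\<close> is \<open>y * cj u\<close>, which differs from
  \<open>y\<close> by an element of the ground field. So second coordinate and norm are both divided
  by the norm of \<open>u\<close>; their quotient is unchanged and only the factor at the square
  transforms.\<close>

lemma Kz_moebius: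
  assumes u: "1 - \<iota> b * y \<noteq> 0"
  shows "Kz z (y / (1 - \<iota> b * y)) = inverse (char_ext vE pE chi (fst z - 1/2) ((1 - \<iota> b * y)\<^sup>2)) * Kz z y"
proof -
  define u where "u = 1 - \<iota> b * y"
  define w where "w = y / u"
  have u0: "u \<noteq> 0" using u by (simp add: u_def)
  have "w = inverse (u * cj u) * (y * cj u)" using u0 by (simp add: w_def divide_inverse)
  then have "w = \<iota> (inverse (nrm u)) * (y * cj u)" by (simp only: iota_inverse iota_nrm)
  moreover have "y * cj u = y - \<iota> (b * nrm y)"
    by (simp add: u_def cj_diff cj_mult emb_mult iota_nrm algebra_simps)
  ultimately have c2w: "c2 w = c2 y / nrm u"
    by (simp add: c_scale c_diff divide_inverse)
  have yw: "y = w * u" using u0 by (simp add: w_def)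
  show ?thesis
  proof (cases "c2 y = 0")
    case True then show ?thesis using c2w by (simp add: Kz_base w_def u_def)
  next
    case False
    then have y0: "y \<noteq> 0" using c_0 by auto
    then have w0: "w \<noteq> 0" using yw by auto
    have nu: "nrm u \<noteq> 0" "nrm y \<noteq> 0" "nrm w \<noteq> 0" using u0 y0 w0 by simp_all
    have nw: "nrm w = nrm y / nrm u" using yw nrm_mult[of w u] nu by (simp add: field_simps)
    have c2w0: "c2 w \<noteq> 0" using c2w False nu by simp
    have k: "kappa y = chiE (u\<^sup>2) * kappa w"
    proof -
      have "y\<^sup>2 = w\<^sup>2 * u\<^sup>2" using yw by (simp add: power_mult_distrib)
      moreover have "c2 w / nrm w = c2 y / nrm y" using c2w nw nu by simp
      ultimately show ?thesis using w0 u0 by (simp add: kappa_def chiE_mult)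
    qed
    have wt: "wt z (vF (c2 y)) (vF (nrm y)) = exp (of_real lnq * (of_int (- 2 * vF (nrm u)) * (fst z - 1/2))) * wt z (vF (c2 w)) (vF (nrm w))"
      unfolding wt_def exp_add[symmetric] c2w nw using False nu
      by (simp add: F.val_divide algebra_simps)
    have ce: "char_ext vE pE chi (fst z - 1/2) (u\<^sup>2) = chiE (u\<^sup>2) * exp (of_real lnq * (of_int (- 2 * vF (nrm u)) * (fst z - 1/2)))"
      using u0 by (simp add: char_ext_E nrm_mult power2_eq_square F.val_mult)
    have "Kz z y = char_ext vE pE chi (fst z - 1/2) (u\<^sup>2) * Kz z w"
      unfolding Kz_eq[OF False] Kz_eq[OF c2w0] k wt ce by simp
    moreover have "char_ext vE pE chi (fst z - 1/2) (u\<^sup>2) \<noteq> 0"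
      using u0 chiE_nonzero[of "u\<^sup>2"] by (simp add: ce)
    ultimately show ?thesis by (simp add: w_def u_def)
  qed
qed

text \<open>\<open>y / (1 - \<iota> b * y)\<close> inverts \<open>x / (1 + \<iota> b * x)\<close>,
  so the change of variables returns the kernel at \<open>x\<close> on one side and at the
  transformed point on the other. At the poles of the two maps the module, respectively
  \<open>f\<close>, is 0.\<close>

lemma Kz_moebius_integral:
  assumes b: "b \<noteq> 0" and f: "f \<in> test_fun UNIV" "f (inverse (\<iota> b)) = 0"
  shows "(\<integral>x. Kz z x * (of_real (mod_abs vE (1 + \<iota> b * x) powi (- 2)) * f (x / (1 + \<iota> b * x))) \<partial>\<mu>) =
    (\<integral>x. Kz z x * (inverse (char_ext vE pE chi (fst z - 1/2) ((1 - \<iota> b * x)\<^sup>2)) * f x) \<partial>\<mu>)"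
proof -
  have b': "\<iota> b \<noteq> 0" "- \<iota> b \<noteq> 0" using b by simp_all
  define F where "F y = Kz z (y / (1 - \<iota> b * y)) * f y" for y
  have "(\<lambda>y. y / (1 + - \<iota> b * y)) \<in> borel_measurable borel" by (rule H.moebius_distr(2)[OF b'(2)])
  then have "(\<lambda>y. Kz z (y / (1 - \<iota> b * y))) \<in> borel_measurable borel"
    using measurable_compose[OF _ Kz_measurable] by simp
  then have Fm: "F \<in> borel_measurable borel"
    unfolding F_def using H.test_fun_measurable[OF f(1)] by (intro borel_measurable_times)
  have 1: "of_real (mod_abs vE (1 + \<iota> b * x) powi (- 2)) * F (x / (1 + \<iota> b * x)) =
     Kz z x * (of_real (mod_abs vE (1 + \<iota> b * x) powi (- 2)) * f (x / (1 + \<iota> b * x)))" for x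
  proof (cases "1 + \<iota> b * x = 0")
    case False
    then have "1 - \<iota> b * (x / (1 + \<iota> b * x)) = 1 / (1 + \<iota> b * x)" by (simp add: field_simps)
    then have "x / (1 + \<iota> b * x) / (1 - \<iota> b * (x / (1 + \<iota> b * x))) = x" using False by simp
    then show ?thesis by (simp add: F_def)
  qed (simp add: mod_abs_def)
  have 2: "F x = Kz z x * (inverse (char_ext vE pE chi (fst z - 1/2) ((1 - \<iota> b * x)\<^sup>2)) * f x)" for x
  proof (cases "1 - \<iota> b * x = 0")
    case True
    then have "x = inverse (\<iota> b)" using b' by (simp add: field_simps)
    then show ?thesis using f(2) by (simp add: F_def)
  qed (simp add: F_def Kz_moebius)
  have "(\<integral>x. Kz z x * (of_real (mod_abs vE (1 + \<iota> b * x) powi (- 2)) * f (x / (1 + \<iota> b * x))) \<partial>\<mu>) = (\<integral>x. F x \<partial>\<mu>)"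
    unfolding 1[symmetric] by (rule H.moebius_integral[OF b'(1) Fm, symmetric])
  then show ?thesis unfolding 2 .
qed

lemma char_ext_moebius_local:
  assumes u: "1 - \<iota> b * x \<noteq> 0"
  shows "\<exists>n. \<forall>y. y - x \<in> fideal vE n \<longrightarrow> 1 - \<iota> b * y \<noteq> 0 \<and>
    (\<forall>s. char_ext vE pE chi s ((1 - \<iota> b * y)\<^sup>2) = char_ext vE pE chi s ((1 - \<iota> b * x)\<^sup>2))"
proof (cases "b = 0")
  case False
  then have b: "\<iota> b \<noteq> 0" by simp
  obtain n where n: "\<And>y. y - (1 - \<iota> b * x) \<in> fideal vE n \<Longrightarrow> y \<noteq> 0 \<and> chiE y = chiE (1 - \<iota> b * x) \<and> vF (nrm y) = vF (nrm (1 - \<iota> b * x))"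
    using Gz_locally_constant[OF u] by blast
  have "1 - \<iota> b * y \<noteq> 0 \<and> (\<forall>s. char_ext vE pE chi s ((1 - \<iota> b * y)\<^sup>2) = char_ext vE pE chi s ((1 - \<iota> b * x)\<^sup>2))"
    if y: "y - x \<in> fideal vE (n - vE (\<iota> b))" for y
  proof -
    have "(1 - \<iota> b * y) - (1 - \<iota> b * x) \<in> fideal vE n"
      using E.fideal_scale[OF b, of "x - y" n] y E.fideal_diff_commute[of x y] by (simp add: algebra_simps)
    from n[OF this] u show ?thesis
      by (simp add: char_ext_E power2_eq_square chiE_mult nrm_mult F.val_mult)
  qed
  then show ?thesis by blast
qed simp

lemma entire_char_ext_inverse:
  assumes "x \<noteq> 0" shows "entire2 (\<lambda>z. inverse (char_ext vE pE chi (fst z - 1/2) x))"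
proof -
  have "(\<lambda>z. inverse (char_ext vE pE chi (fst z - 1/2) x)) = (\<lambda>z. inverse (chiE x) *
      exp ((of_real lnq * of_int (vF (nrm x))) * fst z + 0 * snd z + (- of_real lnq * of_int (vF (nrm x)) / 2)))"
    using assms by (intro HOL.ext) (simp add: char_ext_E exp_minus[symmetric] algebra_simps)
  then show ?thesis unfolding entire2_def
    by (simp only: holomorphic2_mult holomorphic2_const holomorphic2_exp_linear)
qed

text \<open>The test function on the right depends on \<open>z\<close> through its multiplier, so
  the identity theorem does not apply to it directly. On a small box the multiplier is constant in
  \<open>x\<close> and entire in \<open>z\<close>, hence comes out of the pairing; linearity
  assembles \<open>\<phi>\<close> from such boxes.\<close>

lemma entire_ext_moebius:
  assumes b: "b \<noteq> 0" and \<phi>: "\<phi> \<in> test_fun UNIV" "\<phi> (inverse (\<iota> b)) = 0"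
  shows "entire_ext (\<lambda>x. of_real (mod_abs vE (1 + \<iota> b * x) powi (- 2)) * \<phi> (x / (1 + \<iota> b * x))) z =
    entire_ext (\<lambda>x. inverse (char_ext vE pE chi (fst z - 1/2) ((1 - \<iota> b * x)\<^sup>2)) * \<phi> x) z"
proof -
  have b': "\<iota> b \<noteq> 0" using b by simp
  have u0: "1 - \<iota> b * x = 0 \<longleftrightarrow> x = inverse (\<iota> b)" for x
    using b' by (auto simp: field_simps)
  define M where "M f x = of_real (mod_abs vE (1 + \<iota> b * x) powi (- 2)) * f (x / (1 + \<iota> b * x))" for f :: "'e \<Rightarrow> complex" and x
  define N where "N f x = inverse (char_ext vE pE chi (fst z - 1/2) ((1 - \<iota> b * x)\<^sup>2)) * f x" for f and x
  have M_test: "M f \<in> test_fun UNIV" if "f \<in> test_fun UNIV" "f (inverse (\<iota> b)) = 0" for f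
    unfolding M_def using H.moebius_test_fun[OF b' that] .
  have N_test: "N f \<in> test_fun UNIV" if "f \<in> test_fun UNIV" "f (inverse (\<iota> b)) = 0" for f
    unfolding N_def
  proof (rule E.test_fun_mult[OF that(1)])
    fix x assume "f x \<noteq> 0"
    then have "1 - \<iota> b * x \<noteq> 0" using u0 that(2) by metis
    from char_ext_moebius_local[OF this]
    show "\<exists>n. \<forall>y. y - x \<in> fideal vE n \<longrightarrow> inverse (char_ext vE pE chi (fst z - 1/2) ((1 - \<iota> b * y)\<^sup>2)) =
       inverse (char_ext vE pE chi (fst z - 1/2) ((1 - \<iota> b * x)\<^sup>2))" by metis
  qed
  define Q where "Q f \<longleftrightarrow> f \<in> test_fun UNIV \<and> f (inverse (\<iota> b)) = 0 \<and> entire_ext (M f) z = entire_ext (N f) z" for f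
  have "Q \<phi>"
  proof (rule test_fun_decompose[OF _ _ _ \<phi>(1)])
    have z: "(\<lambda>_. 0) \<in> test_fun (UNIV :: 'e set)"
      by (rule E.test_funI) simp_all
    show "Q (\<lambda>_. 0)" using z by (simp add: Q_def M_def[abs_def] N_def[abs_def])
  next
    fix f g assume fg: "Q f" "Q g"
    have "M (\<lambda>x. f x + g x) = (\<lambda>x. M f x + M g x)" "N (\<lambda>x. f x + g x) = (\<lambda>x. N f x + N g x)"
      by (auto simp: M_def N_def algebra_simps)
    then show "Q (\<lambda>x. f x + g x)"
      using fg M_test N_test by (simp add: Q_def E.test_fun_add entire_ext_add)
  next
    fix c f assume f: "Q f"
    have "M (\<lambda>x. c * f x) = (\<lambda>x. c * M f x)" "N (\<lambda>x. c * f x) = (\<lambda>x. c * N f x)"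
      by (auto simp: M_def N_def algebra_simps)
    then show "Q (\<lambda>x. c * f x)"
      using f M_test N_test by (simp add: Q_def E.test_fun_scale entire_ext_scale)
  next
    fix x assume "\<phi> x \<noteq> 0"
    then have ux: "1 - \<iota> b * x \<noteq> 0" using u0 \<phi>(2) by metis
    obtain n where n: "\<And>y. y - x \<in> fideal vE n \<Longrightarrow> 1 - \<iota> b * y \<noteq> 0 \<and>
      (\<forall>s. char_ext vE pE chi s ((1 - \<iota> b * y)\<^sup>2) = char_ext vE pE chi s ((1 - \<iota> b * x)\<^sup>2))"
      using char_ext_moebius_local[OF ux] by blast
    obtain K where K: "Box K K \<subseteq> fideal vE n" using Box_nbhd by blast
    have "Q (indicator (boxat y k))" if y: "y \<in> boxat x K" "k \<ge> K" for y k
    proof -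
      let ?f = "indicator (boxat y k) :: 'e \<Rightarrow> complex"
      let ?C = "\<lambda>z. inverse (char_ext vE pE chi (fst z - 1/2) ((1 - \<iota> b * x)\<^sup>2))"
      have in_fideal: "w - x \<in> fideal vE n" if "w \<in> boxat y k" for w
        using boxat_mono[OF y] that K unfolding boxat_def by blast
      have const: "inverse (char_ext vE pE chi (fst z - 1/2) ((1 - \<iota> b * w)\<^sup>2)) * ?f w = ?C z * ?f w" for w and z :: "complex \<times> complex"
        using n[OF in_fideal[of w]] by (cases "w \<in> boxat y k") simp_all
      have t: "?f \<in> test_fun UNIV" by (rule boxat_test_fun)
      have "inverse (\<iota> b) \<notin> boxat y k" using n[OF in_fideal] u0 by blast
      then have v: "?f (inverse (\<iota> b)) = 0" by simp
      have "entire_ext (M ?f) = (\<lambda>z. ?C z * entire_ext ?f z)"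
      proof (rule entire_ext_unique[OF M_test[OF t v]])
        show "entire2 (\<lambda>z. ?C z * entire_ext ?f z)"
          using ux by (intro entire2_times entire_char_ext_inverse entire_entire_ext t) simp
        fix z assume z: "z \<in> Half_plus \<inter> Half_minus"
        have "(\<integral>w. Kz z w * M ?f w \<partial>\<mu>) = (\<integral>w. Kz z w * (?C z * ?f w) \<partial>\<mu>)"
          unfolding M_def Kz_moebius_integral[OF b t v] const ..
        also have "\<dots> = ?C z * (\<integral>w. Kz z w * ?f w \<partial>\<mu>)"
          by (simp only: mult.left_commute[of _ "?C z"] integral_mult_right_zero)
        finally show "?C z * entire_ext ?f z = pole_factor z * (\<integral>w. Kz z w * M ?f w \<partial>\<mu>)"
          by (simp add: entire_ext_integral[OF t z])
      qed
      moreover have "N ?f = (\<lambda>w. ?C z * ?f w)" unfolding N_def using const by (intro HOL.ext)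
      ultimately show ?thesis using t v by (simp add: Q_def entire_ext_scale)
    qed
    then show "\<exists>K. \<forall>y\<in>boxat x K. \<forall>k\<ge>K. Q (indicator (boxat y k))" by blast
  qed
  then show ?thesis by (simp add: Q_def M_def[abs_def] N_def[abs_def])
qed

lemma K_ext_sb_kernels: "K_ext (s, t) \<in> sb_kernels vF vE pF pE \<iota> chi eta s t"
  unfolding sb_kernels_def mem_Collect_eq
proof (intro conjI allI impI ballI)
  show "distribution (K_ext (s, t))" by (rule distribution_K_ext)
next
  fix a :: 'f and \<phi> :: "'e \<Rightarrow> complex" assume "a \<noteq> 0" "\<phi> \<in> test_fun UNIV"
  from K_ext_dilation[OF this, of "(s, t)"]
  show "of_real (inverse (mod_abs vE (\<iota> a))) * K_ext (s, t) (\<lambda>x. \<phi> (inverse (\<iota> a) * x)) =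
           char_ext vE pE chi (s - 1/2) (\<iota> a) * inverse (char_ext vF pF eta (t + 1/2) a) * K_ext (s, t) \<phi>" by simp
next
  fix b :: 'f and \<phi> :: "'e \<Rightarrow> complex" assume b: "b \<noteq> 0" and \<phi>: "\<phi> \<in> test_fun (- {inverse (\<iota> b)})"
  then have "\<phi> \<in> test_fun UNIV" "\<phi> (inverse (\<iota> b)) = 0" using E.test_fun_iff[of \<phi> "- {inverse (\<iota> b)}"] by auto
  from entire_ext_moebius[OF b this, of "(s, t)"]
  show "K_ext (s, t) (\<lambda>x. of_real (mod_abs vE (1 + \<iota> b * x) powi (- 2)) * \<phi> (x / (1 + \<iota> b * x))) =
           K_ext (s, t) (\<lambda>x. inverse (char_ext vE pE chi (s - 1/2) ((1 - \<iota> b * x)\<^sup>2)) * \<phi> x)"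
    by (simp add: K_ext_def)
qed

end

section \<open>Integrals of characters over strips\<close>

context quadratic_haar
begin

lemma integrable_bounded_measurable:
  fixes f :: "'e \<Rightarrow> complex"
  assumes f: "f \<in> borel_measurable borel" "\<And>x. norm (f x) \<le> 1" and A: "A \<in> sets borel" "A \<subseteq> fideal vE k"
  shows "integrable \<mu> (\<lambda>x. f x * indicator A x)"
proof (rule Bochner_Integration.integrable_bound)
  have "emeasure \<mu> A < \<infinity>" by (rule H.finite_emeasure_bounded[OF A(2)])
  then show "integrable \<mu> (\<lambda>x. indicator A x :: real)" using A(1) by (intro integrable_real_indicator) auto
  show "(\<lambda>x. f x * indicator A x) \<in> borel_measurable \<mu>"
    using f(1) A(1) by (auto intro!: borel_measurable_times borel_measurable_indicator)
  show "AE x in \<mu>. norm (f x * indicator A x) \<le> norm (indicator A x :: real)"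
    using f(2) by (auto simp: norm_mult indicator_def)
qed

text \<open>A finite-level Radon transform argument: the sum of the integrals over all strips through
  \<open>1\<close> of the directions in a sphere sees only the radial averages around \<open>1\<close>, and for a
  character all of these vanish except those inside the conductor.\<close>

lemma strip_integral_nonzero:
  fixes \<rho> :: "'e \<Rightarrow> complex"
  assumes \<rho>0: "\<rho> 0 = 0" and \<rho>_mult: "\<And>x y. x \<noteq> 0 \<Longrightarrow> y \<noteq> 0 \<Longrightarrow> \<rho> (x * y) = \<rho> x * \<rho> y"
    and \<rho>_norm: "\<And>x. x \<noteq> 0 \<Longrightarrow> norm (\<rho> x) = 1"
    and \<rho>_local: "\<And>x. x - 1 \<in> fideal vE (int N0) \<Longrightarrow> x \<noteq> 0 \<Longrightarrow> \<rho> x = 1"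
    and zero: "\<And>i c. (\<integral>x. \<rho> x * indicator {x. x \<noteq> 0 \<and> vE x = i \<and> c2 x - c \<in> fideal vF 0} x \<partial>\<mu>) = 0"
  shows False
proof -
  have \<rho>_lc: "\<exists>n. \<forall>y. y - x \<in> fideal vE n \<longrightarrow> y \<noteq> 0 \<and> vE y = vE x \<and> \<rho> y = \<rho> x" if x: "x \<noteq> 0" for x
  proof (intro exI allI impI)
    fix y assume y: "y - x \<in> fideal vE (vE x + max 1 (int N0))"
    have y0: "y \<noteq> 0" "vE y = vE x" using E.val_stable[OF x, of y] E.fideal_monoD[OF y, of "vE x + 1"] by auto
    have "y / x - 1 = inverse x * (y - x)" using x by (simp add: field_simps)
    then have "y / x - 1 \<in> fideal vE (int N0)"
      using E.fideal_scale[of "inverse x" "y - x" "int N0"] x E.fideal_monoD[OF y, of "vE x + int N0"]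
      by (simp add: E.val_inverse add.commute)
    then have "\<rho> (y / x) = 1" using \<rho>_local x y0 by simp
    then have "\<rho> y = \<rho> x" using \<rho>_mult[of "y / x" x] x y0 by simp
    with y0 show "y \<noteq> 0 \<and> vE y = vE x \<and> \<rho> y = \<rho> x" by blast
  qed
  have \<rho>_meas: "\<rho> \<in> borel_measurable borel"
  proof (rule E.measurable_off_closed[of "{0}" _ 0])
    fix x S assume x: "x \<notin> {0}" and S: "\<rho> x \<in> S"
    then have "x \<noteq> 0" by simp
    from \<rho>_lc[OF this] S show "\<exists>n. \<forall>y. y - x \<in> fideal vE n \<longrightarrow> \<rho> y \<in> S" by metis
  qed (simp_all add: \<rho>0)
  have \<rho>_le: "norm (\<rho> x) \<le> 1" for x using \<rho>_norm[of x] \<rho>0 by (cases "x = 0") auto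
  note int = integrable_bounded_measurable[OF \<rho>_meas \<rho>_le]
  have strip_open: "open {x. x \<noteq> 0 \<and> vE x = i \<and> c2 (a * x) - c \<in> fideal vF 0}" for i c a
    unfolding E.open_iff
  proof
    fix x assume x: "x \<in> {x. x \<noteq> 0 \<and> vE x = i \<and> c2 (a * x) - c \<in> fideal vF 0}"
    then obtain n where n: "\<And>y. y - x \<in> fideal vE n \<Longrightarrow> y \<noteq> 0 \<and> vE y = vE x" using \<rho>_lc by blast
    obtain k where k: "fideal vE k \<subseteq> Box 0 0" using Box_nbhd by blast
    have "y \<in> {x. x \<noteq> 0 \<and> vE x = i \<and> c2 (a * x) - c \<in> fideal vF 0}" if y: "y - x \<in> fideal vE (max n (k - vE a))" for y
    proof -
      have "a * (y - x) \<in> fideal vE k"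
        using E.fideal_scale[of a "y - x" k] E.fideal_monoD[OF y, of "k - vE a"] by (cases "a = 0") auto
      then have "c2 (a * y) - c2 (a * x) \<in> fideal vF 0" using k by (auto simp: Box_def c_diff[symmetric] right_diff_distrib)
      then have "c2 (a * y) - c \<in> fideal vF 0" using F.fideal_diff_trans[of "c2 (a * y)" "c2 (a * x)" 0 c] x by simp
      then show ?thesis using n[of y] E.fideal_monoD[OF y, of n] x by simp
    qed
    then show "\<exists>n. \<forall>y. y - x \<in> fideal vE n \<longrightarrow> y \<in> {x. x \<noteq> 0 \<and> vE x = i \<and> c2 (a * x) - c \<in> fideal vF 0}" by blast
  qed
  \<comment> \<open>The filtration of the units by congruence to 1; \<open>U 0\<close> is the whole
    unit group.\<close>
  define U where "U k = {u. u \<noteq> 0 \<and> vE u = 0 \<and> u - 1 \<in> fideal vE (int k)}" for k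
  have U0: "u \<in> U 0 \<longleftrightarrow> u \<noteq> 0 \<and> vE u = 0" for u
  proof -
    have "u \<noteq> 0 \<and> vE u = 0 \<Longrightarrow> u - 1 \<in> fideal vE 0" by (intro E.fideal_diff) (auto simp: fideal_def)
    then show ?thesis by (auto simp: U_def)
  qed
  have U_borel: "U k \<in> sets borel" for k
  proof -
    have "open (U k)" unfolding E.open_iff
    proof
      fix x assume x: "x \<in> U k"
      then have "x \<noteq> 0" by (simp add: U_def)
      from \<rho>_lc[OF this] obtain n where n: "\<And>y. y - x \<in> fideal vE n \<Longrightarrow> y \<noteq> 0 \<and> vE y = vE x" by blast
      have "y \<in> U k" if y: "y - x \<in> fideal vE (max n (int k))" for y
        using n[of y] x E.fideal_monoD[OF y] E.fideal_diff_trans[of y x "int k" 1] by (auto simp: U_def)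
      then show "\<exists>n. \<forall>y. y - x \<in> fideal vE n \<longrightarrow> y \<in> U k" by blast
    qed
    then show ?thesis by simp
  qed
  have U_sub: "U k \<subseteq> fideal vE 0" for k by (auto simp: U_def fideal_def)
  \<comment> \<open>A character trivial on the units would integrate to the volume of the strip with
    \<open>i = 0\<close> and \<open>c = 0\<close>, which is positive.\<close>
  have pos: "\<exists>u\<in>U 0. \<rho> u \<noteq> 1"
  proof (rule ccontr)
    assume "\<not> ?thesis"
    then have triv: "\<rho> u = 1" if "u \<noteq> 0" "vE u = 0" for u using U0 that by auto
    define A where "A = {x. x \<noteq> 0 \<and> vE x = 0 \<and> c2 x - 0 \<in> fideal vF 0}"
    have A: "open A" "A \<subseteq> fideal vE 0" using strip_open[of 0 1 0] by (auto simp: A_def fideal_def)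
    have "1 \<in> A" by (simp add: A_def)
    then obtain n where "\<And>y. y - 1 \<in> fideal vE n \<Longrightarrow> y \<in> A" using A(1) unfolding E.open_iff by blast
    then have "disc vE 1 n \<subseteq> A" by (auto simp: disc_def)
    then have "emeasure \<mu> (disc vE 1 n) \<le> emeasure \<mu> A" using A(1) by (intro emeasure_mono) auto
    then have "emeasure \<mu> A > 0" using E.q_gt_0 by (auto simp: H.emeasure_disc intro: less_le_trans[rotated])
    moreover have "emeasure \<mu> A \<noteq> \<infinity>" using H.finite_emeasure_bounded[OF A(2)] by simp
    ultimately have "measure \<mu> A > 0" by (simp add: measure_def enn2real_positive_iff less_top)
    moreover have "(\<lambda>x. \<rho> x * indicator A x) = (\<lambda>x. complex_of_real (indicator A x))"
      using triv by (auto simp: A_def indicator_def)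
    then have "(\<integral>x. \<rho> x * indicator A x \<partial>\<mu>) = of_real (measure \<mu> A)"
      using A(1) by (simp add: integral_complex_of_real)
    ultimately show False using zero[of 0 0] by (simp add: A_def)
  qed
  \<comment> \<open>The conductor exponent of \<open>\<rho>\<close>, positive by the previous step;
    hence some \<open>u0\<close> at level \<open>n - 1\<close> is not in the kernel of
    \<open>\<rho>\<close>.\<close>
  define n where "n = (LEAST k. \<forall>u\<in>U k. \<rho> u = 1)"
  have n_triv: "\<forall>u\<in>U n. \<rho> u = 1"
    unfolding n_def by (rule LeastI[of _ N0]) (use \<rho>_local in \<open>auto simp: U_def\<close>)
  have n1: "n \<ge> 1"
  proof (rule ccontr)
    assume "\<not> n \<ge> 1"
    then have "n = 0" by simp
    then show False using n_triv pos by auto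
  qed
  obtain u0 where u0: "u0 \<in> U (n - 1)" "\<rho> u0 \<noteq> 1"
    using not_less_Least[of "n - 1" "\<lambda>k. \<forall>u\<in>U k. \<rho> u = 1"] n1 unfolding n_def[symmetric] by auto
  have u0': "u0 \<noteq> 0" "vE u0 = 0" using u0(1) by (auto simp: U_def)
  define Fk where "Fk k = (\<integral>x. \<rho> x * indicator (U k) x \<partial>\<mu>)" for k
  \<comment> \<open>Multiplication by \<open>u0\<close> preserves \<open>U k\<close> and Haar
    measure but multiplies the integrand by \<open>\<rho> u0\<close>, which is not 1.\<close>
  have F0: "Fk k = 0" if k: "k \<le> n - 1" for k
  proof -
    have u0k: "u0 - 1 \<in> fideal vE (int k)" using u0(1) k E.fideal_monoD[of "u0 - 1" "int (n - 1)" "int k"] by (auto simp: U_def)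
    have mem: "u0 * x \<in> U k \<longleftrightarrow> x \<in> U k" for x
    proof (cases "x \<noteq> 0 \<and> vE x = 0")
      case True
      have "x * (u0 - 1) \<in> fideal vE (int k)" using E.fideal_scale[of x "u0 - 1" "int k"] True u0k by simp
      moreover have "x * (u0 - 1) = (u0 * x - 1) - (x - 1)" by (simp add: algebra_simps)
      ultimately have "u0 * x - 1 \<in> fideal vE (int k) \<longleftrightarrow> x - 1 \<in> fideal vE (int k)"
        using E.fideal_add[of "x * (u0 - 1)" "int k" "x - 1"] E.fideal_diff[of "u0 * x - 1" "int k" "x * (u0 - 1)"] by auto
      then show ?thesis using True u0' by (simp add: U_def E.val_mult)
    next
      case False
      then show ?thesis using u0' by (auto simp: U_def E.val_mult)
    qed
    let ?f = "\<lambda>x. \<rho> x * indicator (U k) x"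
    have e: "?f (u0 * x) = \<rho> u0 * ?f x" for x
      using mem[of x] \<rho>_mult[OF u0'(1), of x] by (auto simp: indicator_def U_def)
    have "(\<integral>x. ?f (u0 * x) \<partial>\<mu>) = (\<integral>x. ?f x \<partial>\<mu>)"
      using H.scales_integrable(2)[OF H.scales_mult[OF u0'(1)] int[OF U_borel U_sub]] u0' by simp
    then have "(\<integral>x. \<rho> u0 * ?f x \<partial>\<mu>) = (\<integral>x. ?f x \<partial>\<mu>)" unfolding e .
    then have "\<rho> u0 * Fk k = Fk k" by (simp only: integral_mult_right_zero Fk_def)
    then show ?thesis using u0(2) by simp
  qed
  have Fn: "Fk n \<noteq> 0"
  proof -
    have Ud: "U n = disc vE 1 (int n)"
    proof (rule set_eqI)
      fix x show "x \<in> U n \<longleftrightarrow> x \<in> disc vE 1 (int n)"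
        using E.val_stable[of 1 x] E.fideal_monoD[of "x - 1" "int n" 1] n1 by (auto simp: U_def disc_def)
    qed
    have "(\<lambda>x. \<rho> x * indicator (U n) x) = (\<lambda>x. complex_of_real (indicator (U n) x))"
      using n_triv by (auto simp: indicator_def)
    then have "Fk n = of_real (measure \<mu> (U n))"
      using U_borel[of n] by (simp add: Fk_def integral_complex_of_real)
    then show ?thesis using E.q_gt_0 by (simp add: Ud H.measure_disc)
  qed
  define Q where "Q j \<longleftrightarrow> (\<forall>w\<in>fideal vE j. c2 w \<in> fideal vF 0)" for j
  \<comment> \<open>The threshold at which ideals begin to fit into the strip of integral second
    coordinate; \<open>w0\<close> shows that large ideals do not fit.\<close>
  obtain j where Qj: "Q j" and nQj: "\<not> Q (j - 1)"
  proof -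
    define w0 where "w0 = \<iota> (inverse pF) * \<alpha>"
    have w0: "c2 w0 \<notin> fideal vF 0"
      using c_unique[of w0 0 "inverse pF"] pF by (simp add: w0_def fideal_def F.val_inverse)
    obtain k where "fideal vE k \<subseteq> Box 0 0" using Box_nbhd by blast
    then have k: "Q k" by (auto simp: Q_def Box_def)
    have nQ: "\<not> Q (vE w0)" using w0 by (auto simp: Q_def fideal_def)
    have mono: "Q b" if "Q a" "a \<le> b" for a b using that E.fideal_mono[of a b] by (auto simp: Q_def)
    have "k > vE w0" using mono[OF k, of "vE w0"] nQ by fastforce
    define l where "l = (LEAST l. Q (vE w0 + int l))"
    have "Q (vE w0 + int (nat (k - vE w0)))" using k \<open>k > vE w0\<close> by simp
    then have "Q (vE w0 + int l)" unfolding l_def by (rule LeastI)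
    moreover have "l \<noteq> 0" using calculation nQ by (intro notI) simp
    moreover have "\<not> Q (vE w0 + int (l - 1))"
      using not_less_Least[of "l - 1" "\<lambda>l. Q (vE w0 + int l)"] \<open>l \<noteq> 0\<close> unfolding l_def[symmetric] by simp
    ultimately show ?thesis using that[of "vE w0 + int l"] by (simp add: of_nat_diff algebra_simps)
  qed
  \<comment> \<open>The critical scale: strips through 1 in directions of this valuation contain all
    of \<open>U n\<close>, while level \<open>n - 1\<close> is too coarse for at least one of
    them.\<close>
  define e0 where "e0 = pE powi (j - int n)"
  have e0: "e0 \<noteq> 0" "vE e0 = j - int n" using pE by (simp_all add: e0_def E.val_power_int)
  obtain R where R: "finite R" "R \<subseteq> fideal vE 0" "\<And>x. x \<in> fideal vE 0 \<Longrightarrow> \<exists>!r. r \<in> R \<and> x - r \<in> fideal vE (int n)"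
    using E.finite_reps[of 0 "int n"] by auto
  define R' where "R' = {r\<in>R. r \<in> U 0}"
  have R'fin: "finite R'" using R(1) by (simp add: R'_def)
  define rep' where "rep' x = (THE r. r \<in> R \<and> x - r \<in> fideal vE (int n))" for x
  have rep'1: "rep' x \<in> R \<and> x - rep' x \<in> fideal vE (int n)" if "x \<in> fideal vE 0" for x
    unfolding rep'_def by (rule theI'[OF R(3)[OF that]])
  have rep': "rep' x \<in> R'" "x - rep' x \<in> fideal vE (int n)" if x: "x \<in> U 0" for x
  proof -
    have "x \<in> fideal vE 0" using x U_sub by blast
    then have r: "rep' x \<in> R \<and> x - rep' x \<in> fideal vE (int n)" by (rule rep'1)
    then show "x - rep' x \<in> fideal vE (int n)" by blast
    have "rep' x - x \<in> fideal vE 1" using r E.fideal_diff_commute[of x] E.fideal_monoD[of _ "int n" 1] n1 by auto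
    then have "rep' x \<in> U 0" using x E.val_stable[of x "rep' x"] by (simp add: U0)
    then show "rep' x \<in> R'" using r by (simp add: R'_def)
  qed
  \<comment> \<open>The strip through 1 with direction \<open>e0 * r\<close>, where \<open>r\<close>
    represents a unit modulo level \<open>n\<close>. Multiplication by \<open>e0 * r\<close> carries
    it to a coordinate strip in a sphere, whose integral is 0 by hypothesis.\<close>
  define \<sigma> where "\<sigma> r x \<longleftrightarrow> c2 (e0 * r * (x - 1)) \<in> fideal vF 0" for r x
  have I0: "(\<integral>x. \<rho> x * indicator {x\<in>U 0. \<sigma> r x} x \<partial>\<mu>) = 0"
    and I_int: "integrable \<mu> (\<lambda>x. \<rho> x * indicator {x\<in>U 0. \<sigma> r x} x)" if r: "r \<in> R'" for r
  proof -
    let ?a = "e0 * r"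
    have a: "?a \<noteq> 0" "vE ?a = j - int n" using r e0 by (auto simp: R'_def U0 E.val_mult)
    let ?S = "{x. x \<noteq> 0 \<and> vE x = j - int n \<and> c2 x - c2 ?a \<in> fideal vF 0}"
    let ?f = "\<lambda>x. \<rho> x * indicator ?S x"
    have S: "?S \<in> sets borel" using strip_open[of "j - int n" 1 "c2 ?a"] by simp
    have Sf: "?S \<subseteq> fideal vE (j - int n)" by (auto simp: fideal_def)
    have s: "?a * x \<in> ?S \<longleftrightarrow> x \<in> {x\<in>U 0. \<sigma> r x}" for x
      using a by (auto simp: U0 \<sigma>_def E.val_mult right_diff_distrib c_diff)
    have e: "?f (?a * x) = \<rho> ?a * (\<rho> x * indicator {x\<in>U 0. \<sigma> r x} x)" for x
      using s[of x] \<rho>_mult[OF a(1), of x] by (cases "x = 0") (auto simp: indicator_def \<rho>0)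
    have "(\<integral>x. ?f (?a * x) \<partial>\<mu>) = 0"
      unfolding H.scales_integrable(2)[OF H.scales_mult[OF a(1)] int[OF S Sf]] zero by simp
    then have "(\<integral>x. \<rho> ?a * (\<rho> x * indicator {x\<in>U 0. \<sigma> r x} x) \<partial>\<mu>) = 0" unfolding e .
    then have "\<rho> ?a * (\<integral>x. \<rho> x * indicator {x\<in>U 0. \<sigma> r x} x \<partial>\<mu>) = 0"
      by (simp only: integral_mult_right_zero)
    then show "(\<integral>x. \<rho> x * indicator {x\<in>U 0. \<sigma> r x} x \<partial>\<mu>) = 0" using \<rho>_norm[OF a(1)] by auto
    have "{x\<in>U 0. \<sigma> r x} = {x. x \<noteq> 0 \<and> vE x = 0 \<and> c2 (?a * x) - c2 ?a \<in> fideal vF 0}"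
      by (auto simp: U0 \<sigma>_def right_diff_distrib c_diff)
    then have "{x\<in>U 0. \<sigma> r x} \<in> sets borel" using strip_open[of 0 ?a "c2 ?a"] by simp
    then show "integrable \<mu> (\<lambda>x. \<rho> x * indicator {x\<in>U 0. \<sigma> r x} x)"
      using U_sub[of 0] by (intro int) auto
  qed
  \<comment> \<open>The number of strips through \<open>x\<close>. It depends only on the level of
    \<open>x\<close> in the filtration, since multiplication by a unit permutes the directions
    modulo level \<open>n\<close>.\<close>
  define W where "W x = card {r\<in>R'. \<sigma> r x}" for x
  define wk where "wk k = card {r\<in>R'. c2 (e0 * pE ^ k * r) \<in> fideal vF 0}" for k
  have Wn: "W x = card R'" if "x \<in> U n" for x
  proof -
    have "\<sigma> r x" if "r \<in> R'" for r
    proof -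
      have "e0 * r * (x - 1) \<in> fideal vE ((j - int n) + 0 + int n)"
        using \<open>x \<in> U n\<close> that e0 by (intro E.fideal_mult) (auto simp: U_def fideal_def R'_def)
      then show ?thesis using Qj by (simp add: \<sigma>_def Q_def)
    qed
    then have "{r\<in>R'. \<sigma> r x} = R'" by blast
    then show ?thesis by (simp add: W_def)
  qed
  have Wk: "W x = wk k" if x: "x \<in> U k" "x \<notin> U (Suc k)" and k: "k < n" for x k
  proof -
    have x1: "x - 1 \<noteq> 0" "vE (x - 1) = int k" using x by (auto simp: U_def fideal_def)
    define u where "u = (x - 1) / pE ^ k"
    have u: "u \<noteq> 0" "vE u = 0" "x - 1 = pE ^ k * u" using x1 pE by (simp_all add: u_def E.val_divide E.val_power)
    have ru: "r * u \<in> U 0" if "r \<in> R'" for r using that u by (auto simp: R'_def U0 E.val_mult)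
    define g where "g r = rep' (r * u)" for r
    have g: "g r \<in> R'" "r * u - g r \<in> fideal vE (int n)" if "r \<in> R'" for r
      using rep'[OF ru[OF that]] by (simp_all add: g_def)
    have inj: "inj_on g R'"
    proof (rule inj_onI)
      fix r s assume rs: "r \<in> R'" "s \<in> R'" "g r = g s"
      then have "r * u - s * u \<in> fideal vE (int n)"
        using g(2)[OF rs(1)] g(2)[OF rs(2)] E.fideal_diff_trans[of "r * u" "g r" _ "s * u"] E.fideal_diff_commute[of "g r" "s * u"] by auto
      then have "u * (r - s) \<in> fideal vE (int n)" by (simp add: algebra_simps)
      then have "r - s \<in> fideal vE (int n)" using E.fideal_scale[OF u(1), of "r - s" "int n"] u(2) by simp
      moreover have "r \<in> fideal vE 0" "r - r \<in> fideal vE (int n)" using rs(1) R(2) by (auto simp: R'_def)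
      ultimately show "r = s" using R(3)[of r] rs(1,2) by (auto simp: R'_def)
    qed
    have gR: "g ` R' = R'"
      by (rule card_subset_eq[OF R'fin]) (use g(1) card_image[OF inj] in auto)
    have eq: "\<sigma> r x \<longleftrightarrow> c2 (e0 * pE ^ k * g r) \<in> fideal vF 0" if r: "r \<in> R'" for r
    proof -
      have "e0 * pE ^ k * (r * u - g r) \<in> fideal vE ((j - int n) + int k + int n)"
        using g(2)[OF r] e0 pE by (intro E.fideal_mult) (auto simp: fideal_def E.val_power)
      then have "c2 (e0 * pE ^ k * (r * u - g r)) \<in> fideal vF 0"
        using Qj E.fideal_monoD[of _ "(j - int n) + int k + int n" j] by (auto simp: Q_def)
      moreover have "e0 * pE ^ k * (r * u - g r) = e0 * r * (x - 1) - e0 * pE ^ k * g r"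
        unfolding u(3) by (simp add: algebra_simps)
      ultimately have d: "c2 (e0 * r * (x - 1)) - c2 (e0 * pE ^ k * g r) \<in> fideal vF 0" by (simp add: c_diff)
      show ?thesis
        using F.fideal_add[OF d, of "c2 (e0 * pE ^ k * g r)"] F.fideal_diff[of "c2 (e0 * r * (x - 1))" 0, OF _ d]
        by (auto simp: \<sigma>_def)
    qed
    have "{r\<in>R'. c2 (e0 * pE ^ k * r) \<in> fideal vF 0} = g ` {r\<in>R'. \<sigma> r x}"
    proof (intro set_eqI iffI)
      fix r assume r: "r \<in> {r\<in>R'. c2 (e0 * pE ^ k * r) \<in> fideal vF 0}"
      then have "r \<in> g ` R'" unfolding gR by blast
      then obtain s where "s \<in> R'" "r = g s" by blast
      then show "r \<in> g ` {r\<in>R'. \<sigma> r x}" using r eq[of s] by blast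
    qed (use eq g(1) in auto)
    then have "wk k = card {r\<in>R'. \<sigma> r x}"
      unfolding wk_def using card_image[OF inj_on_subset[OF inj]] by (metis (no_types, lifting) mem_Collect_eq subsetI)
    then show ?thesis by (simp add: W_def)
  qed
  \<comment> \<open>By the choice of \<open>j\<close> some element of valuation \<open>j - 1\<close>
    has nonintegral second coordinate; dividing it by \<open>e0 * pE ^ (n - 1)\<close> gives a
    direction that is not counted.\<close>
  have wk_less: "wk (n - 1) < card R'"
  proof -
    obtain w where w: "w \<in> fideal vE (j - 1)" "c2 w \<notin> fideal vF 0" using nQj by (auto simp: Q_def)
    then have "w \<notin> fideal vE j" using Qj by (auto simp: Q_def)
    then have w': "w \<noteq> 0" "vE w = j - 1" using w by (auto simp: fideal_def)
    let ?b = "e0 * pE ^ (n - 1)"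
    have b: "?b \<noteq> 0" "vE ?b = j - 1" using e0 pE n1 by (simp_all add: E.val_mult E.val_power of_nat_diff)
    define \<epsilon> where "\<epsilon> = w / ?b"
    have \<epsilon>: "\<epsilon> \<in> U 0" "w = ?b * \<epsilon>" using w' b by (simp_all add: \<epsilon>_def U0 E.val_divide)
    let ?r = "rep' \<epsilon>"
    have "?b * (\<epsilon> - ?r) \<in> fideal vE ((j - 1) + int n)"
      using rep'(2)[OF \<epsilon>(1)] b by (intro E.fideal_mult) (auto simp: fideal_def)
    then have "c2 (?b * (\<epsilon> - ?r)) \<in> fideal vF 0"
      using Qj n1 E.fideal_monoD[of _ "(j - 1) + int n" j] by (auto simp: Q_def)
    then have d: "c2 w - c2 (?b * ?r) \<in> fideal vF 0" by (simp add: \<epsilon>(2) right_diff_distrib c_diff)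
    then have "c2 (?b * ?r) \<notin> fideal vF 0" using F.fideal_add[OF d, of "c2 (?b * ?r)"] w(2) by auto
    then have "{r\<in>R'. c2 (?b * r) \<in> fideal vF 0} \<subset> R'" using rep'(1)[OF \<epsilon>(1)] by blast
    then show ?thesis unfolding wk_def by (rule psubset_card_mono[OF R'fin])
  qed
  have U_mono: "U k \<subseteq> U l" if "l \<le> k" for k l using that E.fideal_monoD[of _ "int k" "int l"] by (auto simp: U_def)
  have decomp: "(of_nat (W x) :: complex) * indicator (U 0) x =
      of_nat (card R') * indicator (U n) x + (\<Sum>k<n. of_nat (wk k) * (indicator (U k) x - indicator (U (Suc k)) x))" for x
  proof (cases "x \<in> U n")
    case True
    have "(indicator (U k) x - indicator (U (Suc k)) x :: complex) = 0" if "k < n" for k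
      using True U_mono[of k n] U_mono[of "Suc k" n] that by (auto simp: indicator_def)
    then have "(\<Sum>k<n. of_nat (wk k) * (indicator (U k) x - indicator (U (Suc k)) x :: complex)) = 0"
      by (intro sum.neutral) auto
    then show ?thesis using Wn[OF True] True U_mono[of 0 n] by auto
  next
    case False
    show ?thesis
    proof (cases "x \<in> U 0")
      case x0: True
      define k where "k = (LEAST k. x \<notin> U (Suc k))"
      have ex: "x \<notin> U (Suc (n - 1))" using False n1 by simp
      have k1: "x \<notin> U (Suc k)" unfolding k_def by (rule LeastI[of "\<lambda>k. x \<notin> U (Suc k)"], rule ex)
      have "k \<le> n - 1" unfolding k_def by (rule Least_le[of "\<lambda>k. x \<notin> U (Suc k)"], rule ex)
      then have kn: "k < n" using n1 by simp
      have kl: "x \<in> U l" if "l \<le> k" for l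
      proof (cases l)
        case 0 then show ?thesis using x0 by simp
      next
        case (Suc l')
        then show ?thesis using not_less_Least[of l' "\<lambda>k. x \<notin> U (Suc k)"] that unfolding k_def[symmetric] by simp
      qed
      have gt: "x \<notin> U l" if "k < l" for l using k1 U_mono[of "Suc k" l] that by auto
      have "(\<Sum>i<n. of_nat (wk i) * (indicator (U i) x - indicator (U (Suc i)) x :: complex)) =
        (\<Sum>i<n. if i = k then of_nat (wk i) else 0)"
      proof (rule sum.cong)
        fix i assume "i \<in> {..<n}"
        show "of_nat (wk i) * (indicator (U i) x - indicator (U (Suc i)) x :: complex) = (if i = k then of_nat (wk i) else 0)"
          using kl[of i] kl[of "Suc i"] gt[of i] gt[of "Suc i"] by (cases i k rule: linorder_cases) auto
      qed simp
      also have "\<dots> = of_nat (wk k)" using kn by simp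
      finally show ?thesis using Wk[OF kl[of k] k1 kn] x0 False by simp
    next
      case x0: False
      have "x \<notin> U k" for k using x0 U_mono[of 0 k] by auto
      then show ?thesis by simp
    qed
  qed
  have intU: "integrable \<mu> (\<lambda>x. \<rho> x * indicator (U k) x)" for k by (rule int[OF U_borel U_sub])
  \<comment> \<open>The sum of the strip integrals weights the layers of the filtration by
    \<open>wk\<close>. Only \<open>Fk n\<close> survives, with the positive coefficient
    \<open>card R' - wk (n - 1)\<close>.\<close>
  have "0 = (\<Sum>r\<in>R'. \<integral>x. \<rho> x * indicator {x\<in>U 0. \<sigma> r x} x \<partial>\<mu>)" using I0 by simp
  also have "\<dots> = (\<integral>x. (\<Sum>r\<in>R'. \<rho> x * indicator {x\<in>U 0. \<sigma> r x} x) \<partial>\<mu>)"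
    using I_int by (intro Bochner_Integration.integral_sum[symmetric])
  also have "\<dots> = (\<integral>x. \<rho> x * (of_nat (W x) * indicator (U 0) x) \<partial>\<mu>)"
  proof (rule Bochner_Integration.integral_cong[OF refl])
    fix x
    have "(\<Sum>r\<in>R'. indicator {x\<in>U 0. \<sigma> r x} x :: complex) = (\<Sum>r\<in>R'. if \<sigma> r x then indicator (U 0) x else 0)"
      by (intro sum.cong refl) (simp add: indicator_def)
    also have "\<dots> = of_nat (W x) * indicator (U 0) x"
      using R'fin by (simp add: sum.If_cases W_def Int_def)
    finally show "(\<Sum>r\<in>R'. \<rho> x * indicator {x\<in>U 0. \<sigma> r x} x) = \<rho> x * (of_nat (W x) * indicator (U 0) x)"
      by (simp add: sum_distrib_left[symmetric])
  qed
  also have "\<dots> = (\<integral>x. of_nat (card R') * (\<rho> x * indicator (U n) x) +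
      (\<Sum>k<n. of_nat (wk k) * (\<rho> x * indicator (U k) x - \<rho> x * indicator (U (Suc k)) x)) \<partial>\<mu>)"
    unfolding decomp by (intro Bochner_Integration.integral_cong refl) (simp add: algebra_simps sum_distrib_left)
  also have "\<dots> = of_nat (card R') * Fk n + (\<Sum>k<n. of_nat (wk k) * (Fk k - Fk (Suc k)))"
    using intU by (simp add: Fk_def)
  also have "(\<Sum>k<n. of_nat (wk k) * (Fk k - Fk (Suc k))) = (\<Sum>k<n. if k = n - 1 then of_nat (wk k) * (- Fk n) else 0)"
    by (rule sum.cong) (use F0 n1 in auto)
  also have "\<dots> = - (of_nat (wk (n - 1)) * Fk n)" using n1 by simp
  finally have "(of_nat (card R') - of_nat (wk (n - 1))) * Fk n = 0" by (auto simp: algebra_simps)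
  then show False using Fn wk_less by simp
qed

end

section \<open>Poles\<close>

context kernel_params
begin

lemma omega_plus_unit: "u \<in> int_units vF \<Longrightarrow> omega_plus u = chi (\<iota> u) * eta u"
  and omega_minus_unit: "u \<in> int_units vF \<Longrightarrow> omega_minus u = chi (\<iota> u) / eta u"
proof -
  assume u: "u \<in> int_units vF"
  then have "\<iota> u \<in> int_units vE" by (simp add: F.int_units_iff E.int_units_iff val_iota)
  with u show "omega_plus u = chi (\<iota> u) * eta u" "omega_minus u = chi (\<iota> u) / eta u"
    by (simp_all add: omega_plus_def omega_minus_def chiE_unit etaF_unit)
qed

lemma exp_lnq_eq_1: "exp (- of_real lnq * w) = 1 \<longleftrightarrow> (\<exists>k::int. w = 2 * of_real pi * \<i> / of_real (ln qF) * of_int k)"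
proof -
  have l: "complex_of_real lnq \<noteq> 0" "complex_of_real (ln qF) = of_real lnq" using lnq_pos by (simp_all add: lnq_def)
  have "exp (- of_real lnq * w) = 1 \<longleftrightarrow> (\<exists>n::int. - of_real lnq * w = of_int (2 * n) * pi * \<i>)"
    using exp_eq[of "- of_real lnq * w" 0] by simp
  also have "\<dots> \<longleftrightarrow> (\<exists>k::int. w = 2 * of_real pi * \<i> / of_real (ln qF) * of_int k)"
  proof
    assume "\<exists>n::int. - of_real lnq * w = of_int (2 * n) * pi * \<i>"
    then obtain n :: int where "- of_real lnq * w = of_int (2 * n) * pi * \<i>" by blast
    then have "of_real lnq * w = - (of_int (2 * n) * pi * \<i>)" by (metis minus_equation_iff mult_minus_left)
    then have "w = 2 * of_real pi * \<i> / of_real lnq * of_int (- n)" using l by (simp add: field_simps)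
    then show "\<exists>k::int. w = 2 * of_real pi * \<i> / of_real (ln qF) * of_int k" unfolding l(2) by blast
  next
    assume "\<exists>k::int. w = 2 * of_real pi * \<i> / of_real (ln qF) * of_int k"
    then obtain k :: int where "w = 2 * of_real pi * \<i> / of_real lnq * of_int k" unfolding l(2) by blast
    then have "- of_real lnq * w = of_int (2 * (- k)) * pi * \<i>" using l by (simp add: field_simps)
    then show "\<exists>n::int. - of_real lnq * w = of_int (2 * n) * pi * \<i>" by blast
  qed
  finally show ?thesis .
qed

lemma pole_set_iff: "z \<in> pole_set \<longleftrightarrow> (triv_plus \<and> A_plus z = 1) \<or> (triv_minus \<and> A_minus z = 1)"
  by (auto simp: pole_set_def pole_factor_def factor_plus_def factor_minus_def)

lemma pole_params_iff:
  "(chi, s, eta, t) \<in> pole_params vF vE \<iota> 1 \<union> pole_params vF vE \<iota> (- 1) \<longleftrightarrow> (s, t) \<in> pole_set"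
proof -
  have "triv_plus \<longleftrightarrow> (\<forall>u\<in>int_units vF. chi (\<iota> u) * eta u powi 1 = 1)"
    by (simp add: triv_plus_def omega_plus_unit)
  moreover have "triv_minus \<longleftrightarrow> (\<forall>u\<in>int_units vF. chi (\<iota> u) * eta u powi (- 1) = 1)"
    by (simp add: triv_minus_def omega_minus_unit divide_inverse power_int_minus)
  moreover have "A_plus (s, t) = 1 \<longleftrightarrow> (\<exists>k::int. 2 * s + of_int 1 * t + 1/2 = 2 * of_real pi * \<i> / of_real (ln qF) * of_int k)"
    unfolding A_plus_def exp_lnq_eq_1 by simp
  moreover have "A_minus (s, t) = 1 \<longleftrightarrow> (\<exists>k::int. 2 * s + of_int (- 1) * t + 1/2 = 2 * of_real pi * \<i> / of_real (ln qF) * of_int k)"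
    unfolding A_minus_def exp_lnq_eq_1 by simp
  ultimately show ?thesis
    using chi eta unfolding pole_set_iff pole_params_def Un_iff mem_Collect_eq prod.case by blast
qed

text \<open>Along a real segment each of the two equations holds at most once, since the real
  exponential is injective; a small parameter avoiding both remains. The slope \<open>c\<close>
  chooses the direction.\<close>

lemma nearby_parameter:
  fixes s t c a b :: complex
  assumes U: "open U" "(s, t) \<in> U" and r: "r > 0"
  shows "\<exists>\<epsilon>::real. (s + of_real \<epsilon>, t + c * of_real \<epsilon>) \<in> U \<and>
    a * exp (- of_real (r * \<epsilon>)) \<noteq> (1::complex) \<and> b * exp (- of_real (r * \<epsilon>)) \<noteq> (1::complex)"
proof -
  have "((\<lambda>\<epsilon>. (s + of_real \<epsilon>, t + c * of_real \<epsilon>)) \<longlongrightarrow> (s + of_real 0, t + c * of_real 0)) (at_right 0)"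
    by (intro tendsto_intros)
  then have "\<forall>\<^sub>F \<epsilon> in at_right 0. (s + of_real \<epsilon>, t + c * of_real \<epsilon>) \<in> U"
    using U by (auto dest: topological_tendstoD)
  then obtain \<delta> :: real where \<delta>: "\<delta> > 0" "\<And>\<epsilon>. 0 < \<epsilon> \<Longrightarrow> \<epsilon> < \<delta> \<Longrightarrow> (s + of_real \<epsilon>, t + c * of_real \<epsilon>) \<in> U"
    unfolding eventually_at_right_field by blast
  have fin: "finite {\<epsilon>::real. a * exp (- of_real (r * \<epsilon>)) = (1::complex)}" for a
  proof -
    have "\<epsilon> = \<epsilon>'" if "a * exp (- of_real (r * \<epsilon>)) = (1::complex)" "a * exp (- of_real (r * \<epsilon>')) = (1::complex)" for \<epsilon> \<epsilon>' :: real
    proof -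
      have "a \<noteq> 0" using that by auto
      then have "complex_of_real (exp (- (r * \<epsilon>))) = of_real (exp (- (r * \<epsilon>')))"
        using that by (metis exp_of_real mult_cancel_left of_real_minus)
      then have "exp (- (r * \<epsilon>)) = exp (- (r * \<epsilon>'))" by (simp only: of_real_eq_iff)
      then show ?thesis using r by simp
    qed
    then have "{\<epsilon>::real. a * exp (- of_real (r * \<epsilon>)) = (1::complex)} \<subseteq> {SOME \<epsilon>. a * exp (- of_real (r * \<epsilon>)) = 1}"
      by (metis (mono_tags, lifting) mem_Collect_eq singletonI someI subsetI)
    then show ?thesis by (rule finite_subset) simp
  qed
  have "infinite {0<..<\<delta>}" using \<delta>(1) by simp
  then have "infinite ({0<..<\<delta>} - ({\<epsilon>. a * exp (- of_real (r * \<epsilon>)) = 1} \<union> {\<epsilon>. b * exp (- of_real (r * \<epsilon>)) = 1}))"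
    using fin by (intro Diff_infinite_finite) auto
  then obtain \<epsilon> where "\<epsilon> \<in> {0<..<\<delta>} - ({\<epsilon>. a * exp (- of_real (r * \<epsilon>)) = 1} \<union> {\<epsilon>. b * exp (- of_real (r * \<epsilon>)) = 1})"
    by (metis finite.emptyI ex_in_conv)
  then show ?thesis using \<delta>(2) by auto
qed

lemma A_plus_shift: "A_plus (s + of_real \<epsilon>, t + c * of_real \<epsilon>) = A_plus (s, t) * exp (- (of_real lnq * (2 + c) * of_real \<epsilon>))"
  and A_minus_shift: "A_minus (s + of_real \<epsilon>, t + c * of_real \<epsilon>) = A_minus (s, t) * exp (- (of_real lnq * (2 - c) * of_real \<epsilon>))"
  unfolding A_plus_def A_minus_def exp_add[symmetric] by (simp_all add: algebra_simps)

lemma off_poles_dense: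
  assumes "open U" "p \<in> U" shows "\<exists>w\<in>U. w \<notin> pole_set"
proof -
  obtain s t where p: "p = (s, t)" by fastforce
  obtain \<epsilon> :: real where e: "(s + of_real \<epsilon>, t + 0 * of_real \<epsilon>) \<in> U"
    "A_plus (s, t) * exp (- of_real ((2 * lnq) * \<epsilon>)) \<noteq> 1" "A_minus (s, t) * exp (- of_real ((2 * lnq) * \<epsilon>)) \<noteq> 1"
    using nearby_parameter[OF assms(1) assms(2)[unfolded p], of "2 * lnq" 0 "A_plus (s, t)" "A_minus (s, t)"] lnq_pos by auto
  then have "(s + of_real \<epsilon>, t + 0 * of_real \<epsilon>) \<notin> pole_set"
    unfolding pole_set_iff A_plus_shift A_minus_shift by (simp add: mult_ac)
  then show ?thesis using e(1) by blast
qed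

text \<open>Moving along \<open>(1, - 2)\<close> keeps 2s + t fixed while 2s - t changes; so points
  on the first branch only are dense in it.\<close>

lemma pole_plus_smooth:
  assumes "open U" "p \<in> U" "triv_plus" "A_plus p = 1" shows "\<exists>w\<in>U. A_plus w = 1 \<and> factor_minus w \<noteq> 0"
proof -
  obtain s t where p: "p = (s, t)" by fastforce
  obtain \<epsilon> :: real where e: "(s + of_real \<epsilon>, t + (- 2) * of_real \<epsilon>) \<in> U"
    "A_minus (s, t) * exp (- of_real ((4 * lnq) * \<epsilon>)) \<noteq> 1"
    using nearby_parameter[OF assms(1) assms(2)[unfolded p], of "4 * lnq" "- 2" "A_minus (s, t)"] lnq_pos by auto
  have "A_plus (s + of_real \<epsilon>, t + (- 2) * of_real \<epsilon>) = 1" "factor_minus (s + of_real \<epsilon>, t + (- 2) * of_real \<epsilon>) \<noteq> 0"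
    using assms(4) e(2) unfolding factor_minus_def A_plus_shift A_minus_shift by (simp_all add: p mult_ac)
  then show ?thesis using e(1) by blast
qed

lemma pole_minus_smooth:
  assumes "open U" "p \<in> U" "triv_minus" "A_minus p = 1" shows "\<exists>w\<in>U. A_minus w = 1 \<and> factor_plus w \<noteq> 0"
proof -
  obtain s t where p: "p = (s, t)" by fastforce
  obtain \<epsilon> :: real where e: "(s + of_real \<epsilon>, t + 2 * of_real \<epsilon>) \<in> U"
    "A_plus (s, t) * exp (- of_real ((4 * lnq) * \<epsilon>)) \<noteq> 1"
    using nearby_parameter[OF assms(1) assms(2)[unfolded p], of "4 * lnq" 2 "A_plus (s, t)"] lnq_pos by auto
  have "A_minus (s + of_real \<epsilon>, t + 2 * of_real \<epsilon>) = 1" "factor_plus (s + of_real \<epsilon>, t + 2 * of_real \<epsilon>) \<noteq> 0"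
    using assms(4) e(2) unfolding factor_plus_def A_plus_shift A_minus_shift by (simp_all add: p mult_ac)
  then show ?thesis using e(1) by blast
qed

lemma product_derivative_nonzero:
  assumes f: "(f has_derivative (\<lambda>h. c * fst h + c' * snd h)) (at w)" "f w = 0" "c \<noteq> 0"
    and g: "entire2 g" "g w \<noteq> 0"
  shows "\<not> ((\<lambda>z. g z * f z) has_derivative (\<lambda>_. 0)) (at w)"
proof
  assume 0: "((\<lambda>z. g z * f z) has_derivative (\<lambda>_. 0)) (at w)"
  obtain A B where "(g has_derivative (\<lambda>h. A * fst h + B * snd h)) (at w)"
    using g(1) unfolding entire2_def holomorphic2_on_iff by blast
  from has_derivative_mult[OF this f(1)]
  have "(\<lambda>_. 0) = (\<lambda>h. g w * (c * fst h + c' * snd h) + (A * fst h + B * snd h) * f w)"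
    using 0 has_derivative_unique by blast
  from fun_cong[OF this, of "(1, 0)"] show False using f(2,3) g(2) by simp
qed

lemma has_derivative_exp_complex:
  fixes f :: "complex \<times> complex \<Rightarrow> complex"
  assumes "(f has_derivative f') (at w)"
  shows "((\<lambda>z. exp (f z)) has_derivative (\<lambda>h. exp (f w) * f' h)) (at w)"
  using has_derivative_compose[OF assms, of exp "(*) (exp (f w))"] DERIV_exp[of "f w"]
  by (simp add: has_field_derivative_def)

lemma factor_plus_derivative: "triv_plus \<Longrightarrow> (factor_plus has_derivative (\<lambda>h. (2 * of_real lnq * A_plus w) * fst h + (of_real lnq * A_plus w) * snd h)) (at w)"
proof -
  assume triv_plus
  have "((\<lambda>z. - of_real lnq * (2 * fst z + snd z + 1/2)) has_derivative (\<lambda>h. - of_real lnq * (2 * fst h + snd h))) (at w)"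
    by (auto intro!: derivative_eq_intros)
  from has_derivative_diff[OF has_derivative_const[of 1] has_derivative_exp_complex[OF this]]
  have d: "((\<lambda>z. 1 - A_plus z) has_derivative (\<lambda>h. 0 - A_plus w * (- of_real lnq * (2 * fst h + snd h)))) (at w)"
    unfolding A_plus_def .
  have "factor_plus = (\<lambda>z. 1 - A_plus z)" using \<open>triv_plus\<close> by (simp add: factor_plus_def[abs_def])
  moreover have "(\<lambda>h. 0 - A_plus w * (- of_real lnq * (2 * fst h + snd h))) =
      (\<lambda>h. (2 * of_real lnq * A_plus w) * fst h + (of_real lnq * A_plus w) * snd h)"
    by (intro HOL.ext) (simp add: algebra_simps)
  ultimately show ?thesis using d by metis
qed

lemma factor_minus_derivative: "triv_minus \<Longrightarrow> (factor_minus has_derivative (\<lambda>h. (2 * of_real lnq * A_minus w) * fst h + (- of_real lnq * A_minus w) * snd h)) (at w)"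
proof -
  assume triv_minus
  have "((\<lambda>z. - of_real lnq * (2 * fst z - snd z + 1/2)) has_derivative (\<lambda>h. - of_real lnq * (2 * fst h - snd h))) (at w)"
    by (auto intro!: derivative_eq_intros)
  from has_derivative_diff[OF has_derivative_const[of 1] has_derivative_exp_complex[OF this]]
  have d: "((\<lambda>z. 1 - A_minus z) has_derivative (\<lambda>h. 0 - A_minus w * (- of_real lnq * (2 * fst h - snd h)))) (at w)"
    unfolding A_minus_def .
  have "factor_minus = (\<lambda>z. 1 - A_minus z)" using \<open>triv_minus\<close> by (simp add: factor_minus_def[abs_def])
  moreover have "(\<lambda>h. 0 - A_minus w * (- of_real lnq * (2 * fst h - snd h))) =
      (\<lambda>h. (2 * of_real lnq * A_minus w) * fst h + (- of_real lnq * A_minus w) * snd h)"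
    by (intro HOL.ext) (simp add: algebra_simps)
  ultimately show ?thesis using d by metis
qed

text \<open>At a point on exactly one branch the product rule leaves the nonzero derivative of one
  factor times the nonzero value of the other. Crossing points are limits of such points.\<close>

lemma reduced_equation_pole_factor: "reduced_equation pole_set UNIV pole_factor"
  unfolding reduced_equation_def
proof (intro conjI)
  show "holomorphic2_on pole_factor UNIV" using entire_pole_factor by (simp add: entire2_def)
  show "pole_set \<inter> UNIV = {z\<in>UNIV. pole_factor z = 0}" by (simp add: pole_set_def)
  let ?N = "{z \<in> pole_set \<inter> UNIV. \<not> (pole_factor has_derivative (\<lambda>_. 0)) (at z)}"
  have lnq: "complex_of_real lnq \<noteq> 0" using lnq_pos by simp
  have pole_factor_comm: "pole_factor = (\<lambda>z. factor_plus z * factor_minus z)" by (intro HOL.ext) (simp add: pole_factor_def)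
  have 1: "w \<in> ?N" if w: "triv_plus" "A_plus w = 1" "factor_minus w \<noteq> 0" for w
    using product_derivative_nonzero[OF factor_plus_derivative[OF w(1), of w] _ _ entire_factor_minus w(3)] w lnq
    by (simp add: pole_set_iff factor_plus_def pole_factor_def[abs_def])
  have 2: "w \<in> ?N" if w: "triv_minus" "A_minus w = 1" "factor_plus w \<noteq> 0" for w
    using product_derivative_nonzero[OF factor_minus_derivative[OF w(1), of w] _ _ entire_factor_plus w(3)] w lnq
    by (simp add: pole_set_iff factor_minus_def pole_factor_comm)
  show "pole_set \<inter> UNIV \<subseteq> closure ?N"
  proof
    fix p assume p: "p \<in> pole_set \<inter> UNIV"
    show "p \<in> closure ?N"
    proof (rule ccontr)
      assume "p \<notin> closure ?N"
      then have U: "open (- closure ?N)" "p \<in> - closure ?N" by auto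
      have "\<exists>w\<in>- closure ?N. w \<in> ?N"
      proof (cases "triv_plus \<and> A_plus p = 1")
        case True
        then show ?thesis using pole_plus_smooth[OF U] 1 by blast
      next
        case False
        then have "triv_minus" "A_minus p = 1" using p by (auto simp: pole_set_iff)
        then show ?thesis using pole_minus_smooth[OF U] 2 by blast
      qed
      then show False using closure_subset[of ?N] by blast
    qed
  qed
qed simp

lemma K_ext_holomorphic: "\<phi> \<in> test_fun UNIV \<Longrightarrow> holomorphic2_on (\<lambda>z. K_ext z \<phi>) (- pole_set)"
  unfolding K_ext_def using entire_entire_ext[of \<phi>] entire_pole_factor
  by (intro holomorphic2_divide) (auto simp: entire2_def pole_set_def intro: holomorphic2_on_subset)

lemma K_ext_simple_pole: "\<phi> \<in> test_fun UNIV \<Longrightarrow> at_most_simple_pole pole_set (\<lambda>z. K_ext z \<phi>) p"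
  unfolding at_most_simple_pole_def
  using reduced_equation_pole_factor entire_entire_ext[of \<phi>]
  by (intro exI[of _ UNIV] exI[of _ pole_factor] exI[of _ "entire_ext \<phi>"]) (auto simp: K_ext_def entire2_def)

lemma holomorphic2_isCont: "holomorphic2_on f U \<Longrightarrow> w \<in> U \<Longrightarrow> isCont f w"
  unfolding holomorphic2_on_def using has_derivative_continuous by blast

text \<open>Off the poles \<open>entire_ext \<phi>\<close> is a holomorphic function times
  \<open>pole_factor\<close>; such points are dense and both sides continuous, so it vanishes where
  \<open>pole_factor\<close> does. Nonremovability thus reduces to a nonzero value at a nearby
  pole.\<close>

lemma removable_imp_zero:
  assumes \<phi>: "\<phi> \<in> test_fun UNIV" and rem: "removable pole_set (\<lambda>z. K_ext z \<phi>) p"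
  obtains U where "open U" "p \<in> U" "\<And>w. w \<in> U \<Longrightarrow> w \<in> pole_set \<Longrightarrow> entire_ext \<phi> w = 0"
proof -
  obtain U h where U: "open U" "p \<in> U" and h: "holomorphic2_on h U" "\<And>z. z \<in> U - pole_set \<Longrightarrow> K_ext z \<phi> = h z"
    using rem unfolding removable_def by blast
  have "entire_ext \<phi> w = 0" if w: "w \<in> U" "w \<in> pole_set" for w
  proof (rule ccontr)
    assume nz: "entire_ext \<phi> w \<noteq> 0"
    define f where "f z = entire_ext \<phi> z - h z * pole_factor z" for z
    have "isCont (entire_ext \<phi>) w" "isCont pole_factor w" "isCont h w"
      using entire_entire_ext[OF \<phi>] entire_pole_factor h(1) w(1) holomorphic2_isCont unfolding entire2_def by blast+
    then have "isCont f w" unfolding f_def by (intro continuous_intros)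
    moreover have "f w \<noteq> 0" using nz w(2) by (simp add: f_def pole_set_def)
    ultimately have "\<forall>\<^sub>F z in nhds w. f z \<noteq> 0"
      unfolding isCont_def tendsto_at_iff_tendsto_nhds by (auto dest: tendsto_imp_eventually_ne)
    then obtain V where V: "open V" "w \<in> V" "\<And>z. z \<in> V \<Longrightarrow> f z \<noteq> 0" unfolding eventually_nhds by blast
    obtain z where z: "z \<in> U \<inter> V" "z \<notin> pole_set" using off_poles_dense[of "U \<inter> V" w] U(1) V w(1) by blast
    then have "entire_ext \<phi> z = h z * pole_factor z" using h(2)[of z] by (simp add: K_ext_def pole_set_def field_simps)
    then show False using V(3)[of z] z(1) by (simp add: f_def)
  qed
  then show ?thesis using that U by blast
qed

text \<open>Every nonzero element is a unit times a power of \<open>pF\<close>, and both characters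
  are 1 at \<open>pF\<close>.\<close>

lemma omega_plus_trivial: "triv_plus \<Longrightarrow> a \<noteq> 0 \<Longrightarrow> omega_plus a = 1" and omega_minus_trivial: "triv_minus \<Longrightarrow> a \<noteq> 0 \<Longrightarrow> omega_minus a = 1"
proof -
  have pw: "omega_plus (pF powi n) = 1 \<and> omega_minus (pF powi n) = 1" for n
  proof -
    have "omega_plus (pF ^ k) = 1 \<and> omega_minus (pF ^ k) = 1" for k
      by (induction k) (use pF in \<open>simp_all add: omega_plus_mult omega_minus_mult omega_plus_pF omega_minus_pF omega_plus_1 omega_minus_1\<close>)
    moreover have "omega_plus (inverse x) = inverse (omega_plus x)" "omega_minus (inverse x) = inverse (omega_minus x)" if "x \<noteq> 0" for x
      using that omega_plus_mult[of x "inverse x"] omega_minus_mult[of x "inverse x"] omega_plus_1 omega_minus_1 by (simp_all add: inverse_unique)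
    ultimately show ?thesis using pF by (simp add: power_int_def power_inverse)
  qed
  assume a: "a \<noteq> 0"
  have a': "a = (a * pF powi (- vF a)) * pF powi (vF a)" "a * pF powi (- vF a) \<in> int_units vF"
    using a pF by (simp_all add: F.int_units_iff F.val_mult F.val_inverse F.val_power_int power_int_minus)
  have nz: "a * pF powi (- vF a) \<noteq> 0" "pF powi (vF a) \<noteq> 0" using a pF by simp_all
  show "omega_plus a = 1" if triv_plus using omega_plus_mult[OF nz] pw[of "vF a"] a' that by (simp add: triv_plus_def)
  show "omega_minus a = 1" if triv_minus using omega_minus_mult[OF nz] pw[of "vF a"] a' that by (simp add: triv_minus_def)
qed

text \<open>On a small box around 1 \<open>Gz\<close> is 1 and, chi times eta being trivial, the
  kernel equals \<open>E z\<close> on the outer layer \<open>b'\<close>. The numerator is therefore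
  \<open>factor_minus\<close> times a nowhere vanishing function, and
  \<open>pole_plus_smooth\<close> supplies poles near \<open>p\<close> where
  \<open>factor_minus\<close> is nonzero.\<close>

lemma pole_plus_not_removable:
  assumes p: "triv_plus" "A_plus p = 1"
  shows "\<exists>\<phi>\<in>test_fun UNIV. \<not> removable pole_set (\<lambda>z. K_ext z \<phi>) p"
proof -
  have "1 \<noteq> (0::'e)" by simp
  from Gz_stretch_inv[OF this] obtain N where N: "\<And>y n. y \<in> boxat 1 N \<Longrightarrow> n \<ge> N \<Longrightarrow> c2 y \<in> fideal vF n \<Longrightarrow>
     boxat y n = boxat (\<iota> (c1 y)) n \<and>
    (\<forall>u\<in>boxat (\<iota> (c1 y)) n. \<forall>a\<in>fideal vF 0. \<forall>z. Gz z (stretch a u) = Gz z u \<and> Gz z u = Gz z 1)" by blast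
  let ?b = "boxat (\<iota> 1) N"
  have G: "\<And>u a z. u \<in> ?b \<Longrightarrow> a \<in> fideal vF 0 \<Longrightarrow> Gz z (stretch a u) = Gz z u"
    and G1: "\<And>u z. u \<in> ?b \<Longrightarrow> Gz z u = Gz z 1"
  proof -
    have "1 \<in> boxat 1 N" "c2 1 \<in> fideal vF N" by simp_all
    from N[OF this(1) order_refl this(2)] have
      *: "\<forall>u\<in>boxat (\<iota> (c1 1)) N. \<forall>a\<in>fideal vF 0. \<forall>z. Gz z (stretch a u) = Gz z u \<and> Gz z u = Gz z 1" by blast
    show "\<And>u a z. u \<in> ?b \<Longrightarrow> a \<in> fideal vF 0 \<Longrightarrow> Gz z (stretch a u) = Gz z u" using * unfolding c_1 by blast
    show "\<And>u z. u \<in> ?b \<Longrightarrow> Gz z u = Gz z 1" using * F.zero_in_fideal[of 0] unfolding c_1 by blast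
  qed
  have Gz1: "Gz z 1 = 1" for z
    by (simp add: Gz_def chiE_1 omega_plus_1 nrm_def)
  define b' where "b' = ?b - {x. c2 x \<in> fideal vF (N + 1)}"
  define E where "E z = exp (- of_real lnq * (of_int N * (2 * fst z + snd z - 1/2)))" for z :: "complex \<times> complex"
  have K: "Kz z x * indicator b' x = E z * complex_of_real (indicator b' x)" for z x
  proof (cases "x \<in> b'")
    case True
    then have "c2 x \<in> fideal vF N" "c2 x \<notin> fideal vF (N + 1)" "x \<in> ?b"
      by (auto simp: b'_def boxat_def Box_def c_diff)
    then have "c2 x \<noteq> 0" "vF (c2 x) = N" by (auto simp: fideal_def)
    then show ?thesis using True G1[OF \<open>x \<in> ?b\<close>] Gz1 omega_plus_trivial[OF p(1)] by (simp add: Kz_factor Hz_def E_def)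
  qed simp
  obtain a where a: "a \<noteq> 0" "vF a = N" using F.ex_val by blast
  \<comment> \<open>Centre of a box inside the layer, with second coordinate of valuation exactly
    \<open>N\<close>; the layer thus has positive volume.\<close>
  define y where "y = \<iota> 1 + \<iota> a * \<alpha>"
  have sub: "boxat y (N + 1) \<subseteq> b'"
  proof
    fix x assume "x \<in> boxat y (N + 1)"
    then have x: "c1 x - 1 \<in> fideal vF (N + 1)" "c2 x - a \<in> fideal vF (N + 1)"
      by (auto simp: boxat_def Box_def c_diff y_def)
    have "a \<in> fideal vF N" "a \<notin> fideal vF (N + 1)" using a by (auto simp: fideal_def)
    then have "c2 x \<in> fideal vF N" "c2 x \<notin> fideal vF (N + 1)"
      using F.fideal_add[OF F.fideal_monoD[OF x(2), of N], of a] F.fideal_diff[OF _ x(2), of "c2 x"] by auto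
    then show "x \<in> b'" using F.fideal_monoD[OF x(1), of N] by (simp add: b'_def boxat_def Box_def c_diff)
  qed
  have c2m: "{x. c2 x \<in> fideal vF (N + 1)} \<in> sets borel"
  proof -
    have "open {x. c2 x \<in> fideal vF (N + 1)}" unfolding E.open_iff
    proof
      fix x assume x: "x \<in> {x. c2 x \<in> fideal vF (N + 1)}"
      obtain k where k: "fideal vE k \<subseteq> Box (N + 1) (N + 1)" using Box_nbhd by blast
      have "w \<in> {x. c2 x \<in> fideal vF (N + 1)}" if "w - x \<in> fideal vE k" for w
        using k that x F.fideal_add[of "c2 w - c2 x" "N + 1" "c2 x"] by (auto simp: Box_def c_diff)
      then show "\<exists>n. \<forall>w. w - x \<in> fideal vE n \<longrightarrow> w \<in> {x. c2 x \<in> fideal vF (N + 1)}" by blast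
    qed
    then show ?thesis by simp
  qed
  have b'm: "b' \<in> sets borel" unfolding b'_def using c2m by (intro sets.Diff) simp_all
  have fin: "emeasure \<mu> b' \<noteq> \<infinity>"
    using emeasure_mono[of b' ?b \<mu>] emeasure_boxat[of "\<iota> 1" N] by (auto simp: b'_def top_unique)
  have "measure \<mu> b' \<ge> measure \<mu> (boxat y (N + 1))"
    using sub b'm fin by (intro measure_mono_fmeasurable) (auto simp: fmeasurable_def less_top)
  moreover have "measure \<mu> (boxat y (N + 1)) > 0"
    unfolding measure_boxat using box_vol_pos F.q_gt_0 by simp
  ultimately have vol: "measure \<mu> b' > 0" by simp
  have int: "(\<integral>x. Kz z x * indicator b' x \<partial>\<mu>) = E z * of_real (measure \<mu> b')" for z
    unfolding K using b'm by (simp add: integral_complex_of_real)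
  let ?\<phi> = "indicator ?b :: 'e \<Rightarrow> complex"
  have t: "?\<phi> \<in> test_fun UNIV" by (rule boxat_test_fun)
  have entire_ext: "entire_ext ?\<phi> = (\<lambda>z. factor_minus z * (E z * of_real (measure \<mu> b')))"
  proof (rule entire_ext_unique[OF t])
    have "E = (\<lambda>z. exp ((- 2 * of_real lnq * of_int N) * fst z + (- of_real lnq * of_int N) * snd z + of_real lnq * of_int N / 2))"
      by (intro HOL.ext) (simp add: E_def algebra_simps)
    then have "entire2 E" unfolding entire2_def by (simp only: holomorphic2_exp_linear)
    then show "entire2 (\<lambda>z. factor_minus z * (E z * of_real (measure \<mu> b')))"
      by (intro entire2_times entire_factor_minus entire2_const)
    fix z assume z: "z \<in> Half_plus \<inter> Half_minus"
    have "(1 - A_plus z) * (\<integral>x. Kz z x * ?\<phi> x \<partial>\<mu>) = (\<integral>x. Kz z x * indicator b' x \<partial>\<mu>)"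
      unfolding b'_def by (rule good_boxat_base(2)[OF G]) (use z p(1) in auto)
    then show "factor_minus z * (E z * of_real (measure \<mu> b')) = pole_factor z * (\<integral>x. Kz z x * ?\<phi> x \<partial>\<mu>)"
      using p(1) by (simp add: pole_factor_def factor_plus_def int mult.assoc)
  qed
  have "\<not> removable pole_set (\<lambda>z. K_ext z ?\<phi>) p"
  proof
    assume "removable pole_set (\<lambda>z. K_ext z ?\<phi>) p"
    then obtain U where U: "open U" "p \<in> U" "\<And>w. w \<in> U \<Longrightarrow> w \<in> pole_set \<Longrightarrow> entire_ext ?\<phi> w = 0"
      using removable_imp_zero[OF t] by blast
    obtain w where "w \<in> U" "A_plus w = 1" "factor_minus w \<noteq> 0" using pole_plus_smooth[OF U(1,2) p] by blast
    moreover then have "w \<in> pole_set" using p(1) by (simp add: pole_set_iff)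
    ultimately show False using U(3)[of w] vol by (simp add: entire_ext E_def)
  qed
  then show ?thesis using t by blast
qed

end

section \<open>Nonvanishing of the residue at the origin\<close>

context kernel_params
begin

definition kappa0 :: "'e \<Rightarrow> complex" where "kappa0 x = (if c2 x = 0 then 0 else kappa x)"

lemma kappa_norm: "c2 x \<noteq> 0 \<Longrightarrow> norm (kappa x) = 1"
proof -
  assume x: "c2 x \<noteq> 0"
  then have "x \<noteq> 0" "nrm x \<noteq> 0" using c_0 by auto
  then show ?thesis using x by (simp add: kappa_def norm_mult chiE_norm omega_plus_norm)
qed

lemma kappa0_norm: "norm (kappa0 x) \<le> 1"
  by (simp add: kappa0_def kappa_norm)

lemma coords_locally_constant:
  assumes "c2 x \<noteq> 0"
  shows "\<exists>n. \<forall>y. y - x \<in> fideal vE n \<longrightarrow> c2 y \<noteq> 0 \<and> vF (c2 y) = vF (c2 x) \<and> vF (nrm y) = vF (nrm x) \<and> kappa y = kappa x"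
proof -
  have x0: "x \<noteq> 0" "nrm x \<noteq> 0" using assms c_0 by auto
  obtain k where k: "\<And>y. y - x \<in> fideal vE k \<Longrightarrow> c2 y \<noteq> 0 \<and> vF (c2 y) = vF (c2 x) \<and> omega_plus (c2 y) = omega_plus (c2 x)"
    using c2_locally_constant[OF assms] by blast
  obtain n where n: "\<And>y. y - x \<in> fideal vE n \<Longrightarrow> y \<noteq> 0 \<and> chiE y = chiE x \<and> vF (nrm y) = vF (nrm x) \<and>
    omega_plus (nrm y) = omega_plus (nrm x)"
    using Gz_locally_constant[OF x0(1)] by blast
  have "c2 y \<noteq> 0 \<and> vF (c2 y) = vF (c2 x) \<and> vF (nrm y) = vF (nrm x) \<and> kappa y = kappa x" if y: "y - x \<in> fideal vE (max n k)" for y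
  proof -
    have 1: "c2 y \<noteq> 0 \<and> vF (c2 y) = vF (c2 x) \<and> omega_plus (c2 y) = omega_plus (c2 x)" by (rule k, rule E.fideal_monoD[OF y]) simp
    have 2: "y \<noteq> 0 \<and> chiE y = chiE x \<and> vF (nrm y) = vF (nrm x) \<and> omega_plus (nrm y) = omega_plus (nrm x)"
      by (rule n, rule E.fideal_monoD[OF y]) simp
    have "kappa y = kappa x"
      unfolding kappa_def power2_eq_square using 1 2 x0 assms by (simp add: chiE_mult omega_plus_divide)
    with 1 2 show ?thesis by blast
  qed
  then show ?thesis by blast
qed

lemma kappa0_measurable: "kappa0 \<in> borel_measurable borel"
proof (rule E.measurable_off_closed[of "range \<iota>"])
  show "closed (range \<iota>)" by (rule range_iota_closed)
  show "kappa0 x = 0" if "x \<in> range \<iota>" for x using that c2_eq_0 by (simp add: kappa0_def)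
  fix x S assume x: "x \<notin> range \<iota>" and S: "kappa0 x \<in> S"
  then have c: "c2 x \<noteq> 0" by (simp add: c2_eq_0)
  obtain n where n: "\<And>y. y - x \<in> fideal vE n \<Longrightarrow> c2 y \<noteq> 0 \<and> kappa y = kappa x" using coords_locally_constant[OF c] by blast
  have "kappa0 y \<in> S" if "y - x \<in> fideal vE n" for y using n[OF that] S c by (simp add: kappa0_def)
  then show "\<exists>n. \<forall>y. y - x \<in> fideal vE n \<longrightarrow> kappa0 y \<in> S" by blast
qed

lemma coords_set_borel: "{x. c2 x \<noteq> 0 \<and> P (vF (c2 x)) (vF (nrm x))} \<in> sets borel"
proof -
  have "open {x. c2 x \<noteq> 0 \<and> P (vF (c2 x)) (vF (nrm x))}" unfolding E.open_iff
  proof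
    fix x assume x: "x \<in> {x. c2 x \<noteq> 0 \<and> P (vF (c2 x)) (vF (nrm x))}"
    then have c: "c2 x \<noteq> 0" by blast
    obtain n where n: "\<And>y. y - x \<in> fideal vE n \<Longrightarrow> c2 y \<noteq> 0 \<and> vF (c2 y) = vF (c2 x) \<and> vF (nrm y) = vF (nrm x)"
      using coords_locally_constant[OF c] by blast
    have "y \<in> {x. c2 x \<noteq> 0 \<and> P (vF (c2 x)) (vF (nrm x))}" if "y - x \<in> fideal vE n" for y
      using n[OF that] x by simp
    then show "\<exists>n. \<forall>y. y - x \<in> fideal vE n \<longrightarrow> y \<in> {x. c2 x \<noteq> 0 \<and> P (vF (c2 x)) (vF (nrm x))}" by blast
  qed
  then show ?thesis by simp
qed

lemma nrm_set_bounded: "x \<noteq> 0 \<Longrightarrow> vF (nrm x) = m \<Longrightarrow> x \<in> fideal vE (- (ram * \<bar>m\<bar>))"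
proof -
  assume x: "x \<noteq> 0" "vF (nrm x) = m"
  have "ram * m \<ge> ram * (- \<bar>m\<bar>)" using ram_pos by (intro mult_left_mono) auto
  moreover have "ram * \<bar>m\<bar> \<ge> 0" using ram_pos by simp
  ultimately have "vE x \<ge> - (ram * \<bar>m\<bar>)" using val_nrm[OF x(1)] x(2) by simp
  then show ?thesis by (simp add: fideal_def)
qed

definition Yset :: "int \<Rightarrow> int \<Rightarrow> 'e set" where
  "Yset n m = {x. c2 x \<noteq> 0 \<and> vF (c2 x) = n \<and> vF (nrm x) = m}"

lemma Yset_borel: "Yset n m \<in> sets borel"
  unfolding Yset_def by (rule coords_set_borel)

lemma Yset_bounded: "Yset n m \<subseteq> fideal vE (- (ram * \<bar>m\<bar>))"
proof
  fix x assume x: "x \<in> Yset n m"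
  then have "x \<noteq> 0" using c_0 by (auto simp: Yset_def)
  then show "x \<in> fideal vE (- (ram * \<bar>m\<bar>))" using x by (intro nrm_set_bounded) (simp_all add: Yset_def)
qed

lemma kappa0_integrable: "A \<in> sets borel \<Longrightarrow> A \<subseteq> fideal vE k \<Longrightarrow> integrable \<mu> (\<lambda>x. kappa0 x * indicator A x)"
  by (rule integrable_bounded_measurable[OF kappa0_measurable kappa0_norm])

lemma integrable_mult_indicator':
  fixes f :: "'e \<Rightarrow> complex"
  assumes "integrable \<mu> f" "A \<in> sets borel" shows "integrable \<mu> (\<lambda>x. f x * indicator A x)"
proof -
  have "integrable \<mu> (\<lambda>x. indicator A x *\<^sub>R f x)"
    by (rule integrable_mult_indicator) (use assms in simp_all)
  moreover have "(\<lambda>x. indicator A x *\<^sub>R f x) = (\<lambda>x. f x * indicator A x)"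
    by (intro HOL.ext) (simp add: indicator_def)
  ultimately show ?thesis by simp
qed

text \<open>Since \<open>ram * vF (nrm x)\<close> is twice \<open>vE x\<close>, the bound
  \<open>ram\<close> for \<open>vE x\<close> becomes the bound 2 for the norm.\<close>

lemma shell0_eq: "x \<noteq> 0 \<Longrightarrow> shell0 x = (if vF (nrm x) \<in> {0, 1} then 1 else 0)"
proof -
  assume x: "x \<noteq> 0"
  have v: "ram * vF (nrm x) = 2 * vE x" by (rule val_nrm[OF x])
  have 1: "x \<in> fideal vE 0 \<longleftrightarrow> vF (nrm x) \<ge> 0"
  proof -
    have "vE x \<ge> 0 \<longleftrightarrow> ram * vF (nrm x) \<ge> 0" using v by simp
    then show ?thesis using x ram_pos by (simp add: fideal_def zero_le_mult_iff)
  qed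
  have 2: "x \<in> fideal vE ram \<longleftrightarrow> vF (nrm x) \<ge> 2"
  proof -
    have "vE x \<ge> ram \<longleftrightarrow> ram * vF (nrm x) \<ge> ram * 2" using v by simp
    then show ?thesis using x ram_pos by (simp add: fideal_def)
  qed
  have "vF (nrm x) \<in> {0, 1} \<longleftrightarrow> vF (nrm x) \<ge> 0 \<and> \<not> vF (nrm x) \<ge> 2" by auto
  then show ?thesis using 1 2 by (auto simp: shell0_def)
qed

text \<open>On the line \<open>t = 2s + c\<close> of poles the integral of the kernel over the fundamental annulus is
  a power series in \<open>q\<^sup>-\<^sup>2\<^sup>s\<close>; if it vanishes identically, so do its coefficients.\<close>

lemma shell_coefficients_zero:
  assumes triv_minus: triv_minus and c: "A_minus (0, c) = 1"
    and zero: "\<And>s. Re (4 * s + c + 1/2) > 0 \<Longrightarrow> (\<integral>x. Kz (s, 2 * s + c) x * shell0 x \<partial>\<mu>) = 0"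
    and m: "m \<in> {0, 1}"
  shows "(\<integral>x. kappa0 x * indicator (Yset n m) x \<partial>\<mu>) = 0"
proof -
  \<comment> \<open>On the line t = 2s + c the weight depends on \<open>s\<close> only through this
    power of q^(-2s).\<close>
  define jj where "jj x = 2 * vF (c2 x) - vF (nrm x)" for x
  define \<Phi> where "\<Phi> x = kappa0 x * of_real (qF powi vF (nrm x)) * shell0 x" for x
  \<comment> \<open>Large enough for all sample points s = r0 + k to lie in the convergence region;
    \<open>X k\<close> is the value of q^(-2s) there and tends to 0.\<close>
  define r0 where "r0 = 1/2 + \<bar>Re c\<bar>"
  define X where "X k = exp (- 2 * lnq * (r0 + real k))" for k :: nat
  have X: "X k > 0" "X k \<le> X 0" "X 0 < 1" for k
    using lnq_pos by (simp_all add: X_def r0_def add_pos_nonneg mult_less_0_iff)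
  have Xlim: "X \<longlonglongrightarrow> 0"
  proof -
    have "(\<lambda>k. X 0 * exp (- 2 * lnq) ^ k) \<longlonglongrightarrow> X 0 * 0"
      using lnq_pos by (intro tendsto_mult tendsto_const LIMSEQ_power_zero) simp
    moreover have "X = (\<lambda>k. X 0 * exp (- 2 * lnq) ^ k)"
      by (intro HOL.ext) (simp add: X_def exp_of_nat_mult[symmetric] exp_add[symmetric] algebra_simps)
    ultimately show ?thesis by simp
  qed
  have Kline: "Kz (complex_of_real (r0 + real k), 2 * complex_of_real (r0 + real k) + c) x * shell0 x = of_real (X k powi jj x) * \<Phi> x" for k x
  proof (cases "c2 x = 0")
    case False
    let ?s = "complex_of_real (r0 + real k)"
    define n m where "n = vF (c2 x)" and "m = vF (nrm x)"
    \<comment> \<open>What is left of the weight is a power of \<open>exp \<tau>\<close>, which is 1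
      by the assumption that the line satisfies \<open>A_minus = 1\<close>.\<close>
    define \<tau> where "\<tau> = of_real lnq * (1/2 - c)"
    have "exp (- \<tau>) = 1" using c by (simp add: \<tau>_def A_minus_def algebra_simps)
    then have e1: "exp \<tau> = 1" by (simp add: exp_minus)
    have "wt (?s, 2 * ?s + c) n m = exp (of_int (2 * n - m) * (- 2 * of_real lnq * ?s) + of_int m * of_real lnq + of_int (n - m) * \<tau>)"
    proof -
      have id: "- l * (a * (2 * s + (2 * s + c) - 1/2) - b * ((2 * s + c) + 1/2)) =
          (2 * a - b) * (- 2 * l * s) + b * l + (a - b) * (l * (1/2 - c))" for l a b s :: complex
        by (simp add: field_simps)
      show ?thesis
        unfolding wt_def fst_conv snd_conv id \<tau>_def by simp
    qed
    also have "\<dots> = exp (- 2 * of_real lnq * ?s) powi (2 * n - m) * exp (complex_of_real lnq) powi m * exp \<tau> powi (n - m)"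
      by (simp only: exp_add exp_power_int)
    also have "exp (- 2 * of_real lnq * ?s) = complex_of_real (X k)"
      unfolding X_def exp_of_real[symmetric] by simp
    also have "exp (complex_of_real lnq) = of_real qF"
      unfolding exp_of_real using F.q_gt_0 by (simp add: lnq_def)
    finally have "wt (?s, 2 * ?s + c) n m = of_real (X k powi (2 * n - m)) * of_real (qF powi m)"
      by (simp add: e1)
    then show ?thesis using False by (simp add: Kz_eq \<Phi>_def kappa0_def jj_def n_def m_def)
  qed (simp add: Kz_base \<Phi>_def kappa0_def)
  have in_Op: "Re (4 * complex_of_real (r0 + real k) + c + 1/2) > 0" for k
    by (simp add: r0_def)
  have f_int: "integrable \<mu> (\<lambda>x. of_real (X k powi jj x) * \<Phi> x)"
    and f_zero: "(\<integral>x. of_real (X k powi jj x) * \<Phi> x \<partial>\<mu>) = 0" for k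
  proof -
    let ?z = "(complex_of_real (r0 + real k), 2 * complex_of_real (r0 + real k) + c)"
    have "?z \<in> Half_plus" using in_Op[of k] by (simp add: Half_plus_def algebra_simps)
    then have "integrable \<mu> (\<lambda>x. Kz ?z x * shell0 x)"
      using good_vanish_0[OF shell0_test shell0_0] by (simp add: good_def)
    then show "integrable \<mu> (\<lambda>x. of_real (X k powi jj x) * \<Phi> x)" unfolding Kline .
    show "(\<integral>x. of_real (X k powi jj x) * \<Phi> x \<partial>\<mu>) = 0" using zero[OF in_Op[of k]] unfolding Kline .
  qed
  define T where "T j = {x. c2 x \<noteq> 0 \<and> jj x \<ge> j}" for j
  define E where "E j = {x. c2 x \<noteq> 0 \<and> jj x = j}" for j
  have TE: "T j \<in> sets borel" "E j \<in> sets borel" for j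
    unfolding T_def E_def jj_def
    using coords_set_borel[of "\<lambda>a b. j \<le> 2 * a - b"] coords_set_borel[of "\<lambda>a b. 2 * a - b = j"] by simp_all
  define AA where "AA j \<longleftrightarrow> (\<forall>k. (\<integral>x. of_real (X k powi jj x) * \<Phi> x * indicator (T j) x \<partial>\<mu>) = 0)" for j
  \<comment> \<open>Dividing by \<open>X k powi j\<close> and letting \<open>k\<close> grow isolates
    the lowest coefficient by dominated convergence; \<open>X k \<le> X 0\<close> makes the
    integrand for \<open>k = 0\<close> a majorant.\<close>
  have limit: "(\<integral>x. \<Phi> x * indicator (E j) x \<partial>\<mu>) = 0" if A: "AA j" for j
  proof -
    define u where "u k x = of_real (X k powi (- j)) * (of_real (X k powi jj x) * \<Phi> x * indicator (T j) x)" for k x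
    have u_int: "integrable \<mu> (u k)" for k
      unfolding u_def by (intro integrable_mult_right integrable_mult_indicator' f_int TE)
    have u_zero: "(\<integral>x. u k x \<partial>\<mu>) = 0" for k
      using A unfolding u_def AA_def by (simp only: integral_mult_right_zero mult_zero_right)
    have u_eq: "u k x = (if x \<in> T j then of_real (X k ^ nat (jj x - j)) * \<Phi> x else 0)" for k x
    proof -
      have "X k powi (- j) * X k powi jj x = X k ^ nat (jj x - j)" if "x \<in> T j"
      proof -
        have "X k powi (- j) * X k powi jj x = X k powi (jj x - j)"
          using X(1)[of k] by (simp add: power_int_add[symmetric])
        also have "\<dots> = X k ^ nat (jj x - j)" using that by (simp add: T_def power_int_def)
        finally show ?thesis .
      qed
      then have "x \<in> T j \<Longrightarrow> complex_of_real (X k powi (- j)) * of_real (X k powi jj x) = of_real (X k ^ nat (jj x - j))"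
        by (simp only: of_real_mult[symmetric])
      then show ?thesis unfolding u_def by (simp add: mult.assoc[symmetric] del: of_real_power_int of_real_power)
    qed
    have dom: "norm (u k x) \<le> norm (u 0 x)" for k x
    proof -
      have "X k ^ nat (jj x - j) \<le> X 0 ^ nat (jj x - j)" using X(1)[of k] X(2)[of k] by (intro power_mono) auto
      then show ?thesis using X(1)[of k] X(1)[of 0] unfolding u_eq
        by (auto simp: norm_mult norm_power intro!: mult_right_mono)
    qed
    have lim: "(\<lambda>k. u k x) \<longlonglongrightarrow> \<Phi> x * indicator (E j) x" for x
    proof (cases "x \<in> T j")
      case True
      show ?thesis
      proof (cases "jj x = j")
        case eq: True
        then show ?thesis using True by (simp add: u_eq E_def T_def)
      next
        case False
        then have "nat (jj x - j) \<noteq> 0" using True by (simp add: T_def)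
        then have "(\<lambda>k. X k ^ nat (jj x - j)) \<longlonglongrightarrow> 0" using Xlim by simp
        then have "(\<lambda>k. complex_of_real (X k ^ nat (jj x - j)) * \<Phi> x) \<longlonglongrightarrow> complex_of_real 0 * \<Phi> x"
          by (intro tendsto_mult tendsto_of_real tendsto_const)
        then show ?thesis using True False by (simp add: u_eq E_def)
      qed
    next
      case False
      then have "x \<notin> E j" by (auto simp: E_def T_def)
      then show ?thesis using False by (simp add: u_eq)
    qed
    have "(\<lambda>k. \<integral>x. u k x \<partial>\<mu>) \<longlonglongrightarrow> (\<integral>x. \<Phi> x * indicator (E j) x \<partial>\<mu>)"
    proof (rule integral_dominated_convergence[where w = "\<lambda>x. norm (u 0 x)"])
      show "u k \<in> borel_measurable \<mu>" for k using borel_measurable_integrable[OF u_int[of k]] .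
      then show "(\<lambda>x. \<Phi> x * indicator (E j) x) \<in> borel_measurable \<mu>"
        by (rule borel_measurable_LIMSEQ_metric[of u]) (rule lim)
      show "integrable \<mu> (\<lambda>x. norm (u 0 x))" using u_int[of 0] by (rule integrable_norm)
      show "AE x in \<mu>. (\<lambda>k. u k x) \<longlonglongrightarrow> \<Phi> x * indicator (E j) x" by (rule AE_I2, rule lim)
      show "AE x in \<mu>. norm (u k x) \<le> norm (u 0 x)" for k by (rule AE_I2, rule dom)
    qed
    then show ?thesis unfolding u_zero by (simp add: LIMSEQ_const_iff)
  qed
  \<comment> \<open>On the shell the second coordinate is bounded and the norm has valuation at most
    1, so exponents are at least \<open>2 * l - 1\<close>; there the peeling of coefficients
    starts.\<close>
  obtain l where l: "fideal vE 0 \<subseteq> Box l l" using Box_bounded by blast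
  have supp: "c2 x \<noteq> 0 \<and> jj x \<ge> 2 * l - 1" if "\<Phi> x \<noteq> 0" for x
  proof -
    have c: "c2 x \<noteq> 0" "shell0 x \<noteq> 0" using that by (auto simp: \<Phi>_def kappa0_def)
    then have x0: "x \<noteq> 0" using c_0 by auto
    have "vF (nrm x) \<le> 1" using c(2) shell0_eq[OF x0] by (auto split: if_splits)
    moreover have "x \<in> fideal vE 0"
    proof (rule ccontr)
      assume "x \<notin> fideal vE 0"
      moreover from this have "x \<notin> fideal vE ram" using E.fideal_monoD[of x ram 0] ram_pos by auto
      ultimately show False using c(2) by (simp add: shell0_def)
    qed
    ultimately have "x \<in> fideal vE 0" "vF (nrm x) \<le> 1" by simp_all
    then show ?thesis using l c(1) by (auto simp: jj_def Box_def fideal_def)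
  qed
  have AA: "AA j" if "j \<ge> 2 * l - 1" for j
    using that
  proof (induction j rule: int_ge_induct)
    case base
    have e: "of_real (X k powi jj x) * \<Phi> x * indicator (T (2 * l - 1)) x = of_real (X k powi jj x) * \<Phi> x" for k x
      using supp[of x] by (cases "\<Phi> x = 0") (auto simp: T_def)
    show ?case unfolding AA_def e using f_zero by blast
  next
    case (step j)
    have "(\<integral>x. of_real (X k powi jj x) * \<Phi> x * indicator (T (j + 1)) x \<partial>\<mu>) = 0" for k
    proof -
      have i1: "integrable \<mu> (\<lambda>x. of_real (X k powi jj x) * \<Phi> x * indicator (T j) x)"
        and i2: "integrable \<mu> (\<lambda>x. of_real (X k powi jj x) * \<Phi> x * indicator (E j) x)"
        by (intro integrable_mult_indicator' f_int TE)+
      have e2: "of_real (X k powi jj x) * \<Phi> x * indicator (E j) x = of_real (X k powi j) * (\<Phi> x * indicator (E j) x)" for x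
        by (cases "x \<in> E j") (simp_all add: E_def)
      have "(\<integral>x. of_real (X k powi jj x) * \<Phi> x * indicator (E j) x \<partial>\<mu>) = 0"
        unfolding e2 integral_mult_right_zero limit[OF step.IH] by simp
      moreover have "(\<integral>x. of_real (X k powi jj x) * \<Phi> x * indicator (T j) x \<partial>\<mu>) = 0"
        using step.IH by (simp add: AA_def)
      moreover have "of_real (X k powi jj x) * \<Phi> x * indicator (T (j + 1)) x =
        of_real (X k powi jj x) * \<Phi> x * indicator (T j) x - of_real (X k powi jj x) * \<Phi> x * indicator (E j) x" for x
        by (auto simp: T_def E_def indicator_def)
      ultimately show ?thesis using i1 i2 by simp
    qed
    then show ?case by (simp add: AA_def)
  qed
  have D: "(\<integral>x. \<Phi> x * indicator (E j) x \<partial>\<mu>) = 0" for j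
  proof (cases "j \<ge> 2 * l - 1")
    case True then show ?thesis using limit AA by blast
  next
    case False
    then have e: "\<Phi> x * indicator (E j) x = 0" for x using supp[of x] by (auto simp: E_def indicator_def)
    show ?thesis unfolding e by simp
  qed
  have "\<Phi> x * indicator (E (2 * n - m)) x = of_real (qF powi m) * (kappa0 x * indicator (Yset n m) x)" for x
  proof (cases "c2 x = 0")
    case False
    then have x0: "x \<noteq> 0" using c_0 by auto
    have "x \<in> E (2 * n - m) \<and> vF (nrm x) \<in> {0, 1} \<longleftrightarrow> x \<in> Yset n m"
      using False m by (auto simp: E_def Yset_def jj_def) presburger+
    then show ?thesis unfolding \<Phi>_def shell0_eq[OF x0] using m
      by (cases "x \<in> Yset n m") (auto simp: Yset_def indicator_def)
  qed (simp add: \<Phi>_def kappa0_def)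
  then have "of_real (qF powi m) * (\<integral>x. kappa0 x * indicator (Yset n m) x \<partial>\<mu>) = 0"
    using D[of "2 * n - m"] by (simp only: integral_mult_right_zero)
  then show ?thesis using F.q_gt_0 by simp
qed

lemma kappa0_scale: "triv_minus \<Longrightarrow> a \<noteq> 0 \<Longrightarrow> kappa0 (\<iota> a * x) = kappa0 x"
  by (auto simp: kappa0_def c_scale kappa_scale omega_minus_trivial)

text \<open>Dilation by a power of \<open>pF\<close> shifts the valuation of the norm by an even
  number and leaves \<open>kappa0\<close> unchanged, so only the parity of \<open>m\<close>
  matters.\<close>

lemma Yset_integral_all:
  assumes triv_minus: triv_minus and base: "\<And>n m. m \<in> {0, 1} \<Longrightarrow> (\<integral>x. kappa0 x * indicator (Yset n m) x \<partial>\<mu>) = 0"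
  shows "(\<integral>x. kappa0 x * indicator (Yset n m) x \<partial>\<mu>) = 0"
proof -
  let ?k = "m div 2"
  let ?a = "pF powi ?k"
  have a: "?a \<noteq> 0" "vF ?a = ?k" "\<iota> ?a \<noteq> 0" using pF by (simp_all add: F.val_power_int)
  let ?f = "\<lambda>x. kappa0 x * indicator (Yset n m) x"
  have int: "integrable \<mu> ?f" by (rule kappa0_integrable[OF Yset_borel Yset_bounded])
  have mem: "\<iota> ?a * x \<in> Yset n m \<longleftrightarrow> x \<in> Yset (n - ?k) (m mod 2)" for x
  proof (cases "c2 x = 0")
    case False
    then have "nrm x \<noteq> 0" using c_0 by auto
    moreover have "2 * ?k + vF (nrm x) = m \<longleftrightarrow> vF (nrm x) = m mod 2" by presburger
    ultimately show ?thesis using False a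
      by (auto simp: Yset_def c_scale nrm_mult nrm_iota F.val_mult F.val_power)
  qed (simp add: Yset_def c_scale)
  have e: "?f (\<iota> ?a * x) = kappa0 x * indicator (Yset (n - ?k) (m mod 2)) x" for x
    using mem[of x] kappa0_scale[OF triv_minus a(1), of x] by (simp add: indicator_def)
  have "m mod 2 \<in> {0, 1}" by auto
  then have "(\<integral>x. ?f (\<iota> ?a * x) \<partial>\<mu>) = 0" unfolding e by (rule base)
  then have "complex_of_real (real (residue_card vE) powi vE (\<iota> ?a)) * (\<integral>x. ?f x \<partial>\<mu>) = 0"
    unfolding H.scales_integrable(2)[OF H.scales_mult[OF a(3)] int] .
  then show ?thesis using E.q_gt_0 by simp
qed

definition Zset :: "'f \<Rightarrow> int \<Rightarrow> int \<Rightarrow> 'e set" where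
  "Zset c N m = {x. c2 x - c \<in> fideal vF (vF c + N) \<and> vF (nrm x) = m}"

lemma Zset_val: "c \<noteq> 0 \<Longrightarrow> N \<ge> 1 \<Longrightarrow> x \<in> Zset c N m \<Longrightarrow> c2 x \<noteq> 0 \<and> vF (c2 x) = vF c"
  using F.val_stable[of c "c2 x"] F.fideal_monoD[of "c2 x - c" "vF c + N" "vF c + 1"] by (simp add: Zset_def)

lemma Zset_bounded: "c \<noteq> 0 \<Longrightarrow> N \<ge> 1 \<Longrightarrow> Zset c N m \<subseteq> fideal vE (- (ram * \<bar>m\<bar>))"
proof
  fix x assume a: "c \<noteq> 0" "N \<ge> 1" "x \<in> Zset c N m"
  then have "x \<noteq> 0" using Zset_val[OF a] c_0 by auto
  then show "x \<in> fideal vE (- (ram * \<bar>m\<bar>))" using a(3) by (intro nrm_set_bounded) (simp_all add: Zset_def)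
qed

lemma c2_disc_borel: "{x. x \<noteq> 0 \<and> vF (nrm x) = m \<and> c2 x - c \<in> fideal vF N} \<in> sets borel"
proof -
  have "open {x. x \<noteq> 0 \<and> vF (nrm x) = m \<and> c2 x - c \<in> fideal vF N}" unfolding E.open_iff
  proof
    fix x assume x: "x \<in> {x. x \<noteq> 0 \<and> vF (nrm x) = m \<and> c2 x - c \<in> fideal vF N}"
    then have "x \<noteq> 0" by simp
    from Gz_locally_constant[OF this] obtain n where n: "\<And>y. y - x \<in> fideal vE n \<Longrightarrow> y \<noteq> 0 \<and> vF (nrm y) = vF (nrm x)" by blast
    obtain k where k: "fideal vE k \<subseteq> Box N N" using Box_nbhd by blast
    have "y \<in> {x. x \<noteq> 0 \<and> vF (nrm x) = m \<and> c2 x - c \<in> fideal vF N}" if y: "y - x \<in> fideal vE (max n k)" for y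
    proof -
      have "y - x \<in> Box N N" using k E.fideal_monoD[OF y, of k] by auto
      then have "c2 y - c2 x \<in> fideal vF N" by (simp add: Box_def c_diff)
      then show ?thesis using n[of y] E.fideal_monoD[OF y, of n] x F.fideal_diff_trans[of "c2 y" "c2 x" N c] by simp
    qed
    then show "\<exists>n. \<forall>y. y - x \<in> fideal vE n \<longrightarrow> y \<in> {x. x \<noteq> 0 \<and> vF (nrm x) = m \<and> c2 x - c \<in> fideal vF N}" by blast
  qed
  then show ?thesis by simp
qed

lemma Zset_borel: "c \<noteq> 0 \<Longrightarrow> N \<ge> 1 \<Longrightarrow> Zset c N m \<in> sets borel"
proof -
  assume c: "c \<noteq> 0" "N \<ge> 1"
  have "x \<noteq> 0" if "x \<in> Zset c N m" for x using Zset_val[OF c that] c_0 by auto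
  then have "Zset c N m = {x. x \<noteq> 0 \<and> vF (nrm x) = m \<and> c2 x - c \<in> fideal vF (vF c + N)}"
    by (auto simp: Zset_def)
  then show ?thesis using c2_disc_borel by simp
qed

lemma unit_reps:
  assumes a: "a \<noteq> 0" and N: "N \<ge> 1"
  obtains R where "finite R" "R \<noteq> {}" "\<And>r. r \<in> R \<Longrightarrow> r \<noteq> 0 \<and> vF r = 0"
    "\<And>x. x \<noteq> 0 \<Longrightarrow> vF x = vF a \<Longrightarrow> \<exists>!r. r \<in> R \<and> x - a * r \<in> fideal vF (vF a + N)"
proof -
  have "max 0 N = N" using N by simp
  note reps = F.finite_reps[of 0 N, unfolded this]
  obtain R where R: "finite R" "R \<subseteq> fideal vF 0" "\<And>x. x \<in> fideal vF 0 \<Longrightarrow> \<exists>!r. r \<in> R \<and> x - r \<in> fideal vF N"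
    by (rule reps) blast
  define R' where "R' = {r\<in>R. r \<noteq> 0 \<and> vF r = 0}"
  have ex: "\<exists>!r. r \<in> R' \<and> x - a * r \<in> fideal vF (vF a + N)" if x: "x \<noteq> 0" "vF x = vF a" for x
  proof -
    have u: "x / a \<noteq> 0" "vF (x / a) = 0" using x a by (simp_all add: F.val_divide)
    have eq: "x - a * r \<in> fideal vF (vF a + N) \<longleftrightarrow> x / a - r \<in> fideal vF N" for r
    proof -
      have "x - a * r = a * (x / a - r)" using a by (simp add: right_diff_distrib)
      then show ?thesis using F.fideal_scale[OF a, of "x / a - r" "vF a + N"] by simp
    qed
    have unit: "r \<noteq> 0 \<and> vF r = 0" if "x / a - r \<in> fideal vF N" for r
    proof -
      have "r - x / a \<in> fideal vF (vF (x / a) + 1)"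
        using F.fideal_monoD[OF that, of 1] N u(2) F.fideal_diff_commute[of "x / a" r 1] by simp
      from F.val_stable[OF u(1) this] u(2) show ?thesis by simp
    qed
    have "x / a \<in> fideal vF 0" using u by (simp add: fideal_def)
    from R(3)[OF this] have "\<exists>!r. r \<in> R \<and> x / a - r \<in> fideal vF N" .
    moreover have "r \<in> R' \<and> x - a * r \<in> fideal vF (vF a + N) \<longleftrightarrow> r \<in> R \<and> x / a - r \<in> fideal vF N" for r
      unfolding eq R'_def using unit[of r] by blast
    ultimately show ?thesis by simp
  qed
  have "R' \<noteq> {}" using ex[OF a refl] by blast
  show ?thesis
  proof (rule that[of R'])
    show "finite R'" using R(1) by (simp add: R'_def)
    show "r \<noteq> 0 \<and> vF r = 0" if "r \<in> R'" for r using that by (simp add: R'_def)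
  qed (rule \<open>R' \<noteq> {}\<close>, rule ex)
qed

text \<open>Dilation by units of the small field permutes the classes of the second coordinate and
  preserves \<open>kappa0\<close>; so all classes contribute equally to the vanishing integral over
  \<open>Yset\<close>.\<close>

lemma Zset_kap_integral:
  assumes triv_minus: triv_minus and Y: "\<And>n m. (\<integral>x. kappa0 x * indicator (Yset n m) x \<partial>\<mu>) = 0"
    and c: "c \<noteq> 0" and N: "N \<ge> 1"
  shows "(\<integral>x. kappa0 x * indicator (Zset c N m) x \<partial>\<mu>) = 0"
proof -
  obtain R where R: "finite R" "R \<noteq> {}" "\<And>r. r \<in> R \<Longrightarrow> r \<noteq> 0 \<and> vF r = 0"
    "\<And>x. x \<noteq> 0 \<Longrightarrow> vF x = vF c \<Longrightarrow> \<exists>!r. r \<in> R \<and> x - c * r \<in> fideal vF (vF c + N)"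
    using unit_reps[OF c N] by blast
  have cr: "c * r \<noteq> 0" "vF (c * r) = vF c" if "r \<in> R" for r using R(3)[OF that] c by (simp_all add: F.val_mult)
  have int: "integrable \<mu> (\<lambda>x. kappa0 x * indicator (Zset (c * r) N m) x)" if "r \<in> R" for r
    by (rule kappa0_integrable[OF Zset_borel Zset_bounded]) (use cr[OF that] N in auto)
  have int1: "integrable \<mu> (\<lambda>x. kappa0 x * indicator (Zset c N m) x)"
    by (rule kappa0_integrable[OF Zset_borel Zset_bounded]) (use c N in auto)
  have same: "(\<integral>x. kappa0 x * indicator (Zset (c * r) N m) x \<partial>\<mu>) = (\<integral>x. kappa0 x * indicator (Zset c N m) x \<partial>\<mu>)" if r: "r \<in> R" for r
  proof -
    have r0: "r \<noteq> 0" "vF r = 0" "\<iota> r \<noteq> 0" "vE (\<iota> r) = 0" using R(3)[OF r] by (simp_all add: val_iota)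
    have mem: "\<iota> r * x \<in> Zset (c * r) N m \<longleftrightarrow> x \<in> Zset c N m" for x
    proof (cases "x = 0")
      case False
      have "r * c2 x - c * r = r * (c2 x - c)" by (simp add: algebra_simps)
      then have "r * c2 x - c * r \<in> fideal vF (vF c + N) \<longleftrightarrow> c2 x - c \<in> fideal vF (vF c + N)"
        using F.fideal_scale[OF r0(1), of "c2 x - c" "vF c + N"] r0(2) by simp
      then show ?thesis using r0 cr[OF r] False
        by (simp add: Zset_def c_scale nrm_mult nrm_iota F.val_mult F.val_power)
    next
      case True
      then show ?thesis using Zset_val[OF c N, of 0 m] Zset_val[OF cr(1)[OF r] N, of 0 m] by auto
    qed
    have e: "kappa0 (\<iota> r * x) * indicator (Zset (c * r) N m) (\<iota> r * x) = kappa0 x * indicator (Zset c N m) x" for x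
      using mem[of x] kappa0_scale[OF triv_minus r0(1), of x] by (simp add: indicator_def)
    show ?thesis using H.scales_integrable(2)[OF H.scales_mult[OF r0(3)] int[OF r]] r0(4) unfolding e by simp
  qed
  have "kappa0 x * indicator (Yset (vF c) m) x = (\<Sum>r\<in>R. kappa0 x * indicator (Zset (c * r) N m) x)" for x
  proof -
    have "(\<Sum>r\<in>R. indicator (Zset (c * r) N m) x :: complex) = indicator (Yset (vF c) m) x"
    proof (cases "x \<in> Yset (vF c) m")
      case True
      then obtain r0 where r0: "r0 \<in> R" "c2 x - c * r0 \<in> fideal vF (vF c + N)"
        and un: "\<And>r. r \<in> R \<Longrightarrow> c2 x - c * r \<in> fideal vF (vF c + N) \<Longrightarrow> r = r0"
        using R(4)[of "c2 x"] unfolding Yset_def by blast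
      have "x \<in> Zset (c * r) N m \<longleftrightarrow> r = r0" if "r \<in> R" for r
        using True r0 un[OF that] cr[OF that] by (auto simp: Zset_def Yset_def)
      then have "(\<Sum>r\<in>R. indicator (Zset (c * r) N m) x :: complex) = (\<Sum>r\<in>R. if r = r0 then 1 else 0)"
        by (intro sum.cong refl) (simp add: indicator_def)
      then show ?thesis using True r0(1) R(1) by simp
    next
      case False
      have "x \<notin> Zset (c * r) N m" if "r \<in> R" for r
        using False Zset_val[OF cr(1)[OF that] N, of x m] cr(2)[OF that] by (auto simp: Yset_def Zset_def)
      then have "(\<Sum>r\<in>R. indicator (Zset (c * r) N m) x :: complex) = 0" by (intro sum.neutral) auto
      then show ?thesis using False by simp
    qed
    then show ?thesis by (simp add: sum_distrib_left[symmetric])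
  qed
  then have "0 = (\<integral>x. (\<Sum>r\<in>R. kappa0 x * indicator (Zset (c * r) N m) x) \<partial>\<mu>)" using Y[of "vF c" m] by simp
  also have "\<dots> = (\<Sum>r\<in>R. \<integral>x. kappa0 x * indicator (Zset (c * r) N m) x \<partial>\<mu>)"
    using int by (rule Bochner_Integration.integral_sum)
  also have "\<dots> = of_nat (card R) * (\<integral>x. kappa0 x * indicator (Zset c N m) x \<partial>\<mu>)" using same by simp
  finally show ?thesis using R(1,2) by simp
qed

definition rho :: "'e \<Rightarrow> complex" where "rho x = (if x = 0 then 0 else inverse (chiE (cj x) ^ 2))"

text \<open>If chi over eta is trivial, \<open>omega_plus\<close> is the square of chi on the small
  field. The norm in the denominator then cancels the factor chi(x)^2, leaving a factor of the
  second coordinate times a character of the big field.\<close>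

lemma kappa_rho: "triv_minus \<Longrightarrow> c2 x \<noteq> 0 \<Longrightarrow> kappa x = chiE (\<iota> (c2 x)) ^ 2 * rho x"
proof -
  assume triv_minus: triv_minus and x: "c2 x \<noteq> 0"
  have x0: "x \<noteq> 0" "nrm x \<noteq> 0" using x c_0 by auto
  have "omega_plus a = chiE (\<iota> a) ^ 2" if "a \<noteq> 0" for a
  proof -
    have "etaF a \<noteq> 0" "omega_minus a = 1" using that etaF_nonzero omega_minus_trivial[OF triv_minus] by auto
    then have "chiE (\<iota> a) = etaF a" by (simp add: omega_minus_def)
    then show ?thesis by (simp add: omega_plus_def power2_eq_square)
  qed
  then have "omega_plus (c2 x / nrm x) = chiE (\<iota> (c2 x)) ^ 2 / chiE (\<iota> (nrm x)) ^ 2"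
    using x x0 by (simp only: omega_plus_divide simp_thms)
  moreover have "chiE (\<iota> (nrm x)) ^ 2 = chiE x ^ 2 * chiE (cj x) ^ 2"
    using x0 by (simp add: iota_nrm chiE_mult power_mult_distrib)
  moreover have "chiE (x\<^sup>2) = chiE x ^ 2"
    using x0 by (simp add: chiE_mult power2_eq_square)
  ultimately have "kappa x = chiE x ^ 2 * (chiE (\<iota> (c2 x)) ^ 2 / (chiE x ^ 2 * chiE (cj x) ^ 2))"
    by (simp only: kappa_def)
  then show ?thesis using chiE_nonzero[OF x0(1)] x0 by (simp add: rho_def divide_inverse)
qed

text \<open>On fine classes of the second coordinate \<open>kappa0\<close> is a constant times
  \<open>rho\<close>, so vanishing passes to \<open>rho\<close>. A strip is cut into such classes by
  the valuation of the second coordinate, up to a part near the ground field of arbitrarily small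
  volume; then \<open>strip_integral_nonzero\<close> applies.\<close>

lemma no_vanishing_cosets:
  assumes triv_minus: triv_minus and Y: "\<And>n m. (\<integral>x. kappa0 x * indicator (Yset n m) x \<partial>\<mu>) = 0"
  shows False
proof -
  obtain n0 where n0: "n0 \<ge> 1" "\<And>a b. a \<noteq> 0 \<Longrightarrow> b - a \<in> fideal vF (vF a + n0) \<Longrightarrow> b \<noteq> 0 \<and> vF b = vF a
    \<and> omega_plus b = omega_plus a \<and> omega_minus b = omega_minus a \<and> chiE (\<iota> b) = chiE (\<iota> a)"
    using omega_plus_locally_constant by blast
  have rho_norm: "norm (rho x) = 1" if "x \<noteq> 0" for x
    using that chiE_norm[of "cj x"] by (simp add: rho_def norm_inverse norm_power)
  have rho_mult: "rho (x * y) = rho x * rho y" if "x \<noteq> 0" "y \<noteq> 0" for x y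
    using that by (simp add: rho_def cj_mult chiE_mult power_mult_distrib)
  obtain n1 where n1: "n1 \<ge> 1" "\<And>x y. x \<noteq> 0 \<Longrightarrow> y - x \<in> fideal vE (vE x + n1) \<Longrightarrow> y \<noteq> 0 \<and> vE y = vE x \<and> chiE y = chiE x"
    using chiE_local by blast
  have cj_fideal: "cj y - cj x \<in> fideal vE n" if "y - x \<in> fideal vE n" for x y n
  proof (cases "y = x")
    case False
    then have "vE (cj (y - x)) = vE (y - x)" by (intro val_cj) simp
    then show ?thesis using that False by (simp add: cj_diff fideal_def)
  qed simp
  have rho_local: "rho x = 1" if "x - 1 \<in> fideal vE (int (nat n1))" "x \<noteq> 0" for x
  proof -
    have "cj x - 1 \<in> fideal vE n1" using cj_fideal[OF that(1)] n1(1) by simp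
    then have "chiE (cj x) = chiE 1" using n1(2)[of 1 "cj x"] by simp
    then show ?thesis using that(2) by (simp add: rho_def chiE_1)
  qed
  have rho_meas: "rho \<in> borel_measurable borel"
  proof (rule E.measurable_off_closed[of "{0}" _ 0])
    fix x S assume x: "x \<notin> {0}" and S: "rho x \<in> S"
    have "rho y \<in> S" if y: "y - x \<in> fideal vE (vE x + n1)" for y
    proof -
      have "y \<noteq> 0" using n1(2)[of x y] y x by simp
      moreover have "chiE (cj y) = chiE (cj x)"
        using n1(2)[of "cj x" "cj y"] cj_fideal[OF y] x val_cj[of x] by simp
      ultimately show ?thesis using S x by (simp add: rho_def)
    qed
    then show "\<exists>n. \<forall>y. y - x \<in> fideal vE n \<longrightarrow> rho y \<in> S" by blast
  qed (simp_all add: rho_def)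
  have rho_le: "norm (rho x) \<le> 1" for x using rho_norm[of x] by (cases "x = 0") (auto simp: rho_def)
  note int = integrable_bounded_measurable[OF rho_meas rho_le]
  have Z: "(\<integral>x. rho x * indicator (Zset c N m) x \<partial>\<mu>) = 0" if c: "c \<noteq> 0" and N: "N \<ge> n0" for c N m
  proof -
    have N1: "N \<ge> 1" using N n0(1) by simp
    have "kappa0 x * indicator (Zset c N m) x = chiE (\<iota> c) ^ 2 * (rho x * indicator (Zset c N m) x)" for x
    proof (cases "x \<in> Zset c N m")
      case True
      then have "c2 x - c \<in> fideal vF (vF c + n0)" using F.fideal_monoD[of "c2 x - c" "vF c + N" "vF c + n0"] N by (simp add: Zset_def)
      then have "chiE (\<iota> (c2 x)) = chiE (\<iota> c)" "c2 x \<noteq> 0" using n0(2)[OF c] by blast+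
      then show ?thesis using kappa_rho[OF triv_minus, of x] by (simp add: kappa0_def)
    qed simp
    then have "chiE (\<iota> c) ^ 2 * (\<integral>x. rho x * indicator (Zset c N m) x \<partial>\<mu>) = 0"
      using Zset_kap_integral[OF triv_minus Y c N1, of m] by (simp only: integral_mult_right_zero)
    then show ?thesis using chiE_nonzero[of "\<iota> c"] c by simp
  qed
  have strip: "(\<integral>x. rho x * indicator {x. x \<noteq> 0 \<and> vF (nrm x) = m \<and> c2 x - c \<in> fideal vF 0} x \<partial>\<mu>) = 0" for m c
  proof -
    let ?A = "{x. x \<noteq> 0 \<and> vF (nrm x) = m \<and> c2 x - c \<in> fideal vF 0}"
    let ?V = "\<lambda>v. {x. c2 x \<noteq> 0 \<and> vF (c2 x) = v}"
    have A: "?A \<in> sets borel" "?A \<subseteq> fideal vE (- (ram * \<bar>m\<bar>))"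
      using c2_disc_borel[of m c 0] nrm_set_bounded by auto
    have V: "?V v \<in> sets borel" for v using coords_set_borel[of "\<lambda>a b. a = v"] by simp
    have Av: "?A \<inter> ?V v \<in> sets borel" "?A \<inter> ?V v \<subseteq> fideal vE (- (ram * \<bar>m\<bar>))" for v
      using A V[of v] by auto
    have piece: "(\<integral>x. rho x * indicator (?A \<inter> ?V v) x \<partial>\<mu>) = 0" for v
    proof -
      define a where "a = pF powi v"
      have a: "a \<noteq> 0" "vF a = v" using pF by (simp_all add: a_def F.val_power_int)
      \<comment> \<open>Fine enough for chi to be constant on the classes (\<open>n0\<close>) and
        for each class to lie in one coset of the integers (\<open>- v\<close>).\<close>
      define N where "N = max n0 (- v)"
      have N: "N \<ge> n0" "N \<ge> 1" "v + N \<ge> 0" using n0(1) by (auto simp: N_def)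
      obtain R where R: "finite R" "R \<noteq> {}" "\<And>r. r \<in> R \<Longrightarrow> r \<noteq> 0 \<and> vF r = 0"
        "\<And>x. x \<noteq> 0 \<Longrightarrow> vF x = vF a \<Longrightarrow> \<exists>!r. r \<in> R \<and> x - a * r \<in> fideal vF (vF a + N)"
        using unit_reps[OF a(1) N(2)] by blast
      define R' where "R' = {r\<in>R. a * r - c \<in> fideal vF 0}"
      have ar: "a * r \<noteq> 0" "vF (a * r) = v" if "r \<in> R" for r using R(3)[OF that] a by (simp_all add: F.val_mult)
      have zint: "integrable \<mu> (\<lambda>x. rho x * indicator (Zset (a * r) N m) x)" if "r \<in> R'" for r
        by (rule int[OF Zset_borel Zset_bounded]) (use ar[of r] that N in \<open>auto simp: R'_def\<close>)
      have "(\<Sum>r\<in>R'. indicator (Zset (a * r) N m) x :: complex) = indicator (?A \<inter> ?V v) x" for x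
      proof (cases "x \<in> ?A \<inter> ?V v")
        case True
        then obtain r0 where r0: "r0 \<in> R" "c2 x - a * r0 \<in> fideal vF (v + N)"
          and un: "\<And>r. r \<in> R \<Longrightarrow> c2 x - a * r \<in> fideal vF (v + N) \<Longrightarrow> r = r0"
          using R(4)[of "c2 x"] a(2) by auto
        have "a * r0 - c2 x \<in> fideal vF 0" using F.fideal_monoD[OF r0(2), of 0] N(3) F.fideal_diff_commute[of "c2 x"] by simp
        then have r0': "r0 \<in> R'" using r0(1) True F.fideal_diff_trans[of "a * r0" "c2 x" 0 c] by (simp add: R'_def)
        have "x \<in> Zset (a * r) N m \<longleftrightarrow> r = r0" if "r \<in> R'" for r
          using True r0 un[of r] that ar[of r] ar[of r0] by (auto simp: Zset_def R'_def)
        then have "(\<Sum>r\<in>R'. indicator (Zset (a * r) N m) x :: complex) = (\<Sum>r\<in>R'. if r = r0 then 1 else 0)"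
          by (intro sum.cong refl) (simp add: indicator_def)
        then show ?thesis using True r0' R(1) by (simp add: R'_def)
      next
        case False
        have "x \<notin> Zset (a * r) N m" if "r \<in> R'" for r
        proof
          assume x: "x \<in> Zset (a * r) N m"
          have r: "r \<in> R" "a * r - c \<in> fideal vF 0" using that by (auto simp: R'_def)
          have "c2 x \<noteq> 0 \<and> vF (c2 x) = v" using Zset_val[OF ar(1)[OF r(1)] N(2) x] ar(2)[OF r(1)] by simp
          moreover have "c2 x - a * r \<in> fideal vF 0" using x F.fideal_monoD[of "c2 x - a * r" "v + N" 0] N(3) ar(2)[OF r(1)] by (simp add: Zset_def)
          then have "c2 x - c \<in> fideal vF 0" using r(2) F.fideal_diff_trans[of "c2 x" "a * r" 0 c] by simp
          moreover have "vF (nrm x) = m" using x by (simp add: Zset_def)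
          ultimately have "x \<in> ?A \<inter> ?V v" using c_0 by auto
          then show False using False by blast
        qed
        then have "(\<Sum>r\<in>R'. indicator (Zset (a * r) N m) x :: complex) = 0" by (intro sum.neutral) auto
        then show ?thesis using False by simp
      qed
      then have "rho x * indicator (?A \<inter> ?V v) x = (\<Sum>r\<in>R'. rho x * indicator (Zset (a * r) N m) x)" for x
        by (simp only: sum_distrib_left[symmetric])
      then have "(\<integral>x. rho x * indicator (?A \<inter> ?V v) x \<partial>\<mu>) = (\<integral>x. (\<Sum>r\<in>R'. rho x * indicator (Zset (a * r) N m) x) \<partial>\<mu>)"
        by (rule Bochner_Integration.integral_cong[OF refl])
      also have "\<dots> = (\<Sum>r\<in>R'. \<integral>x. rho x * indicator (Zset (a * r) N m) x \<partial>\<mu>)"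
        using zint by (rule Bochner_Integration.integral_sum)
      also have "\<dots> = 0" using Z[OF ar(1) N(1)] by (intro sum.neutral) (auto simp: R'_def)
      finally show ?thesis .
    qed
    obtain k where k: "fideal vE (- (ram * \<bar>m\<bar>)) \<subseteq> Box k k" using Box_bounded by blast
    have bound: "norm (\<integral>x. rho x * indicator ?A x \<partial>\<mu>) \<le> (qF powi (- 2 * k) * box_vol) * inverse qF ^ M" for M :: nat
    proof -
      \<comment> \<open>The second coordinate has valuation at least \<open>k\<close>, so finitely
        many pieces cover the strip except for this thin remainder.\<close>
      define B where "B = ?A \<inter> {x. c2 x \<in> fideal vF (k + int M)}"
      have Bm: "B \<in> sets borel"
      proof -
        have "- {x. c2 x \<in> fideal vF (k + int M)} = {x. c2 x \<noteq> 0 \<and> vF (c2 x) < k + int M}" by (auto simp: fideal_def)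
        then have "{x. c2 x \<in> fideal vF (k + int M)} = - {x. c2 x \<noteq> 0 \<and> vF (c2 x) < k + int M}" by blast
        then show ?thesis using A(1) coords_set_borel[of "\<lambda>a b. a < k + int M"] unfolding B_def by auto
      qed
      have Bs: "B \<subseteq> fideal vE (- (ram * \<bar>m\<bar>))" "B \<subseteq> Box k (k + int M)" using A(2) k by (auto simp: B_def Box_def)
      have "indicator ?A x = (\<Sum>v\<in>{k..<k + int M}. indicator (?A \<inter> ?V v) x :: complex) + indicator B x" for x
      proof (cases "x \<in> ?A \<and> c2 x \<notin> fideal vF (k + int M)")
        case True
        then have "c2 x \<noteq> 0" "vF (c2 x) < k + int M" by (auto simp: fideal_def)
        moreover have "c2 x \<in> fideal vF k" using True A(2) k by (auto simp: Box_def)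
        ultimately have v: "c2 x \<noteq> 0" "vF (c2 x) \<in> {k..<k + int M}" by (auto simp: fideal_def)
        have "(\<Sum>v\<in>{k..<k + int M}. indicator (?A \<inter> ?V v) x :: complex) = (\<Sum>v\<in>{k..<k + int M}. if v = vF (c2 x) then 1 else 0)"
          by (intro sum.cong refl) (use True v(1) in \<open>simp add: indicator_def\<close>)
        also have "\<dots> = 1" using v(2) by simp
        finally show ?thesis using True by (simp add: B_def)
      next
        case False
        have "(\<Sum>v\<in>{k..<k + int M}. indicator (?A \<inter> ?V v) x :: complex) = 0"
          using False by (intro sum.neutral) (auto simp: fideal_def indicator_def)
        then show ?thesis using False by (auto simp: B_def indicator_def)
      qed
      then have "rho x * indicator ?A x = (\<Sum>v\<in>{k..<k + int M}. rho x * indicator (?A \<inter> ?V v) x) + rho x * indicator B x" for x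
        by (simp only: distrib_left sum_distrib_left)
      then have "(\<integral>x. rho x * indicator ?A x \<partial>\<mu>) = (\<integral>x. (\<Sum>v\<in>{k..<k + int M}. rho x * indicator (?A \<inter> ?V v) x) + rho x * indicator B x \<partial>\<mu>)"
        by (rule Bochner_Integration.integral_cong[OF refl])
      also have "\<dots> = (\<Sum>v\<in>{k..<k + int M}. \<integral>x. rho x * indicator (?A \<inter> ?V v) x \<partial>\<mu>) + (\<integral>x. rho x * indicator B x \<partial>\<mu>)"
      proof -
        have "integrable \<mu> (\<lambda>x. \<Sum>v\<in>{k..<k + int M}. rho x * indicator (?A \<inter> ?V v) x)"
          using int[OF Av] by (intro Bochner_Integration.integrable_sum)
        from Bochner_Integration.integral_add[OF this int[OF Bm Bs(1)]]
        show ?thesis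
          by (simp only: Bochner_Integration.integral_sum[where I = "{k..<k + int M}" and M = \<mu>, OF int[OF Av]])
      qed
      also have "\<dots> = (\<integral>x. rho x * indicator B x \<partial>\<mu>)" using piece by simp
      finally have eq: "(\<integral>x. rho x * indicator ?A x \<partial>\<mu>) = (\<integral>x. rho x * indicator B x \<partial>\<mu>)" .
      have finB: "emeasure \<mu> B < \<infinity>" by (rule H.finite_emeasure_bounded[OF Bs(1)])
      have "norm (\<integral>x. rho x * indicator B x \<partial>\<mu>) \<le> (\<integral>x. norm (rho x * indicator B x) \<partial>\<mu>)" by (rule integral_norm_bound)
      also have "\<dots> \<le> (\<integral>x. indicator B x \<partial>\<mu>)"
        using int[OF Bm Bs(1)] Bm finB rho_le
        by (intro integral_mono integrable_norm integrable_real_indicator) (auto simp: norm_mult indicator_def)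
      also have "\<dots> = measure \<mu> B" using Bm by simp
      also have "\<dots> \<le> measure \<mu> (Box k (k + int M))"
        using Bm Bs(2) emeasure_Box[of k "k + int M"] by (intro measure_mono_fmeasurable) (auto simp: fmeasurable_def)
      also have "\<dots> = qF powi (- k - (k + int M)) * box_vol"
        using emeasure_Box[of k "k + int M"] box_vol_pos F.q_gt_0 by (simp add: measure_def)
      also have "\<dots> = (qF powi (- 2 * k) * box_vol) * inverse qF ^ M"
      proof -
        have "- k - (k + int M) = - 2 * k + - int M" by simp
        then have "qF powi (- k - (k + int M)) = qF powi (- 2 * k) * qF powi (- int M)"
          using F.q_gt_0 power_int_add[of qF "- 2 * k" "- int M"] by simp
        then show ?thesis by (simp add: power_int_minus power_inverse)
      qed
      finally show ?thesis unfolding eq .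
    qed
    have "(\<lambda>M. (qF powi (- 2 * k) * box_vol) * inverse qF ^ M) \<longlonglongrightarrow> (qF powi (- 2 * k) * box_vol) * 0"
      using F.q_gt_1 by (intro tendsto_mult tendsto_const LIMSEQ_power_zero) (simp add: field_simps)
    then have "norm (\<integral>x. rho x * indicator ?A x \<partial>\<mu>) \<le> 0"
      using bound LIMSEQ_le_const by (metis (no_types, lifting) mult_zero_right)
    then show ?thesis by simp
  qed
  show False
  proof (rule strip_integral_nonzero[of rho "nat n1"])
    fix i c
    define mi where "mi = vF (nrm (pE powi i))"
    have "vE x = i \<longleftrightarrow> vF (nrm x) = mi" if "x \<noteq> 0" for x
    proof -
      have "ram * mi = 2 * i" using val_nrm[of "pE powi i"] pE by (simp add: mi_def E.val_power_int)
      then show ?thesis using val_nrm[OF that] ram_pos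
        by (metis mult_cancel_left not_one_le_zero zero_neq_numeral)
    qed
    then have "{x. x \<noteq> 0 \<and> vE x = i \<and> c2 x - c \<in> fideal vF 0} = {x. x \<noteq> 0 \<and> vF (nrm x) = mi \<and> c2 x - c \<in> fideal vF 0}" by auto
    then show "(\<integral>x. rho x * indicator {x. x \<noteq> 0 \<and> vE x = i \<and> c2 x - c \<in> fideal vF 0} x \<partial>\<mu>) = 0"
      using strip[of mi c] by simp
  qed (use rho_norm rho_mult rho_local in \<open>auto simp: rho_def\<close>)
qed

text \<open>For the indicator of the integers the numerator is \<open>factor_plus\<close> times the
  shell integral. Vanishing at the poles near \<open>p\<close> spreads along the line of constant 2s
  - t; since \<open>factor_plus\<close> has no zero in \<open>Half_plus\<close>, the shell integrals
  vanish there, contrary to \<open>no_vanishing_cosets\<close>.\<close>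

lemma pole_minus_not_removable:
  assumes p: "triv_minus" "A_minus p = 1"
  shows "\<exists>\<phi>\<in>test_fun UNIV. \<not> removable pole_set (\<lambda>z. K_ext z \<phi>) p"
proof -
  let ?\<phi> = "indicator (fideal vE 0) :: 'e \<Rightarrow> complex"
  have t: "?\<phi> \<in> test_fun UNIV" by (rule fideal_test_fun)
  have "good Half_plus factor_plus shell0" by (rule good_vanish_0[OF shell0_test shell0_0])
  then obtain h where h: "entire2 h" "\<And>z. z \<in> Half_plus \<Longrightarrow> h z = factor_plus z * (\<integral>x. Kz z x * shell0 x \<partial>\<mu>)"
    unfolding good_def by blast
  have entire_ext: "entire_ext ?\<phi> = h"
    by (rule entire_ext_unique[OF t h(1)]) (use h(2) p(1) fideal0_integral(2) in \<open>simp add: pole_factor_def factor_minus_def mult_ac\<close>)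
  have "\<not> removable pole_set (\<lambda>z. K_ext z ?\<phi>) p"
  proof
    assume "removable pole_set (\<lambda>z. K_ext z ?\<phi>) p"
    then obtain U where U: "open U" "p \<in> U" "\<And>w. w \<in> U \<Longrightarrow> w \<in> pole_set \<Longrightarrow> h w = 0"
      using removable_imp_zero[OF t] unfolding entire_ext by blast
    define c where "c = snd p - 2 * fst p"
    define S where "S = {s. (s, 2 * s + c) \<in> U}"
    have Am_line: "A_minus (s, 2 * s + c) = 1" for s
      using p(2) by (simp add: A_minus_def c_def)
    have "h (s, 2 * s + c) = (\<lambda>_. 0) (s, 2 * s + c)" for s
    proof (rule entire2_eq_on_line[OF h(1) entire2_const])
      have "open ((\<lambda>s. (s, 2 * s + c)) -` U)"
        by (rule open_vimage[OF U(1)]) (intro continuous_intros)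
      then show "open S" by (simp add: S_def vimage_def)
      have "fst p \<in> S" using U(2) by (simp add: S_def c_def)
      then show "S \<noteq> {}" by blast
      fix s assume "s \<in> S"
      then show "h (s, 2 * s + c) = 0" using U(3) Am_line p(1) by (simp add: S_def pole_set_iff)
    qed
    then have h0: "h (s, 2 * s + c) = 0" for s by simp
    have zero: "(\<integral>x. Kz (s, 2 * s + c) x * shell0 x \<partial>\<mu>) = 0" if "Re (4 * s + c + 1/2) > 0" for s
    proof -
      have z: "(s, 2 * s + c) \<in> Half_plus" using that by (simp add: Half_plus_def algebra_simps)
      have "factor_plus (s, 2 * s + c) \<noteq> 0" using norm_A_plus[OF z] by (auto simp: factor_plus_def)
      then show ?thesis using h(2)[OF z] h0[of s] by simp
    qed
    have "A_minus (0, c) = 1" using Am_line[of 0] by simp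
    then have "(\<integral>x. kappa0 x * indicator (Yset n m) x \<partial>\<mu>) = 0" if "m \<in> {0, 1}" for n m
      by (rule shell_coefficients_zero[OF p(1) _ zero that])
    then have "(\<integral>x. kappa0 x * indicator (Yset n m) x \<partial>\<mu>) = 0" for n m
      by (rule Yset_integral_all[OF p(1)])
    then show False by (rule no_vanishing_cosets[OF p(1)])
  qed
  then show ?thesis using t by blast
qed

lemma K_ext_meromorphic: "meromorphic_family_simple_poles K_ext pole_set"
  unfolding meromorphic_family_simple_poles_def
  using distribution_K_ext K_ext_holomorphic K_ext_simple_pole pole_plus_not_removable pole_minus_not_removable
  by (auto simp: pole_set_iff)

end

theorem theoremA:
  fixes vF :: "'f::{field, topological_space} \<Rightarrow> int"
    and vE :: "'e::{field, topological_space} \<Rightarrow> int"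
    and pF d :: 'f and pE \<alpha> :: 'e and \<iota> :: "'f \<Rightarrow> 'e"
    and \<mu> :: "'e measure"
    and chi :: "'e \<Rightarrow> complex" and eta :: "'f \<Rightarrow> complex"
  assumes "quadratic_extension vF vE pF pE \<iota> \<alpha> d"
    and "normalized_haar vE \<mu>"
    and "unit_char vE chi" and "unit_char vF eta"
  defines "K \<equiv> sb_kernel_fun vF vE pF pE \<iota> \<alpha> d chi eta"
    and "P \<equiv> {(s, t). (chi, s, eta, t) \<in> pole_params vF vE \<iota> 1 \<union> pole_params vF vE \<iota> (- 1)}"
  shows "\<exists>T :: complex \<times> complex \<Rightarrow> ('e \<Rightarrow> complex) \<Rightarrow> complex.
     (\<forall>s t. Re (2 * s + t + 1/2) > 0 \<and> Re (2 * s - t + 1/2) > 0 \<longrightarrow>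
        locally_integrable \<mu> (K s t) \<and>
        (\<forall>\<phi>\<in>test_fun UNIV. T (s, t) \<phi> = fun_distribution \<mu> (K s t) \<phi>)) \<and>
     meromorphic_family_simple_poles T P \<and>
     (\<forall>s t. (s, t) \<notin> P \<longrightarrow> T (s, t) \<in> sb_kernels vF vE pF pE \<iota> chi eta s t)"
proof -
  interpret quadratic_extension vF vE pF pE \<iota> \<alpha> d by fact
  interpret kernel_params vF vE pF pE \<iota> \<alpha> d \<mu> chi eta
    by unfold_locales (use assms in auto)
  have K: "K s t = Kz (s, t)" for s t by (simp add: K_def Kz_def)
  have P: "P = pole_set" unfolding P_def using pole_params_iff by auto
  have region: "(s, t) \<in> Half_plus \<inter> Half_minus" if "Re (2 * s + t + 1/2) > 0 \<and> Re (2 * s - t + 1/2) > 0" for s t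
    using that by (simp add: Half_plus_def Half_minus_def)
  show ?thesis
  proof (intro exI[of _ K_ext] conjI allI impI ballI)
    fix s t assume st: "Re (2 * s + t + 1/2) > 0 \<and> Re (2 * s - t + 1/2) > 0"
    show "locally_integrable \<mu> (K s t)" unfolding K by (rule Kz_locally_integrable[OF region[OF st]])
    show "K_ext (s, t) \<phi> = fun_distribution \<mu> (K s t) \<phi>" if "\<phi> \<in> test_fun UNIV" for \<phi>
      unfolding K fun_distribution_def by (rule K_ext_region[OF that region[OF st]])
  next
    show "meromorphic_family_simple_poles K_ext P" unfolding P by (rule K_ext_meromorphic)
    show "K_ext (s, t) \<in> sb_kernels vF vE pF pE \<iota> chi eta s t" for s t by (rule K_ext_sb_kernels)
  qed
qed

end
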